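(* Let $(p,q)$ be a pair of coprime integers, $0\le p<q$, and let $\varepsilon>0$ satisfy $$\varepsilon<\min\left\{\frac{\sqrt3}{4c_0\sqrt{p^2+q^2+pq}\;\displaystyle\sum_{i=0}^{\left[\frac{p+q}{2}\right]+2}\Big(c_l(i)+\sum_{j=0}^{i}c_\alpha(j)\Big)}\,;\ \frac{1}{8\cos\frac{\pi}{12}\,(p+q)^2}\right\},$$ where $$c_0=\frac{3-\dfrac{p+q+2}{\pi\cos\frac{\pi}{12}\,(p+q)^2}-16\displaystyle\sum_{i=0}^{\left[\frac{p+q}{2}\right]+2}\tan^2\left(\frac{\pi i}{2(p+q)}\right)}{1-\dfrac{p+q+2}{2\pi\cos\frac{\pi}{12}\,(p+q)^2}-8\displaystyle\sum_{i=0}^{\left[\frac{p+q}{2}\right]+2}\tan^2\left(\frac{\pi i}{2(p+q)}\right)},$$ $$c_l(i)=\frac{\cos\frac{\pi}{12}\,(p+q)^2\left(4+\pi^2(2i+1)^2\right)}{(p+q-i-1)^2},\qquad c_\alpha(j)=4\left(8\pi(p+q)^2\cos\frac{\pi}{12}\,\tan^2\frac{\pi j}{2(p+q)}+1\right),$$ and $[x]$ denotes the integer part of $x$. Then on a regular tetrahedron in spherical space with face angle $\alpha=\pi/3+\varepsilon$ there exists a unique, up to the rigid motion of the tetrahedron, simple closed geodesic of type $(p,q)$.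
   Context: Spherical space $\mathbb{S}^3$ is the three-dimensional space of constant curvature $1$ (the unit sphere in $\mathbb{R}^4$). A regular tetrahedron in $\mathbb{S}^3$ is a closed convex polyhedron with four faces such that all its faces are regular spherical triangles and all its vertices are regular trihedral angles; its face angle is the interior angle $\alpha$ of a face triangle. For a given value of the face angle such a tetrahedron is unique up to rigid motion. A geodesic on the tetrahedron is a locally shortest curve on its surface; it consists of geodesic segments in the faces, forms equal angles with the common edge when passing from one face to the adjacent one, and does not pass through vertices of the tetrahedron. A closed geodesic is simple if it has no points of self-intersection. A vertex of a geodesic is a point of the geodesic on an edge of the tetrahedron. A simple closed geodesic is of type $(p,q)$ if it has $p$ vertices on each of two opposite edges of the tetrahedron, $q$ vertices on each of other two opposite edges, and $p+q$ vertices on each of the remaining two opposite edges. A rigid motion of the tetrahedron is a rigid motion of the ambient space carrying the tetrahedron onto itself. *)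

theory Defs
  imports "HOL-Analysis.Analysis"
begin

section \<open>Spherical space\<close>

type_synonym point = "real ^ 4"

definition sph_dist :: "point \<Rightarrow> point \<Rightarrow> real" where
  "sph_dist a b = arccos (a \<bullet> b)"

text \<open>For unit vectors \<open>a \<noteq> \<plusminus> b\<close>: the unit tangent vector at \<open>a\<close> of the great-circle arc
  from \<open>a\<close> to \<open>b\<close>.\<close>
definition sph_dir :: "point \<Rightarrow> point \<Rightarrow> point" where
  "sph_dir a b = sgn (b - (a \<bullet> b) *\<^sub>R a)"

definition sph_angle :: "point \<Rightarrow> point \<Rightarrow> point \<Rightarrow> real" where
  "sph_angle a b c = sph_dist (sph_dir a b) (sph_dir a c)"

text \<open>Smallest spherically convex set containing \<open>S\<close>, provided that \<open>S\<close> is contained in an open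
  hemisphere. For a linearly independent set of two, three or four unit vectors this is the
  minor great-circle arc, the spherical triangle or the solid spherical tetrahedron spanned by it.\<close>
definition sph_hull :: "point set \<Rightarrow> point set" where
  "sph_hull S = sphere 0 1 \<inter> convex_cone hull S"


section \<open>Regular tetrahedra\<close>

text \<open>\<open>T\<close> is the set of vertices of the triangle, and \<open>\<theta>\<close> is the common value of its angles.\<close>
definition regular_sph_triangle :: "point set \<Rightarrow> real \<Rightarrow> bool" where
  "regular_sph_triangle T \<theta> \<longleftrightarrow>
     T \<subseteq> sphere 0 1 \<and> card T = 3 \<and> independent T \<and>
     (\<exists>l. \<forall>a\<in>T. \<forall>b\<in>T. a \<noteq> b \<longrightarrow> sph_dist a b = l) \<and>
     (\<forall>a\<in>T. \<forall>b\<in>T. \<forall>c\<in>T. distinct [a, b, c] \<longrightarrow> sph_angle a b c = \<theta>)"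

text \<open>\<open>V\<close> is the set of vertices of the tetrahedron. The link of a vertex \<open>v\<close> is the spherical
  triangle, in the unit sphere of the tangent space at \<open>v\<close>, that is spanned by the directions of
  the three edges at \<open>v\<close>. Its sides are the plane angles and its angles are the dihedral angles
  of the trihedral angle at \<open>v\<close>, so the trihedral angle is regular iff the link is.\<close>
definition regular_sph_tetrahedron :: "point set \<Rightarrow> real \<Rightarrow> bool" where
  "regular_sph_tetrahedron V \<alpha> \<longleftrightarrow>
     V \<subseteq> sphere 0 1 \<and> card V = 4 \<and> independent V \<and>
     (\<forall>v\<in>V. regular_sph_triangle (V - {v}) \<alpha>) \<and>
     (\<forall>v\<in>V. \<exists>\<theta>. regular_sph_triangle (sph_dir v ` (V - {v})) \<theta>)"

definition tetra_surface :: "point set \<Rightarrow> point set" where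
  "tetra_surface V = (\<Union>v\<in>V. sph_hull (V - {v}))"

text \<open>All isometries of the ambient sphere that preserve the solid tetrahedron are admitted,
  orientation-reversing ones included.\<close>
definition tetra_motion :: "point set \<Rightarrow> (point \<Rightarrow> point) \<Rightarrow> bool" where
  "tetra_motion V f \<longleftrightarrow> orthogonal_transformation f \<and> f ` sph_hull V = sph_hull V"


section \<open>Geodesics on the surface\<close>

text \<open>Supremum of the lengths of inscribed polygons. For curves on the sphere, chordal and
  angular distance give the same supremum.\<close>
definition curve_length :: "(real \<Rightarrow> 'a::metric_space) \<Rightarrow> real \<Rightarrow> real \<Rightarrow> ereal" where
  "curve_length g a b =
     (SUP (n, t) \<in> {(n::nat, t). t 0 = a \<and> t n = b \<and> (\<forall>i<n. t i \<le> t (Suc i))}.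
        ereal (\<Sum>i<n. dist (g (t i)) (g (t (Suc i)))))"

definition shortest_on :: "'a::metric_space set \<Rightarrow> (real \<Rightarrow> 'a) \<Rightarrow> real \<Rightarrow> real \<Rightarrow> bool" where
  "shortest_on M g a b \<longleftrightarrow>
     (\<forall>h. path h \<and> path_image h \<subseteq> M \<and> pathstart h = g a \<and> pathfinish h = g b \<longrightarrow>
          curve_length g a b \<le> curve_length h 0 1)"

text \<open>Locally shortest curves in the intrinsic geometry of the surface. That such a curve consists
  of great-circle arcs in the faces and makes equal angles with an edge on both sides of a crossing
  is a consequence of minimality and is not built into the definition.\<close>
definition tetra_geodesic :: "point set \<Rightarrow> (real \<Rightarrow> point) \<Rightarrow> bool" where
  "tetra_geodesic V g \<longleftrightarrow>
     continuous_on UNIV g \<and> range g \<subseteq> tetra_surface V - V \<and>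
     (\<forall>t. \<exists>a b. a < t \<and> t < b \<and> shortest_on (tetra_surface V) g a b)"

text \<open>A closed curve is a curve with period 1, so that the closing point is a point like any
  other; the geodesic as a point set is \<open>range g\<close>.\<close>
definition simple_closed_geodesic :: "point set \<Rightarrow> (real \<Rightarrow> point) \<Rightarrow> bool" where
  "simple_closed_geodesic V g \<longleftrightarrow>
     tetra_geodesic V g \<and> (\<forall>t. g (t + 1) = g t) \<and> inj_on g {0..<1}"

definition meets_edge :: "(real \<Rightarrow> point) \<Rightarrow> point \<Rightarrow> point \<Rightarrow> nat \<Rightarrow> bool" where
  "meets_edge g a b n \<longleftrightarrow>
     finite (range g \<inter> sph_hull {a, b}) \<and> card (range g \<inter> sph_hull {a, b}) = n"

definition geodesic_type :: "point set \<Rightarrow> nat \<Rightarrow> nat \<Rightarrow> (real \<Rightarrow> point) \<Rightarrow> bool" where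
  "geodesic_type V p q g \<longleftrightarrow>
     (\<exists>a b c d. V = {a, b, c, d} \<and> distinct [a, b, c, d] \<and>
        meets_edge g a b p \<and> meets_edge g c d p \<and>
        meets_edge g a c q \<and> meets_edge g b d q \<and>
        meets_edge g a d (p + q) \<and> meets_edge g b c (p + q))"


section \<open>The bound on the face angle\<close>

text \<open>For \<open>p + q \<le> 6\<close> some \<open>c_l p q i\<close> has denominator 0, and for \<open>p + q\<close> in \<open>{1, 3, 4}\<close> some
  tangent is taken at \<open>pi / 2\<close>. These terms have the value 0 here.\<close>

definition tan_sum :: "nat \<Rightarrow> nat \<Rightarrow> real" where
  "tan_sum p q = (\<Sum>i=0..(p + q) div 2 + 2. (tan (pi * real i / (2 * real (p + q))))\<^sup>2)"

definition c_0 :: "nat \<Rightarrow> nat \<Rightarrow> real" where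
  "c_0 p q =
     (3 - real (p + q + 2) / (pi * cos (pi / 12) * (real (p + q))\<^sup>2) - 16 * tan_sum p q) /
     (1 - real (p + q + 2) / (2 * pi * cos (pi / 12) * (real (p + q))\<^sup>2) - 8 * tan_sum p q)"

definition c_l :: "nat \<Rightarrow> nat \<Rightarrow> nat \<Rightarrow> real" where
  "c_l p q i =
     cos (pi / 12) * (real (p + q))\<^sup>2 * (4 + pi\<^sup>2 * (2 * real i + 1)\<^sup>2) /
     (real p + real q - real i - 1)\<^sup>2"

definition c_alpha :: "nat \<Rightarrow> nat \<Rightarrow> nat \<Rightarrow> real" where
  "c_alpha p q j =
     4 * (8 * pi * (real (p + q))\<^sup>2 * cos (pi / 12) * (tan (pi * real j / (2 * real (p + q))))\<^sup>2 + 1)"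

definition eps_bound :: "nat \<Rightarrow> nat \<Rightarrow> real" where
  "eps_bound p q =
     min (sqrt 3 /
            (4 * c_0 p q * sqrt ((real p)\<^sup>2 + (real q)\<^sup>2 + real p * real q) *
             (\<Sum>i=0..(p + q) div 2 + 2. c_l p q i + (\<Sum>j=0..i. c_alpha p q j))))
         (1 / (8 * cos (pi / 12) * (real (p + q))\<^sup>2))"

end

theory Submission
  imports Defs "HOL-Analysis.Analysis"
begin

text \<open>Unfold the faces met by a geodesic into the unit sphere. Its arcs then lie on one great circle, and the
  inner products of the vertices with the pole of this circle obey a linear recursion with the
  parameter \<open>l = 2 c / (1 + c) = 2 cos \<alpha>\<close>, where \<open>c\<close> is the inner product of two vertices. For
  \<open>l = 1\<close> this recursion describes affine functions on the triangular lattice of the plane.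

  Uniqueness: the numbers of crossings with the edges determine the cyclic sequence of crossed edges, because
  disjoint arcs in a face pair the crossings in a forced way. Going once around the geodesic acts on the triples
  of inner products by a linear map that preserves a quadratic form and the volume. If this map is not
  the identity, its fixed vectors are proportional, so all geodesics of one type run through the
  same points.

  Existence: the line of slope \<open>q / p\<close> through midpoints of edges of the lattice gives the sequence of edges. The
  bound on \<open>\<epsilon>\<close> yields \<open>(1 - l) (p + q)\<^sup>3 \<le> 1 / 600\<close>, which keeps the solutions of the recursion close to
  affine functions. A periodic solution is found from the symmetry under half-turns about
  the midpoints. Lattice points of the same class modulo \<open>2\<close> have heights above the line that differ by at least \<open>2\<close>,
  and this separation survives the perturbation, hence the geodesic is simple.\<close>

section \<open>Angular distance and great-circle arcs\<close>

text \<open>Geodesics are given as locally shortest curves, so straightness has to be extracted from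
  minimality, and minimality of the constructed curve has to be proved. Both rest on one comparison:
  unfolding two faces about their common edge never shortens a distance and preserves it within each
  face, and a path that changes face has a point on the edge. A great circle is carried as a linear
  functional, through its values at the vertices. This makes the passage over an edge linear and
  puts the flat case \<open>l = 1\<close> and the spherical case in the same coordinates. Heights
  over the lattice line are odd integers, so an error below 1 destroys neither a sign nor a
  separation of 2. That error is of order \<open>1 - l\<close> times the cube of
  \<open>p + q\<close>: the number of steps, the growth of the correction made at an edge, and the
  size of the values contribute one factor each. The hypothesis on the angle supplies the cube: the
  sums of \<open>c_alpha\<close> are at least of the order of the square of \<open>p + q\<close>,
  because the last tangents are not small, and the square root in the bound contributes the third
  factor.\<close>

lemma inner_bounds_unit:
  fixes a b :: "'a::real_inner"
  assumes "norm a = 1" "norm b = 1"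
  shows "-1 \<le> a \<bullet> b" "a \<bullet> b \<le> 1"
  using Cauchy_Schwarz_ineq2[of a b] assms by auto

lemma cos_sph_dist: "norm a = 1 \<Longrightarrow> norm b = 1 \<Longrightarrow> cos (sph_dist a b) = a \<bullet> b"
  unfolding sph_dist_def by (meson cos_arccos inner_bounds_unit)

lemma sph_dist_range: "norm a = 1 \<Longrightarrow> norm b = 1 \<Longrightarrow> 0 \<le> sph_dist a b \<and> sph_dist a b \<le> pi"
  unfolding sph_dist_def by (meson arccos_bounded inner_bounds_unit)

lemma sph_dist_commute: "sph_dist a b = sph_dist b a"
  by (simp add: sph_dist_def inner_commute)

lemma sph_dist_self: "norm a = 1 \<Longrightarrow> sph_dist a a = 0"
  by (simp add: sph_dist_def dot_square_norm)

lemma sph_dist_eqI: "norm a = 1 \<Longrightarrow> norm b = 1 \<Longrightarrow> cos t = a \<bullet> b \<Longrightarrow> 0 \<le> t \<Longrightarrow> t \<le> pi \<Longrightarrow> sph_dist a b = t"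
  unfolding sph_dist_def by (metis arccos_cos)

lemma unit_inner_eq_1:
  fixes a b :: "'a::real_inner"
  assumes "norm a = 1" "norm b = 1" "a \<bullet> b = 1" shows "a = b"
proof -
  have "a \<bullet> a = 1" "b \<bullet> b = 1" using assms by (auto simp: dot_square_norm)
  then have "(a - b) \<bullet> (a - b) = 0"
    using assms by (simp add: inner_simps inner_commute)
  then show ?thesis by simp
qed

lemma sph_dist_eq_0: "norm a = 1 \<Longrightarrow> norm b = 1 \<Longrightarrow> sph_dist a b = 0 \<Longrightarrow> a = b"
  using cos_sph_dist[of a b] unit_inner_eq_1[of a b] by simp

lemma sph_dist_eq_pi:
  assumes "norm a = 1" "norm b = 1" "sph_dist a b = pi" shows "a = - b"
  using cos_sph_dist[of a b] unit_inner_eq_1[of a "-b"] assms by simp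

lemma dist_sq_unit:
  fixes a b :: "'a::real_inner"
  assumes "norm a = 1" "norm b = 1" shows "(dist a b)\<^sup>2 = 2 - 2 * (a \<bullet> b)"
proof -
  have "a \<bullet> a = 1" "b \<bullet> b = 1" using assms by (auto simp: dot_square_norm)
  then have "(a - b) \<bullet> (a - b) = 2 - 2 * (a \<bullet> b)"
    using assms by (simp add: inner_simps inner_commute)
  moreover have "(dist a b)\<^sup>2 = (a - b) \<bullet> (a - b)" by (simp add: dist_norm dot_square_norm)
  ultimately show ?thesis by simp
qed

lemma dist_unit_sin:
  assumes "norm a = 1" "norm b = 1" shows "dist a b = 2 * sin (sph_dist a b / 2)"
proof -
  let ?t = "sph_dist a b"
  have "cos ?t = 1 - 2 * (sin (?t/2))\<^sup>2" using cos_double_sin[of "?t/2"] by simp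
  then have "(dist a b)\<^sup>2 = (2 * sin (?t/2))\<^sup>2"
    using dist_sq_unit[OF assms] cos_sph_dist[OF assms] by (simp add: power2_eq_square)
  moreover have "0 \<le> sin (?t/2)" using sph_dist_range[OF assms] by (intro sin_ge_zero) auto
  ultimately show ?thesis
    using power2_eq_iff_nonneg[of "dist a b" "2 * sin (?t/2)"] by simp
qed

text \<open>The components of \<open>a\<close> and \<open>d\<close> orthogonal to \<open>b\<close>
  have norms \<open>sin x\<close> and \<open>sin y\<close>. Cauchy-Schwarz bounds their inner
  product below by \<open>- (sin x * sin y)\<close>, which says
  \<open>cos (x + y) \<le> a \<bullet> d\<close>.\<close>

lemma sph_dist_triangle:
  assumes "norm a = 1" "norm b = 1" "norm d = 1"
  shows "sph_dist a d \<le> sph_dist a b + sph_dist b d"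
proof (cases "sph_dist a b + sph_dist b d \<le> pi")
  case False
  then show ?thesis using sph_dist_range[of a d] assms by linarith
next
  case True
  define x where "x = sph_dist a b"
  define y where "y = sph_dist b d"
  have xy: "0 \<le> x" "x \<le> pi" "0 \<le> y" "y \<le> pi"
    using sph_dist_range assms unfolding x_def y_def by auto
  have cx: "cos x = a \<bullet> b" and cy: "cos y = b \<bullet> d"
    using cos_sph_dist assms unfolding x_def y_def by auto
  let ?p = "a - cos x *\<^sub>R b" and ?q = "d - cos y *\<^sub>R b"
  have bb: "a \<bullet> a = 1" "b \<bullet> b = 1" "d \<bullet> d = 1" using assms by (auto simp: dot_square_norm)
  have "?p \<bullet> ?p = 1 - (cos x)\<^sup>2"
    using bb cx by (simp add: inner_simps inner_commute power2_eq_square)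
  then have p: "norm ?p = sin x"
    by (metis norm_eq_sqrt_inner real_sqrt_unique sin_ge_zero sin_squared_eq xy(1,2))
  have "?q \<bullet> ?q = 1 - (cos y)\<^sup>2"
    using bb cy by (simp add: inner_simps inner_commute power2_eq_square)
  then have q: "norm ?q = sin y"
    by (metis norm_eq_sqrt_inner real_sqrt_unique sin_ge_zero sin_squared_eq xy(3,4))
  have "?p \<bullet> ?q = a \<bullet> d - cos x * cos y"
    using bb cx cy by (simp add: inner_simps inner_commute power2_eq_square)
  moreover have "- (sin x * sin y) \<le> ?p \<bullet> ?q"
    using Cauchy_Schwarz_ineq2[of ?p ?q] p q by auto
  ultimately have "cos (x + y) \<le> a \<bullet> d" by (simp add: cos_add)
  then have "cos (x + y) \<le> cos (sph_dist a d)" using cos_sph_dist assms by auto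
  then show ?thesis
    using cos_mono_le_eq[of "x+y" "sph_dist a d"] True xy sph_dist_range[of a d] assms
    unfolding x_def[symmetric] y_def[symmetric] by auto
qed

text \<open>Additivity of the distances fixes all inner products of \<open>a\<close>,
  \<open>z\<close> and \<open>b\<close>, and with these values their Gram determinant
  vanishes.\<close>

lemma sph_dist_between:
  assumes n: "norm a = 1" "norm z = 1" "norm b = 1"
    and le: "sph_dist a z + sph_dist z b \<le> sph_dist a b" and ne: "a \<noteq> b" "a \<noteq> - b"
  shows "\<exists>s t. 0 \<le> s \<and> 0 \<le> t \<and> z = s *\<^sub>R a + t *\<^sub>R b"
proof -
  define x where "x = sph_dist a z"
  define y where "y = sph_dist z b"
  have r: "0 \<le> x" "0 \<le> y" "x \<le> pi" "y \<le> pi"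
    using sph_dist_range n unfolding x_def y_def by auto
  have xy: "sph_dist a b = x + y" using le sph_dist_triangle[of a z b] n unfolding x_def y_def by simp
  have pos: "0 < x + y" "x + y < pi"
    using sph_dist_range[of a b] sph_dist_eq_0[of a b] sph_dist_eq_pi[of a b] ne n xy by force+
  have s: "0 < sin (x + y)" using pos by (simp add: sin_gt_zero)
  have ips: "a \<bullet> z = cos x" "z \<bullet> b = cos y" "a \<bullet> b = cos (x + y)"
    using cos_sph_dist n xy unfolding x_def y_def by metis+
  have ips': "z \<bullet> a = cos x" "b \<bullet> z = cos y" "b \<bullet> a = cos (x + y)"
    using ips by (simp_all add: inner_commute)
  have bb: "a \<bullet> a = 1" "b \<bullet> b = 1" "z \<bullet> z = 1" using n by (auto simp: dot_square_norm)
  \<comment> \<open>The combination is the one expected for a point that divides the arc into pieces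
    \<open>x\<close> and \<open>y\<close>. Its squared length depends on the inner products only and
    turns out to be 0.\<close>
  let ?d = "sin (x + y) *\<^sub>R z - (sin y *\<^sub>R a + sin x *\<^sub>R b)"
  have "?d \<bullet> ?d = (sin (x+y))\<^sup>2 - 2 * sin (x+y) * (sin y * cos x + sin x * cos y)
      + (sin y)\<^sup>2 + (sin x)\<^sup>2 + 2 * sin x * sin y * cos (x + y)"
    using bb ips ips' by (simp add: inner_simps power2_eq_square algebra_simps)
  also have "\<dots> = 0"
  proof -
    have c: "(cos x)\<^sup>2 = 1 - (sin x)\<^sup>2" "(cos y)\<^sup>2 = 1 - (sin y)\<^sup>2" by (simp_all add: cos_squared_eq)
    have "(sin y)\<^sup>2 + (sin x)\<^sup>2 + 2 * sin x * sin y * (cos x * cos y - sin x * sin y)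
      - (sin x * cos y + cos x * sin y)\<^sup>2
      = (sin y)\<^sup>2 * (1 - (cos x)\<^sup>2) + (sin x)\<^sup>2 * (1 - (cos y)\<^sup>2) - 2 * (sin x)\<^sup>2 * (sin y)\<^sup>2"
      by (simp add: power2_eq_square algebra_simps)
    also have "\<dots> = 0" unfolding c by (simp add: power2_eq_square algebra_simps)
    finally show ?thesis unfolding sin_add cos_add by (simp add: power2_eq_square algebra_simps)
  qed
  finally have "sin (x + y) *\<^sub>R z = sin y *\<^sub>R a + sin x *\<^sub>R b" by simp
  then have "(1 / sin (x+y)) *\<^sub>R (sin (x + y) *\<^sub>R z) = (1 / sin (x+y)) *\<^sub>R (sin y *\<^sub>R a + sin x *\<^sub>R b)" by simp
  then have "z = (sin y / sin (x+y)) *\<^sub>R a + (sin x / sin (x+y)) *\<^sub>R b"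
    using s by (simp add: scaleR_add_right)
  moreover have "0 \<le> sin x" "0 \<le> sin y" using r by (auto intro: sin_ge_zero)
  ultimately show ?thesis using s by (metis divide_nonneg_pos)
qed

section \<open>Great-circle arcs, parametrised proportionally to length\<close>

definition great_arc :: "point \<Rightarrow> point \<Rightarrow> real \<Rightarrow> point" where
  "great_arc a b t = cos (t * sph_dist a b) *\<^sub>R a + sin (t * sph_dist a b) *\<^sub>R sph_dir a b"

lemma great_arc_0 [simp]: "great_arc a b 0 = a"
  by (simp add: great_arc_def)

text \<open>This also covers \<open>b = a\<close> and \<open>b = - a\<close>: there
  \<open>sgn 0 = 0\<close>, and both sides vanish.\<close>

lemma sph_dir_scaled:
  assumes "norm a = 1" "norm b = 1"
  shows "sin (sph_dist a b) *\<^sub>R sph_dir a b = b - (a \<bullet> b) *\<^sub>R a"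
proof -
  let ?w = "b - (a \<bullet> b) *\<^sub>R a"
  have bb: "a \<bullet> a = 1" "b \<bullet> b = 1" using assms by (auto simp: dot_square_norm)
  have "?w \<bullet> ?w = 1 - (cos (sph_dist a b))\<^sup>2"
    using bb cos_sph_dist[OF assms] by (simp add: inner_simps inner_commute power2_eq_square)
  then have "norm ?w = sin (sph_dist a b)"
    by (metis norm_eq_sqrt_inner real_sqrt_unique sin_ge_zero sin_squared_eq sph_dist_range[OF assms])
  then show ?thesis unfolding sph_dir_def sgn_div_norm
    by (cases "sin (sph_dist a b) = 0") auto
qed

lemma great_arc_1 [simp]:
  assumes "norm a = 1" "norm b = 1" shows "great_arc a b 1 = b"
  using sph_dir_scaled[OF assms] cos_sph_dist[OF assms] by (simp add: great_arc_def)

text \<open>Spherical linear interpolation, multiplied by the sine so that no division by 0 can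
  occur.\<close>

lemma great_arc_cone:
  assumes "norm a = 1" "norm b = 1"
  shows "sin (sph_dist a b) *\<^sub>R great_arc a b t
       = sin ((1 - t) * sph_dist a b) *\<^sub>R a + sin (t * sph_dist a b) *\<^sub>R b"
proof -
  let ?x = "sph_dist a b"
  have "sin ?x *\<^sub>R great_arc a b t = (sin ?x * cos (t * ?x)) *\<^sub>R a + sin (t * ?x) *\<^sub>R (sin ?x *\<^sub>R sph_dir a b)"
    by (simp add: great_arc_def scaleR_add_right mult.commute)
  also have "\<dots> = (sin ?x * cos (t * ?x) - sin (t * ?x) * cos ?x) *\<^sub>R a + sin (t * ?x) *\<^sub>R b"
    unfolding sph_dir_scaled[OF assms] cos_sph_dist[OF assms]
    by (simp add: scaleR_diff_right scaleR_diff_left)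
  also have "sin ?x * cos (t * ?x) - sin (t * ?x) * cos ?x = sin ((1 - t) * ?x)"
    using sin_diff[of ?x "t * ?x"] by (simp add: algebra_simps)
  finally show ?thesis .
qed

lemma great_arc_inner:
  assumes "norm a = 1" "norm b = 1" "a \<noteq> - b"
  shows "great_arc a b s \<bullet> great_arc a b t = cos ((s - t) * sph_dist a b)"
proof (cases "a = b")
  case True
  then show ?thesis using assms by (simp add: great_arc_def sph_dist_self dot_square_norm)
next
  case False
  let ?x = "sph_dist a b"
  have "0 < ?x" "?x < pi"
    using sph_dist_range[of a b] sph_dist_eq_0[of a b] sph_dist_eq_pi[of a b] False assms by force+
  then have s: "0 < sin ?x" by (simp add: sin_gt_zero)
  have bb: "a \<bullet> a = 1" "b \<bullet> b = 1" using assms by (auto simp: dot_square_norm)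
  have "sin ?x * (sph_dir a b \<bullet> a) = 0"
    using arg_cong[OF sph_dir_scaled[OF assms(1,2)], of "\<lambda>v. v \<bullet> a"] bb
    by (simp add: inner_simps inner_commute)
  then have e: "sph_dir a b \<bullet> a = 0" "a \<bullet> sph_dir a b = 0" using s by (auto simp: inner_commute)
  have "b - (a \<bullet> b) *\<^sub>R a \<noteq> 0" using sph_dir_scaled[OF assms(1,2)] s e
  proof (intro notI)
    assume "b - (a \<bullet> b) *\<^sub>R a = 0"
    then have "(b - (a \<bullet> b) *\<^sub>R a) \<bullet> b = 0" by simp
    then have "1 - (cos ?x)\<^sup>2 = 0" using bb cos_sph_dist[OF assms(1,2)]
      by (simp add: inner_simps inner_commute power2_eq_square)
    then show False using s by (simp add: sin_squared_eq[symmetric])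
  qed
  then have "norm (sph_dir a b) = 1" by (simp add: sph_dir_def norm_sgn)
  then have "sph_dir a b \<bullet> sph_dir a b = 1" by (simp add: dot_square_norm)
  then have "great_arc a b s \<bullet> great_arc a b t = cos (s * ?x) * cos (t * ?x) + sin (s * ?x) * sin (t * ?x)"
    using bb e by (simp add: great_arc_def inner_simps)
  also have "\<dots> = cos ((s - t) * ?x)" using cos_diff[of "s * ?x" "t * ?x"] by (simp add: left_diff_distrib)
  finally show ?thesis .
qed

lemma norm_great_arc:
  assumes "norm a = 1" "norm b = 1" "a \<noteq> - b" shows "norm (great_arc a b t) = 1"
  using great_arc_inner[OF assms, of t t] by (simp add: norm_eq_sqrt_inner)

lemma dist_great_arc:
  assumes "norm a = 1" "norm b = 1" "a \<noteq> - b" "s \<le> t"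
  shows "dist (great_arc a b s) (great_arc a b t) \<le> (t - s) * sph_dist a b"
proof -
  let ?y = "(t - s) * sph_dist a b"
  have y: "0 \<le> ?y" using assms sph_dist_range[of a b] by simp
  have "(dist (great_arc a b s) (great_arc a b t))\<^sup>2 = 2 - 2 * cos ((s - t) * sph_dist a b)"
    using dist_sq_unit[of "great_arc a b s" "great_arc a b t"] norm_great_arc[OF assms(1-3)]
      great_arc_inner[OF assms(1-3), of s t] by simp
  also have "cos ((s - t) * sph_dist a b) = cos ?y" by (metis cos_minus minus_diff_eq mult_minus_left)
  also have "2 - 2 * cos ?y = (2 * sin (?y/2))\<^sup>2" using cos_double_sin[of "?y/2"] by (simp add: power2_eq_square)
  also have "\<dots> \<le> ?y\<^sup>2"
    using abs_sin_x_le_abs_x[of "?y/2"] y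
    by (intro power2_le_iff_abs_le[THEN iffD2]) auto
  finally show ?thesis using y by (rule power2_le_imp_le)
qed

lemma sph_dist_great_arc:
  assumes "norm a = 1" "norm b = 1" "a \<noteq> - b" "s \<le> t" "t - s \<le> 1"
  shows "sph_dist (great_arc a b s) (great_arc a b t) = (t - s) * sph_dist a b"
proof (rule sph_dist_eqI)
  have "cos ((s - t) * sph_dist a b) = cos ((t - s) * sph_dist a b)"
    by (metis cos_minus minus_diff_eq mult_minus_left)
  then show "cos ((t - s) * sph_dist a b) = great_arc a b s \<bullet> great_arc a b t"
    using great_arc_inner assms by simp
  have r: "0 \<le> sph_dist a b" "sph_dist a b \<le> pi" using sph_dist_range[of a b] assms by auto
  show "0 \<le> (t - s) * sph_dist a b" using r assms by simp
  show "(t - s) * sph_dist a b \<le> pi" using mult_mono[of "t-s" 1 "sph_dist a b" pi] r assms by simp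
qed (use assms norm_great_arc in auto)

lemma continuous_great_arc: "continuous_on S (great_arc a b)"
  unfolding great_arc_def by (intro continuous_intros)

lemma great_arc_in_cone:
  assumes "norm a = 1" "norm b = 1" "a \<noteq> - b" "t \<in> {0..1}"
  shows "\<exists>\<alpha> \<beta>. 0 \<le> \<alpha> \<and> 0 \<le> \<beta> \<and> great_arc a b t = \<alpha> *\<^sub>R a + \<beta> *\<^sub>R b"
proof (cases "a = b")
  case True
  have "great_arc a b t = 1 *\<^sub>R a + 0 *\<^sub>R b"
    using True assms by (simp add: great_arc_def sph_dist_self)
  then show ?thesis by (metis zero_le_one order_refl)
next
  case False
  let ?x = "sph_dist a b"
  have x: "0 < ?x" "?x < pi"
    using sph_dist_range[of a b] sph_dist_eq_0[of a b] sph_dist_eq_pi[of a b] False assms by force+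
  then have s: "0 < sin ?x" by (simp add: sin_gt_zero)
  have "great_arc a b t = (1 / sin ?x) *\<^sub>R (sin ?x *\<^sub>R great_arc a b t)" using s by simp
  also have "\<dots> = (sin ((1 - t) * ?x) / sin ?x) *\<^sub>R a + (sin (t * ?x) / sin ?x) *\<^sub>R b"
    unfolding great_arc_cone[OF assms(1,2)] by (simp add: scaleR_add_right)
  finally have e: "great_arc a b t = (sin ((1 - t) * ?x) / sin ?x) *\<^sub>R a + (sin (t * ?x) / sin ?x) *\<^sub>R b" .
  have t: "0 \<le> t" "t \<le> 1" using assms by auto
  have l: "(1 - t) * ?x \<le> pi" "t * ?x \<le> pi"
    using mult_right_mono[of "1-t" 1 ?x] mult_right_mono[of t 1 ?x] x t by linarith+
  have "0 \<le> sin ((1 - t) * ?x)" "0 \<le> sin (t * ?x)"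
    using l t x by (auto intro!: sin_ge_zero)
  then have "0 \<le> sin ((1 - t) * ?x) / sin ?x" "0 \<le> sin (t * ?x) / sin ?x" using s by simp_all
  with e show ?thesis by blast
qed

section \<open>Length of curves\<close>

lemma curve_length_ge:
  assumes "t 0 = a" "t n = b" "\<And>i. i < n \<Longrightarrow> t i \<le> t (Suc i)"
  shows "ereal (\<Sum>i<n. dist (g (t i)) (g (t (Suc i)))) \<le> curve_length g a b"
  unfolding curve_length_def by (rule SUP_upper2[of "(n,t)"]) (use assms in auto)

lemma curve_length_le:
  assumes "\<And>n t. t 0 = a \<Longrightarrow> t n = b \<Longrightarrow> (\<And>i. i < n \<Longrightarrow> t i \<le> t (Suc i)) \<Longrightarrow>
      ereal (\<Sum>i<n. dist (g (t i)) (g (t (Suc i)))) \<le> L"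
  shows "curve_length g a b \<le> L"
  unfolding curve_length_def by (rule SUP_least) (use assms in auto)

lemma partition_mono:
  fixes t :: "nat \<Rightarrow> real"
  assumes "\<And>i. i < n \<Longrightarrow> t i \<le> t (Suc i)" "i \<le> j" "j \<le> n"
  shows "t i \<le> t j"
  using assms(2,3)
proof (induction j)
  case (Suc j)
  then show ?case using assms(1)[of j] by (cases "i = Suc j") auto
qed auto

lemma partition_in:
  fixes t :: "nat \<Rightarrow> real"
  assumes "t 0 = a" "t n = b" "\<And>i. i < n \<Longrightarrow> t i \<le> t (Suc i)" "i \<le> n"
  shows "t i \<in> {a..b}"
  using partition_mono[of n t 0 i] partition_mono[of n t i n] assms by auto

lemma curve_length_nonneg: "a \<le> b \<Longrightarrow> 0 \<le> curve_length g a b"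
  by (rule order_trans[OF _ curve_length_ge[of "\<lambda>i. if i = 0 then a else b" a 1 b g]]) auto

lemma curve_length_le_add:
  assumes "a \<le> m" "m \<le> b"
  shows "curve_length g a b \<le> curve_length g a m + curve_length g m b"
proof (rule curve_length_le)
  fix n and t :: "nat \<Rightarrow> real"
  assume t: "t 0 = a" "t n = b" "\<And>i. i < n \<Longrightarrow> t i \<le> t (Suc i)"
  \<comment> \<open>Cutting with \<open>min\<close> and \<open>max\<close> yields subdivisions of
    both halves without locating the interval that contains \<open>m\<close>; on that interval the
    triangle inequality is used.\<close>
  let ?p = "\<lambda>i. min (t i) m" and ?q = "\<lambda>i. max (t i) m"
  have "(\<Sum>i<n. dist (g (t i)) (g (t (Suc i)))) \<le>
      (\<Sum>i<n. dist (g (?p i)) (g (?p (Suc i))) + dist (g (?q i)) (g (?q (Suc i))))"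
  proof (rule sum_mono)
    fix i assume "i \<in> {..<n}"
    then have "t i \<le> t (Suc i)" using t by simp
    then consider "t (Suc i) \<le> m" | "m \<le> t i" | "t i \<le> m" "m \<le> t (Suc i)" by linarith
    then show "dist (g (t i)) (g (t (Suc i))) \<le>
       dist (g (?p i)) (g (?p (Suc i))) + dist (g (?q i)) (g (?q (Suc i)))"
      by cases (use \<open>t i \<le> t (Suc i)\<close> in \<open>simp_all add: min_def max_def dist_triangle\<close>)
  qed
  also have "\<dots> = (\<Sum>i<n. dist (g (?p i)) (g (?p (Suc i)))) + (\<Sum>i<n. dist (g (?q i)) (g (?q (Suc i))))"
    by (rule sum.distrib)
  finally have "ereal (\<Sum>i<n. dist (g (t i)) (g (t (Suc i)))) \<le>
     ereal (\<Sum>i<n. dist (g (?p i)) (g (?p (Suc i)))) + ereal (\<Sum>i<n. dist (g (?q i)) (g (?q (Suc i))))"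
    by simp
  also have "\<dots> \<le> curve_length g a m + curve_length g m b"
  proof (rule add_mono)
    show "ereal (\<Sum>i<n. dist (g (?p i)) (g (?p (Suc i)))) \<le> curve_length g a m"
      by (rule curve_length_ge) (use t assms in \<open>auto intro: min.mono min.coboundedI1\<close>)
    show "ereal (\<Sum>i<n. dist (g (?q i)) (g (?q (Suc i)))) \<le> curve_length g m b"
      by (rule curve_length_ge) (use t assms in \<open>auto intro: max.mono max.coboundedI1\<close>)
  qed
  finally show "ereal (\<Sum>i<n. dist (g (t i)) (g (t (Suc i)))) \<le> curve_length g a m + curve_length g m b" .
qed

text \<open>Two subdivisions concatenate to one of \<open>{a..b}\<close>. The suprema may then be
  taken one after the other, since the index sets are non-empty and all values are above minus
  infinity.\<close>

lemma curve_length_add_le: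
  assumes "a \<le> m" "m \<le> b"
  shows "curve_length g a m + curve_length g m b \<le> curve_length g a b"
proof -
  let ?I = "\<lambda>a b. {(n::nat, t::nat\<Rightarrow>real). t 0 = a \<and> t n = b \<and> (\<forall>i<n. t i \<le> t (Suc i))}"
  let ?s = "\<lambda>(n::nat, t). ereal (\<Sum>i<n. dist (g (t i)) (g (t (Suc i))))"
  have ne: "?I a b \<noteq> {}" if "a \<le> b" for a b
  proof -
    have "(1, \<lambda>i. if i = 0 then a else b) \<in> ?I a b" using that by simp
    then show ?thesis by blast
  qed
  have pq: "?s P + ?s Q \<le> curve_length g a b" if "P \<in> ?I a m" "Q \<in> ?I m b" for P Q
  proof -
    obtain n t where P: "P = (n,t)" "t 0 = a" "t n = m" "\<forall>i<n. t i \<le> t (Suc i)" using \<open>P \<in> ?I a m\<close> by auto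
    obtain k s where Q: "Q = (k,s)" "s 0 = m" "s k = b" "\<forall>i<k. s i \<le> s (Suc i)" using \<open>Q \<in> ?I m b\<close> by auto
    define r where "r i = (if i \<le> n then t i else s (i - n))" for i
    have r: "r i = t i" if "i \<le> n" for i using that by (simp add: r_def)
    have r': "r (n + i) = s i" for i using P Q by (cases "i = 0") (auto simp: r_def)
    have "ereal (\<Sum>i<n+k. dist (g (r i)) (g (r (Suc i)))) \<le> curve_length g a b"
    proof (rule curve_length_ge)
      fix i assume "i < n + k"
      show "r i \<le> r (Suc i)"
      proof (cases "i < n")
        case True then show ?thesis using P r by simp
      next
        case False
        then obtain j where "i = n + j" by (metis le_iff_add not_less)
        then show ?thesis using r'[of j] r'[of "Suc j"] Q \<open>i < n + k\<close> by simp
      qed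
    qed (use r[of 0] r'[of k] P Q in auto)
    moreover have "(\<Sum>i<n+k. dist (g (r i)) (g (r (Suc i)))) =
        (\<Sum>i<n. dist (g (t i)) (g (t (Suc i)))) + (\<Sum>i<k. dist (g (s i)) (g (s (Suc i))))"
    proof -
      have "(\<Sum>i<n+k. dist (g (r i)) (g (r (Suc i)))) =
        (\<Sum>i<n. dist (g (r i)) (g (r (Suc i)))) + (\<Sum>i<k. dist (g (r (n + i))) (g (r (n + Suc i))))"
        by (induction k) (auto simp: add.assoc)
      then show ?thesis by (simp only: r') (simp add: r)
    qed
    ultimately show ?thesis using P Q by simp
  qed
  have "curve_length g a m + ?s Q \<le> curve_length g a b" if Q: "Q \<in> ?I m b" for Q
  proof -
    have "curve_length g a m + ?s Q = (SUP P\<in>?I a m. ?s P + ?s Q)"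
      unfolding curve_length_def by (subst SUP_ereal_add_left) (use ne[OF assms(1)] in \<open>auto split: prod.splits\<close>)
    also have "\<dots> \<le> curve_length g a b" by (rule SUP_least) (rule pq[OF _ Q])
    finally show ?thesis .
  qed
  moreover have "curve_length g a m + curve_length g m b = (SUP Q\<in>?I m b. curve_length g a m + ?s Q)"
    unfolding curve_length_def[of g m b]
    by (subst SUP_ereal_add_right) (use ne[OF assms(2)] curve_length_nonneg[OF assms(1), of g] in auto)
  ultimately show ?thesis by (simp only:) (rule SUP_least, blast)
qed

lemma curve_length_add:
  assumes "a \<le> m" "m \<le> b"
  shows "curve_length g a b = curve_length g a m + curve_length g m b"
  using curve_length_le_add[OF assms] curve_length_add_le[OF assms] by (rule antisym)

lemma curve_length_reparam_le:
  assumes "mono_on {a..b} \<phi>"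
  shows "curve_length (\<lambda>t. h (\<phi> t)) a b \<le> curve_length h (\<phi> a) (\<phi> b)"
proof (rule curve_length_le)
  fix n and t :: "nat \<Rightarrow> real"
  assume t: "t 0 = a" "t n = b" "\<And>i. i < n \<Longrightarrow> t i \<le> t (Suc i)"
  have "ereal (\<Sum>i<n. dist (h ((\<phi> \<circ> t) i)) (h ((\<phi> \<circ> t) (Suc i)))) \<le> curve_length h (\<phi> a) (\<phi> b)"
  proof (rule curve_length_ge)
    fix i assume "i < n"
    then show "(\<phi> \<circ> t) i \<le> (\<phi> \<circ> t) (Suc i)"
      using partition_in[OF t, of i] partition_in[OF t, of "Suc i"] t(3)[of i] mono_onD[OF assms, of "t i" "t (Suc i)"]
      by simp
  qed (use t in auto)
  then show "ereal (\<Sum>i<n. dist (h (\<phi> (t i))) (h (\<phi> (t (Suc i))))) \<le> curve_length h (\<phi> a) (\<phi> b)"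
    by simp
qed

lemma curve_length_cong_le:
  assumes "\<And>t. t \<in> {a..b} \<Longrightarrow> g t = h t"
  shows "curve_length g a b \<le> curve_length h a b"
proof (rule curve_length_le)
  fix n and t :: "nat \<Rightarrow> real"
  assume t: "t 0 = a" "t n = b" "\<And>i. i < n \<Longrightarrow> t i \<le> t (Suc i)"
  have "(\<Sum>i<n. dist (g (t i)) (g (t (Suc i)))) = (\<Sum>i<n. dist (h (t i)) (h (t (Suc i))))"
    by (intro sum.cong refl) (use assms partition_in[OF t] in auto)
  then show "ereal (\<Sum>i<n. dist (g (t i)) (g (t (Suc i)))) \<le> curve_length h a b"
    using curve_length_ge[of t a n b h] t by simp
qed

lemma curve_length_cong:
  assumes "\<And>t. t \<in> {a..b} \<Longrightarrow> g t = h t"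
  shows "curve_length g a b = curve_length h a b"
  by (intro antisym curve_length_cong_le) (use assms in auto)

lemma curve_length_reverse_le:
  "curve_length (\<lambda>t. h (s - t)) (s - b) (s - a) \<le> curve_length h a b"
proof (rule curve_length_le)
  fix n and t :: "nat \<Rightarrow> real"
  assume t: "t 0 = s - b" "t n = s - a" "\<And>i. i < n \<Longrightarrow> t i \<le> t (Suc i)"
  let ?r = "\<lambda>i. s - t (n - i)"
  have "ereal (\<Sum>i<n. dist (h (?r i)) (h (?r (Suc i)))) \<le> curve_length h a b"
  proof (rule curve_length_ge)
    fix i assume "i < n"
    then show "?r i \<le> ?r (Suc i)" using t(3)[of "n - Suc i"] by (simp add: Suc_diff_Suc)
  qed (use t in auto)
  moreover have "(\<Sum>i<n. dist (h (?r i)) (h (?r (Suc i)))) =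
     (\<Sum>i<n. dist (h (s - t (Suc (n - Suc i)))) (h (s - t (n - Suc i))))"
    by (intro sum.cong refl) (auto simp: Suc_diff_Suc)
  moreover have "\<dots> = (\<Sum>i<n. dist (h (s - t (Suc i))) (h (s - t i)))"
    by (rule sum.nat_diff_reindex)
  ultimately show "ereal (\<Sum>i<n. dist (h (s - t i)) (h (s - t (Suc i)))) \<le> curve_length h a b"
    by (simp add: dist_commute)
qed

text \<open>Upper bounds for explicit curves: \<open>S\<close> plays the role of arc length, and the
  sum over a subdivision telescopes.\<close>

lemma curve_length_le_potential:
  fixes S :: "real \<Rightarrow> real"
  assumes "\<And>s t. a \<le> s \<Longrightarrow> s \<le> t \<Longrightarrow> t \<le> b \<Longrightarrow> dist (h s) (h t) \<le> S t - S s"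
  shows "curve_length h a b \<le> ereal (S b - S a)"
proof (rule curve_length_le)
  fix n and t :: "nat \<Rightarrow> real"
  assume t: "t 0 = a" "t n = b" "\<And>i. i < n \<Longrightarrow> t i \<le> t (Suc i)"
  have "(\<Sum>i<n. dist (h (t i)) (h (t (Suc i)))) \<le> (\<Sum>i<n. S (t (Suc i)) - S (t i))"
  proof (rule sum_mono)
    fix i assume "i \<in> {..<n}"
    then show "dist (h (t i)) (h (t (Suc i))) \<le> S (t (Suc i)) - S (t i)"
      using assms[of "t i" "t (Suc i)"] t partition_in[OF t, of i] partition_in[OF t, of "Suc i"] by simp
  qed
  also have "\<dots> = S b - S a" using sum_lessThan_telescope[of "\<lambda>i. S (t i)" n] t by simp
  finally show "ereal (\<Sum>i<n. dist (h (t i)) (h (t (Suc i)))) \<le> ereal (S b - S a)" by simp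
qed

lemma curve_length_ge_dist:
  assumes "a \<le> s" "s \<le> t" "t \<le> b"
  shows "ereal (dist (h s) (h t)) \<le> curve_length h a b"
proof -
  let ?t = "\<lambda>i. if i = 0 then a else if i = 1 then s else if i = 2 then t else b" 
  have "ereal (\<Sum>i<3. dist (h (?t i)) (h (?t (Suc i)))) \<le> curve_length h a b"
    by (rule curve_length_ge) (use assms in auto)
  moreover have "dist (h s) (h t) \<le> (\<Sum>i<3. dist (h (?t i)) (h (?t (Suc i))))"
    by (simp add: eval_nat_numeral)
  ultimately show ?thesis by (simp add: order_trans[OF ereal_less_eq(3)[THEN iffD2]])
qed

text \<open>On short pieces the chord falls below the angle only by a factor close to 1. This passes
  from \<open>curve_length\<close>, which is made of chords, to the angular distance.\<close>

lemma sin_ge_near_0: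
  fixes \<eta> :: real
  assumes "0 < \<eta>"
  obtains x0 where "0 < x0" "x0 \<le> pi/2" "\<And>x. 0 \<le> x \<Longrightarrow> x < x0 \<Longrightarrow> (1 - \<eta>) * x \<le> sin x"
proof -
  have "((\<lambda>x. sin x / x) \<longlongrightarrow> (1::real)) (at 0)"
    using DERIV_sin[of "0::real"] by (simp add: has_field_derivative_iff)
  then have "eventually (\<lambda>x. \<bar>sin x / x - 1\<bar> < \<eta>) (at (0::real))"
    using assms by (auto simp: tendsto_iff dist_real_def)
  then obtain d where d: "0 < d" "\<And>x::real. x \<noteq> 0 \<Longrightarrow> \<bar>x\<bar> < d \<Longrightarrow> \<bar>sin x / x - 1\<bar> < \<eta>"
    by (auto simp: eventually_at dist_real_def)
  show ?thesis
  proof (rule that[of "min d (pi/2)"])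
    fix x :: real assume x: "0 \<le> x" "x < min d (pi/2)"
    show "(1 - \<eta>) * x \<le> sin x"
    proof (cases "x = 0")
      case False
      then have "\<bar>sin x / x - 1\<bar> < \<eta>" using d(2)[of x] x by simp
      then have "1 - \<eta> \<le> sin x / x" by linarith
      then show ?thesis using False x by (simp add: field_simps)
    qed simp
  qed (use d in auto)
qed

lemma sph_dist_polygon:
  assumes "\<And>i. i \<le> N \<Longrightarrow> norm (x i) = 1"
  shows "sph_dist (x 0) (x N) \<le> (\<Sum>i<N. sph_dist (x i) (x (Suc i)))"
  using assms
proof (induction N)
  case 0 then show ?case by (simp add: sph_dist_self)
next
  case (Suc N)
  then show ?case using sph_dist_triangle[of "x 0" "x N" "x (Suc N)"] by force
qed

text \<open>The curve \<open>k\<close> arises from \<open>h\<close> by a map that preserves distances between points of the same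
  face only; this is why a point of subdivision may have to be inserted.\<close>
lemma sph_dist_le_curve_length:
  fixes k h :: "real \<Rightarrow> point"
  assumes "a \<le> b" and cont: "continuous_on {a..b} k" and unit: "\<And>t. t \<in> {a..b} \<Longrightarrow> norm (k t) = 1"
    and split: "\<And>s t. a \<le> s \<Longrightarrow> s \<le> t \<Longrightarrow> t \<le> b \<Longrightarrow>
       \<exists>r\<in>{s..t}. dist (k s) (k r) \<le> dist (h s) (h r) \<and> dist (k r) (k t) \<le> dist (h r) (h t)"
  shows "ereal (sph_dist (k a) (k b)) \<le> curve_length h a b"
proof -
  let ?\<theta> = "sph_dist (k a) (k b)"
  have th: "0 \<le> ?\<theta>" using sph_dist_range unit assms(1) by auto
  \<comment> \<open>Replacing angles by chords costs the factor \<open>1 - \<eta>\<close>. It is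
    paid on a mesh so fine that the half angles between neighbouring points stay below
    \<open>x0\<close>.\<close>
  have key: "ereal ((1 - \<eta>) * ?\<theta>) \<le> curve_length h a b" if \<eta>: "0 < \<eta>" "\<eta> < 1" for \<eta>
  proof -
    obtain x0 where x0: "0 < x0" "x0 \<le> pi/2" "\<And>x. 0 \<le> x \<Longrightarrow> x < x0 \<Longrightarrow> (1 - \<eta>) * x \<le> sin x"
      using sin_ge_near_0[OF \<eta>(1)] by blast
    have "0 < sin x0" using x0 by (intro sin_gt_zero) auto
    then have "0 < 2 * sin x0" by simp
    with compact_uniformly_continuous[OF cont] obtain d where d: "0 < d"
        "\<And>s t. s \<in> {a..b} \<Longrightarrow> t \<in> {a..b} \<Longrightarrow> dist t s < d \<Longrightarrow> dist (k t) (k s) < 2 * sin x0"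
      unfolding uniformly_continuous_on_def using compact_Icc by blast
    obtain N :: nat where N: "max 0 ((b - a) / d) < real N" using reals_Archimedean2 by blast
    then have N: "(b - a) / d < real N" "0 < N" by auto
    define t where "t i = a + real i * ((b - a) / N)" for i
    have t0: "t 0 = a" and tN: "t N = b" using N by (auto simp: t_def)
    have step: "t (Suc i) = t i + (b - a) / N" for i by (simp add: t_def distrib_right add_divide_distrib)
    have tm: "t i \<le> t (Suc i)" for i using step assms N by simp
    have tin: "t i \<in> {a..b}" if "i \<le> N" for i using partition_in[OF t0 tN tm that] .
    have "(b - a) / N < d" using N d(1) by (simp add: field_simps)
    then have small: "dist (t (Suc i)) (t i) < d" for i
      using step[of i] \<open>a \<le> b\<close> by (simp add: dist_real_def)
    have "\<exists>r. r \<in> {t i..t (Suc i)} \<and> dist (k (t i)) (k r) \<le> dist (h (t i)) (h r)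
        \<and> dist (k r) (k (t (Suc i))) \<le> dist (h r) (h (t (Suc i)))" if "i < N" for i
      using split[of "t i" "t (Suc i)"] tin[of i] tin[of "Suc i"] tm[of i] that by auto
    then obtain r where r: "\<And>i. i < N \<Longrightarrow> r i \<in> {t i..t (Suc i)}"
        "\<And>i. i < N \<Longrightarrow> dist (k (t i)) (k (r i)) \<le> dist (h (t i)) (h (r i))"
        "\<And>i. i < N \<Longrightarrow> dist (k (r i)) (k (t (Suc i))) \<le> dist (h (r i)) (h (t (Suc i)))"
      by metis
    \<comment> \<open>\<open>T\<close> interleaves the mesh points \<open>t i\<close> with the
      inserted points \<open>r i\<close>, which gives a subdivision with \<open>2 * N\<close>
      steps.\<close>
    define T where "T i = (if even i then t (i div 2) else r (i div 2))" for i
    have T: "T (2 * i) = t i" "T (Suc (2 * i)) = r i" for i by (simp_all add: T_def)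
    have "(1 - \<eta>) * ?\<theta> \<le> (1 - \<eta>) * (\<Sum>i<N. sph_dist (k (t i)) (k (t (Suc i))))"
      using sph_dist_polygon[of N "\<lambda>i. k (t i)"] unit tin t0 tN \<eta> by (intro mult_left_mono) auto
    also have "\<dots> = (\<Sum>i<N. (1 - \<eta>) * sph_dist (k (t i)) (k (t (Suc i))))" by (rule sum_distrib_left)
    also have "\<dots> \<le> (\<Sum>i<N. dist (h (t i)) (h (r i)) + dist (h (r i)) (h (t (Suc i))))"
    proof (rule sum_mono)
      fix i assume "i \<in> {..<N}"
      then have i: "i < N" by simp
      let ?y = "sph_dist (k (t i)) (k (t (Suc i)))"
      have n: "norm (k (t i)) = 1" "norm (k (t (Suc i))) = 1" using i tin unit by auto
      have dd: "dist (k (t i)) (k (t (Suc i))) = 2 * sin (?y / 2)" using dist_unit_sin n by blast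
      also have "\<dots> < 2 * sin x0" using d(2)[OF _ _ small[of i]] tin i dd by (simp add: dist_commute)
      finally have "sin (?y/2) < sin x0" using dd by simp
      then have "?y / 2 < x0"
        using sin_monotone_2pi_le[of x0 "?y/2"] x0 sph_dist_range[OF n] by linarith
      then have "(1 - \<eta>) * (?y/2) \<le> sin (?y/2)" using x0(3)[of "?y/2"] sph_dist_range[OF n] by simp
      then have "(1 - \<eta>) * ?y \<le> dist (k (t i)) (k (t (Suc i)))" using dd by simp
      also have "\<dots> \<le> dist (k (t i)) (k (r i)) + dist (k (r i)) (k (t (Suc i)))" by (rule dist_triangle)
      finally show "(1 - \<eta>) * ?y \<le> dist (h (t i)) (h (r i)) + dist (h (r i)) (h (t (Suc i)))"
        using r(2,3)[OF i] by linarith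
    qed
    also have "\<dots> = (\<Sum>j<2*N. dist (h (T j)) (h (T (Suc j))))"
    proof -
      have "(\<Sum>i<M. dist (h (t i)) (h (r i)) + dist (h (r i)) (h (t (Suc i)))) = (\<Sum>j<2*M. dist (h (T j)) (h (T (Suc j))))" for M
      proof (induction M)
        case (Suc M)
        have "T (Suc (Suc (2 * M))) = t (Suc M)" using T(1)[of "Suc M"] by simp
        then show ?case using Suc T[of M] by simp
      qed simp
      then show ?thesis .
    qed
    finally have "(1 - \<eta>) * ?\<theta> \<le> (\<Sum>j<2*N. dist (h (T j)) (h (T (Suc j))))" .
    moreover have "ereal (\<Sum>j<2*N. dist (h (T j)) (h (T (Suc j)))) \<le> curve_length h a b"
    proof (rule curve_length_ge)
      fix j assume j: "j < 2 * N"
      show "T j \<le> T (Suc j)"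
      proof (cases "even j")
        case True
        then obtain i where "j = 2 * i" by blast
        then show ?thesis using T[of i] r(1)[of i] j by simp
      next
        case False
        then obtain i where i: "j = Suc (2 * i)" by (metis oddE Suc_eq_plus1)
        then show ?thesis using T[of i] T(1)[of "Suc i"] r(1)[of i] j by simp
      qed
    qed (use T(1)[of 0] T(1)[of N] t0 tN in auto)
    ultimately show ?thesis by (rule order_trans[OF ereal_less_eq(3)[THEN iffD2]])
  qed
  \<comment> \<open>For finite length let \<open>\<eta>\<close> tend to 0. Infinite length is
    trivial, and minus infinity contradicts \<open>key\<close>.\<close>
  show ?thesis
  proof (cases "curve_length h a b")
    case (real L)
    have "?\<theta> \<le> L"
    proof (rule field_le_mult_one_interval)
      fix z :: real assume "0 < z" "z < 1"
      then show "z * ?\<theta> \<le> L" using key[of "1 - z"] real by simp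
    qed
    then show ?thesis using real by simp
  next
    case PInf then show ?thesis by simp
  next
    case MInf then show ?thesis using key[of "1/2"] by simp
  qed
qed

section \<open>The surface and its unfolding along an edge\<close>

text \<open>\<open>c\<close> is the cosine of the edge length. The condition \<open>c_pos\<close>
  corresponds to an acute face angle, since \<open>cos \<alpha> = c / (1 + c)\<close>.\<close>

locale tetra =
  fixes V :: "point set" and c :: real
  assumes card_V: "card V = 4" and indep: "independent V"
    and unit: "\<And>v. v \<in> V \<Longrightarrow> norm v = 1"
    and gram: "\<And>u v. u \<in> V \<Longrightarrow> v \<in> V \<Longrightarrow> u \<noteq> v \<Longrightarrow> u \<bullet> v = c"
    and c_pos: "0 < c" and c_less: "c < 1"
begin

text \<open>The orthogonal projection of a third vertex \<open>w\<close> to the plane of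
  \<open>u\<close> and \<open>v\<close> is \<open>c / (1 + c)\<close> times \<open>u + v\<close>.
  Hence the mirror image of \<open>w\<close> in this plane is
  \<open>lam *\<^sub>R (u + v) - w\<close>.\<close>

definition lam :: real where "lam = 2 * c / (1 + c)"

definition coord :: "point \<Rightarrow> point \<Rightarrow> real" where "coord x v = representation V x v"

text \<open>By convention \<open>u v\<close> is the edge under consideration, and \<open>w\<close>,
  \<open>z\<close> are the remaining vertices of its two faces.\<close>

definition quad :: "point \<Rightarrow> point \<Rightarrow> point \<Rightarrow> point \<Rightarrow> bool" where
  "quad u v w z \<longleftrightarrow> V = {u, v, w, z} \<and> distinct [u, v, w, z]"

text \<open>The linear functional with prescribed values at the vertices. Its kernel meets the
  sphere in the great sphere orthogonal to the vector that represents it, and each face plane in a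
  great circle in general.\<close>

definition Fn :: "(point \<Rightarrow> real) \<Rightarrow> point \<Rightarrow> real" where
  "Fn f x = (\<Sum>v\<in>V. coord x v * f v)"

abbreviation "M \<equiv> tetra_surface V"

lemma finite_V: "finite V"
  using card_V by (metis card.infinite zero_neq_numeral)

lemma span_V: "span V = UNIV"
  using card_ge_dim_independent[of V UNIV] indep card_V by auto

lemma lam_pos: "0 < lam" and lam_less: "lam < 1"
  using c_pos c_less by (auto simp: lam_def field_simps)

lemma coord_add: "coord (x + y) v = coord x v + coord y v"
  unfolding coord_def by (simp add: representation_add[OF indep] span_V)

lemma coord_scale: "coord (r *\<^sub>R x) v = r * coord x v"
  unfolding coord_def by (simp add: representation_scale[OF indep] span_V)

lemma coord_diff: "coord (x - y) v = coord x v - coord y v"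
  unfolding coord_def by (simp add: representation_diff[OF indep] span_V)

lemma coord_uminus: "coord (- x) v = - coord x v"
  using coord_scale[of "-1" x v] by simp

lemma linear_coord: "linear (\<lambda>x. coord x v)"
  by (rule linearI) (simp_all add: coord_add coord_scale)

lemma continuous_coord: "continuous_on S (\<lambda>x. coord x v)"
  using linear_continuous_on linear_coord linear_conv_bounded_linear by blast

lemma continuous_coord_comp: "continuous_on S g \<Longrightarrow> continuous_on S (\<lambda>t. coord (g t) v)"
  using continuous_on_compose2[OF continuous_coord[of UNIV v], of S g] by auto

lemma coord_V: "w \<in> V \<Longrightarrow> coord w v = (if v = w then 1 else 0)"
  unfolding coord_def using representation_basis[OF indep] by auto

lemma coord_expand: "x = (\<Sum>v\<in>V. coord x v *\<^sub>R v)"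
  unfolding coord_def using sum_representation_eq[OF indep _ finite_V order_refl, of x] span_V by simp

lemma coord_inject: "(\<And>v. v \<in> V \<Longrightarrow> coord x v = coord y v) \<Longrightarrow> x = y"
  using coord_expand[of x] coord_expand[of y] by (metis (mono_tags, lifting) sum.cong)

lemma Fn_add: "Fn f (x + y) = Fn f x + Fn f y"
  by (simp add: Fn_def coord_add distrib_right sum.distrib)

lemma Fn_scale: "Fn f (r *\<^sub>R x) = r * Fn f x"
  by (simp add: Fn_def coord_scale sum_distrib_left mult.assoc)

lemma continuous_Fn_comp: "continuous_on S g \<Longrightarrow> continuous_on S (\<lambda>t. Fn f (g t))"
  unfolding Fn_def by (intro continuous_intros continuous_coord_comp)

lemma quad_perms:
  assumes "quad u v w z"
  shows "quad v u w z" "quad u v z w" "quad u w v z" "quad w v z u" "quad u w z v" "quad v w u z"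
    "quad w z u v" "quad w u v z" "quad v u z w" "quad w v u z" "quad u z w v" "quad z v w u" "quad v z u w"
  using assms unfolding quad_def by auto

lemma quad_in: "quad u v w z \<Longrightarrow> u \<in> V \<and> v \<in> V \<and> w \<in> V \<and> z \<in> V"
  unfolding quad_def by auto

lemma quad_neq: "quad u v w z \<Longrightarrow> u \<noteq> v \<and> u \<noteq> w \<and> u \<noteq> z \<and> v \<noteq> u \<and> v \<noteq> w \<and> v \<noteq> z
    \<and> w \<noteq> u \<and> w \<noteq> v \<and> w \<noteq> z \<and> z \<noteq> u \<and> z \<noteq> v \<and> z \<noteq> w"
  unfolding quad_def by auto

lemma quad_cases: "quad u v w z \<Longrightarrow> x \<in> V \<Longrightarrow> x = u \<or> x = v \<or> x = w \<or> x = z"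
  unfolding quad_def by auto

lemma quad_ball: "quad u v w z \<Longrightarrow> (\<forall>x\<in>V. P x) \<longleftrightarrow> P u \<and> P v \<and> P w \<and> P z"
  using quad_in[of u v w z] quad_cases[of u v w z] by blast

lemma quad_exists: "u \<in> V \<Longrightarrow> v \<in> V \<Longrightarrow> u \<noteq> v \<Longrightarrow> \<exists>w z. quad u v w z"
proof -
  assume uv: "u \<in> V" "v \<in> V" "u \<noteq> v"
  have "card (V - {u,v}) = 2" using uv card_V finite_V by (simp add: card_Diff_subset)
  then obtain w z where "V - {u,v} = {w,z}" "w \<noteq> z" by (meson card_2_iff)
  then have "quad u v w z" using uv unfolding quad_def by auto
  then show ?thesis by blast
qed

lemma quad_sum: "quad u v w z \<Longrightarrow> (\<Sum>x\<in>V. g x) = g u + g v + g w + (g z :: 'b::ab_group_add)"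
proof -
  assume q: "quad u v w z"
  then have V: "V = {u, v, w, z}" by (simp add: quad_def)
  have d: "distinct [u, v, w, z]" using q by (simp add: quad_def)
  show ?thesis unfolding V using d by (simp add: add.assoc)
qed

lemma quad_expand:
  "quad u v w z \<Longrightarrow> x = coord x u *\<^sub>R u + coord x v *\<^sub>R v + coord x w *\<^sub>R w + coord x z *\<^sub>R z"
  using coord_expand[of x] quad_sum[of u v w z "\<lambda>v. coord x v *\<^sub>R v"] by simp

lemma quad_coord:
  assumes "quad u v w z" "x = a *\<^sub>R u + b *\<^sub>R v + d *\<^sub>R w + e *\<^sub>R z"
  shows "coord x u = a" "coord x v = b" "coord x w = d" "coord x z = e"
  unfolding assms(2) using quad_in[OF assms(1)] quad_neq[OF assms(1)]
  by (simp_all add: coord_add coord_scale coord_V)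

lemma quad_coord_eqI:
  assumes "quad u v w z" "coord x u = coord y u" "coord x v = coord y v" "coord x w = coord y w" "coord x z = coord y z"
  shows "x = y"
  by (rule coord_inject) (use assms quad_cases[OF assms(1)] in auto)

lemma Fn_quad: "quad u v w z \<Longrightarrow> Fn f x = coord x u * f u + coord x v * f v + coord x w * f w + coord x z * f z"
  unfolding Fn_def by (rule quad_sum)

lemma quad_gram:
  assumes "quad u v w z"
  shows "u \<bullet> u = 1" "v \<bullet> v = 1" "w \<bullet> w = 1" "z \<bullet> z = 1"
    "u \<bullet> v = c" "u \<bullet> w = c" "u \<bullet> z = c" "v \<bullet> u = c" "v \<bullet> w = c" "v \<bullet> z = c"
    "w \<bullet> u = c" "w \<bullet> v = c" "w \<bullet> z = c" "z \<bullet> u = c" "z \<bullet> v = c" "z \<bullet> w = c"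
  using gram unit quad_in[OF assms] quad_neq[OF assms] by (simp_all add: dot_square_norm)

text \<open>The Gram matrix of the vertices is \<open>1 - c\<close> times the identity plus
  \<open>c\<close> times the all-ones matrix.\<close>

lemma inner_coord:
  assumes q: "quad u v w z"
  shows "x \<bullet> y = (1 - c) * (coord x u * coord y u + coord x v * coord y v + coord x w * coord y w + coord x z * coord y z)
    + c * (coord x u + coord x v + coord x w + coord x z) * (coord y u + coord y v + coord y w + coord y z)"
proof -
  have "x \<bullet> y = (coord x u *\<^sub>R u + coord x v *\<^sub>R v + coord x w *\<^sub>R w + coord x z *\<^sub>R z) \<bullet>
     (coord y u *\<^sub>R u + coord y v *\<^sub>R v + coord y w *\<^sub>R w + coord y z *\<^sub>R z)"
    using quad_expand[OF q, of x] quad_expand[OF q, of y] by (rule arg_cong2)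
  also have "\<dots> = (1 - c) * (coord x u * coord y u + coord x v * coord y v + coord x w * coord y w + coord x z * coord y z)
    + c * (coord x u + coord x v + coord x w + coord x z) * (coord y u + coord y v + coord y w + coord y z)"
    by (simp only: inner_add_left inner_add_right inner_scaleR_left inner_scaleR_right quad_gram[OF q])
      (simp add: algebra_simps)
  finally show ?thesis .
qed

lemma convex_cone_sum_in:
  assumes "finite S" "\<And>v. v \<in> S \<Longrightarrow> 0 \<le> (a v :: real)"
  shows "(\<Sum>v\<in>S. a v *\<^sub>R v) \<in> convex_cone hull S"
proof -
  have "T \<subseteq> S \<Longrightarrow> (\<Sum>v\<in>T. a v *\<^sub>R v) \<in> convex_cone hull S" if "finite T" for T
    using that
  proof (induction T)
    case empty then show ?case by (simp add: convex_cone_hull_contains_0)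
  next
    case (insert x T)
    then show ?case using assms(2)[of x]
      by (simp add: convex_cone_hull_add convex_cone_hull_mul hull_inc)
  qed
  then show ?thesis using assms(1) by blast
qed

text \<open>The vertices form a basis, so membership in faces and edges becomes a matter of signs of
  coordinates.\<close>

lemma convex_cone_hull_V:
  assumes S: "S \<subseteq> V"
  shows "convex_cone hull S = {x. (\<forall>v\<in>V. 0 \<le> coord x v) \<and> (\<forall>v\<in>V - S. coord x v = 0)}" (is "_ = ?R")
proof
  have "convex_cone ?R"
    unfolding convex_cone_iff using coord_scale[of 0 0] by (auto simp: coord_add coord_scale)
  moreover have "S \<subseteq> ?R" using S by (auto simp: coord_V)
  ultimately show "convex_cone hull S \<subseteq> ?R" by (rule hull_minimal[rotated])
  show "?R \<subseteq> convex_cone hull S"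
  proof
    fix x assume x: "x \<in> ?R"
    have "x = (\<Sum>v\<in>V. coord x v *\<^sub>R v)" by (rule coord_expand)
    also have "\<dots> = (\<Sum>v\<in>S. coord x v *\<^sub>R v)"
      using x S finite_V by (intro sum.mono_neutral_right) auto
    also have "\<dots> \<in> convex_cone hull S"
      using x S finite_V finite_subset by (intro convex_cone_sum_in) auto
    finally show "x \<in> convex_cone hull S" .
  qed
qed

lemma sph_hull_V:
  assumes "S \<subseteq> V"
  shows "x \<in> sph_hull S \<longleftrightarrow> norm x = 1 \<and> (\<forall>v\<in>V. 0 \<le> coord x v) \<and> (\<forall>v\<in>V - S. coord x v = 0)"
  unfolding sph_hull_def convex_cone_hull_V[OF assms] by auto

lemma M_iff: "x \<in> M \<longleftrightarrow> norm x = 1 \<and> (\<forall>v\<in>V. 0 \<le> coord x v) \<and> (\<exists>v\<in>V. coord x v = 0)"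
  unfolding tetra_surface_def by (auto simp: sph_hull_V)

lemma edge_iff:
  assumes "quad u v w z"
  shows "x \<in> sph_hull {u, v} \<longleftrightarrow> norm x = 1 \<and> 0 \<le> coord x u \<and> 0 \<le> coord x v \<and> coord x w = 0 \<and> coord x z = 0"
proof -
  have e: "{u,v} \<subseteq> V" "V - {u,v} = {w,z}" using assms unfolding quad_def by auto
  show ?thesis unfolding sph_hull_V[OF e(1)] e(2) quad_ball[OF assms] by auto
qed

lemma norm_M: "x \<in> M \<Longrightarrow> norm x = 1" by (simp add: M_iff)

lemma coord_M: "x \<in> M \<Longrightarrow> v \<in> V \<Longrightarrow> 0 \<le> coord x v" by (simp add: M_iff)

lemma vertex_if_coord:
  assumes q: "quad u v w z" and x: "x \<in> M" "coord x v = 0" "coord x w = 0" "coord x z = 0"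
  shows "x = u"
proof -
  have e: "x = coord x u *\<^sub>R u" using quad_expand[OF q, of x] x by simp
  then have "norm x = \<bar>coord x u\<bar>" using unit quad_in[OF q] by (metis mult.right_neutral norm_scaleR)
  then have "coord x u = 1" using x coord_M[OF x(1)] quad_in[OF q] norm_M by fastforce
  then show ?thesis using e by simp
qed

text \<open>The hinge at the edge \<open>u v\<close>: the two faces at this edge without their other edges.\<close>
definition H :: "point \<Rightarrow> point \<Rightarrow> point set" where
  "H u v = {x \<in> M. 0 < coord x u \<and> 0 < coord x v}"

lemma norm_H: "x \<in> H u v \<Longrightarrow> norm x = 1" unfolding H_def using norm_M by auto

lemma H_wz: "quad u v w z \<Longrightarrow> x \<in> H u v \<Longrightarrow> coord x w = 0 \<or> coord x z = 0"
  unfolding H_def M_iff using quad_cases[of u v w z] by force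

text \<open>The rotation about the edge \<open>u v\<close> that carries the face \<open>u v z\<close> into the plane of the face
  \<open>u v w\<close>: it takes \<open>z\<close> to the mirror image \<open>lam (u + v) - w\<close> of \<open>w\<close> in the edge. Points of the
  face \<open>u v w\<close> are not moved.\<close>
definition Phi :: "point \<Rightarrow> point \<Rightarrow> point \<Rightarrow> point \<Rightarrow> point \<Rightarrow> point" where
  "Phi u v w z x = x + coord x z *\<^sub>R (lam *\<^sub>R (u + v) - w - z)"

lemma continuous_Phi_comp: "continuous_on S g \<Longrightarrow> continuous_on S (\<lambda>t. Phi u v w z (g t))"
  unfolding Phi_def by (intro continuous_intros continuous_coord_comp)

lemma Phi_id: "coord x z = 0 \<Longrightarrow> Phi u v w z x = x"
  by (simp add: Phi_def)

lemma coord_Phi: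
  assumes q: "quad u v w z"
  shows "coord (Phi u v w z x) u = coord x u + lam * coord x z"
    "coord (Phi u v w z x) v = coord x v + lam * coord x z"
    "coord (Phi u v w z x) w = coord x w - coord x z"
    "coord (Phi u v w z x) z = 0"
  using quad_in[OF q] quad_neq[OF q] unfolding Phi_def
  by (simp_all add: coord_add coord_scale coord_diff coord_V algebra_simps)

text \<open>The factor \<open>(1 - c) * (1 + 3 * c) / (1 + c)\<close> is the drop of the inner
  product of the two apexes when \<open>z\<close> is rotated into the plane of the other face. It is
  positive and meets only products of a \<open>w\<close>- with a \<open>z\<close>-coordinate, so
  distances are kept within a face and do not decrease across the edge.\<close>

lemma inner_Phi:
  assumes q: "quad u v w z"
  shows "Phi u v w z x \<bullet> Phi u v w z y = x \<bullet> y
    - (coord x w * coord y z + coord x z * coord y w) * ((1 - c) * (1 + 3 * c) / (1 + c))"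
proof -
  have l: "lam = 2 * c / (1 + c)" by (simp add: lam_def)
  have c1: "1 + c \<noteq> 0" using c_pos by simp
  show ?thesis
    unfolding inner_coord[OF q] coord_Phi[OF q] l using c1
    by (simp add: divide_simps) (simp add: algebra_simps power2_eq_square power3_eq_cube)
qed

lemma dist_Phi_same:
  assumes q: "quad u v w z" and xy: "coord x w = 0 \<and> coord y w = 0 \<or> coord x z = 0 \<and> coord y z = 0"
  shows "Phi u v w z x \<bullet> Phi u v w z y = x \<bullet> y"
  using inner_Phi[OF q, of x y] xy by auto

lemma inner_Phi_le:
  assumes q: "quad u v w z" and xy: "x \<in> H u v" "y \<in> H u v"
  shows "Phi u v w z x \<bullet> Phi u v w z y \<le> x \<bullet> y"
proof -
  have "0 \<le> coord x w * coord y z + coord x z * coord y w"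
    using xy coord_M quad_in[OF q] unfolding H_def by auto
  moreover have "0 \<le> (1 - c) * (1 + 3 * c) / (1 + c)" using c_pos c_less by simp
  ultimately show ?thesis unfolding inner_Phi[OF q]
    using mult_nonneg_nonneg[of "coord x w * coord y z + coord x z * coord y w" "(1 - c) * (1 + 3 * c) / (1 + c)"]
    by linarith
qed

lemma norm_Phi:
  assumes q: "quad u v w z" and x: "x \<in> H u v"
  shows "norm (Phi u v w z x) = 1"
proof -
  have "norm x = 1" using x norm_M unfolding H_def by auto
  then show ?thesis using inner_Phi[OF q, of x x] H_wz[OF q x] by (auto simp: norm_eq_sqrt_inner)
qed

lemma Phi_inject:
  assumes q: "quad u v w z" and xy: "x \<in> H u v" "y \<in> H u v" and e: "Phi u v w z x = Phi u v w z y"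
  shows "x = y"
proof -
  have "coord x w - coord x z = coord y w - coord y z" using coord_Phi(3)[OF q] e by metis
  moreover have "0 \<le> coord x w" "0 \<le> coord x z" "0 \<le> coord y w" "0 \<le> coord y z"
    using xy coord_M quad_in[OF q] unfolding H_def by auto
  ultimately have wz: "coord x w = coord y w" "coord x z = coord y z"
    using H_wz[OF q xy(1)] H_wz[OF q xy(2)] by auto
  then have "coord x u = coord y u" "coord x v = coord y v"
    using coord_Phi(1,2)[OF q, of x] coord_Phi(1,2)[OF q, of y] e by auto
  then show ?thesis using quad_coord_eqI[OF q] wz by blast
qed

text \<open>The unfolded hinge is a convex cone cut by the sphere, so that great-circle arcs between
  unfolded points can be pulled back.\<close>

lemma Phi_surj:
  assumes q: "quad u v w z" and xy: "x \<in> H u v" "y \<in> H u v"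
    and e: "p = \<alpha> *\<^sub>R Phi u v w z x + \<beta> *\<^sub>R Phi u v w z y" "0 \<le> \<alpha>" "0 \<le> \<beta>" and n: "norm p = 1"
  shows "\<exists>r\<in>H u v. Phi u v w z r = p"
proof -
  define a where "a = \<alpha> * coord x u + \<beta> * coord y u"
  define b where "b = \<alpha> * coord x v + \<beta> * coord y v"
  define W where "W = \<alpha> * coord x w + \<beta> * coord y w"
  define Z where "Z = \<alpha> * coord x z + \<beta> * coord y z"
  have "\<alpha> \<noteq> 0 \<or> \<beta> \<noteq> 0" using n e by auto
  then have ab: "0 < a" "0 < b" using e(2,3) xy unfolding a_def b_def H_def
    by (auto intro: add_pos_nonneg add_nonneg_pos mult_pos_pos)
  have WZ: "0 \<le> W" "0 \<le> Z" using e(2,3) xy coord_M quad_in[OF q] unfolding W_def Z_def H_def by auto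
  have cp: "coord p u = a + lam * Z" "coord p v = b + lam * Z" "coord p w = W - Z" "coord p z = 0"
    unfolding e(1) coord_add coord_scale coord_Phi[OF q] a_def b_def W_def Z_def by (simp_all add: algebra_simps)
  \<comment> \<open>\<open>Phi\<close> sends \<open>w + z\<close> to
    \<open>lam *\<^sub>R (u + v)\<close>. The common part \<open>m\<close> of the two apex
    coordinates can therefore be traded for edge coordinates, after which one apex coordinate is
    0.\<close>
  define m where "m = min W Z"
  define r where "r = (a + lam * m) *\<^sub>R u + (b + lam * m) *\<^sub>R v + (W - m) *\<^sub>R w + (Z - m) *\<^sub>R z"
  have cr: "coord r u = a + lam * m" "coord r v = b + lam * m" "coord r w = W - m" "coord r z = Z - m"
    using quad_coord[OF q r_def] by auto
  have Pr: "Phi u v w z r = p"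
    by (rule quad_coord_eqI[OF q]) (simp_all add: coord_Phi[OF q] cr cp algebra_simps)
  have m: "0 \<le> m" "m \<le> W" "m \<le> Z" "W = m \<or> Z = m" using WZ unfolding m_def by auto
  have pos: "0 < coord r u" "0 < coord r v" using ab m lam_pos unfolding cr by (auto intro: add_pos_nonneg)
  have "norm r = norm p" using inner_Phi[OF q, of r r] m cr Pr by (auto simp: norm_eq_sqrt_inner)
  moreover have "0 \<le> coord r x" if "x \<in> V" for x
    using quad_cases[OF q that] pos cr m by auto
  moreover have "coord r w = 0 \<or> coord r z = 0" using cr m by auto
  ultimately have "r \<in> H u v" using n pos quad_in[OF q] unfolding H_def M_iff by auto
  then show ?thesis using Pr by blast
qed

lemma Phi_not_antipodal:
  assumes q: "quad u v w z" and xy: "x \<in> H u v" "y \<in> H u v"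
  shows "Phi u v w z x \<noteq> - Phi u v w z y"
proof
  assume e: "Phi u v w z x = - Phi u v w z y"
  have "0 < coord (Phi u v w z x) u" "0 < coord (Phi u v w z y) u"
    using xy coord_M quad_in[OF q] lam_pos unfolding coord_Phi[OF q] H_def by (auto intro: add_pos_nonneg)
  then show False using e coord_uminus by auto
qed

lemma dist_Phi_ge:
  assumes q: "quad u v w z" and xy: "x \<in> H u v" "y \<in> H u v"
  shows "dist x y \<le> dist (Phi u v w z x) (Phi u v w z y)"
proof -
  have "(dist x y)\<^sup>2 \<le> (dist (Phi u v w z x) (Phi u v w z y))\<^sup>2"
    using inner_Phi_le[OF q xy] norm_H[OF xy(1)] norm_H[OF xy(2)] norm_Phi[OF q xy(1)] norm_Phi[OF q xy(2)]
    by (simp add: dist_sq_unit[where a=x and b=y] dist_sq_unit)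
  then show ?thesis by (rule power2_le_imp_le) simp
qed

lemma dist_Phi_eq:
  assumes q: "quad u v w z" and xy: "x \<in> H u v" "y \<in> H u v"
    "coord x w = 0 \<and> coord y w = 0 \<or> coord x z = 0 \<and> coord y z = 0"
  shows "dist (Phi u v w z x) (Phi u v w z y) = dist x y"
proof -
  have "(dist x y)\<^sup>2 = (dist (Phi u v w z x) (Phi u v w z y))\<^sup>2"
    using dist_Phi_same[OF q xy(3)] norm_H[OF xy(1)] norm_H[OF xy(2)] norm_Phi[OF q xy(1)] norm_Phi[OF q xy(2)]
    by (simp add: dist_sq_unit[where a=x and b=y] dist_sq_unit)
  then show ?thesis by simp
qed

text \<open>The functionals that take the same value at \<open>z\<close> and at its unfolded
  position, so that one functional describes a great circle across both faces.\<close>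

definition hinge :: "point \<Rightarrow> point \<Rightarrow> point \<Rightarrow> point \<Rightarrow> (point \<Rightarrow> real) \<Rightarrow> bool" where
  "hinge u v w z f \<longleftrightarrow> f w + f z = lam * (f u + f v)"

lemma Fn_Phi:
  assumes q: "quad u v w z" and h: "hinge u v w z f"
  shows "Fn f (Phi u v w z x) = Fn f x"
proof -
  have "f w = lam * (f u + f v) - f z" using h unfolding hinge_def by simp
  then show ?thesis unfolding Fn_quad[OF q] coord_Phi[OF q] by algebra
qed

text \<open>The inverse of \<open>Phi\<close> does not lengthen: the great-circle arc between the
  unfolded points pulls back to a path on the surface that is no longer than the arc.\<close>

lemma hinge_path:
  assumes q: "quad u v w z" and xy: "x \<in> H u v" "y \<in> H u v"
  obtains k where "path k" "path_image k \<subseteq> H u v" "pathstart k = x" "pathfinish k = y"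
    "curve_length k 0 1 \<le> ereal (sph_dist (Phi u v w z x) (Phi u v w z y))"
proof -
  let ?P = "Phi u v w z"
  let ?A = "?P x" and ?B = "?P y"
  have n: "norm ?A = 1" "norm ?B = 1" "?A \<noteq> - ?B"
    using norm_Phi[OF q] Phi_not_antipodal[OF q] xy by auto
  have "\<exists>r. r \<in> H u v \<and> ?P r = great_arc ?A ?B t" if "t \<in> {0..1}" for t
  proof -
    obtain \<alpha> \<beta> where "0 \<le> \<alpha>" "0 \<le> \<beta>" "great_arc ?A ?B t = \<alpha> *\<^sub>R ?A + \<beta> *\<^sub>R ?B"
      using great_arc_in_cone[OF n \<open>t \<in> {0..1}\<close>] by blast
    then show ?thesis using Phi_surj[OF q xy, of "great_arc ?A ?B t" \<alpha> \<beta>] norm_great_arc[OF n] by blast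
  qed
  then obtain k where k: "\<And>t. t \<in> {0..1} \<Longrightarrow> k t \<in> H u v \<and> ?P (k t) = great_arc ?A ?B t" by metis
  have d: "dist (k s) (k t) \<le> (t - s) * sph_dist ?A ?B" if "s \<in> {0..1}" "t \<in> {0..1}" "s \<le> t" for s t
    using dist_Phi_ge[OF q, of "k s" "k t"] k[OF that(1)] k[OF that(2)] dist_great_arc[OF n that(3)] by simp
  have d': "dist (k s) (k t) \<le> sph_dist ?A ?B * dist s t" if "s \<in> {0..1}" "t \<in> {0..1}" for s t
    using d[of s t] d[of t s] that by (cases "s \<le> t") (auto simp: dist_commute dist_real_def mult.commute)
  have "(sph_dist ?A ?B)-lipschitz_on {0..1} k"
    using d' sph_dist_range[OF n(1,2)] by (auto simp: lipschitz_on_def)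
  then have "continuous_on {0..1} k" by (rule lipschitz_on_continuous_on)
  then have "path k" by (simp add: path_def)
  moreover have "path_image k \<subseteq> H u v" using k by (auto simp: path_image_def)
  moreover have "k 0 = x" using k[of 0] Phi_inject[OF q, of "k 0" x] xy by simp
  moreover have "k 1 = y" using k[of 1] Phi_inject[OF q, of "k 1" y] xy n by simp
  moreover have "curve_length k 0 1 \<le> ereal (1 * sph_dist ?A ?B - 0 * sph_dist ?A ?B)"
    by (rule curve_length_le_potential) (use d in \<open>auto simp: left_diff_distrib\<close>)
  ultimately show ?thesis using that[of k] by (simp add: pathstart_def pathfinish_def)
qed

text \<open>\<open>Phi\<close> keeps distances only within a face. If two points of the path lie in
  different faces, the intermediate value theorem for \<open>D\<close> provides a point on the edge,
  and distances to it are kept from both sides.\<close>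

lemma sph_dist_Phi_le_curve_length:
  assumes q: "quad u v w z" and "a \<le> b" and cont: "continuous_on {a..b} h" and hH: "h ` {a..b} \<subseteq> H u v"
  shows "ereal (sph_dist (Phi u v w z (h a)) (Phi u v w z (h b))) \<le> curve_length h a b"
proof (rule sph_dist_le_curve_length[OF \<open>a \<le> b\<close>])
  let ?P = "Phi u v w z"
  show "continuous_on {a..b} (\<lambda>t. ?P (h t))" by (rule continuous_Phi_comp[OF cont])
  show "norm (?P (h t)) = 1" if "t \<in> {a..b}" for t
    using norm_Phi[OF q, of "h t"] hH that by (auto simp: image_subset_iff)
  fix s t assume st: "a \<le> s" "s \<le> t" "t \<le> b"
  have "\<exists>r\<in>{s..t}. (coord (h s) w = 0 \<and> coord (h r) w = 0 \<or> coord (h s) z = 0 \<and> coord (h r) z = 0)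
     \<and> (coord (h r) w = 0 \<and> coord (h t) w = 0 \<or> coord (h r) z = 0 \<and> coord (h t) z = 0)"
  proof -
    define D where "D r = coord (h r) w - coord (h r) z" for r
    have cd: "continuous_on {s..t} D" unfolding D_def
      by (intro continuous_intros continuous_coord_comp continuous_on_subset[OF cont]) (use st in auto)
    have wz: "coord (h r) w = 0 \<and> D r \<le> 0 \<or> coord (h r) z = 0 \<and> 0 \<le> D r" "D r = 0 \<Longrightarrow> coord (h r) w = 0 \<and> coord (h r) z = 0"
      if r: "r \<in> {s..t}" for r
    proof -
      have "h r \<in> H u v" using hH r st by auto
      then have "coord (h r) w = 0 \<or> coord (h r) z = 0" "0 \<le> coord (h r) w" "0 \<le> coord (h r) z"
        using H_wz[OF q, of "h r"] coord_M quad_in[OF q] unfolding H_def by auto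
      then show "coord (h r) w = 0 \<and> D r \<le> 0 \<or> coord (h r) z = 0 \<and> 0 \<le> D r"
        "D r = 0 \<Longrightarrow> coord (h r) w = 0 \<and> coord (h r) z = 0" unfolding D_def by auto
    qed
    consider "D s \<le> 0 \<and> D t \<le> 0 \<or> 0 \<le> D s \<and> 0 \<le> D t" | "D s < 0 \<and> 0 < D t" | "0 < D s \<and> D t < 0" by linarith
    then show ?thesis
    proof cases
      case 1
      then show ?thesis using wz[of s] wz[of t] st by (intro bexI[of _ t]) auto
    next
      case 2
      then obtain r where "r \<in> {s..t}" "D r = 0" using IVT'[of D s 0 t] cd st by force
      then show ?thesis using wz[of s] wz[of t] wz[of r] st by (intro bexI[of _ r]) auto
    next
      case 3
      then obtain r where "r \<in> {s..t}" "D r = 0" using IVT2'[of D t 0 s] cd st by force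
      then show ?thesis using wz[of s] wz[of t] wz[of r] st by (intro bexI[of _ r]) auto
    qed
  qed
  then obtain r where r: "r \<in> {s..t}" "coord (h s) w = 0 \<and> coord (h r) w = 0 \<or> coord (h s) z = 0 \<and> coord (h r) z = 0"
     "coord (h r) w = 0 \<and> coord (h t) w = 0 \<or> coord (h r) z = 0 \<and> coord (h t) z = 0" by blast
  have "h s \<in> H u v" "h r \<in> H u v" "h t \<in> H u v" using hH st r(1) by auto
  then show "\<exists>r\<in>{s..t}. dist (?P (h s)) (?P (h r)) \<le> dist (h s) (h r) \<and> dist (?P (h r)) (?P (h t)) \<le> dist (h r) (h t)"
    using dist_Phi_eq[OF q] r by (intro bexI[OF _ r(1)]) auto
qed

end

section \<open>Locally shortest curves\<close>

lemma curve_length_join: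
  assumes "pathfinish g1 = pathstart g2"
  shows "curve_length (g1 +++ g2) 0 1 \<le> curve_length g1 0 1 + curve_length g2 0 1"
proof -
  have "curve_length (g1 +++ g2) 0 1 = curve_length (g1 +++ g2) 0 (1/2) + curve_length (g1 +++ g2) (1/2) 1"
    by (rule curve_length_add) auto
  also have "curve_length (g1 +++ g2) 0 (1/2) = curve_length (\<lambda>t. g1 (2 * t)) 0 (1/2)"
    by (rule curve_length_cong) (auto simp: joinpaths_def)
  also have "curve_length (g1 +++ g2) (1/2) 1 = curve_length (\<lambda>t. g2 (2 * t - 1)) (1/2) 1"
  proof (rule curve_length_cong)
    fix t :: real assume "t \<in> {1/2..1}"
    then consider "t = 1/2" | "1/2 < t" by fastforce
    then show "(g1 +++ g2) t = g2 (2 * t - 1)"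
    proof cases
      case 1
      show ?thesis unfolding 1 using assms by (simp add: joinpaths_def pathstart_def pathfinish_def)
    qed (simp add: joinpaths_def)
  qed
  also have "curve_length (\<lambda>t. g1 (2 * t)) 0 (1/2) \<le> curve_length g1 0 1"
    using curve_length_reparam_le[of 0 "1/2" "\<lambda>t. 2 * t" g1] by (simp add: mono_on_def)
  also have "curve_length (\<lambda>t. g2 (2 * t - 1)) (1/2) 1 \<le> curve_length g2 0 1"
    using curve_length_reparam_le[of "1/2" 1 "\<lambda>t. 2 * t - 1" g2] by (simp add: mono_on_def)
  finally show ?thesis by (simp add: add_mono)
qed

lemma curve_length_subpath_le:
  fixes a b :: real
  assumes "a \<le> b"
  shows "curve_length (\<lambda>t. h (a + t * (b - a))) 0 1 \<le> curve_length h a b"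
  using curve_length_reparam_le[of 0 1 "\<lambda>t. a + t * (b - a)" h] assms
  by (simp add: mono_on_def mult_right_mono)

context tetra begin

lemma M_to_vertex:
  assumes x: "x \<in> M" "coord x z = 0" and v: "v \<in> V" "v \<noteq> z" and z: "z \<in> V"
  obtains k where "path k" "path_image k \<subseteq> M" "pathstart k = x" "pathfinish k = v" "curve_length k 0 1 < \<infinity>"
proof -
  have n: "norm x = 1" "norm v = 1" using x v unit norm_M by auto
  have "x \<noteq> - v"
  proof
    assume "x = - v"
    then have "coord x v = - 1" using v by (simp add: coord_uminus coord_V)
    then show False using coord_M[OF x(1) v(1)] by simp
  qed
  note n = n this
  have "great_arc x v t \<in> M" if t: "t \<in> {0..1}" for t
  proof -
    obtain \<alpha> \<beta> where ab: "0 \<le> \<alpha>" "0 \<le> \<beta>" "great_arc x v t = \<alpha> *\<^sub>R x + \<beta> *\<^sub>R v"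
      using great_arc_in_cone[OF n t] by blast
    have "coord (great_arc x v t) y = \<alpha> * coord x y + \<beta> * coord v y" for y
      unfolding ab(3) by (simp add: coord_add coord_scale)
    then have "\<forall>y\<in>V. 0 \<le> coord (great_arc x v t) y" "coord (great_arc x v t) z = 0"
      using ab x v coord_M by (auto simp: coord_V)
    then show ?thesis unfolding M_iff using z norm_great_arc[OF n] by auto
  qed
  then have "path_image (great_arc x v) \<subseteq> M" by (auto simp: path_image_def)
  moreover have "path (great_arc x v)" by (simp add: path_def continuous_great_arc)
  moreover have "curve_length (great_arc x v) 0 1 \<le> ereal (1 * sph_dist x v - 0 * sph_dist x v)"
    by (rule curve_length_le_potential) (use dist_great_arc[OF n] in \<open>auto simp: left_diff_distrib\<close>)
  then have "curve_length (great_arc x v) 0 1 < \<infinity>" by auto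
  ultimately show ?thesis using that[of "great_arc x v"] n by (simp add: pathstart_def pathfinish_def)
qed

text \<open>Two faces always share a vertex \<open>v\<close>, and two arcs through it join the
  points. Finite length of shortest curves, which follows, permits the cancellation in
  \<open>shortest_sub\<close>.\<close>

lemma M_path_finite_length:
  assumes "x \<in> M" "y \<in> M"
  obtains k where "path k" "path_image k \<subseteq> M" "pathstart k = x" "pathfinish k = y" "curve_length k 0 1 < \<infinity>"
proof -
  obtain z1 z2 where z: "z1 \<in> V" "coord x z1 = 0" "z2 \<in> V" "coord y z2 = 0" using assms by (auto simp: M_iff)
  have "\<not> V \<subseteq> {z1,z2}" using card_V card_mono[of "{z1,z2}" V] by (auto simp: card_insert_if split: if_splits)
  then obtain v where v: "v \<in> V" "v \<noteq> z1" "v \<noteq> z2" by blast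
  obtain k1 where k1: "path k1" "path_image k1 \<subseteq> M" "pathstart k1 = x" "pathfinish k1 = v" "curve_length k1 0 1 < \<infinity>"
    using M_to_vertex[OF assms(1) z(2) v(1,2) z(1)] by blast
  obtain k2 where k2: "path k2" "path_image k2 \<subseteq> M" "pathstart k2 = y" "pathfinish k2 = v" "curve_length k2 0 1 < \<infinity>"
    using M_to_vertex[OF assms(2) z(4) v(1,3) z(3)] by blast
  have "curve_length (reversepath k2) 0 1 \<le> curve_length k2 0 1"
    using curve_length_reverse_le[of k2 1 1 0] by (simp add: reversepath_def)
  then have r: "curve_length (reversepath k2) 0 1 < \<infinity>" using k2(5) by (rule le_less_trans)
  have "curve_length (k1 +++ reversepath k2) 0 1 \<le> curve_length k1 0 1 + curve_length (reversepath k2) 0 1"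
    by (rule curve_length_join) (simp add: k1 k2)
  also have "\<dots> < \<infinity>" using k1(5) r by simp
  finally show ?thesis using that[of "k1 +++ reversepath k2"] k1 k2 by (simp add: path_image_join)
qed

lemma shortest_sub:
  assumes s: "shortest_on M h a b" and cont: "continuous_on {a..b} h" and hM: "h ` {a..b} \<subseteq> M"
    and ab: "a \<le> a'" "a' \<le> b'" "b' \<le> b"
  shows "shortest_on M h a' b'"
  unfolding shortest_on_def
proof (intro allI impI)
  fix k assume k: "path k \<and> path_image k \<subseteq> M \<and> pathstart k = h a' \<and> pathfinish k = h b'"
  have hin: "h a \<in> M" "h b \<in> M" using hM ab by auto
  obtain k0 where "path k0" "path_image k0 \<subseteq> M" "pathstart k0 = h a" "pathfinish k0 = h b" "curve_length k0 0 1 < \<infinity>"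
    using M_path_finite_length[OF hin] by blast
  then have fin: "curve_length h a b < \<infinity>" using s unfolding shortest_on_def by (metis le_less_trans)
  let ?p = "\<lambda>t. h (a + t * (a' - a))" and ?r = "\<lambda>t. h (b' + t * (b - b'))"
  have inI: "x + t * (y - x) \<in> {x..y}" if "x \<le> y" "t \<in> {0..1}" for x y t :: real
    using that mult_left_le[of t "y - x"] by (auto simp: mult.commute)
  have pI: "(\<lambda>t. a + t * (a' - a)) ` {0..1} \<subseteq> {a..b}" and rI: "(\<lambda>t. b' + t * (b - b')) ` {0..1} \<subseteq> {a..b}"
  proof -
    show "(\<lambda>t. a + t * (a' - a)) ` {0..1} \<subseteq> {a..b}"
    proof
      fix y assume "y \<in> (\<lambda>t. a + t * (a' - a)) ` {0..1}"
      then obtain t where "t \<in> {0..1}" "y = a + t * (a' - a)" by blast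
      then show "y \<in> {a..b}" using inI[of a a' t] ab by auto
    qed
    show "(\<lambda>t. b' + t * (b - b')) ` {0..1} \<subseteq> {a..b}"
    proof
      fix y assume "y \<in> (\<lambda>t. b' + t * (b - b')) ` {0..1}"
      then obtain t where "t \<in> {0..1}" "y = b' + t * (b - b')" by blast
      then have "y \<in> {b'..b}" using inI[of b' b t] ab by blast
      then show "y \<in> {a..b}" using ab by simp
    qed
  qed
  have "path ?p" unfolding path_def
    by (rule continuous_on_compose2[OF cont _ pI]) (intro continuous_intros)
  moreover have "path ?r" unfolding path_def
    by (rule continuous_on_compose2[OF cont _ rI]) (intro continuous_intros)
  moreover have "path_image ?p \<subseteq> M" "path_image ?r \<subseteq> M"
    using pI rI hM unfolding path_image_def image_subset_iff by blast+
  moreover have ends: "pathstart ?p = h a" "pathfinish ?p = h a'" "pathstart ?r = h b'" "pathfinish ?r = h b"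
    by (simp_all add: pathstart_def pathfinish_def)
  ultimately have "path (?p +++ (k +++ ?r)) \<and> path_image (?p +++ (k +++ ?r)) \<subseteq> M \<and>
     pathstart (?p +++ (k +++ ?r)) = h a \<and> pathfinish (?p +++ (k +++ ?r)) = h b"
    using k by (simp add: path_image_join)
  then have "curve_length h a b \<le> curve_length (?p +++ (k +++ ?r)) 0 1"
    using s unfolding shortest_on_def by blast
  also have "\<dots> \<le> curve_length ?p 0 1 + curve_length (k +++ ?r) 0 1"
    by (rule curve_length_join) (use k in \<open>simp add: pathfinish_def\<close>)
  also have "curve_length (k +++ ?r) 0 1 \<le> curve_length k 0 1 + curve_length ?r 0 1"
    by (rule curve_length_join) (use k in \<open>simp add: pathstart_def[of ?r]\<close>)
  also have "curve_length ?p 0 1 \<le> curve_length h a a'" by (rule curve_length_subpath_le) (rule ab)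
  also have "curve_length ?r 0 1 \<le> curve_length h b' b" by (rule curve_length_subpath_le) (rule ab)
  finally have le: "curve_length h a b \<le> curve_length h a a' + (curve_length k 0 1 + curve_length h b' b)"
    by (simp add: add_mono)
  have e: "curve_length h a b = curve_length h a a' + (curve_length h a' b' + curve_length h b' b)"
    using curve_length_add[of a a' b h] curve_length_add[of a' b' b h] ab by simp
  have nn: "0 \<le> curve_length h a a'" "0 \<le> curve_length h a' b'" "0 \<le> curve_length h b' b" "0 \<le> curve_length k 0 1"
    using ab by (auto intro: curve_length_nonneg)
  \<comment> \<open>The outer pieces may be cancelled because the total length is finite by
    \<open>fin\<close>; in \<open>ereal\<close> this is not automatic.\<close>
  show "curve_length h a' b' \<le> curve_length k 0 1"
    using nn le fin unfolding e
    by (cases "curve_length h a a'"; cases "curve_length h a' b'"; cases "curve_length h b' b"; cases "curve_length k 0 1") auto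
qed

text \<open>\<open>hinge_path\<close> bounds the length from above by the unfolded distance, and the
  two halves are bounded from below by theirs. This forces equality in the triangle
  inequality.\<close>

lemma shortest_hinge_straight:
  assumes q: "quad u v w z" and sh: "shortest_on M h a b" and cont: "continuous_on {a..b} h"
    and hH: "h ` {a..b} \<subseteq> H u v" and ne: "h a \<noteq> h b" and s: "a \<le> s" "s \<le> b"
  shows "\<exists>\<alpha> \<beta>. 0 \<le> \<alpha> \<and> 0 \<le> \<beta> \<and>
    Phi u v w z (h s) = \<alpha> *\<^sub>R Phi u v w z (h a) + \<beta> *\<^sub>R Phi u v w z (h b)"
proof -
  let ?P = "Phi u v w z"
  have hin: "h a \<in> H u v" "h s \<in> H u v" "h b \<in> H u v" using hH s by auto
  obtain k where k: "path k" "path_image k \<subseteq> H u v" "pathstart k = h a" "pathfinish k = h b"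
    "curve_length k 0 1 \<le> ereal (sph_dist (?P (h a)) (?P (h b)))"
    using hinge_path[OF q hin(1,3)] by blast
  have "path_image k \<subseteq> M" using k(2) unfolding H_def by auto
  then have "curve_length h a b \<le> curve_length k 0 1" using sh k unfolding shortest_on_def by blast
  then have up: "curve_length h a b \<le> ereal (sph_dist (?P (h a)) (?P (h b)))" using k(5) by (rule order_trans)
  have "ereal (sph_dist (?P (h a)) (?P (h s))) \<le> curve_length h a s"
    by (rule sph_dist_Phi_le_curve_length[OF q]) (use s hH continuous_on_subset[OF cont] in \<open>auto simp: image_subset_iff\<close>)
  moreover have "ereal (sph_dist (?P (h s)) (?P (h b))) \<le> curve_length h s b"
    by (rule sph_dist_Phi_le_curve_length[OF q]) (use s hH continuous_on_subset[OF cont] in \<open>auto simp: image_subset_iff\<close>)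
  ultimately have "ereal (sph_dist (?P (h a)) (?P (h s))) + ereal (sph_dist (?P (h s)) (?P (h b))) \<le> curve_length h a b"
    unfolding curve_length_add[OF s] by (rule add_mono)
  then have "ereal (sph_dist (?P (h a)) (?P (h s))) + ereal (sph_dist (?P (h s)) (?P (h b))) \<le> ereal (sph_dist (?P (h a)) (?P (h b)))"
    using up by (rule order_trans)
  then have "sph_dist (?P (h a)) (?P (h s)) + sph_dist (?P (h s)) (?P (h b)) \<le> sph_dist (?P (h a)) (?P (h b))"
    by simp
  moreover have "?P (h a) \<noteq> ?P (h b)" using Phi_inject[OF q hin(1,3)] ne by auto
  ultimately show ?thesis
    using sph_dist_between[of "?P (h a)" "?P (h s)" "?P (h b)"] norm_Phi[OF q] hin Phi_not_antipodal[OF q hin(1,3)]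
    by blast
qed

text \<open>A competing path inside the hinge is at least as long as the unfolded distance. One that
  leaves the hinge reaches a point at least that far away by \<open>far\<close>.\<close>

lemma shortest_hingeI:
  assumes q: "quad u v w z" and ab: "a \<le> b" and gH: "g a \<in> H u v"
    and len: "curve_length g a b \<le> ereal (sph_dist (Phi u v w z (g a)) (Phi u v w z (g b)))"
    and far: "\<And>y. y \<in> M \<Longrightarrow> y \<notin> H u v \<Longrightarrow> sph_dist (Phi u v w z (g a)) (Phi u v w z (g b)) \<le> dist (g a) y"
  shows "shortest_on M g a b"
  unfolding shortest_on_def
proof (intro allI impI)
  fix k assume k: "path k \<and> path_image k \<subseteq> M \<and> pathstart k = g a \<and> pathfinish k = g b"
  show "curve_length g a b \<le> curve_length k 0 1"
  proof (cases "path_image k \<subseteq> H u v")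
    case True
    have "ereal (sph_dist (Phi u v w z (k 0)) (Phi u v w z (k 1))) \<le> curve_length k 0 1"
      by (rule sph_dist_Phi_le_curve_length[OF q]) (use k True in \<open>auto simp: path_def path_image_def\<close>)
    then show ?thesis using len k by (simp add: pathstart_def pathfinish_def order_trans)
  next
    case False
    then obtain s where s: "s \<in> {0..1}" "k s \<notin> H u v" by (auto simp: path_image_def image_subset_iff)
    have "ereal (dist (k 0) (k s)) \<le> curve_length k 0 1" by (rule curve_length_ge_dist) (use s in auto)
    moreover have "k s \<in> M" using k s by (auto simp: path_image_def)
    then have "sph_dist (Phi u v w z (g a)) (Phi u v w z (g b)) \<le> dist (k 0) (k s)"
      using far[of "k s"] s k by (simp add: pathstart_def)
    ultimately have "ereal (sph_dist (Phi u v w z (g a)) (Phi u v w z (g b))) \<le> curve_length k 0 1"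
      by (simp add: order_trans[OF ereal_less_eq(3)[THEN iffD2]])
    then show ?thesis using len by (rule order_trans[rotated])
  qed
qed

text \<open>\<open>h\<close> is a curve whose image under the unfolding of each hinge is locally a great-circle arc,
  run through monotonically.\<close>
definition straight :: "(real \<Rightarrow> point) \<Rightarrow> bool" where
  "straight h \<longleftrightarrow> continuous_on UNIV h \<and> range h \<subseteq> M - V \<and>
    (\<forall>u v w z t. quad u v w z \<longrightarrow> h t \<in> H u v \<longrightarrow>
      (\<exists>e>0. (\<forall>s. \<bar>s - t\<bar> < e \<longrightarrow> h s \<in> H u v) \<and>
        (\<forall>a s b. t - e < a \<longrightarrow> a \<le> s \<longrightarrow> s \<le> b \<longrightarrow> b < t + e \<longrightarrow> a < b \<longrightarrow>
          (\<exists>\<alpha> \<beta>. 0 \<le> \<alpha> \<and> 0 \<le> \<beta> \<and>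
             Phi u v w z (h s) = \<alpha> *\<^sub>R Phi u v w z (h a) + \<beta> *\<^sub>R Phi u v w z (h b)))))"

lemma periodic_int:
  assumes "\<And>t. h (t + 1) = (h t :: 'a)"
  shows "h (t + real_of_int n) = h t"
proof -
  have *: "h (t + real m) = h t" for t and m :: nat
  proof (induction m)
    case (Suc m)
    have "t + real (Suc m) = (t + real m) + 1" by simp
    then show ?case using assms[of "t + real m"] Suc by metis
  qed simp
  show ?thesis
  proof (cases "0 \<le> n")
    case True then show ?thesis using *[of t "nat n"] by simp
  next
    case False then show ?thesis using *[of "t + real_of_int n" "nat (- n)"] by simp
  qed
qed

lemma simple_closed_eq:
  assumes "simple_closed_geodesic V h" "h s = h t"
  shows "s - t \<in> \<int>"
proof -
  have p: "\<And>t. h (t + 1) = h t" and i: "inj_on h {0..<1}"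
    using assms(1) unfolding simple_closed_geodesic_def by auto
  have f: "h (frac x) = h x" for x
    using periodic_int[of h "x" "- \<lfloor>x\<rfloor>"] p by (simp add: frac_def)
  have "h (frac s) = h (frac t)" using f assms(2) by simp
  then have "frac s = frac t" using i by (auto simp: inj_on_def frac_lt_1)
  then have "s - t = real_of_int (\<lfloor>s\<rfloor> - \<lfloor>t\<rfloor>)" by (simp add: frac_def algebra_simps)
  then show ?thesis by (metis Ints_of_int)
qed

lemma simple_closed_local_inj:
  assumes "simple_closed_geodesic V h" "h s = h t" "\<bar>s - t\<bar> < 1"
  shows "s = t"
  using simple_closed_eq[OF assms(1,2)] assms(3) Ints_nonzero_abs_less1 by force

lemma geodesic_straight:
  assumes g: "simple_closed_geodesic V h"
  shows "straight h"
proof -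
  have tg: "tetra_geodesic V h" using g unfolding simple_closed_geodesic_def by blast
  then have cont: "continuous_on UNIV h" and ran: "range h \<subseteq> M - V" unfolding tetra_geodesic_def by auto
  have "\<exists>e>0. (\<forall>s. \<bar>s - t\<bar> < e \<longrightarrow> h s \<in> H u v) \<and>
        (\<forall>a s b. t - e < a \<longrightarrow> a \<le> s \<longrightarrow> s \<le> b \<longrightarrow> b < t + e \<longrightarrow> a < b \<longrightarrow>
          (\<exists>\<alpha> \<beta>. 0 \<le> \<alpha> \<and> 0 \<le> \<beta> \<and>
             Phi u v w z (h s) = \<alpha> *\<^sub>R Phi u v w z (h a) + \<beta> *\<^sub>R Phi u v w z (h b)))"
    if q: "quad u v w z" and ht: "h t \<in> H u v" for u v w z t
  proof -
    obtain a0 b0 where ab: "a0 < t" "t < b0" "shortest_on M h a0 b0" using tg unfolding tetra_geodesic_def by blast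
    have op: "open {s. 0 < coord (h s) u \<and> 0 < coord (h s) v}"
      by (intro open_Collect_conj open_Collect_less continuous_intros continuous_coord_comp[OF cont])
    moreover have "t \<in> {s. 0 < coord (h s) u \<and> 0 < coord (h s) v}" using ht unfolding H_def by simp
    ultimately obtain e1 where e1: "0 < e1" "ball t e1 \<subseteq> {s. 0 < coord (h s) u \<and> 0 < coord (h s) v}"
      using open_contains_ball by blast
    \<comment> \<open>The bound \<open>1/2\<close> keeps the window shorter than a period, so that
      \<open>h a \<noteq> h b\<close> follows from simplicity.\<close>
    define e where "e = min (min e1 (1/2)) (min (t - a0) (b0 - t))"
    have "e \<le> min e1 (1/2)" "e \<le> min (t - a0) (b0 - t)"
      unfolding e_def by (rule min.cobounded1, rule min.cobounded2)
    then have e: "e \<le> e1" "e \<le> 1/2" "e \<le> t - a0" "e \<le> b0 - t" unfolding min.bounded_iff by blast+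
    have e0: "0 < e" using e1 ab unfolding e_def by simp
    have inH: "h s \<in> H u v" if "\<bar>s - t\<bar> < e" for s
    proof -
      have "s \<in> ball t e1" using that e by (simp add: dist_real_def)
      then show ?thesis using e1(2) ran unfolding H_def by auto
    qed
    moreover have "\<exists>\<alpha> \<beta>. 0 \<le> \<alpha> \<and> 0 \<le> \<beta> \<and>
             Phi u v w z (h s) = \<alpha> *\<^sub>R Phi u v w z (h a) + \<beta> *\<^sub>R Phi u v w z (h b)"
      if "t - e < a" "a \<le> s" "s \<le> b" "b < t + e" "a < b" for a s b
    proof (rule shortest_hinge_straight[OF q _ _ _ _ that(2,3)])
      show "shortest_on M h a b"
        by (rule shortest_sub[OF ab(3)]) (use that e ran continuous_on_subset[OF cont] in auto)
      show "continuous_on {a..b} h" using continuous_on_subset[OF cont] by auto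
      show "h ` {a..b} \<subseteq> H u v" using inH that by (force simp: abs_less_iff)
      show "h a \<noteq> h b" using simple_closed_local_inj[OF g, of a b] that e by auto
    qed
    ultimately show ?thesis using e0 by blast
  qed
  then show ?thesis using cont ran unfolding straight_def by blast
qed

end

section \<open>The crossings of a closed geodesic with the edges\<close>

text \<open>The last two assumptions are what the type provides: finitely many points on each edge,
  and at least one crossing because \<open>p + q\<close> is positive.\<close>

locale geod = tetra V c for V c +
  fixes h :: "real \<Rightarrow> point"
  assumes scg: "simple_closed_geodesic V h"
    and fin_edges: "\<And>u v. u \<in> V \<Longrightarrow> v \<in> V \<Longrightarrow> u \<noteq> v \<Longrightarrow> finite (range h \<inter> sph_hull {u, v})"
    and meets: "\<exists>t. \<exists>v\<in>V. \<exists>w\<in>V. v \<noteq> w \<and> coord (h t) v = 0 \<and> coord (h t) w = 0"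
begin

lemma str: "straight h" by (rule geodesic_straight[OF scg])

lemma cont: "continuous_on S h"
proof -
  have "continuous_on UNIV h" using scg unfolding simple_closed_geodesic_def tetra_geodesic_def by simp
  then show ?thesis using continuous_on_subset by blast
qed

lemma hM: "h t \<in> M" and hV: "h t \<notin> V"
proof -
  have "range h \<subseteq> M - V" using scg unfolding simple_closed_geodesic_def tetra_geodesic_def by simp
  then show "h t \<in> M" "h t \<notin> V" by auto
qed

lemma period: "h (t + 1) = h t" and period_int: "h (t + real_of_int n) = h t"
proof -
  show *: "h (t + 1) = h t" for t using scg unfolding simple_closed_geodesic_def by blast
  show "h (t + real_of_int n) = h t" by (rule periodic_int[of h]) (rule *)
qed

lemma inj_mod: "h s = h t \<Longrightarrow> \<exists>n::int. s = t + real_of_int n"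
  using simple_closed_eq[OF scg, of s t] by (auto elim!: Ints_cases simp: algebra_simps)

lemma inj_near: "h s = h t \<Longrightarrow> \<bar>s - t\<bar> < 1 \<Longrightarrow> s = t"
  using simple_closed_local_inj[OF scg] by blast

lemma coord_h: "v \<in> V \<Longrightarrow> 0 \<le> coord (h t) v" using coord_M[OF hM] .

text \<open>The parameters at which \<open>h\<close> crosses an edge.\<close>
definition T :: "real set" where
  "T = {t. \<exists>v\<in>V. \<exists>w\<in>V. v \<noteq> w \<and> coord (h t) v = 0 \<and> coord (h t) w = 0}"

lemma T_period: "t + real_of_int n \<in> T \<longleftrightarrow> t \<in> T"
  unfolding T_def by (simp add: period_int)

lemma edge_points:
  assumes q: "quad u v w z" "coord (h t) w = 0" "coord (h t) z = 0"
  shows "t \<in> T" "0 < coord (h t) u" "0 < coord (h t) v" "h t \<in> H u v" "h t \<in> sph_hull {u, v}"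
proof -
  show "t \<in> T" unfolding T_def using quad_in[OF q(1)] quad_neq[OF q(1)] q by blast
  have "coord (h t) u \<noteq> 0" using vertex_if_coord[OF quad_perms(1)[OF q(1)], of "h t"] hM hV q quad_in[OF q(1)] by metis
  then show u: "0 < coord (h t) u" using coord_h quad_in[OF q(1)] by (simp add: order_less_le)
  have "coord (h t) v \<noteq> 0" using vertex_if_coord[OF q(1), of "h t"] hM hV q quad_in[OF q(1)] by metis
  then show v: "0 < coord (h t) v" using coord_h quad_in[OF q(1)] by (simp add: order_less_le)
  show "h t \<in> H u v" using u v hM unfolding H_def by simp
  show "h t \<in> sph_hull {u, v}" using edge_iff[OF q(1)] u v q hM norm_M by auto
qed

lemma T_edge:
  assumes "t \<in> T"
  obtains u v w z where "quad u v w z" "coord (h t) w = 0" "coord (h t) z = 0"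
proof -
  obtain w z where "w \<in> V" "z \<in> V" "w \<noteq> z" "coord (h t) w = 0" "coord (h t) z = 0"
    using assms unfolding T_def by blast
  then show ?thesis using quad_exists[of w z] quad_perms(7) that by metis
qed

lemma finite_T_unit: "finite (T \<inter> {a..<a+1})"
proof -
  have "inj_on h (T \<inter> {a..<a+1})"
    by (rule inj_onI) (rule inj_near, auto)
  moreover have "h ` (T \<inter> {a..<a+1}) \<subseteq> (\<Union>u\<in>V. \<Union>v\<in>V - {u}. range h \<inter> sph_hull {u, v})"
  proof
    fix x assume "x \<in> h ` (T \<inter> {a..<a+1})"
    then obtain t where t: "t \<in> T" "x = h t" by blast
    obtain u v w z where q: "quad u v w z" "coord (h t) w = 0" "coord (h t) z = 0" using T_edge[OF t(1)] by blast
    then show "x \<in> (\<Union>u\<in>V. \<Union>v\<in>V - {u}. range h \<inter> sph_hull {u, v})"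
      using edge_points(5)[OF q] t quad_in[OF q(1)] quad_neq[OF q(1)] by blast
  qed
  moreover have "finite (\<Union>u\<in>V. \<Union>v\<in>V - {u}. range h \<inter> sph_hull {u, v})"
    by (intro finite_UN_I finite_V finite_Diff fin_edges) auto
  ultimately show ?thesis by (meson finite_imageD finite_subset)
qed

lemma finite_T: "finite (T \<inter> {a..b})"
proof -
  have *: "finite (T \<inter> {a..<a + real n})" for n
  proof (induction n)
    case (Suc n)
    have "T \<inter> {a..<a + real (Suc n)} \<subseteq> (T \<inter> {a..<a + real n}) \<union> (T \<inter> {a + real n..<a + real n + 1})" by auto
    then show ?case using Suc finite_T_unit by (meson finite_Un finite_subset)
  qed simp
  obtain n where "b - a < real n" using reals_Archimedean2 by blast
  then have "T \<inter> {a..b} \<subseteq> T \<inter> {a..<a + real n}" by auto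
  then show ?thesis using * by (meson finite_subset)
qed

text \<open>The window has the length of a period, so by periodicity it contains the crossing
  \<open>t + 1\<close>; this makes the minimum meaningful.\<close>

definition nxt :: "real \<Rightarrow> real" where "nxt t = Min (T \<inter> {t<..t+1})"
definition prv :: "real \<Rightarrow> real" where "prv t = Max (T \<inter> {t-1..<t})"

lemma nxt:
  assumes "t \<in> T"
  shows "nxt t \<in> T" "t < nxt t" "nxt t \<le> t + 1" "\<And>s. t < s \<Longrightarrow> s < nxt t \<Longrightarrow> s \<notin> T"
proof -
  have f: "finite (T \<inter> {t<..t+1})" using finite_T[of t "t+1"] by (rule rev_finite_subset) auto
  have "t + 1 \<in> T \<inter> {t<..t+1}" using assms T_period[of t 1] by simp
  then have ne: "T \<inter> {t<..t+1} \<noteq> {}" by blast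
  show n: "nxt t \<in> T" "t < nxt t" "nxt t \<le> t + 1" using Min_in[OF f ne] unfolding nxt_def by auto
  show "s \<notin> T" if "t < s" "s < nxt t" for s
  proof
    assume "s \<in> T"
    then have "nxt t \<le> s" unfolding nxt_def using that n by (intro Min_le[OF f]) auto
    then show False using that by simp
  qed
qed

lemma prv:
  assumes "t \<in> T"
  shows "prv t \<in> T" "prv t < t" "t - 1 \<le> prv t" "\<And>s. prv t < s \<Longrightarrow> s < t \<Longrightarrow> s \<notin> T"
proof -
  have f: "finite (T \<inter> {t-1..<t})" using finite_T[of "t-1" "t"] by (rule rev_finite_subset) auto
  have "t - 1 \<in> T \<inter> {t-1..<t}" using assms T_period[of t "-1"] by simp
  then have ne: "T \<inter> {t-1..<t} \<noteq> {}" by blast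
  show n: "prv t \<in> T" "prv t < t" "t - 1 \<le> prv t" using Max_in[OF f ne] unfolding prv_def by auto
  show "s \<notin> T" if "prv t < s" "s < t" for s
  proof
    assume "s \<in> T"
    then have "s \<le> prv t" unfolding prv_def using that n by (intro Max_ge[OF f]) auto
    then show False using that by simp
  qed
qed

lemma prv_nxt: "t \<in> T \<Longrightarrow> prv (nxt t) = t"
  using nxt[of t] prv[of "nxt t"] by (meson linorder_neqE_linordered_idom)

lemma nxt_prv: "t \<in> T \<Longrightarrow> nxt (prv t) = t"
  using nxt[of "prv t"] prv[of t] by (meson linorder_neqE_linordered_idom)

lemma off_edge:
  assumes q: "quad u v w z" and t: "t \<notin> T" "coord (h t) z = 0"
  shows "0 < coord (h t) u" "0 < coord (h t) v" "0 < coord (h t) w"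
  using t quad_in[OF q] quad_neq[OF q] coord_h unfolding T_def by (auto simp: order_less_le)

text \<open>The face in which the geodesic runs does not change between two crossings, since
  the difference of the coordinate of one vertex and the minimum of the others does not vanish.\<close>
lemma gap_face:
  assumes q: "quad u v w z" and gap: "\<And>s. s \<in> {a<..<b} \<Longrightarrow> s \<notin> T"
    and s0: "s0 \<in> {a<..<b}" "coord (h s0) z = 0" and s: "s \<in> {a<..<b}"
  shows "coord (h s) z = 0"
proof (rule ccontr)
  assume n: "coord (h s) z \<noteq> 0"
  define D where "D r = coord (h r) z - min (min (coord (h r) u) (coord (h r) v)) (coord (h r) w)" for r
  have cD: "continuous_on X D" for X
    unfolding D_def by (intro continuous_intros continuous_coord_comp cont)
  have D: "(coord (h r) z = 0 \<longrightarrow> D r < 0) \<and> (coord (h r) z \<noteq> 0 \<longrightarrow> 0 < D r)" if "r \<in> {a<..<b}" for r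
  proof (cases "coord (h r) z = 0")
    case True
    then show ?thesis using off_edge[OF q gap[OF that]] unfolding D_def by auto
  next
    case False
    then have p: "0 < coord (h r) z" using coord_h quad_in[OF q] by (simp add: order_less_le)
    have "\<exists>x\<in>V. coord (h r) x = 0" using hM[of r] unfolding M_iff by blast
    then have "coord (h r) u = 0 \<or> coord (h r) v = 0 \<or> coord (h r) w = 0" using quad_cases[OF q] False by metis
    then show ?thesis using p False coord_h[of _ r] quad_in[OF q] unfolding D_def by (auto simp: min_def)
  qed
  have sgn: "D s0 < 0" "0 < D s" using D s0 s n by auto
  have "\<exists>r\<in>{a<..<b}. D r = 0"
  proof (cases "s0 \<le> s")
    case True
    then obtain r where "s0 \<le> r" "r \<le> s" "D r = 0" using IVT'[of D s0 0 s] sgn cD by force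
    then show ?thesis using s0 s by (intro bexI[of _ r]) auto
  next
    case False
    then obtain r where "s \<le> r" "r \<le> s0" "D r = 0" using IVT2'[of D s0 0 s] sgn cD by force
    then show ?thesis using s0 s by (intro bexI[of _ r]) auto
  qed
  then show False using D by force
qed

definition inface :: "real \<Rightarrow> real \<Rightarrow> point \<Rightarrow> bool" where
  "inface a b z \<longleftrightarrow> (\<forall>s. a < s \<longrightarrow> s < b \<longrightarrow> coord (h s) z = 0 \<and> (\<forall>x\<in>V. x \<noteq> z \<longrightarrow> 0 < coord (h s) x))"

lemma infaceI:
  assumes z: "z \<in> V" and gap: "\<And>s. a < s \<Longrightarrow> s < b \<Longrightarrow> s \<notin> T" and s0: "a < s0" "s0 < b" "coord (h s0) z = 0"
  shows "inface a b z"
proof -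
  have "\<not> V \<subseteq> {z}" using card_V card_mono[of "{z}" V] by auto
  then obtain w where "w \<in> V" "w \<noteq> z" by blast
  then obtain u v where "quad w z u v" using quad_exists[of w z] z by blast
  then have q: "quad u v w z" using quad_perms(7) by blast
  show ?thesis unfolding inface_def
  proof (intro allI impI)
    fix s assume s: "a < s" "s < b"
    then have z0: "coord (h s) z = 0" using gap_face[OF q, of a b s0 s] gap s0 by auto
    then show "coord (h s) z = 0 \<and> (\<forall>x\<in>V. x \<noteq> z \<longrightarrow> 0 < coord (h s) x)"
      using off_edge[OF q gap[OF s]] quad_cases[OF q] by blast
  qed
qed

lemma inface_closed:
  assumes "inface a b z" "a < b" "s \<in> {a..b}"
  shows "coord (h s) z = 0"
proof -
  have "s \<in> closure {a<..<b}" using assms by simp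
  moreover have "closed {s. coord (h s) z = 0}"
    by (intro closed_Collect_eq continuous_coord_comp cont continuous_intros)
  then have "closure {a<..<b} \<subseteq> {s. coord (h s) z = 0}"
    using assms(1) unfolding inface_def by (intro closure_minimal) auto
  ultimately show ?thesis by blast
qed

text \<open>Simplicity makes the coefficients strictly positive: if one of them were 0, two distinct
  points of the curve would have the same unfolded image. Applying functionals removes
  \<open>Phi\<close> from the statement.\<close>

lemma hinge_nbhd:
  assumes q: "quad u v w z" and t: "h t \<in> H u v"
  obtains e where "0 < e" "e \<le> 1/2" "\<And>s. \<bar>s - t\<bar> < e \<Longrightarrow> h s \<in> H u v"
    "\<And>a s b f. \<bar>a - t\<bar> < e \<Longrightarrow> \<bar>b - t\<bar> < e \<Longrightarrow> a < s \<Longrightarrow> s < b \<Longrightarrow>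
       \<exists>\<alpha> \<beta>. 0 < \<alpha> \<and> 0 < \<beta> \<and> (\<forall>f. hinge u v w z f \<longrightarrow> Fn f (h s) = \<alpha> * Fn f (h a) + \<beta> * Fn f (h b))"
proof -
  let ?P = "Phi u v w z"
  have "\<forall>u v w z t. quad u v w z \<longrightarrow> h t \<in> H u v \<longrightarrow>
      (\<exists>e>0. (\<forall>s. \<bar>s - t\<bar> < e \<longrightarrow> h s \<in> H u v) \<and>
        (\<forall>a s b. t - e < a \<longrightarrow> a \<le> s \<longrightarrow> s \<le> b \<longrightarrow> b < t + e \<longrightarrow> a < b \<longrightarrow>
          (\<exists>\<alpha> \<beta>. 0 \<le> \<alpha> \<and> 0 \<le> \<beta> \<and>
             Phi u v w z (h s) = \<alpha> *\<^sub>R Phi u v w z (h a) + \<beta> *\<^sub>R Phi u v w z (h b))))"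
    using str unfolding straight_def by (elim conjE)
  from this[THEN spec, THEN spec, THEN spec, THEN spec, THEN spec, THEN mp, OF q, THEN mp, OF t]
  obtain e0 where e0: "0 < e0" "\<forall>s. \<bar>s - t\<bar> < e0 \<longrightarrow> h s \<in> H u v"
    "\<forall>a s b. t - e0 < a \<longrightarrow> a \<le> s \<longrightarrow> s \<le> b \<longrightarrow> b < t + e0 \<longrightarrow> a < b \<longrightarrow>
          (\<exists>\<alpha> \<beta>. 0 \<le> \<alpha> \<and> 0 \<le> \<beta> \<and> ?P (h s) = \<alpha> *\<^sub>R ?P (h a) + \<beta> *\<^sub>R ?P (h b))"
    by (elim exE conjE)
  show ?thesis
  proof (rule that[of "min e0 (1/2)"])
    fix a s b assume as: "\<bar>a - t\<bar> < min e0 (1/2)" "\<bar>b - t\<bar> < min e0 (1/2)" "a < s" "s < b"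
    have ab: "\<bar>a - t\<bar> < e0" "\<bar>b - t\<bar> < e0" "\<bar>s - t\<bar> < e0" "\<bar>a - t\<bar> < 1/2" "\<bar>b - t\<bar> < 1/2"
      using as by auto
    obtain \<alpha> \<beta> where x: "0 \<le> \<alpha>" "0 \<le> \<beta>" "?P (h s) = \<alpha> *\<^sub>R ?P (h a) + \<beta> *\<^sub>R ?P (h b)"
      using e0(3)[rule_format, of a s b] ab as by (auto simp: abs_less_iff)
    have hs: "h a \<in> H u v" "h b \<in> H u v" "h s \<in> H u v" using e0(2) ab by auto
    have "\<bar>s - a\<bar> < 1" "\<bar>s - b\<bar> < 1" using ab as by linarith+
    then have ne: "h s \<noteq> h a" "h s \<noteq> h b" using inj_near[of s a] inj_near[of s b] as by auto
    have "\<beta> \<noteq> 0"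
    proof
      assume "\<beta> = 0"
      then have e: "?P (h s) = \<alpha> *\<^sub>R ?P (h a)" using x by simp
      moreover have "\<alpha> = 1"
        using arg_cong[OF e, of norm] norm_Phi[OF q hs(1)] norm_Phi[OF q hs(3)] x(1) by simp
      ultimately show False using Phi_inject[OF q hs(3,1)] ne by simp
    qed
    moreover have "\<alpha> \<noteq> 0"
    proof
      assume "\<alpha> = 0"
      then have e: "?P (h s) = \<beta> *\<^sub>R ?P (h b)" using x by simp
      moreover have "\<beta> = 1"
        using arg_cong[OF e, of norm] norm_Phi[OF q hs(2)] norm_Phi[OF q hs(3)] x(2) by simp
      ultimately show False using Phi_inject[OF q hs(3,2)] ne by simp
    qed
    moreover have "Fn f (h s) = \<alpha> * Fn f (h a) + \<beta> * Fn f (h b)" if f: "hinge u v w z f" for f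
      using arg_cong[OF x(3), of "Fn f"] unfolding Fn_add Fn_scale Fn_Phi[OF q f] .
    ultimately show "\<exists>\<alpha> \<beta>. 0 < \<alpha> \<and> 0 < \<beta> \<and> (\<forall>f. hinge u v w z f \<longrightarrow> Fn f (h s) = \<alpha> * Fn f (h a) + \<beta> * Fn f (h b))"
      using x by (intro exI[of _ \<alpha>] exI[of _ \<beta>]) (auto simp: order_less_le)
  qed (use e0 in auto)
qed

text \<open>Two distinct points of an arc determine its great circle. Only positive combinations are
  available here, and strict positivity lets the relation be solved for an end point as
  well.\<close>

lemma zero_spread:
  fixes t e x1 x2 y :: real
  assumes cone: "\<And>a s b. \<bar>a - t\<bar> < e \<Longrightarrow> \<bar>b - t\<bar> < e \<Longrightarrow> a < s \<Longrightarrow> s < b \<Longrightarrow>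
       \<exists>\<alpha> \<beta>. 0 < \<alpha> \<and> 0 < \<beta> \<and> G s = \<alpha> * G a + \<beta> * (G b :: real)"
    and z: "\<bar>x1 - t\<bar> < e" "\<bar>x2 - t\<bar> < e" "x1 < x2" "G x1 = 0" "G x2 = 0" and y: "\<bar>y - t\<bar> < e"
  shows "G y = 0"
proof -
  have "y = x1 \<or> y = x2 \<or> y < x1 \<or> (x1 < y \<and> y < x2) \<or> x2 < y" by linarith
  then consider "y = x1 \<or> y = x2" | "y < x1" | "x1 < y" "y < x2" | "x2 < y" by blast
  then show ?thesis
  proof cases
    case 2
    then show ?thesis using cone[of y x2 x1] z y by auto
  next
    case 3
    then show ?thesis using cone[of x1 x2 y] z y by auto
  next
    case 4
    then show ?thesis using cone[of x1 y x2] z y by auto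
  qed (use z in auto)
qed

text \<open>A connectedness argument: by \<open>zero_spread\<close>, vanishing near one parameter
  passes to a whole neighbourhood of every parameter nearby.\<close>

lemma zero_propagate:
  assumes q: "quad u v w z" and f: "hinge u v w z f" and I: "\<And>s. a < s \<Longrightarrow> s < b \<Longrightarrow> h s \<in> H u v"
    and z: "a \<le> x1" "x1 < x2" "x2 \<le> b" "\<And>s. x1 < s \<Longrightarrow> s < x2 \<Longrightarrow> Fn f (h s) = 0" and s: "a < s" "s < b"
  shows "Fn f (h s) = 0"
proof -
  let ?S = "{a<..<b}"
  define P where "P x \<longleftrightarrow> (\<exists>e>0. \<forall>y. \<bar>y - x\<bar> < e \<longrightarrow> Fn f (h y) = 0)" for x
  have "P s"
  proof (rule connected_induction_simple[of ?S "(x1 + x2)/2" s P])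
    have "\<bar>y - (x1 + x2)/2\<bar> < (x2 - x1)/2 \<Longrightarrow> Fn f (h y) = 0" for y
      by (rule z(4)) (auto simp: abs_less_iff field_simps)
    then show "P ((x1 + x2)/2)" unfolding P_def using z(2) by (intro exI[of _ "(x2 - x1)/2"]) auto
    fix t assume "t \<in> ?S"
    then have "h t \<in> H u v" using I by simp
    then obtain e where e: "0 < e" "\<And>a s b f. \<bar>a - t\<bar> < e \<Longrightarrow> \<bar>b - t\<bar> < e \<Longrightarrow> a < s \<Longrightarrow> s < b \<Longrightarrow>
       \<exists>\<alpha> \<beta>. 0 < \<alpha> \<and> 0 < \<beta> \<and> (\<forall>f. hinge u v w z f \<longrightarrow> Fn f (h s) = \<alpha> * Fn f (h a) + \<beta> * Fn f (h b))"
      using hinge_nbhd[OF q] by metis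
    have sp: "P y" if x: "\<bar>x - t\<bar> < e" "P x" and y: "\<bar>y - t\<bar> < e" for x y
    proof -
      obtain d where d: "0 < d" "\<And>y. \<bar>y - x\<bar> < d \<Longrightarrow> Fn f (h y) = 0" using x(2) unfolding P_def by blast
      define d' where "d' = min (d/2) ((e - \<bar>x - t\<bar>)/2)"
      have d': "0 < d'" using d x unfolding d'_def by auto
      have "d' \<le> d/2" "d' \<le> (e - \<bar>x - t\<bar>)/2"
        unfolding d'_def by (rule min.cobounded1, rule min.cobounded2)
      note d' = d' this
      have "Fn f (h y') = 0" if "\<bar>y' - t\<bar> < e" for y'
      proof (rule zero_spread[of t e "\<lambda>s. Fn f (h s)" x "x + d'" y'])
        show "\<exists>\<alpha> \<beta>. 0 < \<alpha> \<and> 0 < \<beta> \<and> Fn f (h s) = \<alpha> * Fn f (h a) + \<beta> * Fn f (h b)"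
          if "\<bar>a - t\<bar> < e" "\<bar>b - t\<bar> < e" "a < s" "s < b" for a s b
          using e(2)[OF that] f by blast
        have "\<bar>x + d' - t\<bar> \<le> \<bar>x - t\<bar> + d'"
          using abs_triangle_ineq[of "x - t" d'] d'(1) by (simp add: algebra_simps)
        then show "\<bar>x + d' - t\<bar> < e" using d'(3) x(1) by (simp add: field_simps)
      qed (use x d d' that in auto)
      then show ?thesis unfolding P_def using y by (intro exI[of _ "e - \<bar>y - t\<bar>"]) auto
    qed
    show "\<exists>U. openin (top_of_set ?S) U \<and> t \<in> U \<and> (\<forall>x\<in>U. \<forall>y\<in>U. P x \<longrightarrow> P y)"
    proof (intro exI[of _ "?S \<inter> ball t e"] conjI ballI impI)
      show "openin (top_of_set ?S) (?S \<inter> ball t e)" by (simp add: openin_open_Int)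
      show "t \<in> ?S \<inter> ball t e" using \<open>t \<in> ?S\<close> e(1) by simp
      fix x y assume "x \<in> ?S \<inter> ball t e" "y \<in> ?S \<inter> ball t e" "P x"
      then show "P y" using sp[of x y] by (simp add: dist_real_def abs_minus_commute)
    qed
  qed (use z s in \<open>auto simp: connected_Ioo\<close>)
  then show ?thesis unfolding P_def by force
qed

text \<open>At the time \<open>t\<close> the geodesic crosses the edge \<open>u v\<close>, from the face \<open>u v z\<close> to the face \<open>u v w\<close>.\<close>
definition St :: "real \<Rightarrow> point \<Rightarrow> point \<Rightarrow> point \<Rightarrow> point \<Rightarrow> bool" where
  "St t u v w z \<longleftrightarrow> quad u v w z \<and> coord (h t) w = 0 \<and> coord (h t) z = 0 \<and>
     inface t (nxt t) z \<and> inface (prv t) t w"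

lemma St_swap: "St t u v w z \<Longrightarrow> St t v u w z"
  unfolding St_def using quad_perms(1) by blast

lemma St_T: "St t u v w z \<Longrightarrow> t \<in> T"
  unfolding St_def using edge_points(1) by blast

text \<open>Between two points on different sides, the unfolded geodesic crosses the edge: the
  coordinate transversal to the edge is linear along it.\<close>
lemma St_exists:
  assumes q: "quad u v w z" and t: "coord (h t) w = 0" "coord (h t) z = 0"
  shows "St t u v w z \<or> St t u v z w"
proof -
  note ep = edge_points[OF q t]
  obtain e where e: "0 < e" "e \<le> 1/2" "\<And>s. \<bar>s - t\<bar> < e \<Longrightarrow> h s \<in> H u v"
    "\<And>a s b f. \<bar>a - t\<bar> < e \<Longrightarrow> \<bar>b - t\<bar> < e \<Longrightarrow> a < s \<Longrightarrow> s < b \<Longrightarrow>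
       \<exists>\<alpha> \<beta>. 0 < \<alpha> \<and> 0 < \<beta> \<and> (\<forall>f. hinge u v w z f \<longrightarrow> Fn f (h s) = \<alpha> * Fn f (h a) + \<beta> * Fn f (h b))"
    using hinge_nbhd[OF q ep(4)] by metis
  define d where "d = min e (min (nxt t - t) (t - prv t)) / 2"
  have d: "0 < d" "d < e" "d < nxt t - t" "d < t - prv t"
    using e nxt[OF ep(1)] prv[OF ep(1)] unfolding d_def by (auto simp: min_def)
  let ?a = "t - d" and ?b = "t + d"
  define f where "f x = (if x = w then 1 else if x = z then -1 else 0 :: real)" for x
  have ff: "f u = 0" "f v = 0" "f w = 1" "f z = -1" unfolding f_def using quad_neq[OF q] by auto
  have Fnf: "Fn f x = coord x w - coord x z" for x unfolding Fn_quad[OF q] ff by simp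
  have "hinge u v w z f" unfolding hinge_def ff by simp
  then obtain \<alpha> \<beta> where ab: "0 < \<alpha>" "0 < \<beta>" "Fn f (h t) = \<alpha> * Fn f (h ?a) + \<beta> * Fn f (h ?b)"
    using e(4)[of ?a ?b t] d by auto
  have nT: "?a \<notin> T" "?b \<notin> T" using nxt(4)[OF ep(1), of ?b] prv(4)[OF ep(1), of ?a] d by auto
  have wz: "coord (h s) w = 0 \<and> 0 < coord (h s) z \<or> coord (h s) z = 0 \<and> 0 < coord (h s) w" if "\<bar>s - t\<bar> < e" "s \<notin> T" for s
    using H_wz[OF q e(3)[OF that(1)]] off_edge(3)[OF q that(2)] off_edge(3)[OF quad_perms(2)[OF q] that(2)] by blast
  have wa: "coord (h ?a) w = 0 \<and> 0 < coord (h ?a) z \<or> coord (h ?a) z = 0 \<and> 0 < coord (h ?a) w"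
    and wb: "coord (h ?b) w = 0 \<and> 0 < coord (h ?b) z \<or> coord (h ?b) z = 0 \<and> 0 < coord (h ?b) w"
    using wz[of ?a] wz[of ?b] nT d by auto
  have "\<alpha> * (coord (h ?a) w - coord (h ?a) z) + \<beta> * (coord (h ?b) w - coord (h ?b) z) = 0"
    using ab(3) t unfolding Fnf by simp
  then have "coord (h ?a) w = 0 \<and> coord (h ?b) z = 0 \<or> coord (h ?a) z = 0 \<and> coord (h ?b) w = 0"
    using wa wb ab(1,2) by (smt (verit) mult_pos_pos mult_pos_neg)
  moreover have "inface (prv t) t y" if "coord (h ?a) y = 0" "y \<in> V" for y
    by (rule infaceI[of y _ _ ?a]) (use that d prv(4)[OF ep(1)] in auto)
  moreover have "inface t (nxt t) y" if "coord (h ?b) y = 0" "y \<in> V" for y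
    by (rule infaceI[of y _ _ ?b]) (use that d nxt(4)[OF ep(1)] in auto)
  ultimately show ?thesis unfolding St_def using q t quad_perms(2)[OF q] quad_in[OF q] by blast
qed

lemma St_in_H:
  assumes S: "St t u v w z" and s: "prv t < s" "s < nxt t"
  shows "h s \<in> H u v"
proof -
  have q: "quad u v w z" and t: "coord (h t) w = 0" "coord (h t) z = 0" using S unfolding St_def by auto
  have "s < t \<or> s = t \<or> t < s" by linarith
  then have "0 < coord (h s) u \<and> 0 < coord (h s) v"
    using S s edge_points[OF q t] quad_in[OF q] quad_neq[OF q] unfolding St_def inface_def by metis
  then show ?thesis unfolding H_def using hM by simp
qed

lemma Fn_zero_closed:
  assumes "a < b" "\<And>s. a < s \<Longrightarrow> s < b \<Longrightarrow> Fn f (h s) = 0" "s \<in> {a..b}"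
  shows "Fn f (h s) = 0"
proof -
  have "s \<in> closure {a<..<b}" using assms by simp
  moreover have "closed {s. Fn f (h s) = 0}"
    by (intro closed_Collect_eq continuous_Fn_comp cont continuous_intros)
  then have "closure {a<..<b} \<subseteq> {s. Fn f (h s) = 0}"
    using assms(2) by (intro closure_minimal) auto
  ultimately show ?thesis by blast
qed

text \<open>Here \<open>f\<close> consists of the inner products of the vertices with the pole of the great circle.\<close>
lemma St_functional:
  assumes S: "St t u v w z"
  obtains f where "hinge u v w z f" "0 < f u" "f v < 0" "\<And>s. s \<in> {prv t..nxt t} \<Longrightarrow> Fn f (h s) = 0"
proof -
  have q: "quad u v w z" and t: "coord (h t) w = 0" "coord (h t) z = 0" using S unfolding St_def by auto
  note ep = edge_points[OF q t]
  obtain e where e: "0 < e" "e \<le> 1/2" "\<And>s. \<bar>s - t\<bar> < e \<Longrightarrow> h s \<in> H u v"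
    "\<And>a s b f. \<bar>a - t\<bar> < e \<Longrightarrow> \<bar>b - t\<bar> < e \<Longrightarrow> a < s \<Longrightarrow> s < b \<Longrightarrow>
       \<exists>\<alpha> \<beta>. 0 < \<alpha> \<and> 0 < \<beta> \<and> (\<forall>f. hinge u v w z f \<longrightarrow> Fn f (h s) = \<alpha> * Fn f (h a) + \<beta> * Fn f (h b))"
    using hinge_nbhd[OF q ep(4)] by metis
  define d where "d = min e (min (nxt t - t) (t - prv t)) / 2"
  have d: "0 < d" "d < e" "d < nxt t - t" "d < t - prv t"
    using e nxt[OF ep(1)] prv[OF ep(1)] unfolding d_def by (auto simp: min_def)
  let ?b = "t + d"
  have bw: "0 < coord (h ?b) w" "coord (h ?b) z = 0"
    using S d quad_in[OF q] quad_neq[OF q] unfolding St_def inface_def by auto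
  \<comment> \<open>\<open>A\<close> and \<open>B\<close> make \<open>f\<close> vanish at the
    crossing, \<open>C\<close> makes it vanish at a second point in the face ahead, and the hinge
    relation dictates the value at \<open>z\<close>.\<close>
  define A B where "A = coord (h t) v" and "B = - coord (h t) u"
  define C where "C = - (coord (h ?b) u * A + coord (h ?b) v * B) / coord (h ?b) w"
  define f where "f x = (if x = u then A else if x = v then B else if x = w then C else lam * (A + B) - C)" for x
  have ff: "f u = A" "f v = B" "f w = C" "f z = lam * (A + B) - C" unfolding f_def using quad_neq[OF q] by auto
  have hf: "hinge u v w z f" unfolding hinge_def ff by simp
  have z1: "Fn f (h t) = 0" unfolding Fn_quad[OF q] ff using t by (simp add: A_def B_def)
  have z2: "Fn f (h ?b) = 0" unfolding Fn_quad[OF q] ff using bw by (simp add: C_def)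
  have near: "Fn f (h s) = 0" if "\<bar>s - t\<bar> < e" for s
  proof (rule zero_spread[of t e "\<lambda>s. Fn f (h s)" t ?b s])
    show "\<exists>\<alpha> \<beta>. 0 < \<alpha> \<and> 0 < \<beta> \<and> Fn f (h s) = \<alpha> * Fn f (h a) + \<beta> * Fn f (h b)"
      if "\<bar>a - t\<bar> < e" "\<bar>b - t\<bar> < e" "a < s" "s < b" for a s b
      using e(4)[OF that] hf by blast
  qed (use d z1 z2 that in auto)
  have op: "Fn f (h s) = 0" if "prv t < s" "s < nxt t" for s
    by (rule zero_propagate[OF q hf St_in_H[OF S], of "prv t" "nxt t" t ?b]) (use that d near in auto)
  have "Fn f (h s) = 0" if "s \<in> {prv t..nxt t}" for s
    using Fn_zero_closed[of "prv t" "nxt t" f s] op that nxt[OF ep(1)] prv[OF ep(1)] by simp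
  then show ?thesis using that[of f] hf ff ep by (simp add: A_def B_def)
qed

end

context geod begin

section \<open>Arcs in a face and the order of the crossings\<close>

lemma nxt_eqI:
  assumes "t \<in> T" "s \<in> T" "t < s" "\<And>r. t < r \<Longrightarrow> r < s \<Longrightarrow> r \<notin> T"
  shows "nxt t = s"
  using assms nxt[OF assms(1)] by (meson linorder_neqE_linordered_idom)

lemma nxt_shift: "t \<in> T \<Longrightarrow> nxt (t + real_of_int n) = nxt t + real_of_int n"
proof (rule nxt_eqI)
  assume t: "t \<in> T"
  fix r assume "t + real_of_int n < r" "r < nxt t + real_of_int n"
  then show "r \<notin> T" using nxt(4)[OF t, of "r - real_of_int n"] T_period[of "r - real_of_int n" n] by simp
qed (use nxt T_period in auto)

text \<open>Otherwise there would be one crossing per period, and the arcs before and after it would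
  be translates of each other. They lie in different faces: the coordinate of \<open>w\<close>
  vanishes on one and is positive on the other.\<close>

lemma nxt_neq:
  assumes "t \<in> T" shows "h (nxt t) \<noteq> h t"
proof
  assume e: "h (nxt t) = h t"
  obtain u v w z where q: "quad u v w z" "coord (h t) w = 0" "coord (h t) z = 0" using T_edge[OF assms] by blast
  obtain w z where S: "St t u v w z" using St_exists[OF q] by blast
  then have q: "quad u v w z" unfolding St_def by blast
  obtain n :: int where n: "nxt t = t + real_of_int n" using inj_mod[OF e] by blast
  then have "0 < n" "n \<le> 1" using nxt[OF assms] by auto
  then have n1: "nxt t = t + 1" using n by simp
  define s where "s = (prv t + t) / 2"
  have s: "prv t < s" "s < t" "t < s + 1" using prv(2,3)[OF assms] unfolding s_def by (simp_all add: field_simps)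
  have "coord (h s) w = 0" using S s unfolding St_def inface_def by blast
  moreover have "0 < coord (h (s + 1)) w"
    using S s n1 quad_in[OF q] quad_neq[OF q] unfolding St_def inface_def by auto
  ultimately show False by (simp add: period)
qed

lemma prv_neq: "t \<in> T \<Longrightarrow> h (prv t) \<noteq> h t"
  using nxt_neq[of "prv t"] nxt_prv prv(1) by metis

lemma edge_zero_unique:
  assumes q: "quad u v w z" and x: "norm x = 1" "0 < coord x u" "0 < coord x v" "coord x w = 0" "coord x z = 0"
    and y: "norm y = 1" "0 < coord y u" "0 < coord y v" "coord y w = 0" "coord y z = 0"
    and e: "coord x u * coord y v = coord y u * coord x v"
  shows "x = y"
proof -
  define r where "r = coord y u / coord x u"
  have r: "0 < r" using x y unfolding r_def by simp
  have "y = r *\<^sub>R x"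
    by (rule quad_coord_eqI[OF q]) (use x y e in \<open>auto simp: coord_scale r_def field_simps\<close>)
  then show ?thesis using x(1) y(1) r by simp
qed

text \<open>Translates signs of the functional into the order of points along the edge: with
  \<open>0 < f u\<close>, it is positive on the part between its zero \<open>x\<close> and
  \<open>u\<close>.\<close>

lemma Fn_edge_zero:
  assumes q: "quad u v w z" and x: "coord x w = 0" "coord x z = 0" "0 < coord x v" and y: "coord y w = 0" "coord y z = 0"
    and f: "Fn f x = 0" "0 < f u"
  shows "0 < Fn f y \<longleftrightarrow> coord x u * coord y v < coord y u * coord x v"
    "Fn f y = 0 \<longleftrightarrow> coord x u * coord y v = coord y u * coord x v"
proof -
  have "coord x u * f u + coord x v * f v = 0" using f(1) x unfolding Fn_quad[OF q] by simp
  then have fv: "f v = - (coord x u * f u / coord x v)" using x(3) by (simp add: field_simps)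
  define K where "K = f u / coord x v"
  have "Fn f y = K * (coord y u * coord x v - coord x u * coord y v)"
    unfolding Fn_quad[OF q] fv K_def using x y by (simp add: field_simps)
  moreover have "0 < K" unfolding K_def using f x by simp
  ultimately show "0 < Fn f y \<longleftrightarrow> coord x u * coord y v < coord y u * coord x v"
    "Fn f y = 0 \<longleftrightarrow> coord x u * coord y v = coord y u * coord x v"
    by (auto simp: zero_less_mult_iff)
qed

text \<open>Symmetric in \<open>t\<close> and \<open>t'\<close>, so that an arc can be read in
  either direction.\<close>

definition gap :: "real \<Rightarrow> real \<Rightarrow> point \<Rightarrow> bool" where
  "gap t t' z \<longleftrightarrow> t \<in> T \<and> t' \<in> T \<and> (t' = nxt t \<and> inface t t' z \<or> t = nxt t' \<and> inface t' t z)"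

lemma gap_sym: "gap t t' z \<Longrightarrow> gap t' t z"
  unfolding gap_def by blast

lemma gap_shift:
  assumes "gap t t' z" shows "gap (t + real_of_int n) (t' + real_of_int n) z"
proof -
  have i: "inface (a + real_of_int n) (b + real_of_int n) z" if "inface a b z" for a b
    unfolding inface_def
  proof (intro allI impI)
    fix s assume s: "a + real_of_int n < s" "s < b + real_of_int n"
    have "h s = h (s - real_of_int n)" using period_int[of "s - real_of_int n" n] by simp
    then show "coord (h s) z = 0 \<and> (\<forall>x\<in>V. x \<noteq> z \<longrightarrow> 0 < coord (h s) x)"
      using that s unfolding inface_def by simp
  qed
  then show ?thesis using assms nxt_shift T_period unfolding gap_def by auto
qed

lemma gap_cases:
  assumes "gap t t' z"
  shows "t' = nxt t \<and> inface t (nxt t) z \<or> t' = prv t \<and> inface (prv t) t z"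
proof -
  have "t' = nxt t \<and> inface t t' z \<or> t = nxt t' \<and> inface t' t z" "t' \<in> T" using assms unfolding gap_def by auto
  then show ?thesis
  proof (elim disjE conjE)
    assume "t = nxt t'" "inface t' t z"
    moreover from this have "prv t = t'" using prv_nxt[OF \<open>t' \<in> T\<close>] by simp
    ultimately show ?thesis by simp
  qed simp
qed

text \<open>Consecutive arcs lie in different faces, hence a crossing is an end of at most one arc
  in the face opposite \<open>z\<close>.\<close>

lemma gap_unique:
  assumes g: "gap t t' z" "gap t t'' z" shows "t' = t''"
proof -
  have t: "t \<in> T" using g unfolding gap_def by blast
  obtain u v w y where q: "quad u v w y" "coord (h t) w = 0" "coord (h t) y = 0" using T_edge[OF t] by blast
  obtain w y where S: "St t u v w y" using St_exists[OF q] by blast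
  then have q: "quad u v w y" unfolding St_def by blast
  have no: False if "inface t (nxt t) z" "inface (prv t) t z"
  proof -
    have p: "t < (t + nxt t)/2" "(t + nxt t)/2 < nxt t" "prv t < (prv t + t)/2" "(prv t + t)/2 < t"
      using nxt[OF t] prv[OF t] by auto
    have "z = y" using S that(1) p(1,2) quad_in[OF q] unfolding St_def inface_def by (metis less_irrefl)
    moreover have "z = w" using S that(2) p(3,4) quad_in[OF q] unfolding St_def inface_def by (metis less_irrefl)
    ultimately show False using quad_neq[OF q] by simp
  qed
  have "t' = nxt t \<and> inface t (nxt t) z \<or> t' = prv t \<and> inface (prv t) t z"
    "t'' = nxt t \<and> inface t (nxt t) z \<or> t'' = prv t \<and> inface (prv t) t z"
    using gap_cases[OF g(1)] gap_cases[OF g(2)] by auto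
  then show ?thesis using no by blast
qed

lemma gap_overlap:
  assumes g: "gap t t' z" "gap r r' z'" and s: "min t t' < s" "s < max t t'" "min r r' < s" "s < max r r'"
  shows "t = r \<and> t' = r' \<or> t = r' \<and> t' = r"
proof -
  have T: "t \<in> T" "t' \<in> T" "r \<in> T" "r' \<in> T" using g unfolding gap_def by auto
  have lt: "t < nxt t" if "t \<in> T" for t using nxt that by blast
  have no: "x \<notin> T" if "min t t' < x" "x < max t t'" for x
    using g(1) nxt(4)[OF T(1), of x] nxt(4)[OF T(2), of x] lt[OF T(1)] lt[OF T(2)] that unfolding gap_def by auto
  have no': "x \<notin> T" if "min r r' < x" "x < max r r'" for x
    using g(2) nxt(4)[OF T(3), of x] nxt(4)[OF T(4), of x] lt[OF T(3)] lt[OF T(4)] that unfolding gap_def by auto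
  have "min t t' \<in> T" "max t t' \<in> T" "min r r' \<in> T" "max r r' \<in> T" using T by (auto simp: min_def max_def)
  then have "min t t' = min r r'" "max t t' = max r r'"
    using no[of "min r r'"] no[of "max r r'"] no'[of "min t t'"] no'[of "max t t'"] s by linarith+
  then show ?thesis by (auto simp: min_def max_def split: if_splits)
qed

text \<open>An arc in the face opposite \<open>z\<close> that starts on the edge \<open>u v\<close>,
  with its functional. The last clause ties the exit to a sign: \<open>f w < 0\<close> means that
  the zero set cuts off the corner \<open>u\<close>, \<open>0 < f w\<close> that it cuts off
  \<open>v\<close>.\<close>

definition Arc :: "point \<Rightarrow> point \<Rightarrow> point \<Rightarrow> point \<Rightarrow> real \<Rightarrow> real \<Rightarrow> (point \<Rightarrow> real) \<Rightarrow> bool" where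
  "Arc u v w z t t' f \<longleftrightarrow> quad u v w z \<and> gap t t' z \<and> coord (h t) w = 0 \<and> coord (h t) z = 0 \<and>
     0 < f u \<and> f v < 0 \<and> (\<forall>s. min t t' \<le> s \<longrightarrow> s \<le> max t t' \<longrightarrow> coord (h s) z = 0 \<and> Fn f (h s) = 0) \<and>
     (coord (h t') v = 0 \<and> f w < 0 \<or> coord (h t') u = 0 \<and> 0 < f w)"

text \<open>An arc cannot return to its first edge, where \<open>f\<close> has only one zero. On
  each of the other edges the sign of \<open>f w\<close> follows from the value 0 at the end
  point.\<close>

lemma arc_end:
  assumes q: "quad u v w z" and t: "coord (h t) w = 0" "coord (h t) z = 0"
    and t': "t' \<in> T" "coord (h t') z = 0" "h t' \<noteq> h t"
    and f: "0 < f u" "f v < 0" "Fn f (h t) = 0" "Fn f (h t') = 0"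
  shows "coord (h t') v = 0 \<and> f w < 0 \<or> coord (h t') u = 0 \<and> 0 < f w"
proof -
  note e = edge_points[OF q t]
  obtain a b where "a \<in> V" "b \<in> V" "a \<noteq> b" "coord (h t') a = 0" "coord (h t') b = 0"
    using t'(1) unfolding T_def by blast
  then have "\<exists>y\<in>V. y \<noteq> z \<and> coord (h t') y = 0" by (cases "a = z") auto
  then consider "coord (h t') w = 0" | "coord (h t') v = 0" | "coord (h t') u = 0" using quad_cases[OF q] by metis
  then show ?thesis
  proof cases
    case 1
    note e' = edge_points[OF q 1 t'(2)]
    have "coord (h t) u * coord (h t') v = coord (h t') u * coord (h t) v"
      using Fn_edge_zero(2)[OF q t e(3) 1 t'(2) f(3,1)] f(4) by simp
    then have "h t = h t'" using edge_zero_unique[OF q] e e' t t' 1 hM norm_M by metis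
    then show ?thesis using t'(3) by simp
  next
    case 2
    have "0 < coord (h t') u" "0 < coord (h t') w" using edge_points[OF quad_perms(3)[OF q] 2 t'(2)] by auto
    moreover have "coord (h t') u * f u + coord (h t') w * f w = 0" using f(4) 2 t'(2) unfolding Fn_quad[OF q] by simp
    ultimately have "coord (h t') w * f w < 0" using f(1) by (smt (verit) mult_pos_pos)
    then show ?thesis using 2 \<open>0 < coord (h t') w\<close> by (simp add: mult_less_0_iff)
  next
    case 3
    have "0 < coord (h t') v" "0 < coord (h t') w" using edge_points[OF quad_perms(6)[OF q] 3 t'(2)] by auto
    moreover have "coord (h t') v * f v + coord (h t') w * f w = 0" using f(4) 3 t'(2) unfolding Fn_quad[OF q] by simp
    ultimately have "0 < coord (h t') w * f w" using f(2) by (smt (verit) mult_pos_neg)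
    then show ?thesis using 3 \<open>0 < coord (h t') w\<close> by (simp add: zero_less_mult_iff)
  qed
qed

lemma Arc_of_St:
  assumes S: "St t u v w z"
  obtains f where "Arc u v w z t (nxt t) f"
proof -
  have q: "quad u v w z" and t: "coord (h t) w = 0" "coord (h t) z = 0" and i: "inface t (nxt t) z"
    using S unfolding St_def by auto
  note tT = St_T[OF S]
  obtain f where f: "hinge u v w z f" "0 < f u" "f v < 0" "\<And>s. s \<in> {prv t..nxt t} \<Longrightarrow> Fn f (h s) = 0"
    using St_functional[OF S] by blast
  have n: "t < nxt t" "prv t < t" "nxt t \<in> T" using nxt[OF tT] prv[OF tT] by auto
  have z0: "coord (h s) z = 0" if "t \<le> s" "s \<le> nxt t" for s using inface_closed[OF i n(1)] that by simp
  have "coord (h (nxt t)) v = 0 \<and> f w < 0 \<or> coord (h (nxt t)) u = 0 \<and> 0 < f w"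
    by (rule arc_end[OF q t n(3) z0 nxt_neq[OF tT] f(2,3)]) (use n f(4) in auto)
  then have "Arc u v w z t (nxt t) f"
    unfolding Arc_def gap_def using q t f z0 i n tT by (auto simp: min_def max_def)
  then show ?thesis using that by blast
qed

lemma Arc_of_St_back:
  assumes S: "St t u v z w"
  obtains f where "Arc u v w z t (prv t) f"
proof -
  have q': "quad u v z w" and t: "coord (h t) w = 0" "coord (h t) z = 0" and i: "inface (prv t) t z"
    using S unfolding St_def by auto
  have q: "quad u v w z" using quad_perms(2)[OF q'] .
  note tT = St_T[OF S]
  obtain f where f: "hinge u v z w f" "0 < f u" "f v < 0" "\<And>s. s \<in> {prv t..nxt t} \<Longrightarrow> Fn f (h s) = 0"
    using St_functional[OF S] by blast
  have n: "t < nxt t" "prv t < t" "prv t \<in> T" "nxt (prv t) = t" using nxt[OF tT] prv[OF tT] nxt_prv[OF tT] by auto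
  have z0: "coord (h s) z = 0" if "prv t \<le> s" "s \<le> t" for s using inface_closed[OF i n(2)] that by simp
  have "coord (h (prv t)) v = 0 \<and> f w < 0 \<or> coord (h (prv t)) u = 0 \<and> 0 < f w"
    by (rule arc_end[OF q t n(3) z0 prv_neq[OF tT] f(2,3)]) (use n f(4) in auto)
  then have "Arc u v w z t (prv t) f"
    unfolding Arc_def gap_def using q t f z0 i n tT by (auto simp: min_def max_def)
  then show ?thesis using that by blast
qed

lemma Arc_exists:
  assumes "quad u v w z" "coord (h t) w = 0" "coord (h t) z = 0"
  obtains t' f where "Arc u v w z t t' f"
  using St_exists[OF assms] Arc_of_St Arc_of_St_back by metis

lemma Arc_swap:
  assumes A: "Arc u v w z t t' f" shows "Arc v u w z t t' (\<lambda>x. - f x)"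
proof -
  have "Fn (\<lambda>x. - f x) y = - Fn f y" for y unfolding Fn_def by (simp add: sum_negf)
  then show ?thesis using A quad_perms(1) unfolding Arc_def by auto
qed

lemma Arc_flip:
  assumes "Arc u v w z t t' f" "coord (h t') v = 0" shows "Arc u w v z t' t f"
proof -
  have q: "quad u v w z" and z0: "coord (h t') z = 0" using assms unfolding Arc_def by auto
  have "0 < coord (h t') u" using edge_points[OF quad_perms(3)[OF q] assms(2) z0] by simp
  then have "f w < 0" using assms unfolding Arc_def by auto
  then show ?thesis using assms quad_perms(3)[OF q] gap_sym z0 unfolding Arc_def
    by (simp add: min.commute max.commute)
qed

lemma Arc_gap: "Arc u v w z t t' f \<Longrightarrow> gap t t' z"
  unfolding Arc_def by blast

lemma gap_between:
  assumes "gap t t' z" "min t t' < s" "s < max t t'"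
  shows "coord (h s) z = 0" "\<And>x. x \<in> V \<Longrightarrow> x \<noteq> z \<Longrightarrow> 0 < coord (h s) x"
proof -
  have "t < nxt t" "t' < nxt t'" using assms(1) nxt unfolding gap_def by auto
  then have "coord (h s) z = 0 \<and> (\<forall>x\<in>V. x \<noteq> z \<longrightarrow> 0 < coord (h s) x)"
    using assms unfolding gap_def inface_def by (auto simp: min_def max_def split: if_splits)
  then show "coord (h s) z = 0" "\<And>x. x \<in> V \<Longrightarrow> x \<noteq> z \<Longrightarrow> 0 < coord (h s) x" by auto
qed

text \<open>Along the arc the quantity \<open>P\<close> passes from positive to negative, so the
  ratio of the coordinates of \<open>v\<close> and \<open>w\<close> takes its value at
  \<open>x\<close>. The equation for \<open>f\<close> then fixes the coordinate of
  \<open>u\<close>.\<close>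

lemma Arc_cover:
  assumes A: "Arc u v w z t t' f" and v0: "coord (h t') v = 0"
    and x: "norm x = 1" "coord x z = 0" "0 < coord x v" "0 < coord x w" "Fn f x = 0"
  shows "\<exists>s. min t t' < s \<and> s < max t t' \<and> h s = x"
proof -
  have q: "quad u v w z" and t0: "coord (h t) w = 0" "coord (h t) z = 0" and fu: "0 < f u"
    and zf: "\<And>s. min t t' \<le> s \<Longrightarrow> s \<le> max t t' \<Longrightarrow> coord (h s) z = 0 \<and> Fn f (h s) = 0"
    using A unfolding Arc_def by auto
  have z': "coord (h t') z = 0" using zf[of t'] by auto
  define P where "P s = coord (h s) v * coord x w - coord (h s) w * coord x v" for s
  have cP: "continuous_on X P" for X
    unfolding P_def by (intro continuous_intros continuous_coord_comp cont)
  have Pt: "0 < P t" using edge_points(3)[OF q t0] t0 x unfolding P_def by simp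
  have "0 < coord (h t') w" using edge_points(3)[OF quad_perms(3)[OF q] v0 z'] .
  then have Pt': "P t' < 0" using v0 x unfolding P_def by simp
  have "\<exists>s. min t t' \<le> s \<and> s \<le> max t t' \<and> P s = 0"
  proof (cases "t \<le> t'")
    case True
    then show ?thesis using IVT2'[of P t' 0 t] Pt Pt' cP by (auto simp: min_def max_def)
  next
    case False
    then show ?thesis using IVT'[of P t' 0 t] Pt Pt' cP by (auto simp: min_def max_def)
  qed
  then obtain s where s: "min t t' \<le> s" "s \<le> max t t'" "P s = 0" by blast
  then have "s \<noteq> t" "s \<noteq> t'" using Pt Pt' by auto
  then have s': "min t t' < s" "s < max t t'" using s by (auto simp: min_def max_def split: if_splits)
  have p: "0 < coord (h s) v" "0 < coord (h s) w"
    using gap_between(2)[OF Arc_gap[OF A] s'] quad_in[OF q] quad_neq[OF q] by auto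
  define r where "r = coord (h s) v / coord x v"
  have r: "0 < r" "coord (h s) v = r * coord x v" using p x unfolding r_def by auto
  have rw: "coord (h s) w = r * coord x w" using s(3) x p unfolding P_def r_def by (simp add: field_simps)
  have "f u * coord (h s) u = - (f v * coord (h s) v + f w * coord (h s) w)"
    using conjunct1[OF zf[OF s(1,2)]] conjunct2[OF zf[OF s(1,2)]] unfolding Fn_quad[OF q] by (simp add: algebra_simps)
  also have "\<dots> = r * (- (f v * coord x v + f w * coord x w))" unfolding r rw by (simp add: algebra_simps)
  also have "- (f v * coord x v + f w * coord x w) = f u * coord x u"
    using x(5) x(2) unfolding Fn_quad[OF q] by (simp add: algebra_simps)
  finally have ru: "coord (h s) u = r * coord x u" using fu by simp
  have "h s = r *\<^sub>R x"
    by (rule quad_coord_eqI[OF q]) (use r rw ru x zf[OF s(1,2)] in \<open>auto simp: coord_scale\<close>)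
  then have "h s = x" using x(1) norm_M[OF hM[of s]] r by simp
  then show ?thesis using s' by blast
qed

text \<open>The first arc cuts off the corner \<open>u\<close>, and the second starts inside this
  corner. If it left the corner, the arcs would meet by \<open>Arc_cover\<close>; a common point or
  a common end gives equal parameters up to the period, hence the same arc.\<close>

lemma Arc_noncross:
  assumes A: "Arc u v w z t t' f" "coord (h t') v = 0" and B: "Arc u v w z r r' g" and pos: "0 < Fn f (h r)"
  shows "coord (h r') v = 0" "0 < Fn f (h r')"
proof -
  have q: "quad u v w z" and fu: "0 < f u" "f v < 0" using A unfolding Arc_def by auto
  have zA: "coord (h t') z = 0" "Fn f (h t) = 0" "Fn f (h t') = 0" using A unfolding Arc_def by auto
  have zB: "coord (h r') z = 0" "coord (h r') v = 0 \<or> coord (h r') u = 0" using B unfolding Arc_def by auto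
  have fw: "f w < 0" using Arc_flip[OF A] unfolding Arc_def by blast
  note gA = Arc_gap[OF A(1)] and gB = Arc_gap[OF B]
  have neg: "Fn f (h r') < 0" if "coord (h r') u = 0"
  proof -
    have "0 < coord (h r') v" "0 < coord (h r') w" using edge_points[OF quad_perms(6)[OF q] that zB(1)] by auto
    then show ?thesis using fu fw that zB unfolding Fn_quad[OF q] by (simp add: add_neg_neg mult_pos_neg)
  qed
  have n1: "\<not> Fn f (h r') < 0"
  proof
    assume "Fn f (h r') < 0"
    then have "\<exists>s. min r r' \<le> s \<and> s \<le> max r r' \<and> Fn f (h s) = 0"
      using IVT2'[of "\<lambda>s. Fn f (h s)" r' 0 r] IVT'[of "\<lambda>s. Fn f (h s)" r' 0 r] pos continuous_Fn_comp[OF cont]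
      by (cases "r \<le> r'") (auto simp: min_def max_def)
    then obtain s where s: "min r r' \<le> s" "s \<le> max r r'" "Fn f (h s) = 0" by blast
    then have "s \<noteq> r" "s \<noteq> r'" using pos \<open>Fn f (h r') < 0\<close> by auto
    then have s': "min r r' < s" "s < max r r'" using s by (auto simp: min_def max_def split: if_splits)
    note gb = gap_between[OF gB s']
    obtain s1 where s1: "min t t' < s1" "s1 < max t t'" "h s1 = h s"
      using Arc_cover[OF A, of "h s"] gb s quad_in[OF q] quad_neq[OF q] norm_M[OF hM] by blast
    obtain n :: int where n: "s = s1 + real_of_int n" using inj_mod[of s s1] s1 by metis
    have "r = t + real_of_int n \<or> r = t' + real_of_int n"
      using gap_overlap[OF gap_shift[OF gA, of n] gB, of s] s1 s' n by (auto simp: min_def max_def split: if_splits)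
    then have "Fn f (h r) = 0" using zA period_int by auto
    then show False using pos by simp
  qed
  have n2: "Fn f (h r') \<noteq> 0"
  proof
    assume 0: "Fn f (h r') = 0"
    then have v0: "coord (h r') v = 0" using neg zB by force
    have q': "quad u w v z" using quad_perms(3)[OF q] .
    note eA = edge_points[OF q' A(2) zA(1)] and eB = edge_points[OF q' v0 zB(1)]
    have "coord (h t') u * coord (h r') w = coord (h r') u * coord (h t') w"
      using Fn_edge_zero(2)[OF q' A(2) zA(1) eA(3) v0 zB(1) zA(3) fu(1)] 0 by simp
    then have "h t' = h r'" using edge_zero_unique[OF q'] eA eB A(2) v0 zA zB hM norm_M by metis
    then obtain n :: int where n: "r' = t' + real_of_int n" using inj_mod by metis
    have "r = t + real_of_int n"
      using gap_unique[of r' r z "t + real_of_int n"] gap_sym[OF gB] gap_sym[OF gap_shift[OF gA, of n]] n by simp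
    then have "Fn f (h r) = 0" using zA period_int by simp
    then show False using pos by simp
  qed
  show "0 < Fn f (h r')" using n1 n2 by linarith
  then show "coord (h r') v = 0" using neg zB by force
qed

section \<open>Order of the crossings along an edge\<close>

definition E :: "point \<Rightarrow> point \<Rightarrow> point set" where "E u v = range h \<inter> sph_hull {u, v}"

text \<open>The number of crossings between \<open>u\<close> and \<open>x\<close>; the inequality
  compares the ratios of the two coordinates without division.\<close>

definition rank :: "point \<Rightarrow> point \<Rightarrow> point \<Rightarrow> nat" where
  "rank u v x = card {y \<in> E u v. coord x u * coord y v < coord y u * coord x v}"

lemma E_commute: "E u v = E v u" unfolding E_def by (simp add: insert_commute)

lemma finite_E: "quad u v w z \<Longrightarrow> finite (E u v)"
  unfolding E_def using fin_edges quad_in quad_neq by metis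

lemma E_D:
  assumes "quad u v w z" "x \<in> E u v"
  obtains t where "x = h t" "coord x w = 0" "coord x z = 0" "0 < coord x u" "0 < coord x v" "norm x = 1" "t \<in> T"
proof -
  obtain t where t: "x = h t" using assms(2) unfolding E_def by blast
  have x: "coord x w = 0" "coord x z = 0" using assms edge_iff[OF assms(1)] unfolding E_def by auto
  show ?thesis using that[OF t x] edge_points[OF assms(1), of t] x t norm_M[OF hM] by auto
qed

lemma E_I: "quad u v w z \<Longrightarrow> coord (h t) w = 0 \<Longrightarrow> coord (h t) z = 0 \<Longrightarrow> h t \<in> E u v"
  unfolding E_def using edge_points(5) by blast

text \<open>Arcs that start nearer to \<open>u\<close> stay on the side of \<open>u\<close>.
  Following them maps the crossings between \<open>u\<close> and \<open>h t\<close> injectively to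
  those between \<open>u\<close> and \<open>h t'\<close>.\<close>

lemma rank_Arc_le:
  assumes A: "Arc u v w z t t' f" "coord (h t') v = 0"
  shows "rank u v (h t) \<le> rank u w (h t')"
proof -
  have q: "quad u v w z" and t0: "coord (h t) w = 0" "coord (h t) z = 0" and fu: "0 < f u"
    and zA: "coord (h t') z = 0" "Fn f (h t) = 0" "Fn f (h t') = 0" using A unfolding Arc_def by auto
  have q': "quad u w v z" using quad_perms(3)[OF q] .
  note et = edge_points[OF q t0] and et' = edge_points[OF q' A(2) zA(1)]
  let ?A = "{y \<in> E u v. coord (h t) u * coord y v < coord y u * coord (h t) v}"
  let ?B = "{y \<in> E u w. coord (h t') u * coord y w < coord y u * coord (h t') w}"
  have "\<exists>y'. \<exists>r r' g. y = h r \<and> y' = h r' \<and> Arc u v w z r r' g \<and> y' \<in> ?B" if y: "y \<in> ?A" for y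
  proof -
    obtain r where r: "y = h r" "coord y w = 0" "coord y z = 0" using E_D[OF q, of y] y by blast
    obtain r' g where B: "Arc u v w z r r' g" using Arc_exists[OF q, of r] r by blast
    have "0 < Fn f (h r)" using Fn_edge_zero(1)[OF q t0 et(3) _ _ zA(2) fu, of y] r y by blast
    note nc = Arc_noncross[OF A B this]
    have z': "coord (h r') z = 0" using B unfolding Arc_def by auto
    have "h r' \<in> ?B" using Fn_edge_zero(1)[OF q' A(2) zA(1) et'(3) nc(1) z' zA(3) fu] nc(2) E_I[OF q' nc(1) z'] by blast
    then show ?thesis using r B by blast
  qed
  then have "\<exists>p. \<forall>y\<in>?A. \<exists>r r' g. y = h r \<and> p y = h r' \<and> Arc u v w z r r' g \<and> p y \<in> ?B"
    by (intro bchoice) blast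
  then obtain p where p: "\<forall>y\<in>?A. \<exists>r r' g. y = h r \<and> p y = h r' \<and> Arc u v w z r r' g \<and> p y \<in> ?B" by blast
  have "inj_on p ?A"
  proof (rule inj_onI)
    fix y1 y2 assume y: "y1 \<in> ?A" "y2 \<in> ?A" "p y1 = p y2"
    obtain r1 r1' g1 where 1: "y1 = h r1" "p y1 = h r1'" "Arc u v w z r1 r1' g1" using p y(1) by blast
    obtain r2 r2' g2 where 2: "y2 = h r2" "p y2 = h r2'" "Arc u v w z r2 r2' g2" using p y(2) by blast
    obtain n :: int where n: "r1' = r2' + real_of_int n" using inj_mod y(3) 1 2 by metis
    have "r1 = r2 + real_of_int n"
      using gap_unique[of r1' r1 z "r2 + real_of_int n"] gap_sym[OF Arc_gap[OF 1(3)]]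
        gap_sym[OF gap_shift[OF Arc_gap[OF 2(3)], of n]] n by simp
    then show "y1 = y2" using 1 2 period_int by simp
  qed
  moreover have "p ` ?A \<subseteq> ?B" using p by blast
  moreover have "finite ?B" using finite_E[OF q'] by simp
  ultimately show ?thesis unfolding rank_def by (rule card_inj_on_le)
qed

lemma rank_Arc:
  assumes A: "Arc u v w z t t' f" "coord (h t') v = 0"
  shows "rank u v (h t) = rank u w (h t')"
proof (rule antisym)
  show "rank u v (h t) \<le> rank u w (h t')" by (rule rank_Arc_le[OF A])
  have "coord (h t) w = 0" using A unfolding Arc_def by blast
  then show "rank u w (h t') \<le> rank u v (h t)" by (rule rank_Arc_le[OF Arc_flip[OF A]])
qed

lemma rank_less:
  assumes q: "quad u v w z" and x: "x \<in> E u v"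
  shows "rank u v x < card (E u v)"
  unfolding rank_def by (rule psubset_card_mono[OF finite_E[OF q]]) (use x in auto)

lemma rank_inj:
  assumes q: "quad u v w z" and x: "x \<in> E u v" and y: "y \<in> E u v" and e: "rank u v x = rank u v y"
  shows "x = y"
proof (rule ccontr)
  assume ne: "x \<noteq> y"
  have *: "rank u v b < rank u v a" if a: "a \<in> E u v" and b: "b \<in> E u v"
    and l: "coord a u * coord b v < coord b u * coord a v" for a b
  proof -
    have pa: "0 < coord a u" "0 < coord a v" by (rule E_D[OF q a], blast)+
    have pb: "0 < coord b u" "0 < coord b v" by (rule E_D[OF q b], blast)+
    have tr: "coord a u * coord x v < coord x u * coord a v"
      if x: "x \<in> E u v" "coord b u * coord x v < coord x u * coord b v" for x
    proof -
      have px: "0 < coord x u" "0 < coord x v" by (rule E_D[OF q x(1)], blast)+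
      have "coord a u / coord a v < coord b u / coord b v" "coord b u / coord b v < coord x u / coord x v"
        using l x(2) pa pb px by (simp_all add: divide_simps mult.commute)
      then have "coord a u / coord a v < coord x u / coord x v" by linarith
      then show ?thesis using pa px by (simp add: divide_simps mult.commute)
    qed
    show ?thesis unfolding rank_def
    proof (rule psubset_card_mono)
      show "finite {y \<in> E u v. coord a u * coord y v < coord y u * coord a v}" using finite_E[OF q] by simp
      have "b \<in> {y \<in> E u v. coord a u * coord y v < coord y u * coord a v}" using b l by simp
      moreover have "b \<notin> {y \<in> E u v. coord b u * coord y v < coord y u * coord b v}" by simp
      ultimately show "{y \<in> E u v. coord b u * coord y v < coord y u * coord b v} \<subset> {y \<in> E u v. coord a u * coord y v < coord y u * coord a v}"
        using tr by blast
    qed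
  qed
  have "coord x u * coord y v \<noteq> coord y u * coord x v"
  proof
    assume eq: "coord x u * coord y v = coord y u * coord x v"
    show False
      by (rule E_D[OF q x], rule E_D[OF q y]) (use edge_zero_unique[OF q _ _ _ _ _ _ _ _ _ _ eq] ne in blast)
  qed
  then show False using *[OF x y] *[OF y x] e by linarith
qed

lemma rank_surj:
  assumes q: "quad u v w z" and k: "k < card (E u v)"
  shows "\<exists>x\<in>E u v. rank u v x = k"
proof -
  have "inj_on (rank u v) (E u v)" using rank_inj[OF q] by (auto intro: inj_onI)
  then have "card (rank u v ` E u v) = card {..<card (E u v)}" by (simp add: card_image)
  moreover have "rank u v ` E u v \<subseteq> {..<card (E u v)}" using rank_less[OF q] by auto
  ultimately have "rank u v ` E u v = {..<card (E u v)}" by (metis card_subset_eq finite_lessThan)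
  then show ?thesis using k by (metis imageE lessThan_iff)
qed

lemma rank_swap:
  assumes q: "quad u v w z" and x: "x \<in> E u v"
  shows "rank u v x + rank v u x + 1 = card (E u v)"
proof -
  let ?A = "{y \<in> E u v. coord x u * coord y v < coord y u * coord x v}"
  let ?B = "{y \<in> E v u. coord x v * coord y u < coord y v * coord x u}"
  have "y = x" if y: "y \<in> E u v" and eq: "coord y u * coord x v = coord x u * coord y v" for y
    by (rule E_D[OF q x], rule E_D[OF q y]) (use edge_zero_unique[OF q _ _ _ _ _ _ _ _ _ _ eq] in blast)
  note eq = this
  have "E u v = insert x (?A \<union> ?B)"
  proof (intro equalityI subsetI)
    fix y assume y: "y \<in> E u v"
    consider "coord x u * coord y v < coord y u * coord x v" | "coord y u * coord x v < coord x u * coord y v"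
      | "coord y u * coord x v = coord x u * coord y v" by linarith
    then show "y \<in> insert x (?A \<union> ?B)"
    proof cases
      case 2
      then have "coord x v * coord y u < coord y v * coord x u" by (simp add: mult.commute)
      then show ?thesis using y E_commute[of u v] by simp
    qed (use y eq in auto)
  next
    fix y assume "y \<in> insert x (?A \<union> ?B)"
    then show "y \<in> E u v" using x E_commute[of u v] by auto
  qed
  moreover have "x \<notin> ?A \<union> ?B" by simp
  moreover have "finite (E v u)" using finite_E[OF q] E_commute[of u v] by simp
  then have fin: "finite ?A" "finite ?B" using finite_E[OF q] by simp_all
  ultimately have "card (E u v) = Suc (card (?A \<union> ?B))" using card_insert_disjoint[of "?A \<union> ?B" x] by simp
  also have "?A \<inter> ?B = {}"
  proof (rule equals0I)
    fix y assume "y \<in> ?A \<inter> ?B"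
    then have "coord x u * coord y v < coord y u * coord x v" "coord x v * coord y u < coord y v * coord x u" by simp_all
    then show False by (simp add: mult.commute)
  qed
  then have "card (?A \<union> ?B) = card ?A + card ?B" by (rule card_Un_disjoint[OF fin])
  finally show ?thesis unfolding rank_def by simp
qed

text \<open>An arc to \<open>u w\<close> keeps the rank counted from \<open>u\<close>, an arc to
  \<open>v w\<close> keeps the one counted from \<open>v\<close>. As the crossing numbers add up,
  exactly one of the two is possible for a given rank.\<close>

lemma exit_long_edge:
  assumes A: "Arc u v w z t t' f" and c: "card (E u v) = card (E u w) + card (E v w)"
  shows "coord (h t') v = 0 \<longleftrightarrow> rank u v (h t) < card (E u w)"
proof -
  have q: "quad u v w z" and t0: "coord (h t) w = 0" "coord (h t) z = 0" and z': "coord (h t') z = 0"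
    using A unfolding Arc_def by auto
  show ?thesis
  proof
    assume v0: "coord (h t') v = 0"
    then show "rank u v (h t) < card (E u w)"
      using rank_Arc[OF A v0] rank_less[OF quad_perms(3)[OF q] E_I[OF quad_perms(3)[OF q] v0 z']] by simp
  next
    assume l: "rank u v (h t) < card (E u w)"
    show "coord (h t') v = 0"
    proof (rule ccontr)
      assume "coord (h t') v \<noteq> 0"
      then have u0: "coord (h t') u = 0" using A unfolding Arc_def by auto
      have q6: "quad v w u z" using quad_perms(6)[OF q] .
      have "rank v u (h t) = rank v w (h t')" using rank_Arc[OF Arc_swap[OF A] u0] .
      also have "\<dots> < card (E v w)" using rank_less[OF q6 E_I[OF q6 u0 z']] .
      finally show False using rank_swap[OF q E_I[OF q t0]] l c by simp
    qed
  qed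
qed

text \<open>The rule for the long edge is applied backwards: the point of \<open>u w\<close> with
  the same rank from \<open>u\<close> sends its arc to a point of \<open>u v\<close> with the rank
  of \<open>h t\<close>, that is, to \<open>h t\<close> itself.\<close>

lemma exit_short_edge:
  assumes A: "Arc u v w z t t' f" and c: "card (E u w) = card (E u v) + card (E v w)"
  shows "coord (h t') v = 0"
proof -
  have q: "quad u v w z" and t0: "coord (h t) w = 0" "coord (h t) z = 0"
    using A unfolding Arc_def by auto
  have q': "quad u w v z" using quad_perms(3)[OF q] .
  have ht: "h t \<in> E u v" using E_I[OF q t0] .
  have l: "rank u v (h t) < card (E u v)" using rank_less[OF q ht] .
  then obtain x where x: "x \<in> E u w" "rank u w x = rank u v (h t)" using rank_surj[OF q', of "rank u v (h t)"] c by auto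
  obtain r where r: "x = h r" "coord x v = 0" "coord x z = 0" using E_D[OF q' x(1)] by blast
  obtain r' g where B: "Arc u w v z r r' g" using Arc_exists[OF q', of r] r by blast
  have cc: "card (E u w) = card (E u v) + card (E w v)" using c E_commute[of v w] by simp
  have w0: "coord (h r') w = 0" using exit_long_edge[OF B cc] x l r by simp
  have z': "coord (h r') z = 0" using B unfolding Arc_def by auto
  have "rank u v (h r') = rank u v (h t)" using rank_Arc[OF B w0] x r by simp
  then have "h r' = h t" using rank_inj[OF q E_I[OF q w0 z'] ht] by simp
  then obtain n :: int where n: "r' = t + real_of_int n" using inj_mod by metis
  have "r = t' + real_of_int n"
    using gap_unique[of r' r z "t' + real_of_int n"] gap_sym[OF Arc_gap[OF B]] gap_shift[OF Arc_gap[OF A], of n] n by simp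
  then show ?thesis using r period_int by simp
qed

end

section \<open>The evolution of the poles\<close>

text \<open>A state lists the end points of the edge that is crossed, the vertex ahead and the vertex
  behind. A letter tells which of the two end points is replaced by the vertex ahead.\<close>

fun next_state :: "bool \<Rightarrow> 'a \<times> 'a \<times> 'a \<times> 'a \<Rightarrow> 'a \<times> 'a \<times> 'a \<times> 'a" where
  "next_state b (u, v, w, z) = (if b then (w, v, z, u) else (u, w, z, v))"

text \<open>The values of the pole at the first three entries of a state. The new third value comes
  from the hinge relation at the edge that has been reached.\<close>

fun next_triple :: "real \<Rightarrow> bool \<Rightarrow> real \<times> real \<times> real \<Rightarrow> real \<times> real \<times> real" where
  "next_triple l b (x, y, w) = (if b then (w, y, l * (w + y) - x) else (x, w, l * (x + w) - y))"

primrec triples :: "real \<Rightarrow> (nat \<Rightarrow> bool) \<Rightarrow> real \<times> real \<times> real \<Rightarrow> nat \<Rightarrow> real \<times> real \<times> real" where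
  "triples l b X 0 = X"
| "triples l b X (Suc k) = next_triple l (b k) (triples l b X k)"

primrec states :: "(nat \<Rightarrow> bool) \<Rightarrow> 'a \<times> 'a \<times> 'a \<times> 'a \<Rightarrow> nat \<Rightarrow> 'a \<times> 'a \<times> 'a \<times> 'a" where
  "states b s 0 = s"
| "states b s (Suc k) = next_state (b k) (states b s k)"

fun lin_comb :: "real \<Rightarrow> real \<times> real \<times> real \<Rightarrow> real \<Rightarrow> real \<times> real \<times> real \<Rightarrow> real \<times> real \<times> real" where
  "lin_comb r (x, y, w) s (x', y', w') = (r * x + s * x', r * y + s * y', r * w + s * w')"

lemma next_triple_lin: "next_triple l b (lin_comb r X s Y) = lin_comb r (next_triple l b X) s (next_triple l b Y)"
  by (cases X; cases Y) (simp add: algebra_simps)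

lemma triples_lin: "triples l b (lin_comb r X s Y) k = lin_comb r (triples l b X k) s (triples l b Y k)"
  by (induction k) (simp_all add: next_triple_lin)

fun form :: "real \<Rightarrow> real \<times> real \<times> real \<Rightarrow> real \<times> real \<times> real \<Rightarrow> real" where
  "form l (x, y, w) (x', y', w') =
     (2 + l) * (x * x' + y * y' + w * w') - l * (x + y + w) * (x' + y' + w')"

fun det3 :: "real \<times> real \<times> real \<Rightarrow> real \<times> real \<times> real \<Rightarrow> real \<times> real \<times> real \<Rightarrow> real" where
  "det3 (a1, a2, a3) (b1, b2, b3) (c1, c2, c3) =
     a1 * (b2 * c3 - b3 * c2) - a2 * (b1 * c3 - b3 * c1) + a3 * (b1 * c2 - b2 * c1)"

text \<open>Up to a factor, \<open>form l\<close> is the inner product of the poles with the given values at the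
  vertices of a face, if \<open>l = 2 c / (1 + c)\<close>.\<close>
lemma form_next: "form l (next_triple l b X) (next_triple l b Y) = form l X Y"
  by (cases X; cases Y) (simp add: algebra_simps)

lemma form_triples: "form l (triples l b X k) (triples l b Y k) = form l X Y"
  by (induction k) (simp_all add: form_next)

lemma det3_next: "det3 (next_triple l b X) (next_triple l b Y) (next_triple l b W) = det3 X Y W"
  by (cases X; cases Y; cases W) (simp add: algebra_simps)

lemma det3_triples: "det3 (triples l b X k) (triples l b Y k) (triples l b W k) = det3 X Y W"
  by (induction k) (simp_all add: det3_next)

text \<open>Since the square of the sum is at most three times the sum of squares, the form is at
  least \<open>2 * (1 - l)\<close> times the sum of squares.\<close>

lemma form_pos:
  assumes "0 < l" "l < 1" and X: "X \<noteq> (0, 0, 0)"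
  shows "0 < form l X X"
proof -
  obtain x y w where e: "X = (x, y, w)" by (metis prod_cases3)
  let ?s = "x * x + y * y + w * w"
  have "(x + y + w)\<^sup>2 \<le> 3 * ?s"
    using zero_le_power2[of "x - y"] zero_le_power2[of "y - w"] zero_le_power2[of "x - w"]
    by (simp add: power2_eq_square algebra_simps)
  then have "l * (x + y + w)\<^sup>2 \<le> l * (3 * ?s)" using assms by (intro mult_left_mono) auto
  moreover have "x * x + y * y + w * w > 0"
    using X e sum_squares_gt_zero_iff[of x y] not_sum_squares_lt_zero[of x y]
    by (cases "w = 0") (auto intro: add_nonneg_pos simp: zero_less_mult_iff neq_iff)
  then have "l * ?s < 1 * ?s" using assms by (intro mult_strict_right_mono) auto
  ultimately show ?thesis unfolding e by (simp add: power2_eq_square algebra_simps)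
qed

text \<open>Since the monodromy preserves the form and the determinant, it fixes every vector if it
  fixes two independent ones.\<close>
lemma monodromy_fixed:
  assumes l: "0 < l" "l < 1" and X: "triples l b X N = X" and Y: "triples l b Y N = Y"
    and pos: "0 < fst X" "0 < fst Y" and W: "triples l b W N \<noteq> W"
  shows "\<exists>r>0. Y = lin_comb r X 0 X"
proof -
  obtain x1 x2 x3 where x: "X = (x1, x2, x3)" by (metis prod_cases3)
  obtain y1 y2 y3 where y: "Y = (y1, y2, y3)" by (metis prod_cases3)
  have p: "0 < x1" "0 < y1" using pos x y by auto
  define r where "r = y1 / x1"
  define Z where "Z = lin_comb 1 Y (- r) X"
  have Z: "triples l b Z N = Z" unfolding Z_def triples_lin X Y by simp
  obtain z1 z2 z3 where z: "Z = (z1, z2, z3)" by (metis prod_cases3)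
  have z1: "z1 = 0" using z p unfolding Z_def x y r_def by simp
  have zz: "z2 = y2 - r * x2" "z3 = y3 - r * x3" using z unfolding Z_def x y by auto
  have "z2 = 0 \<and> z3 = 0"
  proof (rule ccontr)
    assume nz: "\<not> (z2 = 0 \<and> z3 = 0)"
    \<comment> \<open>\<open>D\<close> is the displacement of \<open>W\<close>. It is orthogonal to
      the fixed vectors \<open>X\<close> and \<open>Z\<close>, and preservation of the determinant
      puts it into their span. So it is orthogonal to itself, and the form is definite.\<close>
    define D where "D = lin_comb 1 (triples l b W N) (- 1) W"
    have fl: "form l A (lin_comb s B t C) = s * form l A B + t * form l A C" for A B C s t
      by (cases A; cases B; cases C) (simp add: algebra_simps)
    have dl: "det3 A E (lin_comb s B t C) = s * det3 A E B + t * det3 A E C" for A B C E s t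
      by (cases A; cases B; cases C; cases E) (simp add: algebra_simps)
    have f1: "form l X D = 0" using form_triples[of l b X N W] unfolding D_def fl X by simp
    have f2: "form l Z D = 0" using form_triples[of l b Z N W] unfolding D_def fl Z by simp
    have dd: "det3 X Z D = 0" using det3_triples[of l b X N Z W] unfolding D_def dl X Z by simp
    obtain d1 d2 d3 where d: "D = (d1, d2, d3)" by (metis prod_cases3)
    define e2 e3 where "e2 = d2 - d1 / x1 * x2" and "e3 = d3 - d1 / x1 * x3"
    have he: "x1 * e2 = x1 * d2 - d1 * x2" "x1 * e3 = x1 * d3 - d1 * x3"
      using p unfolding e2_def e3_def by (simp_all add: field_simps)
    have "x1 * (z2 * e3 - z3 * e2) = z2 * (x1 * e3) - z3 * (x1 * e2)" by (simp add: algebra_simps)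
    also have "\<dots> = 0" using dd unfolding he x z d z1 by (simp add: algebra_simps)
    finally have "x1 * (z2 * e3 - z3 * e2) = 0" .
    then have k: "z2 * e3 = z3 * e2" using p by simp
    obtain s where s: "e2 = s * z2" "e3 = s * z3"
    proof (cases "z2 = 0")
      case True
      then show ?thesis using that[of "e3 / z3"] k nz by auto
    next
      case False
      then show ?thesis using that[of "e2 / z2"] k by (simp add: field_simps)
    qed
    have D: "D = lin_comb (d1 / x1) X s Z"
      using s p unfolding d x z z1 e2_def e3_def by simp
    have "form l D D = (d1 / x1) * form l D X + s * form l D Z" by (subst (2) D) (rule fl)
    moreover have sym: "form l A B = form l B A" for A B by (cases A; cases B) (simp add: algebra_simps)
    have "form l D X = 0" "form l D Z = 0" by (rule trans[OF sym f1], rule trans[OF sym f2])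
    ultimately have "form l D D = 0" by simp
    then have "D = (0, 0, 0)" using form_pos[OF l, of D] by force
    moreover have "A = B" if "lin_comb 1 A (- 1) B = (0, 0, 0)" for A B
      using that by (cases A; cases B) simp
    ultimately have "triples l b W N = W" unfolding D_def by blast
    then show False using W by simp
  qed
  then have "Y = lin_comb r X 0 X" using zz p unfolding x y r_def by simp
  moreover have "0 < r" using p unfolding r_def by simp
  ultimately show ?thesis by blast
qed

section \<open>The poles along a given geodesic\<close>

context geod begin

fun StT :: "real \<Rightarrow> point \<times> point \<times> point \<times> point \<Rightarrow> bool" where
  "StT t (u, v, w, z) = St t u v w z"

text \<open>The triple describes the arc from \<open>t\<close> to the next crossing; the fourth
  vertex contributes nothing because its coordinate is 0 there.\<close>

fun vanish :: "real \<Rightarrow> point \<times> point \<times> point \<times> point \<Rightarrow> real \<times> real \<times> real \<Rightarrow> bool" where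
  "vanish t (u, v, w, z) (x, y, r) \<longleftrightarrow>
     (\<forall>s. t \<le> s \<longrightarrow> s \<le> nxt t \<longrightarrow> coord (h s) u * x + coord (h s) v * y + coord (h s) w * r = 0)"

fun sgnT :: "real \<times> real \<times> real \<Rightarrow> bool" where
  "sgnT (x, y, r) \<longleftrightarrow> 0 < x \<and> y < 0"

lemma St_next:
  assumes S: "St t u v w z"
  shows "coord (h (nxt t)) v = 0 \<Longrightarrow> St (nxt t) u w z v"
    "coord (h (nxt t)) u = 0 \<Longrightarrow> St (nxt t) w v z u"
    "coord (h (nxt t)) v = 0 \<longleftrightarrow> coord (h (nxt t)) u \<noteq> 0"
proof -
  have q: "quad u v w z" and t: "coord (h t) w = 0" "coord (h t) z = 0" and i: "inface t (nxt t) z"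
    using S unfolding St_def by auto
  have tT: "t \<in> T" using St_T[OF S] .
  have z0: "coord (h (nxt t)) z = 0" using inface_closed[OF i, of "nxt t"] nxt(2)[OF tT] by simp
  have p: "prv (nxt t) = t" using prv_nxt[OF tT] .
  have mid: "t < (t + nxt t)/2" "(t + nxt t)/2 < nxt t" using nxt(2)[OF tT] by auto
  have no: "\<not> inface t (nxt t) y" if "y \<in> V" "y \<noteq> z" for y
  proof
    assume "inface t (nxt t) y"
    then have "coord (h ((t + nxt t)/2)) y = 0" using mid unfolding inface_def by blast
    moreover have "0 < coord (h ((t + nxt t)/2)) y" using i mid that unfolding inface_def by blast
    ultimately show False by simp
  qed
  show "St (nxt t) u w z v" if "coord (h (nxt t)) v = 0"
  proof -
    have "St (nxt t) u w z v \<or> St (nxt t) u w v z"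
      by (rule St_exists) (use quad_perms(5)[OF q] that z0 in auto)
    then show ?thesis using no[of v] quad_in[OF q] quad_neq[OF q] p unfolding St_def by auto
  qed
  show "St (nxt t) w v z u" if "coord (h (nxt t)) u = 0"
  proof -
    have "St (nxt t) w v z u \<or> St (nxt t) w v u z"
      by (rule St_exists) (use quad_perms(4)[OF q] that z0 in auto)
    then show ?thesis using no[of u] quad_in[OF q] quad_neq[OF q] p unfolding St_def by auto
  qed
  obtain f where A: "Arc u v w z t (nxt t) f" using Arc_of_St[OF S] by blast
  then show "coord (h (nxt t)) v = 0 \<longleftrightarrow> coord (h (nxt t)) u \<noteq> 0"
    using edge_points(2)[OF quad_perms(3)[OF q] _ z0] unfolding Arc_def by auto
qed

lemma vanish_exists:
  assumes "StT t s" shows "\<exists>X. vanish t s X \<and> sgnT X"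
proof -
  obtain u v w z where s: "s = (u, v, w, z)" by (metis prod_cases4)
  have "St t u v w z" using assms s by simp
  then obtain f where A: "Arc u v w z t (nxt t) f" by (rule Arc_of_St)
  have q: "quad u v w z" and f: "0 < f u" "f v < 0"
    "\<And>r. t \<le> r \<Longrightarrow> r \<le> nxt t \<Longrightarrow> coord (h r) z = 0 \<and> Fn f (h r) = 0"
    using A nxt(2)[of t] unfolding Arc_def gap_def by auto
  have "vanish t s (f u, f v, f w)"
    unfolding s vanish.simps
  proof (intro allI impI)
    fix r assume "t \<le> r" "r \<le> nxt t"
    then show "coord (h r) u * f u + coord (h r) v * f v + coord (h r) w * f w = 0"
      using conjunct1[OF f(3)[of r]] conjunct2[OF f(3)[of r]] unfolding Fn_quad[OF q] by simp
  qed
  then show ?thesis using f by (intro exI[of _ "(f u, f v, f w)"]) simp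
qed

text \<open>The functional of one arc is extended to \<open>z\<close> by the hinge relation at the
  next edge. It vanishes on the part before this edge, hence by \<open>zero_propagate\<close> also
  on the part after it.\<close>

lemma vanish_next_right:
  assumes S: "St t u v w z" and v: "vanish t (u, v, w, z) (x, y, r)" and v0: "coord (h (nxt t)) v = 0"
  shows "vanish (nxt t) (u, w, z, v) (x, r, lam * (x + r) - y)"
proof -
  have q: "quad u v w z" using S unfolding St_def by auto
  have tT: "t \<in> T" using St_T[OF S] .
  have S': "St (nxt t) u w z v" using St_next(1)[OF S v0] .
  have q': "quad u w z v" using S' unfolding St_def by auto
  have i: "inface t (nxt t) z" using S unfolding St_def by auto
  define f where "f a = (if a = u then x else if a = v then y else if a = w then r else lam * (x + r) - y)" for a
  have ff: "f u = x" "f v = y" "f w = r" "f z = lam * (x + r) - y" unfolding f_def using quad_neq[OF q] by auto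
  have hf: "hinge u w z v f" unfolding hinge_def ff by simp
  have z: "Fn f (h s) = 0" if "t < s" "s < nxt t" for s
  proof -
    have "coord (h s) z = 0" using i that unfolding inface_def by blast
    then show ?thesis using v that unfolding Fn_quad[OF q] ff by simp
  qed
  have n: "t < nxt t" "nxt t < nxt (nxt t)" "prv (nxt t) = t"
    using nxt[OF tT] nxt[OF nxt(1)[OF tT]] prv_nxt[OF tT] by auto
  have "Fn f (h s) = 0" if "t < s" "s < nxt (nxt t)" for s
    by (rule zero_propagate[OF q' hf St_in_H[OF S'], of t "nxt (nxt t)" t "nxt t"]) (use n z that in auto)
  then have all: "Fn f (h s) = 0" if "t \<le> s" "s \<le> nxt (nxt t)" for s
    using Fn_zero_closed[of t "nxt (nxt t)" f s] n that by simp
  have i': "inface (nxt t) (nxt (nxt t)) v" using S' unfolding St_def by auto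
  show ?thesis unfolding vanish.simps
  proof (intro allI impI)
    fix s assume s: "nxt t \<le> s" "s \<le> nxt (nxt t)"
    have "coord (h s) v = 0" using inface_closed[OF i' n(2)] s by simp
    then show "coord (h s) u * x + coord (h s) w * r + coord (h s) z * (lam * (x + r) - y) = 0"
      using all[of s] s n unfolding Fn_quad[OF q] ff by simp
  qed
qed

lemma vanish_next_left:
  assumes S: "St t u v w z" and v: "vanish t (u, v, w, z) (x, y, r)" and u0: "coord (h (nxt t)) u = 0"
  shows "vanish (nxt t) (w, v, z, u) (r, y, lam * (r + y) - x)"
proof -
  have "vanish t (v, u, w, z) (y, x, r)" using v by (simp add: add.commute)
  from vanish_next_right[OF St_swap[OF S] this u0] show ?thesis by (simp add: add.commute add.left_commute)
qed

text \<open>At the next crossing one of the coordinates of \<open>u\<close> and \<open>v'\<close> is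
  0, so the vanishing of the functional gives the value at the vertex ahead the sign of the end
  point that it replaces.\<close>

lemma step:
  assumes S: "StT t s" and v: "vanish t s X" and sg: "sgnT X"
    and b: "b \<longleftrightarrow> coord (h (nxt t)) (fst s) = 0"
  shows "StT (nxt t) (next_state b s)" "vanish (nxt t) (next_state b s) (next_triple lam b X)"
    "sgnT (next_triple lam b X)"
proof -
  obtain u v' w z where s: "s = (u, v', w, z)" by (metis prod_cases4)
  obtain x y r where X: "X = (x, y, r)" by (metis prod_cases3)
  have S': "St t u v' w z" using S s by simp
  have q: "quad u v' w z" using S' unfolding St_def by auto
  note n = St_next[OF S']
  have vt: "coord (h (nxt t)) u * x + coord (h (nxt t)) v' * y + coord (h (nxt t)) w * r = 0"
    using v nxt(2)[OF St_T[OF S']] unfolding s X by simp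
  have z0: "coord (h (nxt t)) z = 0"
    using inface_closed[of t "nxt t" z "nxt t"] S' nxt(2)[OF St_T[OF S']] unfolding St_def by simp
  have xy: "0 < x" "y < 0" using sg X by auto
  have "StT (nxt t) (next_state b s) \<and> vanish (nxt t) (next_state b s) (next_triple lam b X) \<and> sgnT (next_triple lam b X)"
  proof (cases b)
    case True
    then have u0: "coord (h (nxt t)) u = 0" using b s by simp
    have p: "0 < coord (h (nxt t)) v'" "0 < coord (h (nxt t)) w" using edge_points(2,3)[OF quad_perms(6)[OF q] u0 z0] by auto
    have "coord (h (nxt t)) v' * y < 0" using p(1) xy(2) by (rule mult_pos_neg)
    then have "0 < coord (h (nxt t)) w * r" using vt u0 by simp
    then have "0 < r" using p by (simp add: zero_less_mult_iff)
    then show ?thesis using True n(2)[OF u0] vanish_next_left[OF S' _ u0] v s X xy by simp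
  next
    case False
    then have v0: "coord (h (nxt t)) v' = 0" using b s n(3) by simp
    have p: "0 < coord (h (nxt t)) u" "0 < coord (h (nxt t)) w" using edge_points(2,3)[OF quad_perms(3)[OF q] v0 z0] by auto
    have "0 < coord (h (nxt t)) u * x" using p(1) xy(1) by (rule mult_pos_pos)
    then have "coord (h (nxt t)) w * r < 0" using vt v0 by simp
    then have "r < 0" using p by (simp add: mult_less_0_iff)
    then show ?thesis using False n(1)[OF v0] vanish_next_right[OF S' _ v0] v s X xy by simp
  qed
  then show "StT (nxt t) (next_state b s)" "vanish (nxt t) (next_state b s) (next_triple lam b X)"
    "sgnT (next_triple lam b X)" by auto
qed

text \<open>The crossing and one interior point of the arc give two independent equations for three
  unknowns.\<close>

lemma vanish_unique:
  assumes S: "StT t s" and X: "vanish t s X" "sgnT X" and Y: "vanish t s Y" "sgnT Y"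
  shows "\<exists>r>0. Y = lin_comb r X 0 X"
proof -
  obtain u v w z where s: "s = (u, v, w, z)" by (metis prod_cases4)
  obtain x1 x2 x3 where x: "X = (x1, x2, x3)" by (metis prod_cases3)
  obtain y1 y2 y3 where y: "Y = (y1, y2, y3)" by (metis prod_cases3)
  have S': "St t u v w z" using S s by simp
  have q: "quad u v w z" "coord (h t) w = 0" "coord (h t) z = 0" using S' unfolding St_def by auto
  note e = edge_points[OF q]
  have n: "t < nxt t" using nxt(2) e(1) by blast
  define m where "m = (t + nxt t) / 2"
  have m: "t < m" "m < nxt t" using n unfolding m_def by auto
  have mw: "0 < coord (h m) w" using S' m quad_in[OF q(1)] quad_neq[OF q(1)] unfolding St_def inface_def by auto
  have ex: "coord (h t) u * x1 + coord (h t) v * x2 = 0" "coord (h t) u * y1 + coord (h t) v * y2 = 0"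
    using X(1) Y(1) q n unfolding s x y by auto
  have em: "coord (h m) u * x1 + coord (h m) v * x2 + coord (h m) w * x3 = 0"
     "coord (h m) u * y1 + coord (h m) v * y2 + coord (h m) w * y3 = 0"
    using X(1) Y(1) m unfolding s x y by auto
  have p: "0 < x1" "0 < y1" using X Y x y by auto
  define r where "r = y1 / x1"
  have r: "0 < r" "y1 = r * x1" using p unfolding r_def by auto
  have "coord (h t) v * (y2 - r * x2) = (coord (h t) u * y1 + coord (h t) v * y2)
     - r * (coord (h t) u * x1 + coord (h t) v * x2)"
    unfolding r by (simp add: algebra_simps)
  then have "coord (h t) v * (y2 - r * x2) = 0" using ex by simp
  then have r2: "y2 = r * x2" using e by simp
  have "coord (h m) w * (y3 - r * x3) = (coord (h m) u * y1 + coord (h m) v * y2 + coord (h m) w * y3)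
     - r * (coord (h m) u * x1 + coord (h m) v * x2 + coord (h m) w * x3)"
    unfolding r r2 by (simp add: algebra_simps)
  then have "y3 = r * x3" using em mw by simp
  then show ?thesis using r r2 x y by (intro exI[of _ r]) simp
qed

text \<open>Bounded intervals contain finitely many crossings, so the iterates exceed every bound; a
  translate of \<open>t\<close> beyond \<open>t0\<close> falls between two of them.\<close>

lemma nxt_iter_covers:
  assumes t0: "t0 \<in> T"
  shows "\<exists>k r. (nxt ^^ k) t0 \<le> r \<and> r < nxt ((nxt ^^ k) t0) \<and> h r = h t"
proof -
  have inT: "(nxt ^^ k) t0 \<in> T" for k by (induction k) (use t0 nxt in auto)
  have up: "(nxt ^^ k) t0 < (nxt ^^ Suc k) t0" for k using nxt(2)[OF inT] by simp
  have sm: "strict_mono (\<lambda>k. (nxt ^^ k) t0)" using up by (auto simp: strict_mono_Suc_iff)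
  obtain n :: int where "t0 - t < real_of_int n" using ex_less_of_int by blast
  define r where "r = t + real_of_int n"
  have r: "t0 < r" "h r = h t" using \<open>t0 - t < real_of_int n\<close> period_int unfolding r_def by auto
  have "\<exists>k. r < (nxt ^^ k) t0"
  proof (rule ccontr)
    assume "\<not> (\<exists>k. r < (nxt ^^ k) t0)"
    then have "range (\<lambda>k. (nxt ^^ k) t0) \<subseteq> T \<inter> {t0..r}"
      using inT sm by (auto simp: not_less) (metis funpow_0 le0 strict_mono_less_eq)
    then have "finite (range (\<lambda>k. (nxt ^^ k) t0))" using finite_T finite_subset by blast
    then show False using strict_mono_imp_inj_on[OF sm] finite_imageD by blast
  qed
  define k where "k = (LEAST k. r < (nxt ^^ k) t0)"
  have k: "r < (nxt ^^ k) t0" unfolding k_def by (rule LeastI_ex) fact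
  then have "k \<noteq> 0" using r by (cases k) auto
  then obtain j where j: "k = Suc j" using not0_implies_Suc by blast
  have "\<not> r < (nxt ^^ j) t0" using not_less_Least[of j "\<lambda>k. r < (nxt ^^ k) t0"] j unfolding k_def by auto
  then show ?thesis using k j r by (intro exI[of _ j] exI[of _ r]) auto
qed

end

section \<open>Uniqueness\<close>

context geod begin

lemma Arc_of_vanish:
  assumes S: "St t u v w z" and v: "vanish t (u, v, w, z) (x, y, r)" and p: "0 < x" "y < 0"
  obtains f where "Arc u v w z t (nxt t) f" "f u = x" "f v = y" "f w = r"
proof -
  have q: "quad u v w z" and t: "coord (h t) w = 0" "coord (h t) z = 0" and i: "inface t (nxt t) z"
    using S unfolding St_def by auto
  have tT: "t \<in> T" using St_T[OF S] .
  have n: "t < nxt t" "nxt t \<in> T" using nxt[OF tT] by auto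
  \<comment> \<open>The value at the fourth vertex is set to 0; the coordinate of that vertex
    vanishes along the arc.\<close>
  define f where "f a = (if a = u then x else if a = v then y else if a = w then r else 0)" for a
  have ff: "f u = x" "f v = y" "f w = r" "f z = 0" unfolding f_def using quad_neq[OF q] by auto
  have z0: "coord (h s) z = 0" if "t \<le> s" "s \<le> nxt t" for s using inface_closed[OF i n(1)] that by simp
  have F: "Fn f (h s) = 0" if "t \<le> s" "s \<le> nxt t" for s
    using v that unfolding Fn_quad[OF q] ff by simp
  have e: "coord (h (nxt t)) v = 0 \<and> f w < 0 \<or> coord (h (nxt t)) u = 0 \<and> 0 < f w"
    by (rule arc_end[OF q t n(2) z0 nxt_neq[OF tT] _ _ F F]) (use n p ff in auto)
  have "gap t (nxt t) z" unfolding gap_def using tT n i by simp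
  then have "Arc u v w z t (nxt t) f"
    unfolding Arc_def using q t z0 F e n p ff by (simp add: min_def max_def)
  then show ?thesis using that ff by blast
qed

definition follows :: "real \<Rightarrow> (nat \<Rightarrow> bool) \<Rightarrow> point \<times> point \<times> point \<times> point \<Rightarrow> bool" where
  "follows t b s \<longleftrightarrow> (\<forall>k. StT ((nxt ^^ k) t) (states b s k))"

lemma letter_coord:
  assumes "StT t s" "StT (nxt t) (next_state b s)"
  shows "b \<longleftrightarrow> coord (h (nxt t)) (fst s) = 0"
proof -
  obtain u v w z where s: "s = (u, v, w, z)" by (metis prod_cases4)
  have S: "St t u v w z" using assms s by simp
  show ?thesis using St_next(3)[OF S] assms(2) unfolding s by (cases b) (auto simp: St_def)
qed

lemma follows_vanish:
  assumes f: "follows t b s" and X: "vanish t s X" "sgnT X"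
  shows "vanish ((nxt ^^ k) t) (states b s k) (triples lam b X k) \<and> sgnT (triples lam b X k)"
proof (induction k)
  case (Suc k)
  have S: "StT ((nxt ^^ k) t) (states b s k)" "StT (nxt ((nxt ^^ k) t)) (next_state (b k) (states b s k))"
    using f unfolding follows_def by (blast, metis funpow.simps(2) o_apply states.simps(2))
  show ?case using step[OF S(1) _ _ letter_coord[OF S]] Suc by simp
qed (use X in simp)

fun rk :: "real \<Rightarrow> point \<times> point \<times> point \<times> point \<Rightarrow> nat" where
  "rk t (u, v, w, z) = rank u v (h t)"

text \<open>If the numbers of crossings of the sides of a face are known, then the arcs in this face, being
  disjoint, pair the crossings in only one way when one number is the sum of the others.\<close>
fun ruled :: "point \<times> point \<times> point \<times> point \<Rightarrow> bool" where
  "ruled (u, v, w, z) \<longleftrightarrow> card (E u v) = card (E u w) + card (E v w)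
     \<or> card (E u w) = card (E u v) + card (E v w) \<or> card (E v w) = card (E u v) + card (E u w)"

text \<open>True if the arc runs to the edge \<open>v w\<close>, so that \<open>u\<close> is
  dropped. The rank is counted from \<open>u\<close>.\<close>

fun exit_left :: "nat \<Rightarrow> point \<times> point \<times> point \<times> point \<Rightarrow> bool" where
  "exit_left r (u, v, w, z) \<longleftrightarrow> \<not> (if card (E u v) = card (E u w) + card (E v w) then r < card (E u w)
     else card (E u w) = card (E u v) + card (E v w))"

text \<open>On a left exit the rank counted from \<open>v\<close> is the one that persists: it is
  converted on \<open>u v\<close>, carried over, and converted back on \<open>v w\<close>, whose
  first entry is \<open>w\<close>.\<close>

fun next_rank :: "nat \<Rightarrow> point \<times> point \<times> point \<times> point \<Rightarrow> nat" where
  "next_rank r (u, v, w, z) = (if exit_left r (u, v, w, z) then card (E v w) - 1 - (card (E u v) - 1 - r) else r)"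

text \<open>Crossing numbers, state and rank determine the next letter and the next rank. In this
  way two geodesics can be compared before any of their points are known to agree.\<close>

lemma next_det:
  assumes S: "StT t s" and rl: "ruled s"
  shows "coord (h (nxt t)) (fst s) = 0 \<longleftrightarrow> exit_left (rk t s) s"
    "StT (nxt t) (next_state (exit_left (rk t s) s) s)"
    "rk (nxt t) (next_state (exit_left (rk t s) s) s) = next_rank (rk t s) s"
proof -
  obtain u v w z where s: "s = (u, v, w, z)" by (metis prod_cases4)
  have S': "St t u v w z" using S s by simp
  note n = St_next[OF S']
  obtain f where A: "Arc u v w z t (nxt t) f" using Arc_of_St[OF S'] by blast
  have q: "quad u v w z" and t: "coord (h t) w = 0" "coord (h t) z = 0" using S' unfolding St_def by auto
  have vz: "coord (h (nxt t)) v = 0 \<longleftrightarrow>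
    (if card (E u v) = card (E u w) + card (E v w) then rank u v (h t) < card (E u w)
     else card (E u w) = card (E u v) + card (E v w))"
  proof (cases "card (E u v) = card (E u w) + card (E v w)")
    case True
    then show ?thesis using exit_long_edge[OF A True] by simp
  next
    case False
    show ?thesis
    proof (cases "card (E u w) = card (E u v) + card (E v w)")
      case True
      then show ?thesis using False exit_short_edge[OF A True] by simp
    next
      case c: False
      then have "card (E v w) = card (E v u) + card (E u w)" using rl False E_commute[of u v] unfolding s by simp
      then have "coord (h (nxt t)) u = 0" using exit_short_edge[OF Arc_swap[OF A]] by simp
      then show ?thesis using n(3) False c by simp
    qed
  qed
  then show e: "coord (h (nxt t)) (fst s) = 0 \<longleftrightarrow> exit_left (rk t s) s"
    using n(3) unfolding s by auto
  show "StT (nxt t) (next_state (exit_left (rk t s) s) s)"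
  proof (cases "exit_left (rk t s) s")
    case True
    then have "coord (h (nxt t)) u = 0" using e s by simp
    then show ?thesis using True n(2) s by simp
  next
    case False
    then have "coord (h (nxt t)) v = 0" using e s n(3) by simp
    then show ?thesis using False n(1) s by simp
  qed
  show "rk (nxt t) (next_state (exit_left (rk t s) s) s) = next_rank (rk t s) s"
  proof (cases "exit_left (rk t s) s")
    case False
    then have v0: "coord (h (nxt t)) v = 0" using e s n(3) by simp
    then show ?thesis using False rank_Arc[OF A v0] s by (simp del: exit_left.simps)
  next
    case True
    then have u0: "coord (h (nxt t)) u = 0" using e s by simp
    have q6: "quad v w u z" using quad_perms(6)[OF q] .
    have z': "coord (h (nxt t)) z = 0" using A unfolding Arc_def by auto
    have "rank v u (h t) = rank v w (h (nxt t))" using rank_Arc[OF Arc_swap[OF A] u0] .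
    then have "rank w v (h (nxt t)) = card (E v w) - 1 - (card (E u v) - 1 - rank u v (h t))"
      using rank_swap[OF q E_I[OF q t]] rank_swap[OF q6 E_I[OF q6 u0 z']] by linarith
    then show ?thesis using True s by (simp del: exit_left.simps)
  qed
qed

lemma vanish_shift:
  assumes "t \<in> T" "vanish (t + real_of_int n) s X" shows "vanish t s X"
proof -
  obtain u v w z where s: "s = (u, v, w, z)" by (metis prod_cases4)
  obtain x y r where X: "X = (x, y, r)" by (metis prod_cases3)
  show ?thesis unfolding s X vanish.simps
  proof (intro allI impI)
    fix a assume a: "t \<le> a" "a \<le> nxt t"
    then show "coord (h a) u * x + coord (h a) v * y + coord (h a) w * r = 0"
      using assms(2)[unfolded s X vanish.simps nxt_shift[OF assms(1)], rule_format, of "a + real_of_int n"]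
      by (simp add: period_int)
  qed
qed

text \<open>After one circuit the triple describes the same arc, so it returns up to a positive
  factor, and the invariant form forces this factor to be 1.\<close>

lemma closed_triple:
  assumes f: "follows t b s" and X: "vanish t s X" "sgnT X"
    and N: "h ((nxt ^^ N) t) = h t" "states b s N = s"
  shows "triples lam b X N = X"
proof -
  have S: "StT t s" using f[unfolded follows_def, rule_format, of 0] by simp
  have tT: "t \<in> T" using S St_T by (cases s) auto
  obtain n :: int where n: "(nxt ^^ N) t = t + real_of_int n" using inj_mod[OF N(1)] by blast
  have "vanish t s (triples lam b X N)" "sgnT (triples lam b X N)"
    using follows_vanish[OF f X, of N] n N(2) vanish_shift[OF tT, of n s "triples lam b X N"] by auto
  then obtain r where r: "0 < r" "triples lam b X N = lin_comb r X 0 X"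
    using vanish_unique[OF S X] by blast
  obtain x y w where x: "X = (x, y, w)" by (metis prod_cases3)
  have xp: "0 < x" using X x by simp
  have "form lam X X = form lam (lin_comb r X 0 X) (lin_comb r X 0 X)"
    using form_triples[of lam b X N X] r by simp
  also have "\<dots> = r\<^sup>2 * form lam X X" unfolding x by (simp add: power2_eq_square algebra_simps)
  finally have "r\<^sup>2 = 1" using form_pos[OF lam_pos lam_less, of X] x xp by simp
  then have "r = 1" using r(1) by (simp add: power2_eq_1_iff)
  then show ?thesis using r(2) x by simp
qed

end

locale two_geods = g: geod V c g + h: geod V c h for V c g h +
  assumes same_card: "\<And>u v w z. g.quad u v w z \<Longrightarrow> card (g.E u v) = card (h.E u v)"
    and ruled: "\<And>u v w z. g.quad u v w z \<Longrightarrow> g.ruled (u, v, w, z)"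
begin

lemma same_exit:
  assumes "g.quad u v w z"
  shows "g.exit_left r (u, v, w, z) = h.exit_left r (u, v, w, z)" "g.next_rank r (u, v, w, z) = h.next_rank r (u, v, w, z)"
    "h.ruled (u, v, w, z)"
  using same_card[OF assms] same_card[OF g.quad_perms(3)[OF assms]] same_card[OF g.quad_perms(6)[OF assms]] ruled[OF assms]
  by simp_all

text \<open>Both geodesics obey the same deterministic rule for letter and rank, so agreement at one
  crossing is inherited by all later ones.\<close>

lemma same_follows:
  assumes f: "g.follows t b s" and S: "h.StT t' s" and r: "g.rk t s = h.rk t' s"
  shows "h.StT ((h.nxt ^^ k) t') (states b s k) \<and> g.rk ((g.nxt ^^ k) t) (states b s k) = h.rk ((h.nxt ^^ k) t') (states b s k)"
proof (induction k)
  case (Suc k)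
  let ?s = "states b s k"
  have G: "g.StT ((g.nxt ^^ k) t) ?s" "g.StT (g.nxt ((g.nxt ^^ k) t)) (next_state (b k) ?s)"
    using f unfolding g.follows_def by (blast, metis funpow.simps(2) o_apply states.simps(2))
  obtain u v w z where s: "?s = (u, v, w, z)" by (metis prod_cases4)
  have q: "g.quad u v w z" using G(1) s unfolding g.St_def by (simp add: g.St_def)
  have rl: "g.ruled ?s" "h.ruled ?s" using ruled[OF q] same_exit(3)[OF q] s by simp_all
  note ng = g.next_det[OF G(1) rl(1)] and nh = h.next_det[OF conjunct1[OF Suc.IH] rl(2)]
  have b: "b k = g.exit_left (g.rk ((g.nxt ^^ k) t) ?s) ?s" using g.letter_coord[OF G] ng(1) by simp
  also have "\<dots> = h.exit_left (h.rk ((h.nxt ^^ k) t') ?s) ?s"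
    using same_exit(1)[OF q] conjunct2[OF Suc.IH] s by simp
  finally have b': "b k = h.exit_left (h.rk ((h.nxt ^^ k) t') ?s) ?s" .
  have "g.next_rank (g.rk ((g.nxt ^^ k) t) ?s) ?s = h.next_rank (h.rk ((h.nxt ^^ k) t') ?s) ?s"
    using same_exit(2)[OF q] conjunct2[OF Suc.IH] s by simp
  then show ?case using ng(3) nh(2,3) unfolding b[symmetric] b'[symmetric] by simp
qed (use S r in simp)

text \<open>Proportional poles have the same zeros. On the open face \<open>Arc_cover\<close> finds
  the point on the other arc, after exchanging \<open>u\<close> and \<open>v\<close> if the arc cuts
  off the corner \<open>v\<close>; the starting point is compared on the edge.\<close>

lemma arc_included:
  assumes G: "g.St t u v w z" "g.vanish t (u, v, w, z) X" "g.sgnT X"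
    and Hh: "h.St t' u v w z" "h.vanish t' (u, v, w, z) (lin_comb r X 0 X)" and r: "0 < r"
    and a: "t' \<le> a" "a < h.nxt t'"
  shows "h a \<in> range g"
proof -
  obtain x y d where X: "X = (x, y, d)" by (metis prod_cases3)
  have p: "0 < x" "y < 0" using G X by auto
  obtain f where f: "g.Arc u v w z t (g.nxt t) f" "f u = x" "f v = y" "f w = d"
    using g.Arc_of_vanish[OF G(1) _ p] G(2) X by blast
  have q: "g.quad u v w z" using G unfolding g.St_def by blast
  have tg: "g.coord (g t) w = 0" "g.coord (g t) z = 0" using G unfolding g.St_def by auto
  have th: "g.coord (h t') w = 0" "g.coord (h t') z = 0" using Hh unfolding h.St_def by auto
  note eg = g.edge_points[OF q tg] and eh = h.edge_points[OF q th]
  have nt: "t < g.nxt t" "t' < h.nxt t'" using g.nxt(2)[OF eg(1)] h.nxt(2)[OF eh(1)] by auto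
  have i: "h.inface t' (h.nxt t') z" using Hh unfolding h.St_def by blast
  have z0: "g.coord (h a) z = 0" using h.inface_closed[OF i nt(2), of a] a by simp
  have "r * (g.coord (h a) u * x + g.coord (h a) v * y + g.coord (h a) w * d) = 0"
    using Hh(2) a unfolding X by (simp add: algebra_simps)
  then have F: "g.Fn f (h a) = 0" unfolding g.Fn_quad[OF q] f z0 using r by simp
  show ?thesis
  proof (cases "a = t'")
    case True
    have F0: "g.Fn f (g t) = 0" using f(1) nt unfolding g.Arc_def by auto
    have "g.coord (g t) u * g.coord (h t') v = g.coord (h t') u * g.coord (g t) v"
      using g.Fn_edge_zero(2)[OF q tg eg(3) th F0] f p F True by simp
    then have "g t = h t'"
      using g.edge_zero_unique[OF q g.norm_M[OF g.hM] eg(2,3) tg g.norm_M[OF h.hM] eh(2,3) th] by blast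
    then show ?thesis using True by (metis rangeI)
  next
    case False
    then have pos: "0 < g.coord (h a) u" "0 < g.coord (h a) v" "0 < g.coord (h a) w"
      using i a g.quad_in[OF q] g.quad_neq[OF q] unfolding h.inface_def by auto
    have "\<exists>s. g s = h a"
    proof (cases "g.coord (g (g.nxt t)) v = 0")
      case True
      then show ?thesis using g.Arc_cover[OF f(1) True g.norm_M[OF h.hM] z0 pos(2,3) F] by blast
    next
      case False
      then have u0: "g.coord (g (g.nxt t)) u = 0" using f(1) unfolding g.Arc_def by auto
      have "g.Fn (\<lambda>x. - f x) (h a) = 0" using F unfolding g.Fn_def by (simp add: sum_negf)
      then show ?thesis using g.Arc_cover[OF g.Arc_swap[OF f(1)] u0 g.norm_M[OF h.hM] z0 pos(1,3)] by blast
    qed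
    then show ?thesis by (metis rangeI)
  qed
qed

lemma range_included:
  assumes G: "g.follows t b s" "g.vanish t s X" "g.sgnT X"
    and Hh: "h.follows t' b s" "h.vanish t' s (lin_comb r X 0 X)" "0 < r"
  shows "range h \<subseteq> range g"
proof
  fix x assume "x \<in> range h"
  then obtain a0 where a0: "x = h a0" by blast
  have S0: "h.StT t' s" using Hh(1)[unfolded h.follows_def, rule_format, of 0] by simp
  then have "t' \<in> h.T" using h.St_T by (cases s) auto
  then obtain k a where a: "(h.nxt ^^ k) t' \<le> a" "a < h.nxt ((h.nxt ^^ k) t')" "h a = h a0"
    using h.nxt_iter_covers by blast
  obtain u v w z where s: "states b s k = (u, v, w, z)" by (metis prod_cases4)
  have "h.sgnT (lin_comb r X 0 X)" using G(3) Hh(3) by (cases X) (simp add: mult_pos_neg)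
  then have hv: "h.vanish ((h.nxt ^^ k) t') (states b s k) (lin_comb r (triples g.lam b X k) 0 (triples g.lam b X k))"
    using h.follows_vanish[OF Hh(1,2), of k] unfolding triples_lin by blast
  have "h.StT ((h.nxt ^^ k) t') (states b s k)" "g.StT ((g.nxt ^^ k) t) (states b s k)"
    using G(1) Hh(1) unfolding g.follows_def h.follows_def by auto
  then have "h a \<in> range g"
    using arc_included[of "(g.nxt ^^ k) t" u v w z "triples g.lam b X k" "(h.nxt ^^ k) t'" r a]
      g.follows_vanish[OF G, of k] hv a Hh(3) unfolding s by simp
  then show "x \<in> range g" using a0 a(3) by simp
qed

lemma reversed: "two_geods V c h g"
proof (unfold_locales)
  show "card (h.E u v) = card (g.E u v)" if "g.quad u v w z" for u v w z using same_card[OF that] by simp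
  show "h.ruled (u, v, w, z)" if "g.quad u v w z" for u v w z using same_exit(3)[OF that] .
qed

text \<open>The poles of both geodesics are fixed by one and the same monodromy, which moves
  \<open>W\<close>; hence they are proportional and the arcs coincide.\<close>

theorem same_range:
  assumes G: "g.follows t b s" "g ((g.nxt ^^ N) t) = g t" "states b s N = s" "triples g.lam b W N \<noteq> W"
    and S: "h.StT t' s" and r: "g.rk t s = h.rk t' s"
  shows "range h = range g"
proof -
  note sf = same_follows[OF G(1) S r]
  have hf: "h.follows t' b s" unfolding h.follows_def using sf by blast
  have GS: "g.StT t s" using G(1)[unfolded g.follows_def, rule_format, of 0] by simp
  obtain u v w z where s: "s = (u, v, w, z)" by (metis prod_cases4)
  have q: "g.quad u v w z" using S unfolding s by (simp add: h.St_def)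
  have hN: "h.StT ((h.nxt ^^ N) t') s" "g.rk ((g.nxt ^^ N) t) s = h.rk ((h.nxt ^^ N) t') s"
    using sf[of N] G(3) by simp_all
  \<comment> \<open>That \<open>h\<close> closes up after the same number of steps is read off from
    the rank, which determines a crossing on a given edge.\<close>
  have "h.rk ((h.nxt ^^ N) t') s = h.rk t' s" using hN(2) G(2) r unfolding s by simp
  then have hc: "h ((h.nxt ^^ N) t') = h t'"
    using h.rank_inj[OF q] h.E_I[OF q] hN(1) S unfolding s by (simp add: h.St_def)
  obtain X where X: "g.vanish t s X" "g.sgnT X" using g.vanish_exists[OF GS] by blast
  obtain Y where Y: "h.vanish t' s Y" "h.sgnT Y" using h.vanish_exists[OF S] by blast
  have "triples g.lam b X N = X" by (rule g.closed_triple[OF G(1) X G(2,3)])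
  moreover have "triples g.lam b Y N = Y" by (rule h.closed_triple[OF hf Y hc G(3)])
  moreover have "0 < fst X" "0 < fst Y" using X Y by (cases X, simp, cases Y, simp)
  ultimately obtain r where r: "0 < r" "Y = lin_comb r X 0 X"
    using monodromy_fixed[OF g.lam_pos g.lam_less _ _ _ _ G(4)] by blast
  have "range h \<subseteq> range g" using range_included[OF G(1) X hf _ r(1)] Y r by blast
  moreover have "range g \<subseteq> range h"
  proof -
    have "X = lin_comb (1/r) Y 0 Y" unfolding r(2) using r(1) by (cases X) simp
    then show ?thesis using two_geods.range_included[OF reversed hf Y G(1), of "1/r"] X r by simp
  qed
  ultimately show ?thesis by blast
qed

end

section \<open>Reversal of the direction of travel\<close>

lemma range_reverse: "range (\<lambda>t. h (- t :: real)) = range h"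
proof (intro equalityI subsetI)
  fix x assume "x \<in> range h"
  then obtain t where "x = h (- (- t))" by auto
  then show "x \<in> range (\<lambda>t. h (- t))" by blast
qed auto

text \<open>Lengths do not change under reversal. The half-open period \<open>{0..<1}\<close> is not
  symmetric, so injectivity is transferred through \<open>frac\<close>.\<close>

lemma reverse_simple_closed_geodesic:
  assumes g: "simple_closed_geodesic V h"
  shows "simple_closed_geodesic V (\<lambda>t. h (- t))"
proof -
  have cont: "continuous_on UNIV h" and ran: "range h \<subseteq> tetra_surface V - V"
    and sh: "\<And>t. \<exists>a b. a < t \<and> t < b \<and> shortest_on (tetra_surface V) h a b"
    and per: "\<And>t. h (t + 1) = h t"
    using g unfolding simple_closed_geodesic_def tetra_geodesic_def by auto
  have r: "range (\<lambda>t. h (- t)) = range h"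
    by (rule range_reverse)
  have "continuous_on UNIV (\<lambda>t. h (- t))"
    by (rule continuous_on_compose2[OF cont]) (auto intro: continuous_intros)
  moreover have "\<exists>a b. a < t \<and> t < b \<and> shortest_on (tetra_surface V) (\<lambda>t. h (- t)) a b" for t
  proof -
    obtain a b where ab: "a < - t" "- t < b" "shortest_on (tetra_surface V) h a b" using sh by blast
    have "shortest_on (tetra_surface V) (\<lambda>t. h (- t)) (- b) (- a)"
      unfolding shortest_on_def
    proof (intro allI impI)
      fix k assume k: "path k \<and> path_image k \<subseteq> tetra_surface V \<and> pathstart k = h (- (- b)) \<and> pathfinish k = h (- (- a))"
      have "curve_length (\<lambda>t. h (- t)) (- b) (- a) \<le> curve_length h a b"
        using curve_length_reverse_le[of h 0 b a] by simp
      also have "\<dots> \<le> curve_length (reversepath k) 0 1"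
        using ab(3) k unfolding shortest_on_def by simp
      also have "\<dots> \<le> curve_length k 0 1"
        using curve_length_reverse_le[of k 1 1 0] by (simp add: reversepath_def)
      finally show "curve_length (\<lambda>t. h (- t)) (- b) (- a) \<le> curve_length k 0 1" .
    qed
    then show ?thesis using ab by (intro exI[of _ "- b"] exI[of _ "- a"]) auto
  qed
  moreover have "h (- (t + 1)) = h (- t)" for t using per[of "- (t + 1)"] by simp
  moreover have "inj_on (\<lambda>t. h (- t)) {0..<1}"
  proof (rule inj_onI)
    fix x y :: real assume xy: "x \<in> {0..<1}" "y \<in> {0..<1}" "h (- x) = h (- y)"
    have "inj_on h {0..<1}" using g unfolding simple_closed_geodesic_def by blast
    have f: "h (frac s) = h s" for s
    proof -
      have *: "h (t + real m) = h t" for t and m :: nat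
      proof (induction m)
        case (Suc m)
        have "t + real (Suc m) = (t + real m) + 1" by simp
        then show ?case using per[of "t + real m"] Suc by metis
      qed simp
      show ?thesis
      proof (cases "0 \<le> \<lfloor>s\<rfloor>")
        case True
        then show ?thesis using *[of "frac s" "nat \<lfloor>s\<rfloor>"] by (simp add: frac_def)
      next
        case False
        then show ?thesis using *[of s "nat (- \<lfloor>s\<rfloor>)"] by (simp add: frac_def)
      qed
    qed
    have "frac (- x) = frac (- y)"
      using \<open>inj_on h {0..<1}\<close> f[of "- x"] f[of "- y"] xy(3) by (auto simp: inj_on_def frac_lt_1)
    moreover have fx: "frac x = x" "frac y = y" using xy(1,2) by (simp_all add: frac_eq)
    moreover have "x = 0" if "x \<in> \<int>" using that fx(1) frac_eq_0_iff[of x] by simp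
    moreover have "y = 0" if "y \<in> \<int>" using that fx(2) frac_eq_0_iff[of y] by simp
    moreover have "x < 1" "y < 1" using xy(1,2) by simp_all
    ultimately show "x = y" by (auto simp: frac_neg split: if_splits)
  qed
  ultimately show ?thesis unfolding simple_closed_geodesic_def tetra_geodesic_def r using ran by blast
qed

context geod begin

lemma geod_reverse: "geod V c (\<lambda>t. h (- t))"
proof -
  have r: "range (\<lambda>t. h (- t)) = range h"
    by (rule range_reverse)
  show ?thesis
  proof (unfold_locales)
    show "simple_closed_geodesic V (\<lambda>t. h (- t))" by (rule reverse_simple_closed_geodesic[OF scg])
    show "finite (range (\<lambda>t. h (- t)) \<inter> sph_hull {u, v})" if "u \<in> V" "v \<in> V" "u \<noteq> v" for u v
      unfolding r by (rule fin_edges[OF that])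
    obtain t where "\<exists>v\<in>V. \<exists>w\<in>V. v \<noteq> w \<and> coord (h t) v = 0 \<and> coord (h t) w = 0" using meets by blast
    then show "\<exists>t. \<exists>v\<in>V. \<exists>w\<in>V. v \<noteq> w \<and> coord (h (- t)) v = 0 \<and> coord (h (- t)) w = 0"
      by (intro exI[of _ "- t"]) simp
  qed
qed

lemma St_reverse:
  assumes S: "St t u v z w"
  shows "geod.St V (\<lambda>t. h (- t)) (- t) u v w z"
proof -
  interpret r: geod V c "\<lambda>t. h (- t)" by (rule geod_reverse)
  have q: "quad u v w z" and t: "coord (h t) w = 0" "coord (h t) z = 0" and i: "inface (prv t) t z"
    using S quad_perms(2) unfolding St_def by auto
  have "r.St (- t) u v w z \<or> r.St (- t) u v z w" by (rule r.St_exists[OF q]) (use t in auto)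
  moreover have "\<not> r.St (- t) u v z w"
  proof
    assume R: "r.St (- t) u v z w"
    note n = r.nxt(2)[OF r.St_T[OF R]] and p = prv(2)[OF St_T[OF S]]
    have ir: "r.inface (- t) (r.nxt (- t)) w" using R unfolding r.St_def by blast
    \<comment> \<open>A parameter just before \<open>t\<close> that lies in the gap of
      \<open>h\<close> before \<open>t\<close> and, reflected, in the gap after \<open>- t\<close>
      of the reversed curve.\<close>
    define s where "s = (max (prv t) (- r.nxt (- t)) + t) / 2"
    have s: "prv t < s" "s < t" "- r.nxt (- t) < s" using n p unfolding s_def by (auto simp: max_def field_simps)
    have "coord (h s) w = 0" using ir s unfolding r.inface_def by (metis minus_minus neg_less_iff_less minus_less_iff)
    moreover have "0 < coord (h s) w" using i s quad_in[OF q] quad_neq[OF q] unfolding inface_def by auto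
    ultimately show False by simp
  qed
  ultimately show ?thesis by blast
qed

end

text \<open>The second geodesic may traverse the common crossing in either direction.\<close>
theorem (in two_geods) unique_range:
  assumes G: "g.follows t b s" "g ((g.nxt ^^ N) t) = g t" "states b s N = s" "triples g.lam b W N \<noteq> W"
  shows "range h = range g"
proof -
  obtain u v w z where s: "s = (u, v, w, z)" by (metis prod_cases4)
  have S: "g.St t u v w z" using G(1)[unfolded g.follows_def, rule_format, of 0] s by simp
  have q: "g.quad u v w z" and gt: "g.coord (g t) w = 0" "g.coord (g t) z = 0" using S unfolding g.St_def by auto
  have "g.rank u v (g t) < card (g.E u v)" by (rule g.rank_less[OF q g.E_I[OF q gt]])
  \<comment> \<open>Equal crossing numbers allow the second geodesic to be entered at the crossing
    with the same rank on the same edge.\<close>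
  then obtain x where x: "x \<in> h.E u v" "h.rank u v x = g.rank u v (g t)"
    using h.rank_surj[OF q] same_card[OF q] by metis
  obtain t' where t': "x = h t'" "g.coord (h t') w = 0" "g.coord (h t') z = 0" using h.E_D[OF q x(1)] by metis
  consider "h.St t' u v w z" | "h.St t' u v z w" using h.St_exists[OF q t'(2,3)] by blast
  then show ?thesis
  proof cases
    case 1
    then show ?thesis using same_range[OF G, of t'] x t' s by simp
  next
    case 2
    interpret r: geod V c "\<lambda>t. h (- t)" by (rule h.geod_reverse)
    have ran: "range (\<lambda>t. h (- t)) = range h"
      by (rule range_reverse)
    have E: "r.E u v = h.E u v" for u v unfolding r.E_def h.E_def ran by simp
    have rk: "r.rank u v x = h.rank u v x" for u v x unfolding r.rank_def h.rank_def E ..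
    interpret gr: two_geods V c g "\<lambda>t. h (- t)"
      by unfold_locales (use same_card ruled E in auto)
    have "r.StT (- t') s" using h.St_reverse[OF 2] s by simp
    moreover have "g.rk t s = r.rk (- t') s" using x t' s by (simp add: rk)
    ultimately have "range (\<lambda>t. h (- t)) = range g" by (rule gr.same_range[OF G])
    then show ?thesis using ran by simp
  qed
qed

section \<open>Construction of a closed geodesic from a periodic sequence of poles\<close>

text \<open>Converse of \<open>sph_dist_between\<close>. The cosine and the sine of
  \<open>x + y\<close> are computed from the coefficients; the sine is positive, which excludes a
  sum beyond \<open>pi\<close>.\<close>

lemma sph_dist_cone:
  assumes n: "norm a = 1" "norm z = 1" "norm b = 1" and z: "z = s *\<^sub>R a + t *\<^sub>R b" "0 \<le> s" "0 \<le> t"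
    and ne: "a \<noteq> - b"
  shows "sph_dist a z + sph_dist z b = sph_dist a b"
proof (cases "a = b")
  case True
  then have "z = (s + t) *\<^sub>R a" using z by (simp add: scaleR_add_left)
  then have "s + t = 1" using n z by simp
  then have "z = a" using \<open>z = (s + t) *\<^sub>R a\<close> by simp
  then show ?thesis using True n by (simp add: sph_dist_self)
next
  case False
  define C where "C = a \<bullet> b"
  have bb: "a \<bullet> a = 1" "b \<bullet> b = 1" "z \<bullet> z = 1" "b \<bullet> a = C" "a \<bullet> b = C"
    using n by (auto simp: dot_square_norm C_def inner_commute)
  have C: "C < 1" "-1 < C"
    using inner_bounds_unit[OF n(1,3)] unit_inner_eq_1[OF n(1,3)] unit_inner_eq_1[of a "- b"] n ne False
    unfolding C_def by (auto simp: order_less_le)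
  have one: "s * s + t * t + 2 * (s * t * C) = 1"
    using bb(3) bb unfolding z(1) by (simp add: inner_simps algebra_simps)
  define x where "x = sph_dist a z"
  define y where "y = sph_dist z b"
  have r: "0 \<le> x" "x \<le> pi" "0 \<le> y" "y \<le> pi" using sph_dist_range n unfolding x_def y_def by auto
  have cx: "cos x = s + t * C" using cos_sph_dist[OF n(1,2)] bb unfolding x_def z(1) by (simp add: inner_simps)
  have cy: "cos y = s * C + t" using cos_sph_dist[OF n(2,3)] bb unfolding y_def z(1) by (simp add: inner_simps)
  \<comment> \<open>\<open>R\<close> is the sine of the angle between \<open>a\<close> and
    \<open>b\<close>. By the law of sines the sines of the two parts are \<open>t * R\<close> and
    \<open>s * R\<close>.\<close>
  define R where "R = sqrt (1 - C * C)"
  have "0 < 1 - C * C" using mult_strict_mono[of C 1 C 1] C abs_square_less_1[of C] by (simp add: power2_eq_square abs_less_iff)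
  then have R: "0 < R" "R * R = 1 - C * C" unfolding R_def by simp_all
  have "(sin x)\<^sup>2 = 1 - (s + t * C) * (s + t * C)" using sin_squared_eq[of x] cx by (simp add: power2_eq_square)
  also have "\<dots> = (t * t) * (R * R)" using one unfolding R(2) by algebra
  finally have "(sin x)\<^sup>2 = (t * R)\<^sup>2" by (simp add: power2_eq_square)
  then have sx: "sin x = t * R" using r z R by (simp add: power2_eq_iff_nonneg sin_ge_zero)
  have "(sin y)\<^sup>2 = 1 - (s * C + t) * (s * C + t)" using sin_squared_eq[of y] cy by (simp add: power2_eq_square)
  also have "\<dots> = (s * s) * (R * R)" using one unfolding R(2) by algebra
  finally have "(sin y)\<^sup>2 = (s * R)\<^sup>2" by (simp add: power2_eq_square)
  then have sy: "sin y = s * R" using r z R by (simp add: power2_eq_iff_nonneg sin_ge_zero)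
  have "cos (x + y) = C"
  proof -
    have "cos (x + y) = (s + t * C) * (s * C + t) - s * t * (R * R)"
      unfolding cos_add cx cy sx sy by (simp add: algebra_simps)
    also have "\<dots> = C * (s * s + t * t + 2 * (s * t * C))" unfolding R(2) by (simp add: algebra_simps)
    finally show ?thesis using one by simp
  qed
  moreover have "sin (x + y) = R"
  proof -
    have "sin (x + y) = R * (s * s + t * t + 2 * (s * t * C))"
      unfolding sin_add cx cy sx sy by (simp add: algebra_simps)
    then show ?thesis using one by simp
  qed
  then have "x + y \<le> pi"
  proof (cases "x + y = 2 * pi")
    case True
    then show ?thesis using \<open>sin (x + y) = R\<close> R(1) by simp
  next
    case False
    then show ?thesis using \<open>sin (x + y) = R\<close> R(1) sin_le_zero[of "x + y"] r by linarith
  qed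
  ultimately have "sph_dist a b = x + y"
    using sph_dist_eqI[OF n(1,3), of "x + y"] r C_def by simp
  then show ?thesis unfolding x_def y_def by simp
qed

lemma great_arc_interior:
  assumes "norm a = 1" "norm b = 1" "a \<noteq> - b" "a \<noteq> b" "0 < t" "t < 1"
  obtains \<alpha> \<beta> where "0 < \<alpha>" "0 < \<beta>" "great_arc a b t = \<alpha> *\<^sub>R a + \<beta> *\<^sub>R b"
proof -
  let ?x = "sph_dist a b"
  have x: "0 < ?x" "?x < pi"
    using sph_dist_range[of a b] sph_dist_eq_0[of a b] sph_dist_eq_pi[of a b] assms by force+
  then have s: "0 < sin ?x" by (simp add: sin_gt_zero)
  have "great_arc a b t = (1 / sin ?x) *\<^sub>R (sin ?x *\<^sub>R great_arc a b t)" using s by simp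
  also have "\<dots> = (sin ((1 - t) * ?x) / sin ?x) *\<^sub>R a + (sin (t * ?x) / sin ?x) *\<^sub>R b"
    unfolding great_arc_cone[OF assms(1,2)] by (simp add: scaleR_add_right)
  finally have e: "great_arc a b t = (sin ((1 - t) * ?x) / sin ?x) *\<^sub>R a + (sin (t * ?x) / sin ?x) *\<^sub>R b" .
  have l: "(1 - t) * ?x < pi" "t * ?x < pi"
    using mult_right_mono[of "1-t" 1 ?x] mult_right_mono[of t 1 ?x] x assms by linarith+
  have "0 < sin ((1 - t) * ?x)" "0 < sin (t * ?x)"
    using l x assms by (auto intro!: sin_gt_zero)
  then show ?thesis using that[OF _ _ e] s by simp
qed

text \<open>The geodesic is to cross the edges \<open>u i v i\<close> in turn, with \<open>w i\<close> the vertex ahead and \<open>z i\<close> the vertex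
  behind; \<open>A i\<close>, \<open>B i\<close>, \<open>C i\<close> are the inner products of \<open>u i\<close>, \<open>v i\<close>, \<open>w i\<close> with the pole of its arc in
  the face \<open>u i v i w i\<close>.\<close>
locale pole_cycle = tetra V c for V c +
  fixes u v w z :: "int \<Rightarrow> point" and A B C :: "int \<Rightarrow> real" and b :: "int \<Rightarrow> bool" and N :: nat
  assumes N_pos: "0 < N"
    and Q: "\<And>i. quad (u i) (v i) (w i) (z i)"
    and left: "\<And>i. b i \<Longrightarrow> u (i + 1) = w i \<and> v (i + 1) = v i \<and> w (i + 1) = z i \<and> z (i + 1) = u i \<and>
       A (i + 1) = C i \<and> B (i + 1) = B i \<and> C (i + 1) = lam * (C i + B i) - A i"
    and right: "\<And>i. \<not> b i \<Longrightarrow> u (i + 1) = u i \<and> v (i + 1) = w i \<and> w (i + 1) = z i \<and> z (i + 1) = v i \<and>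
       A (i + 1) = A i \<and> B (i + 1) = C i \<and> C (i + 1) = lam * (A i + C i) - B i"
    and A_pos: "\<And>i. 0 < A i" and B_neg: "\<And>i. B i < 0"
    and per: "\<And>i. u (i + int N) = u i \<and> v (i + int N) = v i \<and> w (i + int N) = w i \<and> z (i + int N) = z i \<and>
       A (i + int N) = A i \<and> B (i + int N) = B i"
    and disjoint_arcs: "\<And>i j x. 0 \<le> i \<Longrightarrow> i < int N \<Longrightarrow> 0 \<le> j \<Longrightarrow> j < int N \<Longrightarrow> i \<noteq> j \<Longrightarrow> z i = z j \<Longrightarrow>
       norm x = 1 \<Longrightarrow> (\<forall>y\<in>V. 0 \<le> coord x y) \<Longrightarrow> coord x (z i) = 0 \<Longrightarrow>
       coord x (u i) * A i + coord x (v i) * B i + coord x (w i) * C i = 0 \<Longrightarrow>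
       coord x (u j) * A j + coord x (v j) * B j + coord x (w j) * C j \<noteq> 0"
begin

definition pole :: "int \<Rightarrow> point \<Rightarrow> real" where
  "pole i x = (if x = u i then A i else if x = v i then B i else if x = w i then C i else lam * (A i + B i) - C i)"

lemma pole_simps: "pole i (u i) = A i" "pole i (v i) = B i" "pole i (w i) = C i" "pole i (z i) = lam * (A i + B i) - C i"
  unfolding pole_def using quad_neq[OF Q[of i]] by auto

lemma pole_hinge: "hinge (u i) (v i) (w i) (z i) (pole i)"
  unfolding hinge_def pole_simps by simp

text \<open>The zero of the pole on the edge \<open>u i v i\<close>; the signs of \<open>A i\<close>
  and \<open>B i\<close> place it in the interior of the edge.\<close>

definition pt :: "int \<Rightarrow> point" where "pt i = sgn ((- B i) *\<^sub>R u i + A i *\<^sub>R v i)"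

lemma pt_coord:
  obtains r where "0 < r" "coord (pt i) (u i) = r * (- B i)" "coord (pt i) (v i) = r * A i"
    "coord (pt i) (w i) = 0" "coord (pt i) (z i) = 0" "norm (pt i) = 1"
proof -
  let ?x = "(- B i) *\<^sub>R u i + A i *\<^sub>R v i"
  have e: "?x = (- B i) *\<^sub>R u i + A i *\<^sub>R v i + 0 *\<^sub>R w i + 0 *\<^sub>R z i" by simp
  note c = quad_coord[OF Q e]
  have "?x \<noteq> 0"
  proof
    assume "?x = 0"
    then have "coord (0 *\<^sub>R ?x) (v i) = A i" using c(2) by simp
    then show False using A_pos[of i] unfolding coord_scale by simp
  qed
  then show ?thesis
    using that[of "inverse (norm ?x)"] c unfolding pt_def sgn_div_norm coord_scale
    by (simp add: norm_sgn)
qed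

lemma pt_pos: "0 < coord (pt i) (u i)" "0 < coord (pt i) (v i)" "coord (pt i) (w i) = 0" "coord (pt i) (z i) = 0"
    "norm (pt i) = 1"
proof -
  obtain r where r: "0 < r" "coord (pt i) (u i) = r * (- B i)" "coord (pt i) (v i) = r * A i"
    "coord (pt i) (w i) = 0" "coord (pt i) (z i) = 0" "norm (pt i) = 1" by (rule pt_coord)
  have "0 < r * (- B i)" by (rule mult_pos_pos[OF r(1)]) (use B_neg[of i] in simp)
  moreover have "0 < r * A i" by (rule mult_pos_pos[OF r(1) A_pos])
  ultimately show "0 < coord (pt i) (u i)" "0 < coord (pt i) (v i)" "coord (pt i) (w i) = 0" "coord (pt i) (z i) = 0"
    "norm (pt i) = 1" using r by simp_all
qed

lemma pt_in_M: "pt i \<in> M"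
proof -
  have "0 \<le> coord (pt i) x" if "x \<in> V" for x
    using quad_cases[OF Q that, of i] pt_pos[of i] by auto
  then show ?thesis unfolding M_iff using pt_pos[of i] quad_in[OF Q, of i] by auto
qed

lemma pole_pt: "Fn (pole i) (pt i) = 0"
proof -
  obtain r where "0 < r" "coord (pt i) (u i) = r * (- B i)" "coord (pt i) (v i) = r * A i"
    "coord (pt i) (w i) = 0" "coord (pt i) (z i) = 0" by (rule pt_coord)
  then show ?thesis unfolding Fn_quad[OF Q[of i]] pole_simps by simp
qed

text \<open>Consecutive poles have the same values at the three vertices of their common face. At
  the fourth vertex they may differ, which is why its coordinate has to vanish.\<close>

lemma pole_next:
  "coord x (z i) = 0 \<Longrightarrow> Fn (pole (i + 1)) x = Fn (pole i) x"
proof -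
  assume z: "coord x (z i) = 0"
  show ?thesis
  proof (cases "b i")
    case True
    note l = left[OF True]
    have "Fn (pole (i + 1)) x = coord x (w i) * C i + coord x (v i) * B i + coord x (u i) * A i"
      unfolding Fn_quad[OF Q[of "i + 1"]] pole_simps using l z by simp
    then show ?thesis unfolding Fn_quad[OF Q[of i]] pole_simps using z by simp
  next
    case False
    note l = right[OF False]
    have "Fn (pole (i + 1)) x = coord x (u i) * A i + coord x (w i) * C i + coord x (v i) * B i"
      unfolding Fn_quad[OF Q[of "i + 1"]] pole_simps using l z by simp
    then show ?thesis unfolding Fn_quad[OF Q[of i]] pole_simps using z by simp
  qed
qed

lemma next_pt:
  shows "coord (pt (i + 1)) (z i) = 0" "0 < coord (pt (i + 1)) (w i)"
    "b i \<Longrightarrow> coord (pt (i + 1)) (u i) = 0 \<and> 0 < coord (pt (i + 1)) (v i)"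
    "\<not> b i \<Longrightarrow> coord (pt (i + 1)) (v i) = 0 \<and> 0 < coord (pt (i + 1)) (u i)"
proof -
  note p = pt_pos[of "i + 1"]
  have l: "b i \<Longrightarrow> u (i + 1) = w i \<and> v (i + 1) = v i \<and> w (i + 1) = z i \<and> z (i + 1) = u i" using left by blast
  have r: "\<not> b i \<Longrightarrow> u (i + 1) = u i \<and> v (i + 1) = w i \<and> w (i + 1) = z i \<and> z (i + 1) = v i" using right by blast
  show "coord (pt (i + 1)) (z i) = 0" "0 < coord (pt (i + 1)) (w i)"
    "b i \<Longrightarrow> coord (pt (i + 1)) (u i) = 0 \<and> 0 < coord (pt (i + 1)) (v i)"
    "\<not> b i \<Longrightarrow> coord (pt (i + 1)) (v i) = 0 \<and> 0 < coord (pt (i + 1)) (u i)"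
    using p l r by metis+
qed

lemma Fn_next_pt: "Fn (pole i) (pt (i + 1)) = 0"
  using pole_next[OF next_pt(1)] pole_pt by simp

lemma z_w: "z i = w (i + 1)"
  using left[of i] right[of i] by (cases "b i") auto

lemma pt_distinct: "pt i \<noteq> pt (i + 1)" "pt i \<noteq> - pt (i + 1)"
proof -
  show "pt i \<noteq> pt (i + 1)" using pt_pos(3)[of i] next_pt(2)[of i] by auto
  show "pt i \<noteq> - pt (i + 1)"
  proof
    assume "pt i = - pt (i + 1)"
    then have "coord (pt i) (w i) = - coord (pt (i + 1)) (w i)" by (simp add: coord_uminus)
    then show False using pt_pos(3)[of i] next_pt(2)[of i] by simp
  qed
qed

lemma pt_per: "pt (i + int N) = pt i"
  unfolding pt_def using per[of i] by simp

abbreviation arc :: "int \<Rightarrow> real \<Rightarrow> point" where "arc i t \<equiv> great_arc (pt i) (pt (i + 1)) t"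

lemmas arc_hyps = pt_pos(5) pt_pos(5) pt_distinct(2)

lemma arc_interior:
  assumes "0 < t" "t < 1"
  shows "coord (arc i t) (z i) = 0" "0 < coord (arc i t) (u i)" "0 < coord (arc i t) (v i)" "0 < coord (arc i t) (w i)"
proof -
  obtain \<alpha> \<beta> where ab: "0 < \<alpha>" "0 < \<beta>" "arc i t = \<alpha> *\<^sub>R pt i + \<beta> *\<^sub>R pt (i + 1)"
    by (rule great_arc_interior[OF pt_pos(5) pt_pos(5) pt_distinct(2,1) assms])
  note p = pt_pos[of i] and n = next_pt[of i]
  show "coord (arc i t) (z i) = 0" "0 < coord (arc i t) (u i)" "0 < coord (arc i t) (v i)" "0 < coord (arc i t) (w i)"
    unfolding ab(3) coord_add coord_scale using p n ab(1,2)
    by (cases "b i"; auto intro: add_pos_nonneg add_pos_pos)+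
qed

lemma arc_Fn: "t \<in> {0..1} \<Longrightarrow> Fn (pole i) (arc i t) = 0"
  using great_arc_in_cone[OF pt_pos(5) pt_pos(5) pt_distinct(2), of t i] pole_pt[of i] Fn_next_pt[of i]
  by (auto simp: Fn_add Fn_scale)

lemma arc_in_face:
  assumes "t \<in> {0..1}"
  shows "arc i t \<in> M" "coord (arc i t) (z i) = 0" "norm (arc i t) = 1" "arc i t \<notin> V"
proof -
  obtain \<alpha> \<beta> where ab: "0 \<le> \<alpha>" "0 \<le> \<beta>" "arc i t = \<alpha> *\<^sub>R pt i + \<beta> *\<^sub>R pt (i + 1)"
    using great_arc_in_cone[OF pt_pos(5) pt_pos(5) pt_distinct(2), of t i] assms by blast
  have "0 \<le> coord (arc i t) x" if "x \<in> V" for x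
    unfolding ab(3) coord_add coord_scale using ab(1,2) coord_M[OF pt_in_M that] by simp
  moreover show z0: "coord (arc i t) (z i) = 0" unfolding ab(3) coord_add coord_scale using pt_pos(4) next_pt(1) by simp
  moreover show "norm (arc i t) = 1" by (rule norm_great_arc[OF pt_pos(5) pt_pos(5) pt_distinct(2)])
  ultimately show "arc i t \<in> M" unfolding M_iff using quad_in[OF Q, of i] by blast
  have two: "\<exists>x\<in>V. \<exists>y\<in>V. x \<noteq> y \<and> 0 < coord (arc i t) x \<and> 0 < coord (arc i t) y"
  proof -
    consider "t = 0" | "t = 1" | "0 < t \<and> t < 1" using assms by fastforce
    then show ?thesis
    proof cases
      case 1
      then show ?thesis using pt_pos(1,2)[of i] quad_in[OF Q, of i] quad_neq[OF Q, of i]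
        by (intro bexI[of _ "u i"] bexI[of _ "v i"]) auto
    next
      case 2
      then show ?thesis using pt_pos(1,2,5)[of "i + 1"] pt_pos(5)[of i] quad_in[OF Q, of "i + 1"] quad_neq[OF Q, of "i + 1"]
        by (intro bexI[of _ "u (i + 1)"] bexI[of _ "v (i + 1)"]) auto
    next
      case 3
      then show ?thesis using arc_interior(2,3)[of t i] quad_in[OF Q, of i] quad_neq[OF Q, of i]
        by (intro bexI[of _ "u i"] bexI[of _ "v i"]) auto
    qed
  qed
  show "arc i t \<notin> V"
  proof
    assume a: "arc i t \<in> V"
    obtain x y where "x \<in> V" "y \<in> V" "x \<noteq> y" "0 < coord (arc i t) x" "0 < coord (arc i t) y" using two by blast
    then show False using coord_V[OF a] by (metis less_irrefl)
  qed
qed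

definition G :: "real \<Rightarrow> point" where "G t = arc \<lfloor>t\<rfloor> (frac t)"

lemma G_arc: "t \<in> {real_of_int i..real_of_int i + 1} \<Longrightarrow> G t = arc i (t - real_of_int i)"
proof (cases "t = real_of_int i + 1")
  case True
  then have "\<lfloor>t\<rfloor> = i + 1" "frac t = 0" by (simp_all add: frac_def)
  then show ?thesis unfolding G_def using True pt_pos(5)[of i] pt_pos(5)[of "i + 1"] by simp
next
  case False
  assume "t \<in> {real_of_int i..real_of_int i + 1}"
  then have "\<lfloor>t\<rfloor> = i" using False by (simp add: floor_eq_iff)
  then show ?thesis unfolding G_def by (simp add: frac_def)
qed

lemma G_int: "G (real_of_int i) = pt i"
  using G_arc[of "real_of_int i" i] by simp

lemma G_per: "G (t + real N) = G t"
proof -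
  have "\<lfloor>t + real N\<rfloor> = \<lfloor>t\<rfloor> + int N" by (metis floor_add_int of_int_of_nat_eq)
  moreover from this have "frac (t + real N) = frac t" by (simp add: frac_def)
  moreover have "pt (\<lfloor>t\<rfloor> + int N + 1) = pt (\<lfloor>t\<rfloor> + 1)" using pt_per[of "\<lfloor>t\<rfloor> + 1"] by (simp add: algebra_simps)
  ultimately show ?thesis unfolding G_def by (simp add: pt_per)
qed

lemma G_cont: "continuous_on UNIV G"
proof -
  have c1: "continuous_on {real_of_int i..real_of_int i + 1} G" for i
  proof -
    have "continuous_on {real_of_int i..real_of_int i + 1} (\<lambda>t. arc i (t - real_of_int i))"
      by (rule continuous_on_compose2[OF continuous_great_arc[of UNIV]]) (auto intro: continuous_intros)
    then show ?thesis by (rule continuous_on_eq) (use G_arc in auto)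
  qed
  have "isCont G t" for t
  proof -
    let ?i = "\<lfloor>t\<rfloor>"
    \<comment> \<open>Two adjacent closed parameter intervals contain a neighbourhood of
      \<open>t\<close>, also when \<open>t\<close> is an integer.\<close>
    have "continuous_on ({real_of_int (?i - 1)..real_of_int (?i - 1) + 1} \<union> {real_of_int ?i..real_of_int ?i + 1}) G"
      by (rule continuous_on_closed_Un[OF _ _ c1 c1]) auto
    moreover have "t \<in> interior ({real_of_int (?i - 1)..real_of_int (?i - 1) + 1} \<union> {real_of_int ?i..real_of_int ?i + 1})"
    proof (rule interiorI[of "{real_of_int ?i - 1<..<real_of_int ?i + 1}"])
      show "t \<in> {real_of_int ?i - 1<..<real_of_int ?i + 1}" by (simp; linarith)
    qed auto
    ultimately show ?thesis by (rule continuous_on_interior)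
  qed
  then show ?thesis by (simp add: continuous_at_imp_continuous_on)
qed

lemma G_M: "G t \<in> M - V"
  using arc_in_face(1,4)[of "frac t" "\<lfloor>t\<rfloor>"] frac_ge_0[of t] frac_lt_1[of t] unfolding G_def by auto

lemma G_H:
  assumes "real_of_int i - 1 < t" "t < real_of_int i + 1"
  shows "G t \<in> H (u i) (v i)"
proof -
  consider "t = real_of_int i" | "real_of_int i < t" | "t < real_of_int i" by linarith
  then have "0 < coord (G t) (u i) \<and> 0 < coord (G t) (v i)"
  proof cases
    case 1
    then show ?thesis using G_int pt_pos by simp
  next
    case 2
    then show ?thesis using G_arc[of t i] arc_interior[of "t - real_of_int i" i] assms by simp
  next
    case 3
    let ?j = "i - 1"
    have G: "G t = arc ?j (t - real_of_int ?j)" by (rule G_arc) (use 3 assms in auto)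
    have p: "0 < t - real_of_int ?j" "t - real_of_int ?j < 1" using 3 assms by auto
    note a = arc_interior[OF p, of ?j]
    have "(u i = w ?j \<and> v i = v ?j) \<or> (u i = u ?j \<and> v i = w ?j)" using left[of ?j] right[of ?j] by (cases "b ?j") auto
    then show ?thesis unfolding G using a by auto
  qed
  then show ?thesis using G_M[of t] unfolding H_def by auto
qed

lemma G_side:
  assumes "real_of_int i - 1 < t" "t < real_of_int i + 1"
  shows "real_of_int i \<le> t \<Longrightarrow> coord (G t) (z i) = 0" "t \<le> real_of_int i \<Longrightarrow> coord (G t) (w i) = 0"
    "real_of_int i < t \<Longrightarrow> 0 < coord (G t) (w i)" "t < real_of_int i \<Longrightarrow> 0 < coord (G t) (z i)"
    "Fn (pole i) (G t) = 0"
proof -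
  have up: "coord (G t) (z i) = 0 \<and> Fn (pole i) (G t) = 0" if "real_of_int i \<le> t"
    using G_arc[of t i] arc_in_face[of "t - real_of_int i" i] arc_Fn[of "t - real_of_int i" i] assms that by simp
  have lo: "coord (G t) (w i) = 0 \<and> Fn (pole i) (G t) = 0" if "t \<le> real_of_int i"
  proof -
    let ?j = "i - 1"
    have G: "G t = arc ?j (t - real_of_int ?j)" by (rule G_arc) (use that assms in auto)
    have i: "t - real_of_int ?j \<in> {0..1}" using that assms by auto
    have "coord (G t) (z ?j) = 0" "Fn (pole ?j) (G t) = 0"
      unfolding G by (rule arc_in_face(2)[OF i], rule arc_Fn[OF i])
    then show ?thesis using z_w[of ?j] pole_next[of "G t" ?j] by simp
  qed
  show "real_of_int i \<le> t \<Longrightarrow> coord (G t) (z i) = 0" "t \<le> real_of_int i \<Longrightarrow> coord (G t) (w i) = 0"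
    using up lo by auto
  show "Fn (pole i) (G t) = 0" using up lo by linarith
  show "0 < coord (G t) (w i)" if "real_of_int i < t"
    using G_arc[of t i] arc_interior[of "t - real_of_int i" i] assms that by simp
  show "0 < coord (G t) (z i)" if "t < real_of_int i"
  proof -
    let ?j = "i - 1"
    have G: "G t = arc ?j (t - real_of_int ?j)" by (rule G_arc) (use that assms in auto)
    have p: "0 < t - real_of_int ?j" "t - real_of_int ?j < 1" using that assms by auto
    have "z i = u ?j \<or> z i = v ?j" using left[of ?j] right[of ?j] by (cases "b ?j") auto
    then show ?thesis unfolding G using arc_interior[OF p, of ?j] by auto
  qed
qed

definition len :: "int \<Rightarrow> real" where "len i = sph_dist (pt i) (pt (i + 1))"

lemma len_range: "0 < len i" "len i \<le> pi"
  using sph_dist_range[OF pt_pos(5) pt_pos(5), of i "i + 1"] sph_dist_eq_0[OF pt_pos(5) pt_pos(5), of i "i + 1"] pt_distinct(1)[of i]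
  unfolding len_def by (auto simp: order_less_le)

lemma G_dist:
  assumes "real_of_int i \<le> s" "s \<le> t" "t \<le> real_of_int i + 1"
  shows "dist (G s) (G t) \<le> (t - s) * len i" "sph_dist (G s) (G t) = (t - s) * len i"
proof -
  have G: "G s = arc i (s - real_of_int i)" "G t = arc i (t - real_of_int i)" using G_arc assms by auto
  show "dist (G s) (G t) \<le> (t - s) * len i"
    using dist_great_arc[OF pt_pos(5) pt_pos(5) pt_distinct(2), of "s - real_of_int i" "t - real_of_int i" i] assms
    unfolding G len_def by simp
  show "sph_dist (G s) (G t) = (t - s) * len i"
    using sph_dist_great_arc[OF pt_pos(5) pt_pos(5) pt_distinct(2), of "s - real_of_int i" "t - real_of_int i" i] assms
    unfolding G len_def by simp
qed

text \<open>Signed arc length along the two arcs that meet at crossing \<open>i\<close>, measured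
  from this crossing.\<close>

definition potential :: "int \<Rightarrow> real \<Rightarrow> real" where
  "potential i t = (if real_of_int i \<le> t then (t - real_of_int i) * len i else (t - real_of_int i) * len (i - 1))"

lemma G_dist_potential:
  assumes "real_of_int i - 1 \<le> s" "s \<le> t" "t \<le> real_of_int i + 1"
  shows "dist (G s) (G t) \<le> potential i t - potential i s"
proof -
  consider "real_of_int i \<le> s" | "t < real_of_int i" | "s < real_of_int i" "real_of_int i \<le> t" using assms by linarith
  then show ?thesis
  proof cases
    case 1
    then show ?thesis using G_dist(1)[of i s t] assms unfolding potential_def by (simp add: algebra_simps)
  next
    case 2
    then show ?thesis using G_dist(1)[of "i - 1" s t] assms unfolding potential_def by (simp add: algebra_simps)
  next
    case 3
    have "dist (G s) (G t) \<le> dist (G s) (G (real_of_int i)) + dist (G (real_of_int i)) (G t)" by (rule dist_triangle)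
    also have "\<dots> \<le> (real_of_int i - s) * len (i - 1) + (t - real_of_int i) * len i"
      using G_dist(1)[of "i - 1" s "real_of_int i"] G_dist(1)[of i "real_of_int i" t] assms 3 by simp
    finally show ?thesis using 3 unfolding potential_def by (simp add: algebra_simps)
  qed
qed

lemma potential_diff_le:
  assumes "s \<le> t" shows "potential i t - potential i s \<le> (t - s) * pi" "0 \<le> potential i t - potential i s"
proof -
  note l = len_range[of i] len_range[of "i - 1"]
  have m: "x * len j \<le> x * pi" "0 \<le> x * len j" if "0 \<le> x" for x j
    using that len_range[of j] by (auto intro: mult_left_mono)
  consider "real_of_int i \<le> s" | "t < real_of_int i" | "s < real_of_int i" "real_of_int i \<le> t" using assms by linarith
  then have "potential i t - potential i s \<le> (t - s) * pi \<and> 0 \<le> potential i t - potential i s"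
  proof cases
    case 1
    then show ?thesis using m[of "t - s" i] assms unfolding potential_def by (simp add: algebra_simps)
  next
    case 2
    then show ?thesis using m[of "t - s" "i - 1"] assms unfolding potential_def by (simp add: algebra_simps)
  next
    case 3
    then show ?thesis using m[of "t - real_of_int i" i] m[of "real_of_int i - s" "i - 1"] unfolding potential_def
      by (simp add: algebra_simps)
  qed
  then show "potential i t - potential i s \<le> (t - s) * pi" "0 \<le> potential i t - potential i s" by auto
qed

text \<open>After unfolding along an edge, the two arcs that meet there form one great-circle arc.\<close>
lemma Phi_G:
  assumes "real_of_int i - 1 < s" "s < t" "t < real_of_int i + 1"
  shows "sph_dist (Phi (u i) (v i) (w i) (z i) (G s)) (Phi (u i) (v i) (w i) (z i) (G t)) = potential i t - potential i s"
proof -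
  let ?P = "Phi (u i) (v i) (w i) (z i)"
  have same: "sph_dist (?P (G x)) (?P (G y)) = sph_dist (G x) (G y)"
    if "real_of_int i - 1 < x" "x \<le> y" "y < real_of_int i + 1" "real_of_int i \<le> x \<or> y \<le> real_of_int i" for x y
    unfolding sph_dist_def using dist_Phi_same[OF Q, of "G x" i "G y"] G_side(1,2)[of i x] G_side(1,2)[of i y] that by auto
  consider "real_of_int i \<le> s" | "t \<le> real_of_int i" | "s < real_of_int i" "real_of_int i < t" using assms by linarith
  then show ?thesis
  proof cases
    case 1
    then show ?thesis using same[of s t] G_dist(2)[of i s t] assms unfolding potential_def by (simp add: algebra_simps)
  next
    case 2
    then show ?thesis using same[of s t] G_dist(2)[of "i - 1" s t] assms unfolding potential_def by (cases "t = real_of_int i") (auto simp: algebra_simps)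
  next
    case 3
    let ?k = "real_of_int i"
    have s0: "coord (G s) (w i) = 0" "0 < coord (G s) (z i)" "Fn (pole i) (G s) = 0" using G_side(2,4,5)[of i s] 3 assms by auto
    have t0: "coord (G t) (z i) = 0" "0 < coord (G t) (w i)" "Fn (pole i) (G t) = 0" using G_side(1,3,5)[of i t] 3 assms by auto
    have HH: "G s \<in> H (u i) (v i)" "G t \<in> H (u i) (v i)" using G_H assms by auto
    \<comment> \<open>The weights cancel the \<open>w\<close>-coordinates of the two unfolded
      points, so \<open>Y\<close> points to the edge. The pole vanishes there, hence
      \<open>Y\<close> has the direction of \<open>pt i\<close>, which thus lies between the two
      points.\<close>
    define Y where "Y = coord (G t) (w i) *\<^sub>R ?P (G s) + coord (G s) (z i) *\<^sub>R ?P (G t)"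
    have Yw: "coord Y (w i) = 0" "coord Y (z i) = 0"
      unfolding Y_def coord_add coord_scale coord_Phi[OF Q] using s0 t0 by auto
    have "0 < coord Y (u i)" "0 < coord Y (v i)"
      unfolding Y_def coord_add coord_scale coord_Phi[OF Q] using s0 t0 HH lam_pos unfolding H_def
      by (auto intro!: add_pos_pos mult_pos_pos)
    note Yp = this
    have FY: "Fn (pole i) Y = 0" unfolding Y_def Fn_add Fn_scale Fn_Phi[OF Q pole_hinge] using s0 t0 by simp
    have eqn: "coord Y (u i) * A i + coord Y (v i) * B i = 0" using FY Yw unfolding Fn_quad[OF Q[of i]] pole_simps by simp
    have eqp: "coord (pt i) (u i) * A i + coord (pt i) (v i) * B i = 0"
      using pole_pt[of i] pt_pos[of i] unfolding Fn_quad[OF Q[of i]] pole_simps by simp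
    define r where "r = coord (pt i) (u i) / coord Y (u i)"
    have r: "0 < r" "coord (pt i) (u i) = r * coord Y (u i)" using Yp pt_pos[of i] unfolding r_def by auto
    have "B i * coord (pt i) (v i) = B i * (r * coord Y (v i))"
      using eqn eqp unfolding r(2) by algebra
    then have rv: "coord (pt i) (v i) = r * coord Y (v i)" using B_neg[of i] by simp
    have "pt i = r *\<^sub>R Y"
      by (rule quad_coord_eqI[OF Q[of i]]) (use r rv Yw pt_pos[of i] in \<open>auto simp: coord_scale\<close>)
    then have cone: "pt i = (r * coord (G t) (w i)) *\<^sub>R ?P (G s) + (r * coord (G s) (z i)) *\<^sub>R ?P (G t)"
      unfolding Y_def by (simp add: scaleR_add_right)
    have "sph_dist (?P (G s)) (pt i) + sph_dist (pt i) (?P (G t)) = sph_dist (?P (G s)) (?P (G t))"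
      by (rule sph_dist_cone[OF norm_Phi[OF Q HH(1)] pt_pos(5) norm_Phi[OF Q HH(2)] cone _ _ Phi_not_antipodal[OF Q HH]])
        (use r s0 t0 in auto)
    moreover have "?P (G ?k) = pt i" unfolding G_int by (rule Phi_id) (rule pt_pos)
    ultimately have "sph_dist (?P (G s)) (?P (G t)) = sph_dist (G s) (G ?k) + sph_dist (G ?k) (G t)"
      using same[of s ?k] same[of ?k t] 3 assms by simp
    then show ?thesis
      using G_dist(2)[of "i - 1" s ?k] G_dist(2)[of i ?k t] 3 assms unfolding potential_def by (simp add: algebra_simps)
  qed
qed

text \<open>Closedness gives each point of the hinge a positive distance from the rest of the
  surface, as \<open>shortest_hingeI\<close> requires.\<close>

lemma closed_M_minus_H: "closed (M - H x y)"
proof -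
  have e: "M - H x y = {a. norm a = 1} \<inter> (\<Inter>v\<in>V. {a. 0 \<le> coord a v}) \<inter> (\<Union>v\<in>V. {a. coord a v = 0})
     \<inter> ({a. coord a x \<le> 0} \<union> {a. coord a y \<le> 0})"
    unfolding H_def by (auto simp: M_iff not_less)
  have "closed {a. 0 \<le> coord a v}" "closed {a. coord a v = 0}" "closed {a. coord a v \<le> 0}" for v
    by (intro closed_Collect_le closed_Collect_eq continuous_coord continuous_intros)+
  moreover have "closed {a::point. norm a = 1}" by (intro closed_Collect_eq continuous_intros)
  ultimately show ?thesis unfolding e using finite_V
    by (intro closed_Int closed_Un closed_INT closed_UN) auto
qed

lemma G_shortest: "\<exists>a b. a < t \<and> t < b \<and> shortest_on M G a b"
proof -
  let ?i = "\<lfloor>t\<rfloor>"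
  have ti: "real_of_int ?i - 1 < t" "t < real_of_int ?i + 1" by linarith+
  have GH: "G t \<in> H (u ?i) (v ?i)" by (rule G_H[OF ti])
  obtain r where r: "0 < r" "\<And>y. y \<in> M - H (u ?i) (v ?i) \<Longrightarrow> r \<le> dist (G t) y"
    using separate_point_closed[OF closed_M_minus_H, of "G t" "u ?i" "v ?i"] GH by blast
  \<comment> \<open>The curve has speed at most \<open>pi\<close>. Moving the starting point costs
    \<open>d * pi\<close> and the window has length at most \<open>2 * (d * pi)\<close>; together
    they stay below \<open>r\<close>. The other bounds keep the window within the two arcs at the
    edge.\<close>
  define d where "d = min (r / (3 * pi)) (min (t - (real_of_int ?i - 1)) (real_of_int ?i + 1 - t)) / 2"
  have d: "0 < d" using r ti unfolding d_def by simp
  have "2 * d \<le> r / (3 * pi)" "2 * d \<le> min (t - (real_of_int ?i - 1)) (real_of_int ?i + 1 - t)"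
    unfolding d_def by simp_all
  then have d2: "2 * d \<le> r / (3 * pi)" "2 * d \<le> t - (real_of_int ?i - 1)" "2 * d \<le> real_of_int ?i + 1 - t"
    unfolding min.bounded_iff by blast+
  have dr: "6 * (d * pi) \<le> r" using d2(1) by (simp add: field_simps)
  let ?a = "t - d" and ?b = "t + d"
  have ab: "real_of_int ?i - 1 < ?a" "?a < ?b" "?b < real_of_int ?i + 1" "?a \<le> t" using d d2 by auto
  have "shortest_on M G ?a ?b"
  proof (rule shortest_hingeI[OF Q[of ?i]])
    show "G ?a \<in> H (u ?i) (v ?i)" by (rule G_H) (use ab in auto)
    show "curve_length G ?a ?b \<le> ereal (sph_dist (Phi (u ?i) (v ?i) (w ?i) (z ?i) (G ?a)) (Phi (u ?i) (v ?i) (w ?i) (z ?i) (G ?b)))"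
      unfolding Phi_G[OF ab(1-3)]
      by (rule curve_length_le_potential) (use G_dist_potential ab in auto)
    fix y assume "y \<in> M" "y \<notin> H (u ?i) (v ?i)"
    then have "r \<le> dist (G t) y" using r by blast
    also have "\<dots> \<le> dist (G ?a) (G t) + dist (G ?a) y" by (metis dist_commute dist_triangle)
    also have "dist (G ?a) (G t) \<le> d * pi"
      using G_dist_potential[of ?i ?a t] potential_diff_le(1)[of ?a t ?i] ab d ti by simp
    finally have "r - d * pi \<le> dist (G ?a) y" by simp
    moreover have "potential ?i ?b - potential ?i ?a \<le> 2 * (d * pi)"
      using potential_diff_le(1)[of ?a ?b ?i] ab by simp
    ultimately show "sph_dist (Phi (u ?i) (v ?i) (w ?i) (z ?i) (G ?a)) (Phi (u ?i) (v ?i) (w ?i) (z ?i) (G ?b)) \<le> dist (G ?a) y"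
      unfolding Phi_G[OF ab(1-3)] using dr mult_pos_pos[OF d pi_gt_zero] by linarith
  qed (use ab in auto)
  then show ?thesis using ab d by (intro exI[of _ ?a] exI[of _ ?b]) auto
qed

end

section \<open>Simplicity of the constructed curve and its points on the edges\<close>

context pole_cycle begin

definition edge :: "int \<Rightarrow> point set" where "edge i = {u i, v i}"

lemma arcs_meet:
  assumes ij: "0 \<le> i" "i < int N" "0 \<le> j" "j < int N" and zz: "z i = z j"
    and x: "norm x = 1" "\<forall>y\<in>V. 0 \<le> coord x y" "coord x (z i) = 0" and F: "Fn (pole i) x = 0" "Fn (pole j) x = 0"
  shows "i = j"
proof (rule ccontr)
  assume "i \<noteq> j"
  have "coord x (u i) * A i + coord x (v i) * B i + coord x (w i) * C i = 0"
    using F(1) x(3) unfolding Fn_quad[OF Q[of i]] pole_simps by simp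
  moreover have "coord x (u j) * A j + coord x (v j) * B j + coord x (w j) * C j = 0"
    using F(2) x(3) zz unfolding Fn_quad[OF Q[of j]] pole_simps by simp
  ultimately show False using disjoint_arcs[OF ij \<open>i \<noteq> j\<close> zz x] by simp
qed

text \<open>\<open>per\<close> speaks of \<open>A\<close> and \<open>B\<close>; since
  \<open>C i\<close> is one of the two values at the next index, its periodicity follows.\<close>

lemma C_eq: "C i = (if b i then A (i + 1) else B (i + 1))"
  using left[of i] right[of i] by simp

lemma b_iff: "b i \<longleftrightarrow> u (i + 1) = w i"
  using left[of i] right[of i] quad_neq[OF Q[of i]] by (cases "b i") auto

lemma C_per: "C (i + int N) = C i" and b_per: "b (i + int N) = b i"
proof -
  have e: "i + int N + 1 = (i + 1) + int N" by simp
  show b: "b (i + int N) = b i" unfolding b_iff e using per[of i] per[of "i + 1"] by simp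
  show "C (i + int N) = C i" unfolding C_eq b unfolding e using per[of "i + 1"] by simp
qed

lemma pole_per: "pole (i + int N) = pole i"
proof -
  have e: "u (i + int N) = u i" "v (i + int N) = v i" "w (i + int N) = w i" "A (i + int N) = A i" "B (i + int N) = B i"
    using per[of i] by auto
  show ?thesis unfolding pole_def e C_per ..
qed

lemma per_mod:
  assumes P: "\<And>i. f (i + int N) = (f i :: 'b)" shows "f (i mod int N) = f i"
proof -
  have *: "f (i + int N * int m) = f i" for i and m :: nat
  proof (induction m)
    case (Suc m)
    have "i + int N * int (Suc m) = (i + int N * int m) + int N" by (simp add: algebra_simps)
    then show ?case using P Suc by metis
  qed simp
  define k where "k = i div int N"
  have i: "i = i mod int N + int N * k" unfolding k_def by simp
  show ?thesis
  proof (cases "0 \<le> k")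
    case True
    then show ?thesis using *[of "i mod int N" "nat k"] i by simp
  next
    case False
    then have "i + int N * int (nat (- k)) = i mod int N" using i by simp
    then show ?thesis using *[of i "nat (- k)"] by simp
  qed
qed

text \<open>The faces at the edge of \<open>pt j\<close> are opposite \<open>z j\<close> and
  \<open>w j\<close>. Accordingly \<open>pt i\<close> is compared with the arc that starts at
  \<open>pt j\<close> or with the one that ends there; in the latter case two consecutive crossings
  would coincide.\<close>

lemma pt_inj:
  assumes ij: "0 \<le> i" "i < int N" "0 \<le> j" "j < int N" and e: "pt i = pt j"
  shows "i = j"
proof (rule ccontr)
  assume ne: "i \<noteq> j"
  note pi = pt_pos[of i] and pj = pt_pos[of j]
  have nn: "\<forall>y\<in>V. 0 \<le> coord (pt i) y" using coord_M[OF pt_in_M] by blast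
  have zi: "z i \<in> V" "z j \<in> V" "w j \<in> V" using quad_in[OF Q] by auto
  have "z i \<noteq> u j" "z i \<noteq> v j" using pi(4) pj(1,2) e by auto
  then consider "z i = z j" | "z i = w j" using quad_cases[OF Q[of j] zi(1)] by blast
  then show False
  proof cases
    case 1
    show False using arcs_meet[OF ij 1 pi(5) nn pi(4) pole_pt] pole_pt[of j] e ne by simp
  next
    case 2
    \<comment> \<open>The arc that ends at \<open>pt j\<close> has the index \<open>j - 1\<close>,
      reduced modulo \<open>N\<close> because \<open>j\<close> may be 0.\<close>
    define j' where "j' = (j - 1) mod int N"
    have N: "0 < int N" using N_pos by simp
    have j': "0 \<le> j'" "j' < int N" unfolding j'_def using N by auto
    have pe: "pole j' = pole (j - 1)" unfolding j'_def by (rule per_mod[of pole]) (rule pole_per)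
    have ze: "z j' = z (j - 1)" unfolding j'_def by (rule per_mod[of z]) (use per in simp)
    have zz: "z i = z j'" using ze z_w[of "j - 1"] 2 by simp
    have "Fn (pole j') (pt i) = 0" unfolding pe e using Fn_next_pt[of "j - 1"] by simp
    then have ij': "i = j'" using arcs_meet[OF ij(1,2) j' zz pi(5) nn pi(4) pole_pt] by simp
    have "pt (j' + 1) = pt (j - 1 + 1)" unfolding pt_def j'_def
    proof -
      have f: "u (x + 1 + int N) = u (x + 1)" "v (x + 1 + int N) = v (x + 1)" "A (x + 1 + int N) = A (x + 1)"
         "B (x + 1 + int N) = B (x + 1)" for x using per[of "x + 1"] by auto
      have g: "x + int N + 1 = x + 1 + int N" for x by simp
      show "sgn (- B ((j - 1) mod int N + 1) *\<^sub>R u ((j - 1) mod int N + 1) + A ((j - 1) mod int N + 1) *\<^sub>R v ((j - 1) mod int N + 1)) =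
        sgn (- B (j - 1 + 1) *\<^sub>R u (j - 1 + 1) + A (j - 1 + 1) *\<^sub>R v (j - 1 + 1))"
        using per_mod[of "\<lambda>x. u (x + 1)" "j - 1"] per_mod[of "\<lambda>x. v (x + 1)" "j - 1"]
          per_mod[of "\<lambda>x. A (x + 1)" "j - 1"] per_mod[of "\<lambda>x. B (x + 1)" "j - 1"] f g by simp
    qed
    then have "pt (i + 1) = pt i" using e ij' by simp
    then show False using pt_distinct(1)[of i] by simp
  qed
qed

lemma G_mod: "G t = G (t - real N * real_of_int \<lfloor>t / real N\<rfloor>)"
proof -
  have *: "G (t + real N * real m) = G t" for t and m :: nat
  proof (induction m)
    case (Suc m)
    have "t + real N * real (Suc m) = (t + real N * real m) + real N" by (simp add: algebra_simps)
    then show ?case using G_per Suc by metis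
  qed simp
  let ?k = "\<lfloor>t / real N\<rfloor>"
  show ?thesis
  proof (cases "0 \<le> ?k")
    case True
    then show ?thesis using *[of "t - real N * real_of_int ?k" "nat ?k"] by simp
  next
    case False
    then show ?thesis using *[of t "nat (- ?k)"] by simp
  qed
qed

lemma G_edge_iff:
  assumes q: "quad x y r s" and g: "coord (G t) r = 0" "coord (G t) s = 0"
  shows "t = real_of_int \<lfloor>t\<rfloor>" "edge \<lfloor>t\<rfloor> = {x, y}"
proof -
  let ?i = "\<lfloor>t\<rfloor>"
  show t: "t = real_of_int ?i"
  proof (rule ccontr)
    assume "t \<noteq> real_of_int ?i"
    then have "frac t \<noteq> 0" by (simp add: frac_def)
    then have f: "0 < frac t" "frac t < 1" using frac_ge_0[of t] frac_lt_1[of t] by auto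
    have "0 < coord (G t) a" if "a \<in> V" "a \<noteq> z ?i" for a
      using arc_interior[OF f, of ?i] quad_cases[OF Q[of ?i] that(1)] that(2) unfolding G_def by auto
    then have "r = z ?i" "s = z ?i" using g quad_in[OF q] by (metis less_irrefl)+
    then show False using quad_neq[OF q] by simp
  qed
  have G: "G t = pt ?i" using G_int[of ?i] t by simp
  have "r \<noteq> u ?i" "r \<noteq> v ?i" "s \<noteq> u ?i" "s \<noteq> v ?i" using g pt_pos(1,2)[of ?i] unfolding G by auto
  then have "u ?i \<in> {x, y}" "v ?i \<in> {x, y}" using quad_cases[OF q] quad_in[OF Q, of ?i] by blast+
  then show "edge ?i = {x, y}" using quad_neq[OF Q[of ?i]] unfolding edge_def by auto
qed

text \<open>Crossings are separated by \<open>pt_inj\<close>. Any other point determines its face by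
  the vanishing coordinate and its arc by \<open>arcs_meet\<close>, and on a single arc the distance
  is a positive multiple of the difference of parameters.\<close>

lemma G_inj:
  assumes s: "0 \<le> s" "s < real N" and t: "0 \<le> t" "t < real N" and e: "G s = G t"
  shows "s = t"
proof -
  let ?i = "\<lfloor>s\<rfloor>" and ?j = "\<lfloor>t\<rfloor>"
  have ij: "0 \<le> ?i" "?i < int N" "0 \<le> ?j" "?j < int N" using s t by (auto simp: floor_less_iff)
  show ?thesis
  proof (cases "s = real_of_int ?i \<or> t = real_of_int ?j")
    case True
    have q: "quad (u k) (v k) (w k) (z k)" for k using Q .
    have both: "s = real_of_int ?i \<and> t = real_of_int ?j"
    proof -
      have "t = real_of_int ?j" if "s = real_of_int ?i"
      proof -
        have "G t = pt ?i" using e G_int[of ?i] that by simp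
        then show ?thesis using G_edge_iff(1)[OF Q[of ?i], of t] pt_pos(3,4)[of ?i] by simp
      qed
      moreover have "s = real_of_int ?i" if "t = real_of_int ?j"
      proof -
        have "G s = pt ?j" using e G_int[of ?j] that by simp
        then show ?thesis using G_edge_iff(1)[OF Q[of ?j], of s] pt_pos(3,4)[of ?j] by simp
      qed
      ultimately show ?thesis using True by blast
    qed
    then have "pt ?i = pt ?j" using e G_int[of ?i] G_int[of ?j] by simp
    then show ?thesis using pt_inj[OF ij] both by simp
  next
    case False
    then have "frac s \<noteq> 0" "frac t \<noteq> 0" by (auto simp: frac_def)
    then have f: "0 < frac s" "frac s < 1" "0 < frac t" "frac t < 1"
      using frac_ge_0[of t] frac_lt_1[of t] frac_ge_0[of s] frac_lt_1[of s] by auto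
    have zp: "0 < coord (G t) a" if "a \<in> V" "a \<noteq> z ?j" for a
      using arc_interior[OF f(3,4), of ?j] quad_cases[OF Q[of ?j] that(1)] that(2) unfolding G_def by auto
    have zs: "coord (G s) (z ?i) = 0" using arc_interior(1)[OF f(1,2), of ?i] unfolding G_def .
    then have zz: "z ?i = z ?j" using zp[of "z ?i"] e quad_in[OF Q, of ?i] by auto
    have Fs: "Fn (pole ?i) (G s) = 0" "Fn (pole ?j) (G t) = 0"
      using arc_Fn f unfolding G_def by auto
    have "?i = ?j"
      by (rule arcs_meet[OF ij zz, of "G s"]) (use G_M[of s] norm_M coord_M zs Fs e in auto)
    then have st: "\<bar>s - t\<bar> < 1" by linarith
    let ?k = "real_of_int ?i"
    have fl: "?k \<le> s" "?k \<le> t" "s \<le> ?k + 1" "t \<le> ?k + 1" using \<open>?i = ?j\<close> by linarith+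
    have "sph_dist (G s) (G t) = \<bar>s - t\<bar> * len ?i"
    proof (cases "s \<le> t")
      case True
      show ?thesis using G_dist(2)[OF fl(1) True fl(4)] True by simp
    next
      case False
      then have "t \<le> s" by simp
      show ?thesis using G_dist(2)[OF fl(2) \<open>t \<le> s\<close> fl(3)] \<open>t \<le> s\<close> sph_dist_commute[of "G s" "G t"] by simp
    qed
    moreover have "norm (G t) = 1" using G_M[of t] norm_M by blast
    then have "sph_dist (G s) (G t) = 0" using e by (simp add: sph_dist_self)
    ultimately show ?thesis using len_range(1)[of ?i] by simp
  qed
qed

definition curve :: "real \<Rightarrow> point" where "curve t = G (real N * t)"

lemma range_curve: "range curve = range G"
proof -
  have "G t \<in> range curve" for t
    using N_pos unfolding curve_def by (intro image_eqI[of _ _ "t / real N"]) auto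
  then show ?thesis unfolding curve_def by auto
qed

lemma curve_scg: "simple_closed_geodesic V curve"
proof -
  have N: "0 < real N" using N_pos by simp
  have "continuous_on UNIV curve" unfolding curve_def
    by (rule continuous_on_compose2[OF G_cont]) (auto intro: continuous_intros)
  moreover have "range curve \<subseteq> M - V" using G_M unfolding range_curve by blast
  moreover have "\<exists>a b. a < t \<and> t < b \<and> shortest_on M curve a b" for t
  proof -
    obtain a b where ab: "a < real N * t" "real N * t < b" "shortest_on M G a b" using G_shortest by blast
    have m: "mono_on {a / N..b / N} (\<lambda>t. real N * t)" using N by (auto simp: mono_on_def)
    have "shortest_on M curve (a / N) (b / N)"
      unfolding shortest_on_def
    proof (intro allI impI)
      fix k assume k: "path k \<and> path_image k \<subseteq> M \<and> pathstart k = curve (a / N) \<and> pathfinish k = curve (b / N)"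
      have "curve_length curve (a / N) (b / N) \<le> curve_length G a b"
        using curve_length_reparam_le[OF m, of G] N unfolding curve_def by simp
      also have "\<dots> \<le> curve_length k 0 1"
        using ab(3) k N unfolding shortest_on_def curve_def by simp
      finally show "curve_length curve (a / N) (b / N) \<le> curve_length k 0 1" .
    qed
    then show ?thesis using ab N by (intro exI[of _ "a / N"] exI[of _ "b / N"]) (auto simp: field_simps)
  qed
  moreover have "curve (t + 1) = curve t" for t
    using G_per[of "real N * t"] unfolding curve_def by (simp add: algebra_simps)
  moreover have "inj_on curve {0..<1}"
  proof (rule inj_onI)
    fix s t :: real assume st: "s \<in> {0..<1}" "t \<in> {0..<1}" "curve s = curve t"
    have "real N * s = real N * t"
      by (rule G_inj) (use st N in \<open>auto simp: curve_def\<close>)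
    then show "s = t" using N by simp
  qed
  ultimately show ?thesis unfolding simple_closed_geodesic_def tetra_geodesic_def by blast
qed

lemma curve_edge:
  assumes q: "quad x y r s"
  shows "range curve \<inter> sph_hull {x, y} = pt ` {i. 0 \<le> i \<and> i < int N \<and> edge i = {x, y}}" (is "?L = ?R")
proof (intro equalityI subsetI)
  fix a assume a: "a \<in> ?L"
  then obtain t0 where "a = G t0" unfolding range_curve by blast
  define t where "t = t0 - real N * real_of_int \<lfloor>t0 / real N\<rfloor>"
  have at: "a = G t" using G_mod[of t0] \<open>a = G t0\<close> unfolding t_def by simp
  have N: "0 < real N" using N_pos by simp
  have "real_of_int \<lfloor>t0 / real N\<rfloor> \<le> t0 / real N" "t0 / real N < real_of_int \<lfloor>t0 / real N\<rfloor> + 1" by linarith+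
  then have t: "0 \<le> t" "t < real N"
    using N unfolding t_def pos_le_divide_eq[OF N] pos_divide_less_eq[OF N] by (simp_all add: algebra_simps)
  have "coord (G t) r = 0" "coord (G t) s = 0" using a edge_iff[OF q, of a] at by auto
  note e = G_edge_iff[OF q this]
  have "0 \<le> \<lfloor>t\<rfloor>" "\<lfloor>t\<rfloor> < int N" using t by (auto simp: floor_less_iff)
  moreover have "a = pt \<lfloor>t\<rfloor>" using at e(1) G_int[of "\<lfloor>t\<rfloor>"] by simp
  ultimately show "a \<in> ?R" using e(2) by blast
next
  fix a assume "a \<in> ?R"
  then obtain i where i: "a = pt i" "edge i = {x, y}" by blast
  have "a \<in> range curve" unfolding range_curve i using G_int[of i] by (metis rangeI)
  have "r \<noteq> u i" "r \<noteq> v i" "s \<noteq> u i" "s \<noteq> v i" using i(2) quad_neq[OF q] unfolding edge_def by auto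
  then have "r = w i \<or> r = z i" "s = w i \<or> s = z i"
    using quad_cases[OF Q[of i], of r] quad_cases[OF Q[of i], of s] quad_in[OF q] by auto
  then have "coord a r = 0" "coord a s = 0" using pt_pos(3,4)[of i] unfolding i(1) by auto
  moreover have "0 \<le> coord a x" "0 \<le> coord a y" "norm a = 1"
    using coord_M[OF pt_in_M] quad_in[OF q] pt_pos(5) unfolding i(1) by auto
  ultimately show "a \<in> ?L" using edge_iff[OF q, of a] \<open>a \<in> range curve\<close> by blast
qed

lemma card_curve_edge:
  assumes q: "quad x y r s"
  shows "finite (range curve \<inter> sph_hull {x, y})"
    "card (range curve \<inter> sph_hull {x, y}) = card {i. 0 \<le> i \<and> i < int N \<and> edge i = {x, y}}"
proof -
  have "{i. 0 \<le> i \<and> i < int N \<and> edge i = {x, y}} \<subseteq> {0..<int N}" by auto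
  then have "finite {i. 0 \<le> i \<and> i < int N \<and> edge i = {x, y}}" using finite_subset by blast
  then show "finite (range curve \<inter> sph_hull {x, y})" unfolding curve_edge[OF q] by simp
  show "card (range curve \<inter> sph_hull {x, y}) = card {i. 0 \<le> i \<and> i < int N \<and> edge i = {x, y}}"
    unfolding curve_edge[OF q] by (rule card_image) (auto intro!: inj_onI pt_inj)
qed

text \<open>Brings the constructed curve under the theory of given geodesics, so that it can be the
  first of the two geodesics in the uniqueness argument.\<close>

sublocale curve: geod V c curve
proof
  show "simple_closed_geodesic V curve" by (rule curve_scg)
  show "finite (range curve \<inter> sph_hull {x, y})" if xy: "x \<in> V" "y \<in> V" "x \<noteq> y" for x y
    using quad_exists[OF xy] card_curve_edge(1) by blast
  have "curve 0 = pt 0" unfolding curve_def using G_int[of 0] by simp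
  then show "\<exists>t. \<exists>v\<in>V. \<exists>w\<in>V. v \<noteq> w \<and> coord (curve t) v = 0 \<and> coord (curve t) w = 0"
    using pt_pos(3,4)[of 0] quad_in[OF Q, of 0] quad_neq[OF Q, of 0] by metis
qed

lemma curve_T: "t \<in> curve.T \<longleftrightarrow> real N * t = real_of_int \<lfloor>real N * t\<rfloor>"
proof
  assume "t \<in> curve.T"
  then obtain x y r s where "quad x y r s" "coord (curve t) r = 0" "coord (curve t) s = 0" by (rule curve.T_edge)
  then show "real N * t = real_of_int \<lfloor>real N * t\<rfloor>" using G_edge_iff(1) unfolding curve_def by blast
next
  assume e: "real N * t = real_of_int \<lfloor>real N * t\<rfloor>"
  let ?i = "\<lfloor>real N * t\<rfloor>"
  have "curve t = pt ?i" unfolding curve_def using G_int[of ?i] e by simp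
  then show "t \<in> curve.T" unfolding curve.T_def
    using pt_pos(3,4)[of ?i] quad_in[OF Q, of ?i] quad_neq[OF Q, of ?i] by (intro CollectI bexI[of _ "w ?i"] bexI[of _ "z ?i"]) auto
qed

lemma curve_nxt: "curve.nxt (real_of_int i / real N) = real_of_int (i + 1) / real N"
proof (rule curve.nxt_eqI)
  have N: "0 < real N" using N_pos by simp
  show "real_of_int i / real N \<in> curve.T" "real_of_int (i + 1) / real N \<in> curve.T" using N by (simp_all add: curve_T)
  show "real_of_int i / real N < real_of_int (i + 1) / real N" using N by (simp add: divide_strict_right_mono)
  fix r assume r: "real_of_int i / real N < r" "r < real_of_int (i + 1) / real N"
  then have "real_of_int i < real N * r" "real N * r < real_of_int i + 1" using N by (simp_all add: field_simps)
  show "r \<notin> curve.T"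
  proof
    assume "r \<in> curve.T"
    then have e: "real N * r = real_of_int \<lfloor>real N * r\<rfloor>" unfolding curve_T .
    have "real_of_int i < real_of_int \<lfloor>real N * r\<rfloor>" "real_of_int \<lfloor>real N * r\<rfloor> < real_of_int (i + 1)"
      using \<open>real_of_int i < real N * r\<close> \<open>real N * r < real_of_int i + 1\<close> e by auto
    then show False unfolding of_int_less_iff by simp
  qed
qed

lemma curve_St: "curve.St (real_of_int i / real N) (u i) (v i) (w i) (z i)"
proof -
  have N: "0 < real N" using N_pos by simp
  have c: "curve (real_of_int i / real N) = pt i" unfolding curve_def using N G_int[of i] by simp
  have "curve.St (real_of_int i / real N) (u i) (v i) (w i) (z i) \<or> curve.St (real_of_int i / real N) (u i) (v i) (z i) (w i)"
    by (rule curve.St_exists[OF Q]) (use c pt_pos in auto)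
  moreover have "\<not> curve.St (real_of_int i / real N) (u i) (v i) (z i) (w i)"
  proof
    assume S: "curve.St (real_of_int i / real N) (u i) (v i) (z i) (w i)"
    let ?t = "(real_of_int i + 1/2) / real N"
    have "real_of_int i / real N < ?t" "?t < curve.nxt (real_of_int i / real N)"
      unfolding curve_nxt using N by (simp_all add: divide_strict_right_mono)
    then have "coord (curve ?t) (w i) = 0" using S unfolding curve.St_def curve.inface_def by blast
    moreover have "curve ?t = G (real_of_int i + 1/2)" unfolding curve_def using N by simp
    ultimately show False using G_side(3)[of i "real_of_int i + 1/2"] by simp
  qed
  ultimately show ?thesis by blast
qed

lemma curve_nxt_iter: "(curve.nxt ^^ k) 0 = real_of_int (int k) / real N"
proof (induction k)
  case (Suc k)
  have "(curve.nxt ^^ Suc k) 0 = curve.nxt (real_of_int (int k) / real N)" using Suc by simp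
  then show ?case unfolding curve_nxt by (simp add: add.commute)
qed simp

lemma curve_states:
  "states (\<lambda>k. b (int k)) (u 0, v 0, w 0, z 0) k = (u (int k), v (int k), w (int k), z (int k))"
proof (induction k)
  case (Suc k)
  have e: "int (Suc k) = int k + 1" by simp
  show ?case unfolding states.simps Suc e using left[of "int k"] right[of "int k"] by simp
qed simp

lemma curve_follows: "curve.follows 0 (\<lambda>k. b (int k)) (u 0, v 0, w 0, z 0)"
  unfolding curve.follows_def curve_nxt_iter curve_states curve.StT.simps by (intro allI curve_St)

lemma curve_closes: "curve ((curve.nxt ^^ N) 0) = curve 0"
  "states (\<lambda>k. b (int k)) (u 0, v 0, w 0, z 0) N = (u 0, v 0, w 0, z 0)"
  unfolding curve_nxt_iter curve_states using curve.period[of 0] N_pos per[of 0] by simp_all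

end

section \<open>The sequence of edges crossed by a straight line in the triangular lattice\<close>

text \<open>The fourth point of a parallelogram is \<open>a + b - d\<close>; the rule is the hinge
  relation for \<open>lam = 1\<close>.\<close>

definition affine_fun :: "(int \<times> int \<Rightarrow> real) \<Rightarrow> bool" where
  "affine_fun g \<longleftrightarrow> (\<forall>a b d. g (a + b - d) = g a + g b - g d)"

text \<open>The line has slope \<open>q / p\<close>. It crosses the edges of direction \<open>(1, -1)\<close> at the even indices,
  from \<open>U i\<close> to \<open>U i + (1, -1)\<close>, and at the odd indices the vertical (\<open>P i\<close>) and the
  horizontal edges. It is the zero set of \<open>ht\<close>, and its points over
  \<open>c0\<close> and \<open>c0 + p + q\<close> are midpoints of edges.\<close>
locale chain =
  fixes p q s0 c0 :: int
  assumes p0: "0 \<le> p" and pq: "p < q" and cop: "coprime p q"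
    and s0: "0 \<le> s0" "s0 < p + q" and c0: "c0 = 0 \<or> c0 = 1" and centre: "p * c0 + 2 * s0 + 1 = p + q"
begin

abbreviation "n \<equiv> p + q"

lemma n_pos: "0 < n" using p0 pq by simp

text \<open>A digital straight line: quotient and remainder locate the lattice point
  \<open>U i\<close> next above the line on the antidiagonal with coordinate sum \<open>i\<close>,
  and its height in units from 0 to \<open>n - 1\<close>.\<close>

definition \<sigma> :: "int \<Rightarrow> int" where "\<sigma> i = (p * i + s0) mod n"
definition xx :: "int \<Rightarrow> int" where "xx i = (p * i + s0) div n"
definition P :: "int \<Rightarrow> bool" where "P i \<longleftrightarrow> q \<le> \<sigma> i"
definition U :: "int \<Rightarrow> int \<times> int" where "U i = (xx i, i - xx i)"

definition lu where "lu k = (if odd k \<and> P (k div 2) then U (k div 2 + 1) else U (k div 2))"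
definition lv where "lv k = (if odd k \<and> \<not> P (k div 2) then U (k div 2 + 1) else U (k div 2)) + (1, -1)"
definition lw where "lw k = (if odd k then (if P (k div 2) then U (k div 2 + 1) + (1, -1) else U (k div 2 + 1)) else U (k div 2) + (1, 0))"
definition turn where "turn k = (if odd k then \<not> P (k div 2) else P (k div 2))"

text \<open>The scaling makes all values odd. No lattice point lies on the line, and an error below
  1 cannot change the side.\<close>

definition ht :: "int \<times> int \<Rightarrow> int" where "ht a = 2 * (p * snd a - q * fst a) + 2 * s0 + 1"

lemma sigma_range: "0 \<le> \<sigma> i" "\<sigma> i < n"
  unfolding \<sigma>_def using n_pos by auto

lemma sigma_xx: "p * i + s0 = n * xx i + \<sigma> i"
  unfolding \<sigma>_def xx_def by simp

lemma div_mod_unique: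
  assumes "a = n * d + r" "0 \<le> r" "r < n" shows "a div n = d" "a mod n = r"
  using assms n_pos by (auto simp: int_div_pos_eq int_mod_pos_eq)

lemma xx_Suc: "xx (i + 1) = xx i + (if P i then 1 else 0)"
  and sigma_Suc: "\<sigma> (i + 1) = \<sigma> i + p - (if P i then n else 0)"
proof -
  have e: "p * (i + 1) + s0 = n * (xx i + (if P i then 1 else 0)) + (\<sigma> i + p - (if P i then n else 0))"
    using sigma_xx[of i] by (auto simp: algebra_simps)
  have r: "0 \<le> \<sigma> i + p - (if P i then n else 0)" "\<sigma> i + p - (if P i then n else 0) < n"
    using sigma_range[of i] p0 pq unfolding P_def by auto
  show "xx (i + 1) = xx i + (if P i then 1 else 0)" "\<sigma> (i + 1) = \<sigma> i + p - (if P i then n else 0)"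
    unfolding xx_def[of "i + 1"] \<sigma>_def[of "i + 1"] using div_mod_unique[OF e r] by auto
qed

lemma U_Suc: "U (i + 1) = U i + (if P i then (1, 0) else (0, 1))"
  unfolding U_def xx_Suc by simp

lemma xx_shift: "xx (i + n * m) = xx i + p * m" and sigma_shift: "\<sigma> (i + n * m) = \<sigma> i"
proof -
  have e: "p * (i + n * m) + s0 = n * (xx i + p * m) + \<sigma> i"
    using sigma_xx[of i] by (simp add: algebra_simps)
  show "xx (i + n * m) = xx i + p * m" "\<sigma> (i + n * m) = \<sigma> i"
    unfolding xx_def[of "i + n * m"] \<sigma>_def[of "i + n * m"] using div_mod_unique[OF e sigma_range] by auto
qed

lemma P_shift: "P (i + n * m) = P i" unfolding P_def sigma_shift ..

lemma U_shift: "U (i + n * m) = U i + (p * m, q * m)"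
  unfolding U_def xx_shift by (simp add: algebra_simps)

lemma half_shift: "(k + 2 * n * m) div 2 = k div 2 + n * m" "odd (k + 2 * n * m) = odd k" for k m :: int
proof -
  have e: "k + 2 * n * m = k + 2 * (n * m)" by simp
  have "(k + 2 * x) div 2 = k div 2 + x" for x :: int by simp
  then show "(k + 2 * n * m) div 2 = k div 2 + n * m" unfolding e .
  show "odd (k + 2 * n * m) = odd k" unfolding e by simp
qed

lemma l_shift:
  "lu (k + 2 * n * m) = lu k + (p * m, q * m)" "lv (k + 2 * n * m) = lv k + (p * m, q * m)"
  "lw (k + 2 * n * m) = lw k + (p * m, q * m)" "turn (k + 2 * n * m) = turn k"
proof -
  have U1: "U (k div 2 + n * m + 1) = U (k div 2 + 1) + (p * m, q * m)"
    using U_shift[of "k div 2 + 1" m] by (simp add: algebra_simps)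
  show "lu (k + 2 * n * m) = lu k + (p * m, q * m)" "lv (k + 2 * n * m) = lv k + (p * m, q * m)"
    "lw (k + 2 * n * m) = lw k + (p * m, q * m)" "turn (k + 2 * n * m) = turn k"
    unfolding lu_def lv_def lw_def turn_def half_shift P_shift U1 U_shift by (auto simp: algebra_simps)
qed

lemma even_odd_cases:
  fixes k :: int
  obtains (even) i where "k = 2 * i" "odd k = False" "k div 2 = i" "odd (k + 1)" "(k + 1) div 2 = i"
  | (odd) i where "k = 2 * i + 1" "odd k = True" "k div 2 = i" "odd (k + 1) = False" "(k + 1) div 2 = i + 1"
  by (cases "even k") (auto elim!: evenE oddE)

lemma l_step:
  "turn k \<Longrightarrow> lu (k + 1) = lw k \<and> lv (k + 1) = lv k \<and> lw (k + 1) = lw k + lv k - lu k"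
  "\<not> turn k \<Longrightarrow> lu (k + 1) = lu k \<and> lv (k + 1) = lw k \<and> lw (k + 1) = lu k + lw k - lv k"
proof -
  have "(turn k \<longrightarrow> lu (k + 1) = lw k \<and> lv (k + 1) = lv k \<and> lw (k + 1) = lw k + lv k - lu k) \<and>
    (\<not> turn k \<longrightarrow> lu (k + 1) = lu k \<and> lv (k + 1) = lw k \<and> lw (k + 1) = lu k + lw k - lv k)"
  proof (cases k rule: even_odd_cases)
    case (even i)
    have "U (1 + i) = U i + (if P i then (1, 0) else (0, 1))" using U_Suc[of i] by (simp add: add.commute)
    then show ?thesis
      unfolding lu_def lv_def lw_def turn_def using even by (cases "P i") (simp_all add: U_Suc algebra_simps)
  next
    case (odd i)
    have "U (1 + i) = U i + (if P i then (1, 0) else (0, 1))" using U_Suc[of i] by (simp add: add.commute)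
    then show ?thesis
      unfolding lu_def lv_def lw_def turn_def using odd by (cases "P i") (simp_all add: U_Suc algebra_simps)
  qed
  then show "turn k \<Longrightarrow> lu (k + 1) = lw k \<and> lv (k + 1) = lv k \<and> lw (k + 1) = lw k + lv k - lu k"
    "\<not> turn k \<Longrightarrow> lu (k + 1) = lu k \<and> lv (k + 1) = lw k \<and> lw (k + 1) = lu k + lw k - lv k" by auto
qed

lemma ht_U: "ht (U i) = 2 * \<sigma> i + 1"
  unfolding ht_def U_def using sigma_xx[of i] by (simp add: algebra_simps)

lemma ht_add: "ht (a + (x, y)) = ht a + 2 * (p * y - q * x)"
  unfolding ht_def by (cases a) (simp add: algebra_simps)

lemma ht_lu: "0 < ht (lu k)" "ht (lu k) < 2 * n" and ht_lv: "ht (lv k) < 0" "- 2 * n < ht (lv k)"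
proof -
  have *: "0 < ht (U i)" "ht (U i) < 2 * n" for i unfolding ht_U using sigma_range[of i] by auto
  show "0 < ht (lu k)" "ht (lu k) < 2 * n" unfolding lu_def using * by auto
  show "ht (lv k) < 0" "- 2 * n < ht (lv k)" unfolding lv_def ht_add using * by (auto simp: algebra_simps)
qed

text \<open>The half-turn about the midpoint of the edge with index \<open>c\<close>. The hypothesis
  places this midpoint on the line; in terms of \<open>i\<close> the half-turn is \<open>i\<close>
  to \<open>c - i\<close>, and it exchanges the ends above and below.\<close>

lemma refl_sum:
  assumes c: "p * c + 2 * s0 + 1 = n * t"
  shows "\<sigma> (c - i) = n - 1 - \<sigma> i" "xx i + xx (c - i) = t - 1"
proof -
  have e: "p * (c - i) + s0 = n * (t - 1 - xx i) + (n - 1 - \<sigma> i)"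
    using sigma_xx[of i] c by (simp add: algebra_simps)
  have r: "0 \<le> n - 1 - \<sigma> i" "n - 1 - \<sigma> i < n" using sigma_range[of i] by auto
  show "\<sigma> (c - i) = n - 1 - \<sigma> i" "xx i + xx (c - i) = t - 1"
    unfolding \<sigma>_def[of "c - i"] xx_def[of "c - i"] using div_mod_unique[OF e r] by auto
qed

lemma refl_P:
  assumes c: "p * c + 2 * s0 + 1 = n * t" shows "P (c - i - 1) = P i"
proof -
  have "\<sigma> (c - (i + 1)) = n - 1 - \<sigma> (i + 1)" using refl_sum(1)[OF c] .
  moreover have "c - (i + 1) = c - i - 1" by simp
  ultimately have "\<sigma> (c - i - 1) = n - 1 - \<sigma> (i + 1)" by simp
  then show ?thesis unfolding P_def using sigma_Suc[of i] sigma_range[of i] unfolding P_def by (auto split: if_splits)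
qed

lemma refl_U:
  assumes c: "p * c + 2 * s0 + 1 = n * t" shows "U i + U (c - i) + (1, -1) = (t, c - t)"
  unfolding U_def using refl_sum(2)[OF c, of i] by simp

lemma refl_l:
  assumes c: "p * c + 2 * s0 + 1 = n * t"
  shows "lu k + lv (2 * c - k) = (t, c - t)" "turn (2 * c - 1 - k) \<longleftrightarrow> \<not> turn k"
proof -
  have "lu k + lv (2 * c - k) = (t, c - t) \<and> (turn (2 * c - 1 - k) \<longleftrightarrow> \<not> turn k)"
  proof (cases k rule: even_odd_cases)
    case (even i)
    have e: "2 * c - k = 2 * (c - i)" "2 * c - 1 - k = 2 * (c - i - 1) + 1" using even by auto
    have d: "odd (2 * c - k) = False" "(2 * c - k) div 2 = c - i" "odd (2 * c - 1 - k) = True" "(2 * c - 1 - k) div 2 = c - i - 1"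
      unfolding e by auto
    show ?thesis unfolding lu_def lv_def turn_def d even(2-5) using refl_U[OF c, of i] refl_P[OF c, of i]
      by (simp add: add.assoc)
  next
    case (odd i)
    have e: "2 * c - k = 2 * (c - i - 1) + 1" "2 * c - 1 - k = 2 * (c - i - 1)" using odd by auto
    have d: "odd (2 * c - k)" "(2 * c - k) div 2 = c - i - 1" "odd (2 * c - 1 - k) = False" "(2 * c - 1 - k) div 2 = c - i - 1"
      unfolding e by auto
    have s: "c - i - 1 = c - (i + 1)" by simp
    show ?thesis unfolding lu_def lv_def turn_def d using odd(2-5) refl_U[OF c, of i] refl_U[OF c, of "i + 1"] refl_P[OF c, of i]
      unfolding s by (auto simp: add.assoc)
  qed
  then show "lu k + lv (2 * c - k) = (t, c - t)" "turn (2 * c - 1 - k) \<longleftrightarrow> \<not> turn k" by auto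
qed

lemma ht_sum: "ht a + ht b = 2 * (p * snd (a + b) - q * fst (a + b)) + 4 * s0 + 2"
  unfolding ht_def by (simp add: algebra_simps)

lemma refl_ht:
  assumes c: "p * c + 2 * s0 + 1 = n * t"
  shows "ht (lu k) = - ht (lv (2 * c - k))"
proof -
  have "ht (lu k) + ht (lv (2 * c - k)) = 2 * (p * c + 2 * s0 + 1 - n * t)"
    unfolding ht_sum refl_l(1)[OF c] by (simp add: algebra_simps)
  then show ?thesis using c by simp
qed

lemma centre0: "p * c0 + 2 * s0 + 1 = n * 1" using centre by simp
lemma centre1: "p * (c0 + n) + 2 * s0 + 1 = n * (1 + p)" using centre by (simp add: algebra_simps)

text \<open>The affine function that vanishes along the edge \<open>k\<close> and is 1 at the vertex
  ahead: altering the third entry of a triple by a number adds this multiple of \<open>el k\<close>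
  to an affine solution.\<close>

definition el :: "int \<Rightarrow> int \<times> int \<Rightarrow> int" where
  "el k a = (if odd k then (if P (k div 2) then fst a - fst (lu k) else snd a - snd (lu k))
     else fst a + snd a - fst (lu k) - snd (lu k))"

lemma el_edge: "el k (lu k) = 0" "el k (lv k) = 0" "el k (lw k) = 1"
  unfolding el_def lu_def lv_def lw_def U_Suc by (auto simp: U_def)

lemma el_affine: "el k (a + b - d) = el k a + el k b - el k d"
  unfolding el_def by (simp add: algebra_simps)

lemma xx_mono: "0 \<le> xx (i + int m) - xx i \<and> xx (i + int m) - xx i \<le> int m"
proof (induction m)
  case (Suc m)
  have e: "i + int (Suc m) = (i + int m) + 1" by simp
  show ?case unfolding e xx_Suc using Suc by auto
qed simp

lemma l_near:
  "a \<in> {lu k, lv k, lw k} \<Longrightarrow> xx (k div 2) \<le> fst a \<and> fst a \<le> xx (k div 2) + 2 \<and>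
     k div 2 - xx (k div 2) - 1 \<le> snd a \<and> snd a \<le> k div 2 - xx (k div 2) + 1 \<and>
     k div 2 \<le> fst a + snd a \<and> fst a + snd a \<le> k div 2 + 1"
  unfolding lu_def lv_def lw_def U_Suc by (auto simp: U_def)

text \<open>Two indices advance the line by one antidiagonal, so an elementary function grows at
  most by 1/2 per index, up to a constant.\<close>

lemma el_bound:
  assumes "k \<le> k'" and a: "a \<in> {lu k', lv k', lw k'}"
  shows "\<bar>real_of_int (el k a)\<bar> \<le> real_of_int (k' - k) / 2 + 5 / 2"
proof -
  define i where "i = k div 2"
  define i' where "i' = k' div 2"
  have ii: "i \<le> i'" "2 * (i' - i) \<le> k' - k + 1" using assms(1) unfolding i_def i'_def by auto
  have mono: "0 \<le> xx i' - xx i" "xx i' - xx i \<le> i' - i" using xx_mono[of i "nat (i' - i)"] ii by auto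
  have u: "xx i \<le> fst (lu k)" "fst (lu k) \<le> xx i + 1" "i - xx i \<le> snd (lu k)" "snd (lu k) \<le> i - xx i + 1"
     "odd k \<or> fst (lu k) + snd (lu k) = i" "odd k \<longrightarrow> \<not> P i \<longrightarrow> snd (lu k) = i - xx i"
    unfolding lu_def i_def U_Suc by (auto simp: U_def)
  note l = l_near[OF a, folded i'_def]
  have "\<bar>el k a\<bar> \<le> i' - i + 2"
    using l u mono ii unfolding el_def i_def[symmetric] by (auto simp: abs_le_iff)
  then have "2 * \<bar>el k a\<bar> \<le> k' - k + 5" using ii by simp
  then have "real_of_int (2 * \<bar>el k a\<bar>) \<le> real_of_int (k' - k + 5)" unfolding of_int_le_iff .
  then have "2 * \<bar>real_of_int (el k a)\<bar> \<le> real_of_int (k' - k) + 5" by simp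
  then show ?thesis by (simp add: field_simps del: of_int_diff of_int_abs)
qed

text \<open>The gain of \<open>el c0\<close> under the translation by \<open>(p, q)\<close>: the
  edge \<open>c0\<close> is an antidiagonal one for \<open>c0 = 0\<close> and a horizontal one for
  \<open>c0 = 1\<close>.\<close>

definition m0 :: int where "m0 = (if c0 = 0 then n else q)"

lemma m0: "n \<le> 2 * m0" "1 \<le> m0" unfolding m0_def using p0 pq by auto

lemma s0_not_P: "c0 = 1 \<Longrightarrow> \<not> P 0"
proof -
  assume "c0 = 1"
  then have "2 * s0 + 1 = q" using centre by simp
  then have "s0 < q" using s0 by simp
  moreover have "\<sigma> 0 = s0" unfolding \<sigma>_def using s0 by simp
  ultimately show "\<not> P 0" unfolding P_def by simp
qed

lemma el_translate: "el c0 (a + (p * t, q * t)) = el c0 a + m0 * t"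
  using c0 s0_not_P unfolding el_def m0_def by (auto simp: algebra_simps)

text \<open>The two half-turns differ by the translation by \<open>(p, q)\<close>, which adds
  \<open>m0\<close>. The sum is the coefficient in the linear equation for the periodic solution,
  and it is not 0.\<close>

lemma el_sum: "el c0 (lu (c0 + n)) + el c0 (lv (c0 + n)) = m0"
proof -
  have 1: "lu (c0 + n) + lv (c0 + n) = (1 + p, c0 + n - (1 + p))" using refl_l(1)[OF centre1, of "c0 + n"] by simp
  have 0: "lu c0 + lv c0 = (1, c0 - 1)" using refl_l(1)[OF centre0, of c0] by simp
  have "lu (c0 + n) + lv (c0 + n) - lv c0 = lu c0 + (p * 1, q * 1)"
    using 1 0 by (simp add: prod_eq_iff algebra_simps)
  then have "el c0 (lu (c0 + n)) + el c0 (lv (c0 + n)) - el c0 (lv c0) = el c0 (lu c0) + m0 * 1"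
    using el_affine[of c0 "lu (c0 + n)" "lv (c0 + n)" "lv c0"] el_translate[of "lu c0" 1] by simp
  then show ?thesis using el_edge[of c0] by simp
qed

section \<open>Perturbation of the poles\<close>

definition tri :: "(int \<times> int \<Rightarrow> real) \<Rightarrow> int \<Rightarrow> real \<times> real \<times> real" where
  "tri g k = (g (lu k), g (lv k), g (lw k))"

definition sol :: "real \<Rightarrow> real \<times> real \<times> real \<Rightarrow> nat \<Rightarrow> real \<times> real \<times> real" where
  "sol l X = triples l (\<lambda>j. turn (c0 + int j)) X"

lemma sol_0: "sol l X 0 = X" unfolding sol_def by simp
lemma sol_Suc: "sol l X (Suc k) = next_triple l (turn (c0 + int k)) (sol l X k)" unfolding sol_def by simp

text \<open>In each step the third entry differs from the affine one by \<open>1 - l\<close> times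
  this sum at the new edge.\<close>

definition esum :: "real \<times> real \<times> real \<Rightarrow> real" where "esum X = fst X + fst (snd X)"

text \<open>Variation of constants: the solution is an affine function, corrected at each edge by a
  multiple of the elementary function of this edge.\<close>
lemma sol_affine:
  assumes g: "affine_fun g"
  shows "sol l (tri g c0) k =
    tri (\<lambda>a. g a - (1 - l) * (\<Sum>j=1..k. esum (sol l (tri g c0) j) * el (c0 + int j) a)) (c0 + int k)"
proof (induction k)
  case 0
  then show ?case by (simp add: sol_0)
next
  case (Suc k)
  define s where "s j = esum (sol l (tri g c0) j)" for j
  define gk where "gk k a = g a - (1 - l) * (\<Sum>j=1..k. s j * el (c0 + int j) a)" for k a
  have aff: "gk k (a + b - d) = gk k a + gk k b - gk k d" for k a b d
  proof -
    have "g (a + b - d) = g a + g b - g d" using g unfolding affine_fun_def by blast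
    then show ?thesis unfolding gk_def el_affine
      by (simp add: algebra_simps sum.distrib sum_subtractf)
  qed
  have gS: "gk (Suc k) a = gk k a - (1 - l) * s (Suc k) * el (c0 + int (Suc k)) a" for a
    unfolding gk_def by (simp add: algebra_simps)
  have IH: "sol l (tri g c0) k = (gk k (lu (c0 + int k)), gk k (lv (c0 + int k)), gk k (lw (c0 + int k)))"
    using Suc unfolding gk_def s_def tri_def by simp
  have e: "c0 + int (Suc k) = c0 + int k + 1" by simp
  note el = el_edge[of "c0 + int k + 1"]
  have "sol l (tri g c0) (Suc k) = tri (gk (Suc k)) (c0 + int (Suc k))"
  proof (cases "turn (c0 + int k)")
    case True
    note st = l_step(1)[OF True]
    have nx: "sol l (tri g c0) (Suc k) = (gk k (lw (c0 + int k)), gk k (lv (c0 + int k)),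
       l * (gk k (lw (c0 + int k)) + gk k (lv (c0 + int k))) - gk k (lu (c0 + int k)))"
      unfolding sol_Suc IH using True by simp
    then have "s (Suc k) = gk k (lw (c0 + int k)) + gk k (lv (c0 + int k))" unfolding s_def esum_def by simp
    then have "tri (gk (Suc k)) (c0 + int (Suc k)) = (gk k (lw (c0 + int k)), gk k (lv (c0 + int k)),
       l * (gk k (lw (c0 + int k)) + gk k (lv (c0 + int k))) - gk k (lu (c0 + int k)))"
      unfolding tri_def gS e el unfolding conjunct1[OF st] conjunct1[OF conjunct2[OF st]] conjunct2[OF conjunct2[OF st]] aff
      by (simp add: algebra_simps)
    then show ?thesis unfolding nx by (rule sym)
  next
    case False
    note st = l_step(2)[OF False]
    have nx: "sol l (tri g c0) (Suc k) = (gk k (lu (c0 + int k)), gk k (lw (c0 + int k)),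
       l * (gk k (lu (c0 + int k)) + gk k (lw (c0 + int k))) - gk k (lv (c0 + int k)))"
      unfolding sol_Suc IH using False by simp
    then have "s (Suc k) = gk k (lu (c0 + int k)) + gk k (lw (c0 + int k))" unfolding s_def esum_def by simp
    then have "tri (gk (Suc k)) (c0 + int (Suc k)) = (gk k (lu (c0 + int k)), gk k (lw (c0 + int k)),
       l * (gk k (lu (c0 + int k)) + gk k (lw (c0 + int k))) - gk k (lv (c0 + int k)))"
      unfolding tri_def gS e el unfolding conjunct1[OF st] conjunct1[OF conjunct2[OF st]] conjunct2[OF conjunct2[OF st]] aff
      by (simp add: algebra_simps)
    then show ?thesis unfolding nx by (rule sym)
  qed
  then show ?case unfolding gk_def s_def .
qed

text \<open>A bootstrap: errors up to \<open>D\<close> at earlier steps make the edge sums at most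
  \<open>B + 2 * D\<close>. The accumulated correction is then at most half of \<open>D\<close> plus
  a multiple of \<open>D\<close> that \<open>small\<close> keeps below 1/2. \<open>E\<close>
  dominates the elementary functions in the range considered.\<close>

lemma sol_bound:
  assumes g: "affine_fun g" and l: "l \<le> 1"
    and B: "\<And>k. k \<le> N \<Longrightarrow> \<bar>g (lu (c0 + int k)) + g (lv (c0 + int k))\<bar> \<le> B"
    and E: "real N / 2 + 2 \<le> E" and small: "4 * ((1 - l) * N * E) \<le> 1" and k: "k \<le> N"
  shows "\<bar>fst (sol l (tri g c0) k) - g (lu (c0 + int k))\<bar> \<le> 2 * ((1 - l) * N * E) * B \<and>
    \<bar>fst (snd (sol l (tri g c0) k)) - g (lv (c0 + int k))\<bar> \<le> 2 * ((1 - l) * N * E) * B \<and>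
    \<bar>snd (snd (sol l (tri g c0) k)) - g (lw (c0 + int k))\<bar> \<le> 2 * ((1 - l) * N * E) * B"
  using k
proof (induction k rule: less_induct)
  case (less k)
  define D where "D = 2 * ((1 - l) * N * E) * B"
  have E0: "0 < E" using E by (smt (verit) of_nat_0_le_iff divide_nonneg_pos)
  have B0: "0 \<le> B" using B[of 0] by simp
  have D0: "0 \<le> D" unfolding D_def using E0 B0 l by simp
  show ?case
  proof (cases k)
    case 0
    then show ?thesis using D0 unfolding D_def by (simp add: sol_0 tri_def)
  next
    case (Suc j)
    let ?s = "sol l (tri g c0)"
    have IH: "\<bar>fst (?s i) - g (lu (c0 + int i))\<bar> \<le> D" "\<bar>fst (snd (?s i)) - g (lv (c0 + int i))\<bar> \<le> D"
       "\<bar>snd (snd (?s i)) - g (lw (c0 + int i))\<bar> \<le> D" if "i < k" for i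
      using less.IH[OF that] less.prems that unfolding D_def by auto
    obtain x y r where s: "?s j = (x, y, r)" by (metis prod_cases3)
    have c: "c0 + int k = c0 + int j + 1" using Suc by simp
    have uv: "\<bar>fst (?s k) - g (lu (c0 + int k))\<bar> \<le> D \<and> \<bar>fst (snd (?s k)) - g (lv (c0 + int k))\<bar> \<le> D"
      using IH[of j] Suc s l_step[of "c0 + int j"] unfolding c
      by (cases "turn (c0 + int j)") (auto simp: sol_Suc)
    have S: "\<bar>esum (?s i)\<bar> \<le> B + 2 * D" if "i \<le> k" for i
    proof -
      have "\<bar>fst (?s i) - g (lu (c0 + int i))\<bar> \<le> D" "\<bar>fst (snd (?s i)) - g (lv (c0 + int i))\<bar> \<le> D"
        using IH[of i] uv that by (cases "i = k", auto)+
      moreover have "\<bar>g (lu (c0 + int i)) + g (lv (c0 + int i))\<bar> \<le> B" using B[of i] that less.prems by simp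
      ultimately show ?thesis unfolding esum_def by linarith
    qed
    let ?w = "lw (c0 + int k)"
    have "snd (snd (?s k)) = g ?w - (1 - l) * (\<Sum>i=1..k. esum (?s i) * el (c0 + int i) ?w)"
      by (subst sol_affine[OF g]) (simp add: tri_def)
    then have "\<bar>snd (snd (?s k)) - g ?w\<bar> = (1 - l) * \<bar>\<Sum>i=1..k. esum (?s i) * el (c0 + int i) ?w\<bar>"
      using l by (simp add: abs_mult)
    also have "\<bar>\<Sum>i=1..k. esum (?s i) * el (c0 + int i) ?w\<bar> \<le> (\<Sum>i=1..k. (B + 2 * D) * E)"
    proof (rule order_trans[OF sum_abs sum_mono])
      fix i assume i: "i \<in> {1..k}"
      have "\<bar>real_of_int (el (c0 + int i) ?w)\<bar> \<le> real_of_int (c0 + int k - (c0 + int i)) / 2 + 5 / 2"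
        by (rule el_bound) (use i in auto)
      also have "\<dots> \<le> E" using i less.prems E by (simp add: field_simps)
      finally show "\<bar>esum (?s i) * real_of_int (el (c0 + int i) ?w)\<bar> \<le> (B + 2 * D) * E"
        unfolding abs_mult using S[of i] i B0 D0 by (intro mult_mono) auto
    qed
    also have "(\<Sum>i=1..k. (B + 2 * D) * E) = real k * ((B + 2 * D) * E)" by simp
    also have "\<dots> \<le> real N * ((B + 2 * D) * E)"
      using less.prems B0 D0 E0 by (intro mult_right_mono) auto
    finally have "\<bar>snd (snd (?s k)) - g ?w\<bar> \<le> (1 - l) * (real N * ((B + 2 * D) * E))"
      using l by (simp add: mult_left_mono)
    also have "\<dots> = D / 2 + 2 * ((1 - l) * N * E) * D" unfolding D_def by (simp add: field_simps)
    also have "\<dots> \<le> D / 2 + (1/2) * D"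
      by (intro add_left_mono mult_right_mono) (use small D0 in auto)
    also have "\<dots> = D" by simp
    finally show ?thesis using uv unfolding D_def by blast
  qed
qed

end

text \<open>A half-turn as seen by the pole: the ends are exchanged, the sign changes, and the
  vertex behind, with value \<open>l * (x + y) - w\<close>, becomes the vertex ahead.\<close>

fun rev_triple :: "real \<Rightarrow> real \<times> real \<times> real \<Rightarrow> real \<times> real \<times> real" where
  "rev_triple l (x, y, w) = (- y, - x, w - l * (x + y))"

lemma next_rev_triple: "next_triple l (\<not> b) (rev_triple l (next_triple l b X)) = rev_triple l X"
  by (cases X) (auto simp: algebra_simps)

lemma lin_comb_proj: "fst (lin_comb r X s Y) = r * fst X + s * fst Y"
  "fst (snd (lin_comb r X s Y)) = r * fst (snd X) + s * fst (snd Y)"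
  "snd (snd (lin_comb r X s Y)) = r * snd (snd X) + s * snd (snd Y)"
  by (cases X; cases Y; simp)+

context chain begin

lemma sol_lin: "sol l (lin_comb r X s Y) k = lin_comb r (sol l X k) s (sol l Y k)"
  unfolding sol_def by (rule triples_lin)

lemma affine_ht: "affine_fun (\<lambda>a. real_of_int (ht a))"
  unfolding affine_fun_def ht_def by (simp add: algebra_simps)

lemma affine_el: "affine_fun (\<lambda>a. real_of_int (el k a))"
  unfolding affine_fun_def by (simp add: el_affine)

lemma n_ge_1: "1 \<le> real_of_int n"
  using n_pos by (metis of_int_1_le_iff int_one_le_iff_zero_less)

lemma eta_n2:
  fixes l :: real
  assumes "l \<le> 1" "(1 - l) * (real_of_int n)^3 \<le> 1/600"
  shows "(1 - l) * (real_of_int n)\<^sup>2 \<le> 1/600"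
proof -
  have "(real_of_int n)\<^sup>2 \<le> (real_of_int n)^3" using n_ge_1 by (intro power_increasing) auto
  then have "(1 - l) * (real_of_int n)\<^sup>2 \<le> (1 - l) * (real_of_int n)^3" using assms by (intro mult_left_mono) auto
  then show ?thesis using assms by linarith
qed

text \<open>\<open>sol_bound\<close> in units of \<open>n\<close>: the steps, the elementary
  functions and the edge sums are all of order \<open>n\<close>, so the error is a constant once the
  cube is controlled.\<close>

lemma sol_near:
  assumes g: "affine_fun g" and l: "l \<le> 1" "(1 - l) * (real_of_int n)^3 \<le> 1/600"
    and N: "real N = e * real_of_int n" "0 \<le> e" "e \<le> 4"
    and B: "\<And>k. k \<le> N \<Longrightarrow> \<bar>g (lu (c0 + int k)) + g (lv (c0 + int k))\<bar> \<le> b * real_of_int n" "0 \<le> b"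
    and k: "k \<le> N"
  defines "D \<equiv> 2 * (e * (e / 2 + 2) * b) / 600"
  shows "\<bar>fst (sol l (tri g c0) k) - g (lu (c0 + int k))\<bar> \<le> D"
    "\<bar>fst (snd (sol l (tri g c0) k)) - g (lv (c0 + int k))\<bar> \<le> D"
    "\<bar>snd (snd (sol l (tri g c0) k)) - g (lw (c0 + int k))\<bar> \<le> D"
proof -
  let ?n = "real_of_int n"
  define E where "E = (e / 2 + 2) * ?n"
  have E: "real N / 2 + 2 \<le> E" unfolding E_def N using n_ge_1 by (simp add: algebra_simps)
  have "(1 - l) * real N * E = (e * (e / 2 + 2)) * ((1 - l) * ?n\<^sup>2)"
    unfolding E_def N by (simp only: power2_eq_square mult_ac)
  also have "\<dots> \<le> (e * (e / 2 + 2)) * (1 / 600)"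
    using eta_n2[OF l] N by (intro mult_left_mono) auto
  also have "\<dots> \<le> (4 * (4 / 2 + 2)) * (1 / 600)" using N by (intro mult_right_mono mult_mono) auto
  finally have small: "4 * ((1 - l) * real N * E) \<le> 1" by simp
  have "2 * ((1 - l) * real N * E) * (b * ?n) = 2 * (e * (e / 2 + 2) * b) * ((1 - l) * ?n ^ 3)"
    unfolding E_def N by (simp only: power3_eq_cube mult_ac)
  also have "\<dots> \<le> 2 * (e * (e / 2 + 2) * b) * (1 / 600)"
    using l N B(2) by (intro mult_left_mono) auto
  finally have D: "2 * ((1 - l) * real N * E) * (b * ?n) \<le> D" unfolding D_def by simp
  note sb = sol_bound[OF g l(1) B(1) E small k]
  show "\<bar>fst (sol l (tri g c0) k) - g (lu (c0 + int k))\<bar> \<le> D"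
    "\<bar>fst (snd (sol l (tri g c0) k)) - g (lv (c0 + int k))\<bar> \<le> D"
    "\<bar>snd (snd (sol l (tri g c0) k)) - g (lw (c0 + int k))\<bar> \<le> D"
    using sb D by linarith+
qed

lemma tri_el: "tri (\<lambda>a. real_of_int (el c0 a)) c0 = (0, 0, 1)"
  unfolding tri_def by (simp add: el_edge)

text \<open>In the flat case one circuit of \<open>4 * n\<close> steps is the translation by
  \<open>(2 * p, 2 * q)\<close>, which raises \<open>el c0\<close> by \<open>2 * m0 \<ge> 2\<close>.
  The error is at most 288/600, so the first entry cannot return to 0.\<close>

lemma monodromy_not_identity:
  assumes l: "l \<le> 1" "(1 - l) * (real_of_int n)^3 \<le> 1/600"
  shows "sol l (0, 0, 1) (nat (4 * n)) \<noteq> (0, 0, 1)"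
proof -
  let ?N = "nat (4 * n)"
  have N: "real ?N = 4 * real_of_int n" "int ?N = 4 * n" using n_pos by simp_all
  have "\<bar>fst (sol l (tri (\<lambda>a. real_of_int (el c0 a)) c0) ?N) - real_of_int (el c0 (lu (c0 + int ?N)))\<bar>
      \<le> 2 * (4 * (4 / 2 + 2) * 9) / 600"
  proof (rule sol_near[OF affine_el l N(1)])
    fix k assume k: "k \<le> ?N"
    have "real k \<le> real ?N" using k by simp
    then have e: "real k / 2 + 5 / 2 \<le> (9 / 2) * real_of_int n" using n_ge_1 unfolding N(1) by simp
    have "\<bar>real_of_int (el c0 (lu (c0 + int k)))\<bar> \<le> real k / 2 + 5 / 2"
      "\<bar>real_of_int (el c0 (lv (c0 + int k)))\<bar> \<le> real k / 2 + 5 / 2"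
      using el_bound[of c0 "c0 + int k"] by auto
    then show "\<bar>real_of_int (el c0 (lu (c0 + int k))) + real_of_int (el c0 (lv (c0 + int k)))\<bar> \<le> 9 * real_of_int n"
      using e by linarith
  qed auto
  moreover have "el c0 (lu (c0 + int ?N)) = 2 * m0"
    using l_shift(1)[of c0 2] el_translate[of "lu c0" 2] el_edge[of c0] N by (simp add: algebra_simps)
  moreover have "1 \<le> real_of_int m0" using m0(2) by simp
  ultimately have "fst (sol l (0, 0, 1) ?N) \<noteq> 0" unfolding tri_el by auto
  then show ?thesis by auto
qed

text \<open>The pole of the great circle through two midpoints is found by solving a linear equation;
  half-turns about the midpoints make the sequence of poles periodic.\<close>
lemma periodic_solution:
  assumes l: "l \<le> 1" "(1 - l) * (real_of_int n)^3 \<le> 1/600"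
  obtains X where "\<And>k. sol l X (k + nat (2 * n)) = sol l X k"
    "\<And>k. \<bar>fst (sol l X k) - ht (lu (c0 + int k))\<bar> < 1"
    "\<And>k. \<bar>fst (snd (sol l X k)) - ht (lv (c0 + int k))\<bar> < 1"
    "\<And>k. \<bar>snd (snd (sol l X k)) - ht (lw (c0 + int k))\<bar> < 1"
proof -
  let ?N = "nat n" and ?n = "real_of_int n"
  have N: "real ?N = 1 * ?n" "int ?N = n" using n_pos by simp_all
  define H where "H = tri (\<lambda>a. real_of_int (ht a)) c0"
  define F where "F = sol l H"
  define C where "C = sol l (0, 0, 1)"
  have elb: "\<bar>real_of_int (el c0 a)\<bar> \<le> 3 * ?n" if "k \<le> ?N" "a \<in> {lu (c0 + int k), lv (c0 + int k), lw (c0 + int k)}" for k a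
  proof -
    have "real k \<le> real ?N" using that(1) by simp
    then have "real k / 2 + 5 / 2 \<le> 3 * ?n" using n_ge_1 unfolding N(1) by simp
    moreover have "\<bar>real_of_int (el c0 a)\<bar> \<le> real k / 2 + 5 / 2"
      using el_bound[of c0 "c0 + int k" a] that by simp
    ultimately show ?thesis by (rule order_trans[rotated])
  qed
  have F: "\<bar>fst (F k) - ht (lu (c0 + int k))\<bar> \<le> 1/60" "\<bar>fst (snd (F k)) - ht (lv (c0 + int k))\<bar> \<le> 1/60"
    "\<bar>snd (snd (F k)) - ht (lw (c0 + int k))\<bar> \<le> 1/60" if "k \<le> ?N" for k
  proof -
    have "\<bar>real_of_int (ht (lu (c0 + int k))) + real_of_int (ht (lv (c0 + int k)))\<bar> \<le> 2 * ?n" for k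
    proof -
      have "\<bar>ht (lu (c0 + int k)) + ht (lv (c0 + int k))\<bar> \<le> 2 * n"
        using ht_lu[of "c0 + int k"] ht_lv[of "c0 + int k"] by linarith
      then have "real_of_int \<bar>ht (lu (c0 + int k)) + ht (lv (c0 + int k))\<bar> \<le> real_of_int (2 * n)" unfolding of_int_le_iff .
      then show ?thesis by simp
    qed
    note sn = sol_near[OF affine_ht l N(1) _ _ this _ that]
    show "\<bar>fst (F k) - ht (lu (c0 + int k))\<bar> \<le> 1/60" "\<bar>fst (snd (F k)) - ht (lv (c0 + int k))\<bar> \<le> 1/60"
      "\<bar>snd (snd (F k)) - ht (lw (c0 + int k))\<bar> \<le> 1/60"
      using sn unfolding F_def H_def by simp_all
  qed
  have C: "\<bar>fst (C k) - el c0 (lu (c0 + int k))\<bar> \<le> 1/20" "\<bar>fst (snd (C k)) - el c0 (lv (c0 + int k))\<bar> \<le> 1/20"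
    "\<bar>snd (snd (C k)) - el c0 (lw (c0 + int k))\<bar> \<le> 1/20" if k: "k \<le> ?N" for k
  proof -
    have b: "\<bar>real_of_int (el c0 (lu (c0 + int k))) + real_of_int (el c0 (lv (c0 + int k)))\<bar> \<le> 6 * ?n" if "k \<le> ?N" for k
      using elb[OF that, of "lu (c0 + int k)"] elb[OF that, of "lv (c0 + int k)"] by auto
    note sn = sol_near[OF affine_el l N(1) _ _ b _ k]
    show "\<bar>fst (C k) - el c0 (lu (c0 + int k))\<bar> \<le> 1/20" "\<bar>fst (snd (C k)) - el c0 (lv (c0 + int k))\<bar> \<le> 1/20"
      "\<bar>snd (snd (C k)) - el c0 (lw (c0 + int k))\<bar> \<le> 1/20"
      using sn unfolding C_def tri_el by simp_all
  qed
  have ht0: "ht (lu c0) + ht (lv c0) = 0" using refl_ht[OF centre0, of c0] by simp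
  have ht1: "ht (lu (c0 + n)) + ht (lv (c0 + n)) = 0" using refl_ht[OF centre1, of "c0 + n"] by simp
  have eC: "9/10 * real_of_int m0 \<le> esum (C ?N)"
  proof -
    have "real_of_int (el c0 (lu (c0 + n))) + real_of_int (el c0 (lv (c0 + n))) = real_of_int m0"
      using el_sum by (metis of_int_add)
    moreover have "1 \<le> real_of_int m0" using m0(2) by simp
    moreover have "\<bar>fst (C ?N) - el c0 (lu (c0 + n))\<bar> \<le> 1/20" "\<bar>fst (snd (C ?N)) - el c0 (lv (c0 + n))\<bar> \<le> 1/20"
      using C(1,2)[of ?N] unfolding N(2) by blast+
    ultimately show ?thesis unfolding esum_def by linarith
  qed
  have eF: "\<bar>esum (F ?N)\<bar> \<le> 1/30"
  proof -
    have "real_of_int (ht (lu (c0 + n))) + real_of_int (ht (lv (c0 + n))) = 0" using ht1 by (metis of_int_add of_int_0)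
    moreover have "\<bar>fst (F ?N) - ht (lu (c0 + n))\<bar> \<le> 1/60" "\<bar>fst (snd (F ?N)) - ht (lv (c0 + n))\<bar> \<le> 1/60"
      using F(1,2)[of ?N] unfolding N(2) by blast+
    ultimately show ?thesis unfolding esum_def by linarith
  qed
  have m0r: "?n \<le> 2 * real_of_int m0" "0 < real_of_int m0" using m0 by (metis of_int_le_iff of_int_mult of_int_numeral, simp)
  \<comment> \<open>Adding a multiple of \<open>(0, 0, 1)\<close> does not disturb the edge
    \<open>c0\<close>. Here \<open>\<zeta>\<close> gives the ends of the edge \<open>c0 + n\<close>
    opposite values, which puts the zero at the midpoint. As \<open>esum (C ?N)\<close> is of order
    \<open>n\<close>, \<open>\<zeta>\<close> is of order \<open>1 / n\<close>.\<close>
  define \<zeta> where "\<zeta> = - esum (F ?N) / esum (C ?N)"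
  have eC0: "0 < esum (C ?N)" using eC m0r by linarith
  have "\<bar>\<zeta>\<bar> * (9/10 * real_of_int m0) \<le> \<bar>\<zeta>\<bar> * esum (C ?N)" using eC by (intro mult_left_mono) auto
  also have "\<dots> = \<bar>esum (F ?N)\<bar>" unfolding \<zeta>_def using eC0 by (simp add: abs_divide)
  finally have "\<bar>\<zeta>\<bar> * (9/10 * real_of_int m0) \<le> 1/30" using eF by linarith
  moreover have "\<bar>\<zeta>\<bar> * ?n \<le> \<bar>\<zeta>\<bar> * (2 * real_of_int m0)" using m0r by (intro mult_left_mono) auto
  ultimately have zn: "\<bar>\<zeta>\<bar> * ?n \<le> 2/27" by (simp add: algebra_simps)
  have z1: "\<bar>\<zeta>\<bar> \<le> 2/27" using zn n_ge_1 mult_left_mono[of 1 ?n "\<bar>\<zeta>\<bar>"] by simp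
  define X where "X = lin_comb 1 H \<zeta> (0, 0, 1)"
  have S: "sol l X k = lin_comb 1 (F k) \<zeta> (C k)" for k unfolding X_def sol_lin F_def C_def ..
  \<comment> \<open>\<open>C\<close> grows like \<open>n\<close>, so its contribution after
    multiplication by \<open>\<zeta>\<close> remains bounded and below 1/2.\<close>
  have dev: "\<bar>(1 * f + \<zeta> * d) - h\<bar> < 1" if "\<bar>f - h\<bar> \<le> 1/60" "\<bar>d - e\<bar> \<le> 1/20" "\<bar>e\<bar> \<le> 3 * ?n" for f d h e
  proof -
    have "\<bar>\<zeta> * d\<bar> = \<bar>\<zeta>\<bar> * \<bar>d\<bar>" by (rule abs_mult)
    also have "\<bar>d\<bar> \<le> 3 * ?n + 1/20" using that(2,3) by linarith
    then have "\<bar>\<zeta>\<bar> * \<bar>d\<bar> \<le> \<bar>\<zeta>\<bar> * (3 * ?n + 1/20)" by (rule mult_left_mono) simp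
    also have "\<dots> = 3 * (\<bar>\<zeta>\<bar> * ?n) + \<bar>\<zeta>\<bar> / 20" by (simp add: algebra_simps)
    also have "\<dots> \<le> 1/2" using zn z1 by linarith
    finally show ?thesis using that(1) by linarith
  qed
  have near: "\<bar>fst (sol l X k) - ht (lu (c0 + int k))\<bar> < 1" "\<bar>fst (snd (sol l X k)) - ht (lv (c0 + int k))\<bar> < 1" if "k \<le> ?N" for k
    unfolding S lin_comb_proj
    using dev[OF F(1)[OF that] C(1)[OF that]] dev[OF F(2)[OF that] C(2)[OF that]] elb[OF that] by auto
  have "esum X = 0" unfolding X_def H_def tri_def esum_def using ht0 by (simp flip: of_int_add)
  then obtain x r where X0: "X = (x, - x, r)" unfolding esum_def by (cases X) (auto simp: add_eq_0_iff)
  have "esum (sol l X ?N) = esum (F ?N) + \<zeta> * esum (C ?N)"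
    unfolding S esum_def lin_comb_proj by (simp add: algebra_simps)
  also have "\<dots> = 0" unfolding \<zeta>_def using eC0 by simp
  finally have XN: "rev_triple l (sol l X ?N) = sol l X ?N"
    unfolding esum_def by (cases "sol l X ?N") (simp add: add_eq_0_iff)
  \<comment> \<open>At the edge \<open>c0 + n\<close> the triple is fixed by
    \<open>rev_triple\<close>; \<open>next_rev_triple\<close> carries the symmetry outwards, because
    \<open>turn\<close> is negated by the half-turn.\<close>
  have refl: "sol l X (?N + j) = rev_triple l (sol l X (?N - j))" if "j \<le> ?N" for j
    using that
  proof (induction j)
    case 0
    then show ?case using XN by simp
  next
    case (Suc j)
    then have IH: "sol l X (?N + j) = rev_triple l (sol l X (?N - j))" by simp
    obtain i where i: "?N - j = Suc i" "?N - Suc j = i" using Suc.prems by (metis Suc_diff_Suc Suc_le_lessD)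
    have Ni: "?N = Suc i + j" using i(1) by simp
    have nn: "n = int i + 1 + int j" using N(2) unfolding Ni by simp
    have "int (?N + j) = n + int j" using N(2) by simp
    then have "2 * (c0 + n) - 1 - (c0 + int i) = c0 + int (?N + j)" using nn by simp
    then have t: "turn (c0 + int (?N + j)) = (\<not> turn (c0 + int i))" using refl_l(2)[OF centre1, of "c0 + int i"] by simp
    have "sol l X (?N + Suc j) = next_triple l (turn (c0 + int (?N + j))) (sol l X (?N + j))" by (simp add: sol_Suc)
    also have "\<dots> = next_triple l (\<not> turn (c0 + int i)) (rev_triple l (next_triple l (turn (c0 + int i)) (sol l X i)))"
      unfolding t IH i(1) sol_Suc ..
    also have "\<dots> = rev_triple l (sol l X i)" by (rule next_rev_triple)
    finally show ?case using i(2) by simp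
  qed
  have N2: "?N + ?N = nat (2 * n)" using n_pos by simp
  \<comment> \<open>The initial triple has opposite end values as well and is therefore its own
    reversal; this closes the sequence.\<close>
  have full: "sol l X (nat (2 * n)) = X" using refl[of ?N] X0 unfolding N2 by (simp add: sol_0)
  have tper: "turn (c0 + int (k + nat (2 * n))) = turn (c0 + int k)" for k
    using l_shift(4)[of "c0 + int k" 1] n_pos by (simp add: algebra_simps)
  have per: "sol l X (k + nat (2 * n)) = sol l X k" for k
  proof (induction k)
    case 0
    then show ?case using full by (simp add: sol_0)
  next
    case (Suc k)
    then show ?case using tper[of k] by (simp add: sol_Suc)
  qed
  have near2: "\<bar>fst (sol l X k) - ht (lu (c0 + int k))\<bar> < 1 \<and> \<bar>fst (snd (sol l X k)) - ht (lv (c0 + int k))\<bar> < 1"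
    if "k < nat (2 * n)" for k
  proof (cases "k \<le> ?N")
    case True
    then show ?thesis using near by blast
  next
    case False
    define j where "j = k - ?N"
    have j: "k = ?N + j" "j \<le> ?N" using False that N2 unfolding j_def by auto
    obtain x y w where s: "sol l X (?N - j) = (x, y, w)" by (metis prod_cases3)
    have e: "2 * (c0 + n) - (c0 + int k) = c0 + int (?N - j)" "2 * (c0 + n) - (c0 + int (?N - j)) = c0 + int k"
    proof -
      have "int (?N - j) = n - int j" "int k = n + int j" using j N(2) by (simp_all add: of_nat_diff)
      then show "2 * (c0 + n) - (c0 + int k) = c0 + int (?N - j)" "2 * (c0 + n) - (c0 + int (?N - j)) = c0 + int k"
        by simp_all
    qed
    have "ht (lu (c0 + int k)) = - ht (lv (c0 + int (?N - j)))" "ht (lv (c0 + int k)) = - ht (lu (c0 + int (?N - j)))"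
      using refl_ht[OF centre1, of "c0 + int k", unfolded e(1)]
        refl_ht[OF centre1, of "c0 + int (?N - j)", unfolded e(2)] by linarith+
    moreover have "sol l X k = rev_triple l (x, y, w)" using refl[OF j(2)] j(1) s by simp
    ultimately show ?thesis using near[of "?N - j"] s by (auto simp: abs_minus_commute)
  qed
  have htper: "ht (a + (p * t, q * t)) = ht a" for a t unfolding ht_add by simp
  have near3: "\<bar>fst (sol l X k) - ht (lu (c0 + int k))\<bar> < 1 \<and> \<bar>fst (snd (sol l X k)) - ht (lv (c0 + int k))\<bar> < 1" for k
  proof (induction k rule: less_induct)
    case (less k)
    show ?case
    proof (cases "k < nat (2 * n)")
      case True
      then show ?thesis using near2 by blast
    next
      case False
      define j where "j = k - nat (2 * n)"
      have j: "k = j + nat (2 * n)" "j < k" using False n_pos unfolding j_def by auto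
      have e: "c0 + int k = (c0 + int j) + 2 * n * 1" using j(1) n_pos by simp
      have "ht (lu (c0 + int k)) = ht (lu (c0 + int j))" "ht (lv (c0 + int k)) = ht (lv (c0 + int j))"
        unfolding e l_shift htper by simp_all
      then show ?thesis using less.IH[OF j(2)] per[of j] j(1) by simp
    qed
  qed
  \<comment> \<open>The vertex ahead is an end of the next edge, to which \<open>near3\<close>
    applies.\<close>
  have near_w: "\<bar>snd (snd (sol l X k)) - ht (lw (c0 + int k))\<bar> < 1" for k
  proof -
    obtain x y w where s: "sol l X k = (x, y, w)" by (metis prod_cases3)
    have e: "c0 + int (Suc k) = c0 + int k + 1" by simp
    show ?thesis using near3[of "Suc k"] l_step[of "c0 + int k"] s unfolding e
      by (cases "turn (c0 + int k)") (auto simp: sol_Suc)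
  qed
  show ?thesis using that[OF per] near3 near_w by blast
qed

end

lemma lattice_injective:
  fixes p q x y :: int
  assumes "coprime p q" "p * y = q * x"
  obtains t where "x = p * t" "y = q * t"
proof (cases "p = 0")
  case True
  then have "\<bar>q\<bar> = 1" using assms(1) by simp
  then have q: "q * q = 1" by (metis abs_mult_self_eq mult_1)
  have "x = 0" using True assms(2) q by auto
  then show ?thesis using that[of "q * y"] True q by (simp add: algebra_simps flip: mult.assoc)
next
  case False
  have "p dvd q * x" using assms(2) by (metis dvd_triv_left)
  then have "p dvd x" using assms(1) by (simp add: coprime_dvd_mult_right_iff)
  then obtain t where t: "x = p * t" by blast
  then have "p * y = p * (q * t)" using assms(2) by simp
  then have "y = q * t" using False by simp
  then show ?thesis using that t by blast
qed

context chain begin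

text \<open>Each triangle of the chain has the vertices \<open>R\<close>, \<open>R \<plusminus> (1, 0)\<close> and \<open>R \<plusminus> (0, 1)\<close>, with the upper
  sign at the odd indices.\<close>
definition corner :: "int \<Rightarrow> int \<times> int" where
  "corner k = (if odd k then (if P (k div 2) then lv k else lu k) else lw k)"

definition side :: "int \<Rightarrow> int" where "side k = (if odd k then 1 else - 1)"

lemma corner_vertices:
  "odd k \<Longrightarrow> P (k div 2) \<Longrightarrow> lv k = corner k \<and> lw k = corner k + (side k, 0) \<and> lu k = corner k + (0, side k)"
  "odd k \<Longrightarrow> \<not> P (k div 2) \<Longrightarrow> lu k = corner k \<and> lv k = corner k + (side k, 0) \<and> lw k = corner k + (0, side k)"
  "even k \<Longrightarrow> lw k = corner k \<and> lu k = corner k + (side k, 0) \<and> lv k = corner k + (0, side k)"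
  unfolding corner_def side_def lu_def lv_def lw_def U_Suc by (auto simp: prod_eq_iff)

lemma corner_index: "fst (corner k) + snd (corner k) = k div 2 + (if odd k then 0 else 1)"
  unfolding corner_def lu_def lv_def lw_def by (auto simp: U_def)

lemma corner_ht: "ht (corner k + (side k, 0)) = ht (corner k) - 2 * q * side k"
  "ht (corner k + (0, side k)) = ht (corner k) + 2 * p * side k"
  by (simp_all add: ht_add)

text \<open>Even differences make half of the difference vector a lattice vector, and equal heights
  make that a multiple of \<open>(p, q)\<close>. So the corners differ by a multiple of the
  translation that takes \<open>4 * n\<close> indices.\<close>

lemma corner_same_side:
  assumes s: "side i = side j" and e: "even (fst (corner i) - fst (corner j))" "even (snd (corner i) - snd (corner j))"
    and h: "ht (corner i) = ht (corner j)"
  shows "4 * n dvd i - j"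
proof -
  obtain x where x: "fst (corner i) - fst (corner j) = 2 * x" using e(1) by (rule dvdE)
  obtain y where y: "snd (corner i) - snd (corner j) = 2 * y" using e(2) by (rule dvdE)
  note xy = x y
  have "p * (2 * y) = q * (2 * x)" using h unfolding ht_def xy[symmetric] by (simp add: algebra_simps)
  then have "p * y = q * x" by simp
  then obtain t where t: "x = p * t" "y = q * t" using lattice_injective[OF cop] by blast
  have par: "odd i = odd j" using s unfolding side_def by (simp split: if_splits)
  have "i div 2 - j div 2 = 2 * (x + y)"
    using corner_index[of i] corner_index[of j] xy par by (simp split: if_splits)
  then have "i - j = 4 * (x + y)" using par by (auto elim!: evenE oddE)
  then have "i - j = 4 * n * t" unfolding t by (simp add: algebra_simps)
  then show ?thesis by simp
qed

text \<open>For equal sides the heights differ by a multiple of 4, which is not 0 within a period.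
  For opposite sides, which correspond to a half-turn and hence to a pole of the opposite sign, the
  sum is twice an odd number.\<close>

lemma corner_height_gap:
  assumes e: "even (fst (corner i) - fst (corner j))" "even (snd (corner i) - snd (corner j))"
    and ne: "\<not> 4 * n dvd i - j"
  shows "side i = side j \<Longrightarrow> 2 \<le> \<bar>ht (corner i) - ht (corner j)\<bar>"
    "side i \<noteq> side j \<Longrightarrow> 2 \<le> \<bar>ht (corner i) + ht (corner j)\<bar>"
proof -
  obtain x where x: "fst (corner i) - fst (corner j) = 2 * x" using e(1) by (rule dvdE)
  obtain y where y: "snd (corner i) - snd (corner j) = 2 * y" using e(2) by (rule dvdE)
  have xy: "fst (corner i) = 2 * x + fst (corner j)" "snd (corner i) = 2 * y + snd (corner j)" using x y by auto
  have d: "ht (corner i) - ht (corner j) = 4 * (p * y - q * x)"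
    unfolding ht_def xy by (simp add: algebra_simps)
  show "2 \<le> \<bar>ht (corner i) - ht (corner j)\<bar>" if "side i = side j"
  proof -
    have "ht (corner i) \<noteq> ht (corner j)" using corner_same_side[OF that e] ne by blast
    moreover define m where "m = p * y - q * x"
    ultimately have "ht (corner i) - ht (corner j) = 4 * m" "m \<noteq> 0" using d by auto
    then show ?thesis by linarith
  qed
  have "ht (corner i) + ht (corner j) = 2 * (2 * (p * y - q * x + p * snd (corner j) - q * fst (corner j) + s0) + 1)"
    unfolding ht_def xy by (simp add: algebra_simps)
  then show "2 \<le> \<bar>ht (corner i) + ht (corner j)\<bar>" by presburger
qed

end

text \<open>\<open>(f i + r) div 2\<close> increases exactly when \<open>f\<close> steps to a value
  of the counted parity, so the count telescopes.\<close>

lemma card_increments: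
  fixes f :: "int \<Rightarrow> int"
  assumes f: "\<And>i. f (i + 1) = f i \<or> f (i + 1) = f i + 1"
  shows "finite {i. a \<le> i \<and> i < a + int m \<and> f (i + 1) = f i + 1 \<and> even (f (i + 1) + r)}"
    "int (card {i. a \<le> i \<and> i < a + int m \<and> f (i + 1) = f i + 1 \<and> even (f (i + 1) + r)})
      = (f (a + int m) + r) div 2 - (f a + r) div 2"
proof -
  let ?S = "\<lambda>m. {i. a \<le> i \<and> i < a + int m \<and> f (i + 1) = f i + 1 \<and> even (f (i + 1) + r)}"
  have fin: "finite (?S m)" for m by (rule finite_subset[of _ "{a..a + int m}"]) auto
  then show "finite (?S m)" .
  show "int (card (?S m)) = (f (a + int m) + r) div 2 - (f a + r) div 2"
  proof (induction m)
    case 0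
    have e: "?S 0 = {}" by auto
    show ?case unfolding e by simp
  next
    case (Suc m)
    let ?b = "a + int m"
    have b: "a + int (Suc m) = ?b + 1" by simp
    have S: "?S (Suc m) = (if f (?b + 1) = f ?b + 1 \<and> even (f (?b + 1) + r) then insert ?b (?S m) else ?S m)"
    proof -
      have i: "(a \<le> i \<and> i < a + int (Suc m) \<and> Q) = (i = ?b \<and> Q \<or> (a \<le> i \<and> i < ?b \<and> Q))" for i Q by auto
      show ?thesis unfolding i by auto
    qed
    have "?b \<notin> ?S m" by simp
    then have "int (card (?S (Suc m))) = int (card (?S m)) + (if f (?b + 1) = f ?b + 1 \<and> even (f (?b + 1) + r) then 1 else 0)"
    proof -
      have c: "int (card (if B then insert x A else A)) = int (card A) + (if B then 1 else 0)"
        if "x \<notin> A" "finite A" for B and x :: int and A using that by simp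
      assume "?b \<notin> ?S m"
      then show ?thesis unfolding S using fin by (rule c)
    qed
    moreover have "(f (?b + 1) + r) div 2 = (f ?b + r) div 2 + (if f (?b + 1) = f ?b + 1 \<and> even (f (?b + 1) + r) then 1 else 0)"
      using f[of ?b] by (elim disjE) (simp_all, presburger)
    ultimately show ?case unfolding b using Suc by simp
  qed
qed

locale tetra_chain = tetra V c + chain p q s0 c0 for V c p q s0 c0 +
  fixes va vb vc vd :: point
  assumes quad_abcd: "quad va vb vc vd"
    and small_deficit: "(1 - lam) * (real_of_int (p + q)) ^ 3 \<le> 1/600"
begin

text \<open>The flat tetrahedron unrolls onto the triangular lattice, and lattice points congruent
  modulo 2 represent the same vertex.\<close>

definition cl :: "int \<times> int \<Rightarrow> point" where
  "cl a = (if even (fst a) then (if even (snd a) then va else vb) else (if even (snd a) then vc else vd))"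

lemma cl_eq: "cl a = cl b \<longleftrightarrow> even (fst a - fst b) \<and> even (snd a - snd b)"
  unfolding cl_def using quad_neq[OF quad_abcd] by auto

lemma cl_cases: "cl a \<in> {va, vb, vc, vd}" unfolding cl_def by auto

lemma quad_cl:
  assumes "cl a \<noteq> cl b" "cl a \<noteq> cl d" "cl a \<noteq> cl e" "cl b \<noteq> cl d" "cl b \<noteq> cl e" "cl d \<noteq> cl e"
  shows "quad (cl a) (cl b) (cl d) (cl e)"
proof -
  have V: "V = {va, vb, vc, vd}" using quad_abcd unfolding quad_def by blast
  have sub: "{cl a, cl b, cl d, cl e} \<subseteq> V" using cl_cases V by auto
  have "card {cl a, cl b, cl d, cl e} = card V" using assms card_V by simp
  then have "{cl a, cl b, cl d, cl e} = V" using card_subset_eq[OF finite_V sub] by blast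
  then show ?thesis unfolding quad_def using assms by auto
qed

lemma periodic_poles:
  "\<exists>X. (\<forall>k. sol lam X (k + nat (2 * n)) = sol lam X k) \<and>
    (\<forall>k. \<bar>fst (sol lam X k) - ht (lu (c0 + int k))\<bar> < 1) \<and>
    (\<forall>k. \<bar>fst (snd (sol lam X k)) - ht (lv (c0 + int k))\<bar> < 1) \<and>
    (\<forall>k. \<bar>snd (snd (sol lam X k)) - ht (lw (c0 + int k))\<bar> < 1)"
  by (rule periodic_solution[of lam]) (use lam_less small_deficit in \<open>auto intro: less_imp_le\<close>)

definition X0 where "X0 = (SOME X. (\<forall>k. sol lam X (k + nat (2 * n)) = sol lam X k) \<and>
    (\<forall>k. \<bar>fst (sol lam X k) - ht (lu (c0 + int k))\<bar> < 1) \<and>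
    (\<forall>k. \<bar>fst (snd (sol lam X k)) - ht (lv (c0 + int k))\<bar> < 1) \<and>
    (\<forall>k. \<bar>snd (snd (sol lam X k)) - ht (lw (c0 + int k))\<bar> < 1))"

lemma X0: "sol lam X0 (k + nat (2 * n)) = sol lam X0 k"
  "\<bar>fst (sol lam X0 k) - ht (lu (c0 + int k))\<bar> < 1"
  "\<bar>fst (snd (sol lam X0 k)) - ht (lv (c0 + int k))\<bar> < 1"
  "\<bar>snd (snd (sol lam X0 k)) - ht (lw (c0 + int k))\<bar> < 1"
  using someI_ex[OF periodic_poles, folded X0_def] by auto

text \<open>The poles repeat after \<open>2 * n\<close> indices. The labels of the vertices need
  \<open>4 * n\<close>, since the translation by \<open>(p, q)\<close> changes the class modulo
  2.\<close>

definition Xi :: "int \<Rightarrow> real \<times> real \<times> real" where "Xi i = sol lam X0 (nat (i mod (2 * n)))"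

definition ui where "ui i = cl (lu (c0 + i))"
definition vi where "vi i = cl (lv (c0 + i))"
definition wi where "wi i = cl (lw (c0 + i))"
definition zi where "zi i = cl (lu (c0 + i) + lv (c0 + i) - lw (c0 + i))"

lemma Xi_step: "Xi (i + 1) = next_triple lam (turn (c0 + i)) (Xi i)"
proof -
  define k where "k = nat (i mod (2 * n))"
  have n2: "0 < 2 * n" using n_pos by simp
  have k: "int k = i mod (2 * n)" "k < nat (2 * n)" unfolding k_def using n2 by (simp_all add: zless_nat_conj)
  have "c0 + i = (c0 + int k) + 2 * n * (i div (2 * n))" unfolding k(1) by simp
  then have t: "turn (c0 + i) = turn (c0 + int k)" using l_shift(4) by metis
  have m: "(i + 1) mod (2 * n) = (int k + 1) mod (2 * n)" unfolding k(1) by (simp add: mod_add_left_eq)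
  have "Xi (i + 1) = sol lam X0 (Suc k)"
  proof (cases "Suc k = nat (2 * n)")
    case True
    then have "int k + 1 = 2 * n" using n2 by simp
    then have "nat ((i + 1) mod (2 * n)) = 0" unfolding m by simp
    then show ?thesis unfolding Xi_def True using X0(1)[of 0] by simp
  next
    case False
    then have "int k + 1 < 2 * n" using k(2) by linarith
    then have "nat ((i + 1) mod (2 * n)) = Suc k" unfolding m by simp
    then show ?thesis unfolding Xi_def by simp
  qed
  then show ?thesis unfolding sol_Suc t Xi_def k_def[symmetric] by simp
qed

lemma Xi_near: "\<bar>fst (Xi i) - ht (lu (c0 + i))\<bar> < 1" "\<bar>fst (snd (Xi i)) - ht (lv (c0 + i))\<bar> < 1"
  "\<bar>snd (snd (Xi i)) - ht (lw (c0 + i))\<bar> < 1"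
proof -
  define k where "k = nat (i mod (2 * n))"
  have k: "int k = i mod (2 * n)" unfolding k_def using n_pos by simp
  have e: "c0 + i = (c0 + int k) + 2 * n * (i div (2 * n))" unfolding k(1) by simp
  have htper: "ht (a + (p * t, q * t)) = ht a" for a t unfolding ht_add by simp
  have "ht (lu (c0 + i)) = ht (lu (c0 + int k))" "ht (lv (c0 + i)) = ht (lv (c0 + int k))" "ht (lw (c0 + i)) = ht (lw (c0 + int k))"
    unfolding e l_shift htper by auto
  then show "\<bar>fst (Xi i) - ht (lu (c0 + i))\<bar> < 1" "\<bar>fst (snd (Xi i)) - ht (lv (c0 + i))\<bar> < 1"
    "\<bar>snd (snd (Xi i)) - ht (lw (c0 + i))\<bar> < 1"
    using X0(2-4)[of k] unfolding Xi_def k_def[symmetric] by simp_all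
qed

text \<open>The triple \<open>Xi i\<close> in the order corner, horizontal neighbour, vertical neighbour.\<close>
definition cv :: "int \<Rightarrow> real \<times> real \<times> real" where
  "cv i = (let (x, y, w) = Xi i; k = c0 + i in
     if odd k then (if P (k div 2) then (y, w, x) else (x, y, w)) else (w, x, y))"

lemma cv_near:
  "\<bar>fst (cv i) - ht (corner (c0 + i))\<bar> < 1"
  "\<bar>fst (snd (cv i)) - (ht (corner (c0 + i)) - 2 * q * side (c0 + i))\<bar> < 1"
  "\<bar>snd (snd (cv i)) - (ht (corner (c0 + i)) + 2 * p * side (c0 + i))\<bar> < 1"
proof -
  let ?k = "c0 + i"
  obtain x y w where X: "Xi i = (x, y, w)" by (metis prod_cases3)
  note N = Xi_near[of i, unfolded X fst_conv snd_conv]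
  have "\<bar>fst (cv i) - ht (corner ?k)\<bar> < 1 \<and> \<bar>fst (snd (cv i)) - ht (corner ?k + (side ?k, 0))\<bar> < 1
     \<and> \<bar>snd (snd (cv i)) - ht (corner ?k + (0, side ?k))\<bar> < 1"
    using N corner_vertices[of ?k] unfolding cv_def X Let_def by (cases "odd ?k"; cases "P (?k div 2)") auto
  then show "\<bar>fst (cv i) - ht (corner ?k)\<bar> < 1"
    "\<bar>fst (snd (cv i)) - (ht (corner ?k) - 2 * q * side ?k)\<bar> < 1"
    "\<bar>snd (snd (cv i)) - (ht (corner ?k) + 2 * p * side ?k)\<bar> < 1"
    unfolding corner_ht by auto
qed

lemma cl_side: "cl (a + (side k, 0)) = cl (a + (1, 0))" "cl (a + (0, side k)) = cl (a + (0, 1))"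
  unfolding cl_eq side_def by auto

lemma cv_sum:
  "coord x (ui i) * fst (Xi i) + coord x (vi i) * fst (snd (Xi i)) + coord x (wi i) * snd (snd (Xi i)) =
   coord x (cl (corner (c0 + i))) * fst (cv i) + coord x (cl (corner (c0 + i) + (1, 0))) * fst (snd (cv i))
     + coord x (cl (corner (c0 + i) + (0, 1))) * snd (snd (cv i))"
proof -
  let ?k = "c0 + i"
  obtain a b d where X: "Xi i = (a, b, d)" by (metis prod_cases3)
  show ?thesis
    using corner_vertices[of ?k] unfolding ui_def vi_def wi_def cv_def X Let_def cl_side[symmetric, of _ ?k]
    by (cases "odd ?k"; cases "P (?k div 2)") (auto simp: algebra_simps)
qed

lemma zi_corner: "zi i = cl (corner (c0 + i) + (1, 1))"
  unfolding zi_def cl_eq using corner_vertices[of "c0 + i"]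
  by (cases "odd (c0 + i)"; cases "P ((c0 + i) div 2)") (auto simp: side_def)

lemma quad_i: "quad (ui i) (vi i) (wi i) (zi i)"
  unfolding ui_def vi_def wi_def zi_def
  by (rule quad_cl; unfold cl_eq; use corner_vertices[of "c0 + i"] in
      \<open>cases "odd (c0 + i)"; cases "P ((c0 + i) div 2)"; auto simp: side_def\<close>)

end

lemma pos_sum_zero:
  fixes R X Y :: real
  assumes "0 \<le> R" "0 \<le> X" "0 \<le> Y" "0 < a" "0 < b" "0 < d" "R * a + X * b + Y * d = 0"
  shows "R = 0 \<and> X = 0 \<and> Y = 0"
proof -
  have "0 \<le> R * a" "0 \<le> X * b" "0 \<le> Y * d" using assms by simp_all
  then have "R * a = 0" "X * b = 0" "Y * d = 0" using assms(7) by linarith+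
  then show ?thesis using assms by auto
qed

context tetra_chain begin

lemma quad_corner:
  "quad (cl (corner k)) (cl (corner k + (1, 0))) (cl (corner k + (0, 1))) (cl (corner k + (1, 1)))"
  by (rule quad_cl; unfold cl_eq; auto)

text \<open>Two arcs in one face are compared in the common order of the vertices given by the
  corner. Heights at least 2 apart and errors below 1 make the difference of the functionals, or
  their sum, of one strict sign at all three vertices, so they have no common zero in the
  face.\<close>

lemma arcs_disjoint:
  assumes ij: "0 \<le> i" "i < 4 * n" "0 \<le> j" "j < 4 * n" "i \<noteq> j" and z: "zi i = zi j"
    and x: "norm x = 1" "\<forall>y\<in>V. 0 \<le> coord x y" "coord x (zi i) = 0"
    and Fi: "coord x (ui i) * fst (Xi i) + coord x (vi i) * fst (snd (Xi i)) + coord x (wi i) * snd (snd (Xi i)) = 0"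
  shows "coord x (ui j) * fst (Xi j) + coord x (vi j) * fst (snd (Xi j)) + coord x (wi j) * snd (snd (Xi j)) \<noteq> 0"
proof
  assume Fj: "coord x (ui j) * fst (Xi j) + coord x (vi j) * fst (snd (Xi j)) + coord x (wi j) * snd (snd (Xi j)) = 0"
  let ?ci = "corner (c0 + i)" and ?cj = "corner (c0 + j)"
  have e: "even (fst ?ci - fst ?cj)" "even (snd ?ci - snd ?cj)" using z unfolding zi_corner cl_eq by auto
  have nd: "\<not> 4 * n dvd (c0 + i) - (c0 + j)"
  proof
    assume "4 * n dvd (c0 + i) - (c0 + j)"
    then have "4 * n dvd i - j" by simp
    moreover have "\<bar>i - j\<bar> < 4 * n" using ij by auto
    ultimately have "i - j = 0" using n_pos by (meson dvd_imp_le_int not_less abs_of_pos zdvd_not_zless zero_less_abs_iff dvd_abs_iff)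
    then show False using ij by simp
  qed
  define R X Y where "R = coord x (cl ?ci)" and "X = coord x (cl (?ci + (1, 0)))" and "Y = coord x (cl (?ci + (0, 1)))"
  have cls: "cl ?cj = cl ?ci" "cl (?cj + (1, 0)) = cl (?ci + (1, 0))" "cl (?cj + (0, 1)) = cl (?ci + (0, 1))"
    using e unfolding cl_eq by auto
  note q = quad_corner[of "c0 + i"]
  have nn: "0 \<le> R" "0 \<le> X" "0 \<le> Y" using x(2) quad_in[OF q] unfolding R_def X_def Y_def by auto
  have nz: "\<not> (R = 0 \<and> X = 0 \<and> Y = 0)"
  proof
    assume "R = 0 \<and> X = 0 \<and> Y = 0"
    then have "x = 0" using quad_expand[OF q, of x] x(3) unfolding R_def X_def Y_def zi_corner by simp
    then show False using x(1) by simp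
  qed
  have i0: "R * fst (cv i) + X * fst (snd (cv i)) + Y * snd (snd (cv i)) = 0"
    using Fi unfolding cv_sum R_def X_def Y_def .
  have j0: "R * fst (cv j) + X * fst (snd (cv j)) + Y * snd (snd (cv j)) = 0"
    using Fj unfolding cv_sum cls R_def X_def Y_def .
  note ni = cv_near[of i] and nj = cv_near[of j]
  show False
  proof (cases "side (c0 + i) = side (c0 + j)")
    case True
    have g: "2 \<le> \<bar>real_of_int (ht ?ci) - real_of_int (ht ?cj)\<bar>"
      using corner_height_gap(1)[OF e nd True] by (metis of_int_abs of_int_diff of_int_le_iff of_int_numeral)
    have s: "R * (fst (cv i) - fst (cv j)) + X * (fst (snd (cv i)) - fst (snd (cv j))) + Y * (snd (snd (cv i)) - snd (snd (cv j))) = 0"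
      using i0 j0 by (simp add: algebra_simps)
    show False
    proof (cases "real_of_int (ht ?cj) < real_of_int (ht ?ci)")
      case True
      have "0 < fst (cv i) - fst (cv j)" "0 < fst (snd (cv i)) - fst (snd (cv j))" "0 < snd (snd (cv i)) - snd (snd (cv j))"
        using ni nj g True \<open>side (c0 + i) = side (c0 + j)\<close> by (simp_all add: abs_less_iff)
      then show False using pos_sum_zero[OF nn _ _ _ s] nz by blast
    next
      case False
      have "0 < fst (cv j) - fst (cv i)" "0 < fst (snd (cv j)) - fst (snd (cv i))" "0 < snd (snd (cv j)) - snd (snd (cv i))"
        using ni nj g False \<open>side (c0 + i) = side (c0 + j)\<close> by (simp_all add: abs_less_iff)
      moreover have "R * (fst (cv j) - fst (cv i)) + X * (fst (snd (cv j)) - fst (snd (cv i))) + Y * (snd (snd (cv j)) - snd (snd (cv i))) = 0"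
        using s by (simp add: algebra_simps)
      ultimately show False using pos_sum_zero[OF nn] nz by blast
    qed
  next
    case False
    \<comment> \<open>With opposite sides the offsets of the neighbours' heights have opposite
      signs, so adding the two functionals cancels them.\<close>
    then have sd: "side (c0 + j) = - side (c0 + i)" unfolding side_def by (auto split: if_splits)
    have g: "2 \<le> \<bar>real_of_int (ht ?ci) + real_of_int (ht ?cj)\<bar>"
      using corner_height_gap(2)[OF e nd False] by (metis of_int_abs of_int_add of_int_le_iff of_int_numeral)
    have s: "R * (fst (cv i) + fst (cv j)) + X * (fst (snd (cv i)) + fst (snd (cv j))) + Y * (snd (snd (cv i)) + snd (snd (cv j))) = 0"
      using i0 j0 by (simp add: algebra_simps)
    show False
    proof (cases "0 < real_of_int (ht ?ci) + real_of_int (ht ?cj)")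
      case True
      have "0 < fst (cv i) + fst (cv j)" "0 < fst (snd (cv i)) + fst (snd (cv j))" "0 < snd (snd (cv i)) + snd (snd (cv j))"
        using ni nj g True unfolding sd by (simp_all add: abs_less_iff)
      then show False using pos_sum_zero[OF nn _ _ _ s] nz by blast
    next
      case False
      have "0 < - fst (cv i) - fst (cv j)" "0 < - fst (snd (cv i)) - fst (snd (cv j))" "0 < - snd (snd (cv i)) - snd (snd (cv j))"
        using ni nj g False unfolding sd by (simp_all add: abs_less_iff)
      moreover have "R * (- fst (cv i) - fst (cv j)) + X * (- fst (snd (cv i)) - fst (snd (cv j))) + Y * (- snd (snd (cv i)) - snd (snd (cv j))) = 0"
        using s by (simp add: algebra_simps)
      ultimately show False using pos_sum_zero[OF nn] nz by blast
    qed
  qed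
qed

lemma state_step:
  "turn (c0 + i) \<Longrightarrow> ui (i + 1) = wi i \<and> vi (i + 1) = vi i \<and> wi (i + 1) = zi i \<and> zi (i + 1) = ui i"
  "\<not> turn (c0 + i) \<Longrightarrow> ui (i + 1) = ui i \<and> vi (i + 1) = wi i \<and> wi (i + 1) = zi i \<and> zi (i + 1) = vi i"
proof -
  have e: "c0 + (i + 1) = (c0 + i) + 1" by simp
  \<comment> \<open>Signs are irrelevant modulo 2: opposite points across an edge of the lattice
    carry the label of one vertex.\<close>
  have c: "cl (a + b - d) = cl (d + b - a)" for a b d
    unfolding cl_eq by simp
  show "ui (i + 1) = wi i \<and> vi (i + 1) = vi i \<and> wi (i + 1) = zi i \<and> zi (i + 1) = ui i" if "turn (c0 + i)"
    using l_step(1)[OF that] c[of "lw (c0 + i)" "lv (c0 + i)" "lu (c0 + i)"]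
    unfolding ui_def vi_def wi_def zi_def e by simp
  have c': "cl (a + b - d) = cl (a + d - b)" for a b d
    unfolding cl_eq by simp
  show "ui (i + 1) = ui i \<and> vi (i + 1) = wi i \<and> wi (i + 1) = zi i \<and> zi (i + 1) = vi i" if "\<not> turn (c0 + i)"
    using l_step(2)[OF that] c'[of "lu (c0 + i)" "lw (c0 + i)" "lv (c0 + i)"]
    unfolding ui_def vi_def wi_def zi_def e by simp
qed

lemma state_per: "ui (i + 4 * n) = ui i" "vi (i + 4 * n) = vi i" "wi (i + 4 * n) = wi i" "zi (i + 4 * n) = zi i"
proof -
  have e: "c0 + (i + 4 * n) = (c0 + i) + 2 * n * 2" by simp
  show "ui (i + 4 * n) = ui i" "vi (i + 4 * n) = vi i" "wi (i + 4 * n) = wi i" "zi (i + 4 * n) = zi i"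
    unfolding ui_def vi_def wi_def zi_def e l_shift cl_eq by simp_all
qed

lemma Xi_per: "Xi (i + 4 * n) = Xi i"
proof -
  have "i + 4 * n = i + 2 * (2 * n)" by simp
  then have "(i + 4 * n) mod (2 * n) = i mod (2 * n)" by (metis mod_mult_self1)
  then show ?thesis unfolding Xi_def by simp
qed

sublocale geo: pole_cycle V c ui vi wi zi "\<lambda>i. fst (Xi i)" "\<lambda>i. fst (snd (Xi i))" "\<lambda>i. snd (snd (Xi i))"
  "\<lambda>i. turn (c0 + i)" "nat (4 * n)"
proof
  have N: "int (nat (4 * n)) = 4 * n" using n_pos by simp
  show "0 < nat (4 * n)" using n_pos by simp
  fix i
  show "quad (ui i) (vi i) (wi i) (zi i)" by (rule quad_i)
  obtain x y w where X: "Xi i = (x, y, w)" by (metis prod_cases3)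
  show "ui (i + 1) = wi i \<and> vi (i + 1) = vi i \<and> wi (i + 1) = zi i \<and> zi (i + 1) = ui i \<and>
       fst (Xi (i + 1)) = snd (snd (Xi i)) \<and> fst (snd (Xi (i + 1))) = fst (snd (Xi i)) \<and>
       snd (snd (Xi (i + 1))) = lam * (snd (snd (Xi i)) + fst (snd (Xi i))) - fst (Xi i)" if "turn (c0 + i)"
    using state_step(1)[OF that] that unfolding Xi_step X by simp
  show "ui (i + 1) = ui i \<and> vi (i + 1) = wi i \<and> wi (i + 1) = zi i \<and> zi (i + 1) = vi i \<and>
       fst (Xi (i + 1)) = fst (Xi i) \<and> fst (snd (Xi (i + 1))) = snd (snd (Xi i)) \<and>
       snd (snd (Xi (i + 1))) = lam * (fst (Xi i) + snd (snd (Xi i))) - fst (snd (Xi i))" if "\<not> turn (c0 + i)"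
    using state_step(2)[OF that] that unfolding Xi_step X by simp
  \<comment> \<open>Positive integer heights are at least 1, which exceeds the error.\<close>
  have "1 \<le> real_of_int (ht (lu (c0 + i)))" using ht_lu(1)[of "c0 + i"] by simp
  then show "0 < fst (Xi i)" using Xi_near(1)[of i] by linarith
  have "ht (lv (c0 + i)) \<le> - 1" using ht_lv(1)[of "c0 + i"] by simp
  then have "real_of_int (ht (lv (c0 + i))) \<le> real_of_int (- 1)" unfolding of_int_le_iff .
  then show "fst (snd (Xi i)) < 0" using Xi_near(2)[of i] by simp
  show "ui (i + int (nat (4 * n))) = ui i \<and> vi (i + int (nat (4 * n))) = vi i \<and> wi (i + int (nat (4 * n))) = wi i \<and>
    zi (i + int (nat (4 * n))) = zi i \<and> fst (Xi (i + int (nat (4 * n)))) = fst (Xi i) \<and>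
    fst (snd (Xi (i + int (nat (4 * n))))) = fst (snd (Xi i))"
    unfolding N state_per Xi_per by simp
next
  fix i j x
  have N: "int (nat (4 * n)) = 4 * n" using n_pos by simp
  assume "0 \<le> i" "i < int (nat (4 * n))" "0 \<le> j" "j < int (nat (4 * n))" "i \<noteq> j" "zi i = zi j"
    "norm x = 1" "\<forall>y\<in>V. 0 \<le> coord x y" "coord x (zi i) = 0"
    "coord x (ui i) * fst (Xi i) + coord x (vi i) * fst (snd (Xi i)) + coord x (wi i) * snd (snd (Xi i)) = 0"
  then show "coord x (ui j) * fst (Xi j) + coord x (vi j) * fst (snd (Xi j)) + coord x (wi j) * snd (snd (Xi j)) \<noteq> 0"
    unfolding N by (rule arcs_disjoint)
qed

section \<open>Counting the crossings with each edge\<close>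

lemma edge_even: "even (c0 + i) \<Longrightarrow> geo.edge i = (if even ((c0 + i) div 2) then {va, vd} else {vb, vc})"
  unfolding geo.edge_def ui_def vi_def lu_def lv_def cl_def U_def by auto

lemma edge_odd_P: "odd (c0 + i) \<Longrightarrow> P ((c0 + i) div 2) \<Longrightarrow>
    geo.edge i = (if even (xx ((c0 + i) div 2 + 1)) then {va, vb} else {vc, vd})"
  unfolding geo.edge_def ui_def vi_def lu_def lv_def cl_def U_def xx_Suc by auto

lemma edge_odd_Q: "odd (c0 + i) \<Longrightarrow> \<not> P ((c0 + i) div 2) \<Longrightarrow>
    geo.edge i = (if even ((c0 + i) div 2 + 1 - xx ((c0 + i) div 2 + 1)) then {vb, vd} else {va, vc})"
  unfolding geo.edge_def ui_def vi_def lu_def lv_def cl_def U_def xx_Suc by auto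

lemma pairs_distinct:
  "{va, vd} \<noteq> {vb, vc}" "{va, vd} \<noteq> {va, vb}" "{va, vd} \<noteq> {vc, vd}" "{va, vd} \<noteq> {vb, vd}" "{va, vd} \<noteq> {va, vc}"
  "{vb, vc} \<noteq> {va, vb}" "{vb, vc} \<noteq> {vc, vd}" "{vb, vc} \<noteq> {vb, vd}" "{vb, vc} \<noteq> {va, vc}"
  "{va, vb} \<noteq> {vc, vd}" "{va, vb} \<noteq> {vb, vd}" "{va, vb} \<noteq> {va, vc}"
  "{vc, vd} \<noteq> {vb, vd}" "{vc, vd} \<noteq> {va, vc}" "{vb, vd} \<noteq> {va, vc}"
  using quad_neq[OF quad_abcd] by (auto simp: doubleton_eq_iff)

lemma even_index_set:
  "{i. 0 \<le> i \<and> i < 4 * n \<and> even (c0 + i) \<and> R ((c0 + i) div 2)} = (\<lambda>j. 2 * j - c0) ` {j. c0 \<le> j \<and> j < c0 + 2 * n \<and> R j}"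
proof (intro equalityI subsetI)
  fix i assume "i \<in> {i. 0 \<le> i \<and> i < 4 * n \<and> even (c0 + i) \<and> R ((c0 + i) div 2)}"
  then have i: "0 \<le> i" "i < 4 * n" "even (c0 + i)" "R ((c0 + i) div 2)" by auto
  define j where "j = (c0 + i) div 2"
  have "c0 + i = 2 * j" using i(3) unfolding j_def by simp
  then have "i = 2 * j - c0" "c0 \<le> j" "j < c0 + 2 * n" using i c0 by auto
  then show "i \<in> (\<lambda>j. 2 * j - c0) ` {j. c0 \<le> j \<and> j < c0 + 2 * n \<and> R j}" using i(4) unfolding j_def by blast
next
  fix i assume "i \<in> (\<lambda>j. 2 * j - c0) ` {j. c0 \<le> j \<and> j < c0 + 2 * n \<and> R j}"
  then obtain j where j: "i = 2 * j - c0" "c0 \<le> j" "j < c0 + 2 * n" "R j" by blast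
  then have i: "0 \<le> i" "i < 4 * n" and e: "c0 + i = 2 * j" using c0 by auto
  have d: "even (c0 + i)" "(c0 + i) div 2 = j" unfolding e by simp_all
  show "i \<in> {i. 0 \<le> i \<and> i < 4 * n \<and> even (c0 + i) \<and> R ((c0 + i) div 2)}"
    by (simp only: mem_Collect_eq d i j(4) simp_thms)
qed

lemma odd_index_set:
  "{i. 0 \<le> i \<and> i < 4 * n \<and> odd (c0 + i) \<and> R ((c0 + i) div 2)} = (\<lambda>j. 2 * j + 1 - c0) ` {j. 0 \<le> j \<and> j < 2 * n \<and> R j}"
proof (intro equalityI subsetI)
  fix i assume "i \<in> {i. 0 \<le> i \<and> i < 4 * n \<and> odd (c0 + i) \<and> R ((c0 + i) div 2)}"
  then have i: "0 \<le> i" "i < 4 * n" "odd (c0 + i)" "R ((c0 + i) div 2)" by auto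
  define j where "j = (c0 + i) div 2"
  have "c0 + i = 2 * j + 1" using i(3) unfolding j_def by simp
  then have "i = 2 * j + 1 - c0" "0 \<le> j" "j < 2 * n" using i c0 by auto
  then show "i \<in> (\<lambda>j. 2 * j + 1 - c0) ` {j. 0 \<le> j \<and> j < 2 * n \<and> R j}" using i(4) unfolding j_def by blast
next
  fix i assume "i \<in> (\<lambda>j. 2 * j + 1 - c0) ` {j. 0 \<le> j \<and> j < 2 * n \<and> R j}"
  then obtain j where j: "i = 2 * j + 1 - c0" "0 \<le> j" "j < 2 * n" "R j" by blast
  then have i: "0 \<le> i" "i < 4 * n" and e: "c0 + i = 2 * j + 1" using c0 by auto
  have d: "odd (c0 + i)" "(c0 + i) div 2 = j" unfolding e by simp_all
  show "i \<in> {i. 0 \<le> i \<and> i < 4 * n \<and> odd (c0 + i) \<and> R ((c0 + i) div 2)}"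
    by (simp only: mem_Collect_eq d i j(4) simp_thms)
qed

text \<open>A circuit has \<open>2 * n\<close> crossings of antidiagonal edges, which alternate
  between two opposite edges of the tetrahedron.\<close>

lemma count_S:
  "card {i. 0 \<le> i \<and> i < 4 * n \<and> even (c0 + i) \<and> even ((c0 + i) div 2 + r)} = nat n"
proof -
  have "card {i. 0 \<le> i \<and> i < 4 * n \<and> even (c0 + i) \<and> even ((c0 + i) div 2 + r)}
    = card {j. c0 \<le> j \<and> j < c0 + 2 * n \<and> even (j + r)}"
    unfolding even_index_set[of "\<lambda>j. even (j + r)"] by (rule card_image) (auto intro: inj_onI)
  also have "{j. c0 \<le> j \<and> j < c0 + 2 * n \<and> even (j + r)}
    = {j. c0 \<le> j \<and> j < c0 + int (nat (2 * n)) \<and> j + 1 = j + 1 \<and> even (j + 1 + (r + 1))}"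
    using n_pos by auto
  also have "int (card \<dots>) = (c0 + int (nat (2 * n)) + (r + 1)) div 2 - (c0 + (r + 1)) div 2"
    by (rule card_increments(2)[of "\<lambda>i. i"]) simp
  also have "\<dots> = n"
  proof -
    have "c0 + int (nat (2 * n)) + (r + 1) = (c0 + (r + 1)) + 2 * n" using n_pos by simp
    moreover have "(x + 2 * n) div 2 = x div 2 + n" for x by simp
    ultimately show ?thesis by simp
  qed
  finally show ?thesis using n_pos by simp
qed

text \<open>The vertical edges are crossed where \<open>xx\<close> increases. Over a circuit it
  gains \<open>2 * p\<close>, and the parity of the new value selects one of two opposite
  edges.\<close>

lemma count_P:
  "card {i. 0 \<le> i \<and> i < 4 * n \<and> odd (c0 + i) \<and> P ((c0 + i) div 2) \<and> even (xx ((c0 + i) div 2 + 1) + r)} = nat p"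
proof -
  have "card {i. 0 \<le> i \<and> i < 4 * n \<and> odd (c0 + i) \<and> P ((c0 + i) div 2) \<and> even (xx ((c0 + i) div 2 + 1) + r)}
    = card {j. 0 \<le> j \<and> j < 2 * n \<and> P j \<and> even (xx (j + 1) + r)}"
    unfolding odd_index_set[of "\<lambda>j. P j \<and> even (xx (j + 1) + r)"] by (rule card_image) (auto intro: inj_onI)
  also have "{j. 0 \<le> j \<and> j < 2 * n \<and> P j \<and> even (xx (j + 1) + r)}
    = {j. 0 \<le> j \<and> j < 0 + int (nat (2 * n)) \<and> xx (j + 1) = xx j + 1 \<and> even (xx (j + 1) + r)}"
    using n_pos by (auto simp: xx_Suc)
  also have "int (card \<dots>) = (xx (0 + int (nat (2 * n))) + r) div 2 - (xx 0 + r) div 2"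
    by (rule card_increments(2)[of xx]) (simp add: xx_Suc)
  also have "\<dots> = p"
  proof -
    have "xx (0 + int (nat (2 * n))) + r = (xx 0 + r) + 2 * p" using n_pos xx_shift[of 0 2] by (simp add: algebra_simps)
    moreover have "(x + 2 * p) div 2 = x div 2 + p" for x by simp
    ultimately show ?thesis by simp
  qed
  finally show ?thesis using p0 by simp
qed

lemma count_Q:
  "card {i. 0 \<le> i \<and> i < 4 * n \<and> odd (c0 + i) \<and> \<not> P ((c0 + i) div 2) \<and>
     even ((c0 + i) div 2 + 1 - xx ((c0 + i) div 2 + 1) + r)} = nat q"
proof -
  let ?f = "\<lambda>j. j - xx j"
  have "card {i. 0 \<le> i \<and> i < 4 * n \<and> odd (c0 + i) \<and> \<not> P ((c0 + i) div 2) \<and> even ((c0 + i) div 2 + 1 - xx ((c0 + i) div 2 + 1) + r)}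
    = card {j. 0 \<le> j \<and> j < 2 * n \<and> \<not> P j \<and> even (j + 1 - xx (j + 1) + r)}"
    unfolding odd_index_set[of "\<lambda>j. \<not> P j \<and> even (j + 1 - xx (j + 1) + r)"] by (rule card_image) (auto intro: inj_onI)
  also have "{j. 0 \<le> j \<and> j < 2 * n \<and> \<not> P j \<and> even (j + 1 - xx (j + 1) + r)}
    = {j. 0 \<le> j \<and> j < 0 + int (nat (2 * n)) \<and> ?f (j + 1) = ?f j + 1 \<and> even (?f (j + 1) + r)}"
    using n_pos by (auto simp: xx_Suc)
  also have "int (card \<dots>) = (?f (0 + int (nat (2 * n))) + r) div 2 - (?f 0 + r) div 2"
    by (rule card_increments(2)[of ?f]) (simp add: xx_Suc)
  also have "\<dots> = q"
  proof -
    have "?f (0 + int (nat (2 * n))) + r = (?f 0 + r) + 2 * q" using n_pos xx_shift[of 0 2] by (simp add: algebra_simps)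
    moreover have "(x + 2 * q) div 2 = x div 2 + q" for x by simp
    ultimately show ?thesis by simp
  qed
  finally show ?thesis using p0 pq by simp
qed

lemma edge_sets:
  "{i. 0 \<le> i \<and> i < 4 * n \<and> geo.edge i = {va, vd}} = {i. 0 \<le> i \<and> i < 4 * n \<and> even (c0 + i) \<and> even ((c0 + i) div 2 + 0)}"
  "{i. 0 \<le> i \<and> i < 4 * n \<and> geo.edge i = {vb, vc}} = {i. 0 \<le> i \<and> i < 4 * n \<and> even (c0 + i) \<and> even ((c0 + i) div 2 + 1)}"
  "{i. 0 \<le> i \<and> i < 4 * n \<and> geo.edge i = {va, vb}} = {i. 0 \<le> i \<and> i < 4 * n \<and> odd (c0 + i) \<and> P ((c0 + i) div 2) \<and> even (xx ((c0 + i) div 2 + 1) + 0)}"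
  "{i. 0 \<le> i \<and> i < 4 * n \<and> geo.edge i = {vc, vd}} = {i. 0 \<le> i \<and> i < 4 * n \<and> odd (c0 + i) \<and> P ((c0 + i) div 2) \<and> even (xx ((c0 + i) div 2 + 1) + 1)}"
  "{i. 0 \<le> i \<and> i < 4 * n \<and> geo.edge i = {vb, vd}} = {i. 0 \<le> i \<and> i < 4 * n \<and> odd (c0 + i) \<and> \<not> P ((c0 + i) div 2) \<and> even ((c0 + i) div 2 + 1 - xx ((c0 + i) div 2 + 1) + 0)}"
  "{i. 0 \<le> i \<and> i < 4 * n \<and> geo.edge i = {va, vc}} = {i. 0 \<le> i \<and> i < 4 * n \<and> odd (c0 + i) \<and> \<not> P ((c0 + i) div 2) \<and> even ((c0 + i) div 2 + 1 - xx ((c0 + i) div 2 + 1) + 1)}"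
proof -
  have *: "{i. 0 \<le> i \<and> i < 4 * n \<and> A i} = {i. 0 \<le> i \<and> i < 4 * n \<and> B i}" if "\<And>i. A i = B i" for A B :: "int \<Rightarrow> bool"
    using that by simp
  have I: "((if a then x else y) = z) = (if a then x = z else y = z)" for a and x y z :: "point set" by simp
  note d = pairs_distinct pairs_distinct[symmetric]
  have E: "geo.edge i = (if even (c0 + i) then (if even ((c0 + i) div 2) then {va, vd} else {vb, vc})
    else if P ((c0 + i) div 2) then (if even (xx ((c0 + i) div 2 + 1)) then {va, vb} else {vc, vd})
    else (if even ((c0 + i) div 2 + 1 - xx ((c0 + i) div 2 + 1)) then {vb, vd} else {va, vc}))" for i
    using edge_even edge_odd_P edge_odd_Q by simp
  show "{i. 0 \<le> i \<and> i < 4 * n \<and> geo.edge i = {va, vd}} = {i. 0 \<le> i \<and> i < 4 * n \<and> even (c0 + i) \<and> even ((c0 + i) div 2 + 0)}"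
    by (rule *, simp only: E I d refl, auto)
  show "{i. 0 \<le> i \<and> i < 4 * n \<and> geo.edge i = {vb, vc}} = {i. 0 \<le> i \<and> i < 4 * n \<and> even (c0 + i) \<and> even ((c0 + i) div 2 + 1)}"
    by (rule *, simp only: E I d refl, auto)
  show "{i. 0 \<le> i \<and> i < 4 * n \<and> geo.edge i = {va, vb}} = {i. 0 \<le> i \<and> i < 4 * n \<and> odd (c0 + i) \<and> P ((c0 + i) div 2) \<and> even (xx ((c0 + i) div 2 + 1) + 0)}"
    by (rule *, simp only: E I d refl, auto)
  show "{i. 0 \<le> i \<and> i < 4 * n \<and> geo.edge i = {vc, vd}} = {i. 0 \<le> i \<and> i < 4 * n \<and> odd (c0 + i) \<and> P ((c0 + i) div 2) \<and> even (xx ((c0 + i) div 2 + 1) + 1)}"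
    by (rule *, simp only: E I d refl, auto)
  show "{i. 0 \<le> i \<and> i < 4 * n \<and> geo.edge i = {vb, vd}} = {i. 0 \<le> i \<and> i < 4 * n \<and> odd (c0 + i) \<and> \<not> P ((c0 + i) div 2) \<and> even ((c0 + i) div 2 + 1 - xx ((c0 + i) div 2 + 1) + 0)}"
    by (rule *, simp only: E I d refl, auto)
  show "{i. 0 \<le> i \<and> i < 4 * n \<and> geo.edge i = {va, vc}} = {i. 0 \<le> i \<and> i < 4 * n \<and> odd (c0 + i) \<and> \<not> P ((c0 + i) div 2) \<and> even ((c0 + i) div 2 + 1 - xx ((c0 + i) div 2 + 1) + 1)}"
    by (rule *, simp only: E I d refl, auto)
qed

lemma curve_meets:
  "meets_edge geo.curve va vb (nat p)" "meets_edge geo.curve vc vd (nat p)"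
  "meets_edge geo.curve va vc (nat q)" "meets_edge geo.curve vb vd (nat q)"
  "meets_edge geo.curve va vd (nat n)" "meets_edge geo.curve vb vc (nat n)"
proof -
  have N: "int (nat (4 * n)) = 4 * n" using n_pos by simp
  have q: "quad va vb vc vd" "quad vc vd va vb" "quad va vc vb vd" "quad vb vd va vc" "quad va vd vb vc" "quad vb vc va vd"
    using quad_abcd unfolding quad_def by auto
  show "meets_edge geo.curve va vb (nat p)"
    unfolding meets_edge_def using geo.card_curve_edge[OF q(1)] count_P unfolding N edge_sets by (simp only: simp_thms)
  show "meets_edge geo.curve vc vd (nat p)"
    unfolding meets_edge_def using geo.card_curve_edge[OF q(2)] count_P unfolding N edge_sets by (simp only: simp_thms)
  show "meets_edge geo.curve va vc (nat q)"
    unfolding meets_edge_def using geo.card_curve_edge[OF q(3)] count_Q unfolding N edge_sets by (simp only: simp_thms)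
  show "meets_edge geo.curve vb vd (nat q)"
    unfolding meets_edge_def using geo.card_curve_edge[OF q(4)] count_Q unfolding N edge_sets by (simp only: simp_thms)
  show "meets_edge geo.curve va vd (nat n)"
    unfolding meets_edge_def using geo.card_curve_edge[OF q(5)] count_S unfolding N edge_sets by (simp only: simp_thms)
  show "meets_edge geo.curve vb vc (nat n)"
    unfolding meets_edge_def using geo.card_curve_edge[OF q(6)] count_S unfolding N edge_sets by (simp only: simp_thms)
qed

end

section \<open>The bound on the face angle\<close>

lemma cos_pi_12: "96/100 \<le> cos (pi / 12)" "cos (pi / 12) \<le> 1"
proof -
  have "cos (2 * (pi / 12)) = sqrt 3 / 2" using cos_30 by simp
  then have "2 * (cos (pi / 12))\<^sup>2 - 1 = sqrt 3 / 2" unfolding cos_double_cos .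
  moreover have "(17/10 :: real) \<le> sqrt 3" by (rule real_le_rsqrt) (simp add: power2_eq_square)
  ultimately have "(96/100)\<^sup>2 \<le> (cos (pi / 12))\<^sup>2" by (simp add: power2_eq_square)
  moreover have "0 \<le> cos (pi / 12)" by (rule cos_ge_zero) (use pi_gt_zero in linarith)+
  ultimately show "96/100 \<le> cos (pi / 12)" by (rule power2_le_imp_le)
qed simp

text \<open>The bounds are the squares of the tangents at \<open>pi / 4\<close> and
  \<open>pi / 3\<close>; \<open>j < n\<close> keeps the angle below \<open>pi / 2\<close>.\<close>

lemma tan_sq_ge:
  fixes j n :: nat
  assumes "j < n"
  shows "n \<le> 2 * j \<Longrightarrow> 1 \<le> (tan (pi * real j / (2 * real n)))\<^sup>2"
    "2 * n \<le> 3 * j \<Longrightarrow> 3 \<le> (tan (pi * real j / (2 * real n)))\<^sup>2"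
proof -
  let ?x = "pi * real j / (2 * real n)"
  have n: "0 < real n" using assms by simp
  have lt: "?x < pi / 2" using assms n pi_gt_zero by (simp add: field_simps)
  show "1 \<le> (tan ?x)\<^sup>2" if "n \<le> 2 * j"
  proof -
    have "real n \<le> 2 * real j" using that by linarith
    then have "pi * real n \<le> pi * (2 * real j)" by (rule mult_left_mono) simp
    then have "pi / 4 \<le> ?x" using n by (simp add: field_simps)
    then have "tan (pi / 4) \<le> tan ?x" using lt pi_gt_zero by (subst tan_mono_le_eq) auto
    then have "1 \<le> tan ?x" by (simp add: tan_45)
    then show ?thesis by simp
  qed
  show "3 \<le> (tan ?x)\<^sup>2" if "2 * n \<le> 3 * j"
  proof -
    have "2 * real n \<le> 3 * real j" using that by linarith
    then have "pi * (2 * real n) \<le> pi * (3 * real j)" by (rule mult_left_mono) simp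
    then have "pi / 3 \<le> ?x" using n by (simp add: field_simps)
    then have "tan (pi / 3) \<le> tan ?x" using lt pi_gt_zero by (subst tan_mono_le_eq) auto
    then have "sqrt 3 \<le> tan ?x" by (simp add: tan_60)
    then have "(sqrt 3)\<^sup>2 \<le> (tan ?x)\<^sup>2" by (rule power_mono) simp
    then show ?thesis by simp
  qed
qed

text \<open>92 is 32 times 3 times 96/100, rounded down, from \<open>pi > 3\<close> and the lower
  bound for the cosine.\<close>

lemma c_alpha_ge:
  "4 \<le> c_alpha p q j" "92 * (real (p + q))\<^sup>2 * (tan (pi * real j / (2 * real (p + q))))\<^sup>2 \<le> c_alpha p q j"
proof -
  let ?c = "cos (pi / 12)" and ?A = "(real (p + q))\<^sup>2 * (tan (pi * real j / (2 * real (p + q))))\<^sup>2"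
  have A: "0 \<le> ?A" "0 \<le> 32 * (pi * ?c) * ?A" using cos_pi_12(1) by simp_all
  have e: "c_alpha p q j = 32 * (pi * ?c) * ?A + 4" unfolding c_alpha_def by (simp add: algebra_simps)
  have "3 * (96/100) \<le> pi * ?c" using pi_gt3 cos_pi_12(1) by (intro mult_mono) auto
  then have "92 \<le> 32 * (pi * ?c)" by simp
  then have "92 * ?A \<le> 32 * (pi * ?c) * ?A" using A(1) by (rule mult_right_mono)
  then show "92 * (real (p + q))\<^sup>2 * (tan (pi * real j / (2 * real (p + q))))\<^sup>2 \<le> c_alpha p q j" "4 \<le> c_alpha p q j"
    unfolding e using A(2) by (simp_all only: mult.assoc[symmetric])
qed

lemma c_l_nonneg: "0 \<le> c_l p q i"
  unfolding c_l_def using cos_pi_12(1) by (intro divide_nonneg_nonneg mult_nonneg_nonneg add_nonneg_nonneg) auto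

text \<open>The numerator is twice the denominator plus 1, so bounds for the denominator alone
  control the quotient.\<close>

lemma c_0_eq:
  defines "D \<equiv> \<lambda>p q. 1 - real (p + q + 2) / (2 * pi * cos (pi / 12) * (real (p + q))\<^sup>2) - 8 * tan_sum p q"
  assumes "D p q \<noteq> 0" shows "c_0 p q = 2 + 1 / D p q"
proof -
  have "3 - real (p + q + 2) / (pi * cos (pi / 12) * (real (p + q))\<^sup>2) - 16 * tan_sum p q = 2 * D p q + 1"
    unfolding D_def by (simp add: field_split_simps)
  then have "c_0 p q = (2 * D p q + 1) / D p q" unfolding c_0_def D_def by simp
  then show ?thesis using assms(2) by (simp add: field_simps)
qed

lemma eps_bound_1: "\<epsilon> < eps_bound 0 1 \<Longrightarrow> \<epsilon> < 95/100000"
proof -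
  assume e: "\<epsilon> < eps_bound 0 1"
  \<comment> \<open>The angles are 0, \<open>pi / 2\<close> and \<open>pi\<close>; at
    \<open>pi / 2\<close> the tangent has the value 0 by convention. Likewise
    \<open>c_l 0 1 0\<close> has denominator 0, so only the other two terms are estimated from below
    by positive numbers.\<close>
  have T: "tan_sum 0 1 = 0" unfolding tan_sum_def by (simp add: numeral_2_eq_2 tan_def)
  let ?c = "cos (pi / 12)" and ?D = "1 - real (0 + 1 + 2) / (2 * pi * cos (pi / 12) * (real (0 + 1))\<^sup>2) - 8 * tan_sum 0 1"
  have pc: "3 * (96/100) \<le> pi * ?c" using pi_gt3 cos_pi_12(1) by (intro mult_mono) auto
  then have D: "0 < ?D" "?D \<le> 1" unfolding T by (simp_all add: field_simps)
  then have "1 \<le> 1 / ?D" by (simp add: field_simps)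
  moreover have "c_0 0 1 = 2 + 1 / ?D" using c_0_eq[of 0 1] D(1) by simp
  ultimately have c0: "3 \<le> c_0 0 1" by linarith
  have pp: "9 \<le> pi\<^sup>2" using pi_gt3 power_mono[of 3 pi 2] by simp
  let ?S = "\<Sum>i=0..(0 + 1) div 2 + 2. c_l 0 1 i + (\<Sum>j=0..i. c_alpha 0 1 j)"
  have "(96/100) * 85 \<le> ?c * (4 + pi\<^sup>2 * 9)" using cos_pi_12(1) pp by (intro mult_mono) auto
  then have l1: "81 \<le> c_l 0 1 1" unfolding c_l_def by (simp add: power2_eq_square)
  have "(96/100) * 229 \<le> ?c * (4 + pi\<^sup>2 * 25)" using cos_pi_12(1) pp by (intro mult_mono) auto
  then have l2: "54 \<le> c_l 0 1 2" unfolding c_l_def by (simp add: power2_eq_square)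
  have S: "159 \<le> ?S"
    using l1 l2 c_l_nonneg[of 0 1 0] c_alpha_ge(1)[of 0 1 0] c_alpha_ge(1)[of 0 1 1] c_alpha_ge(1)[of 0 1 2]
    by (simp add: numeral_2_eq_2)
  have "\<epsilon> < sqrt 3 / (4 * c_0 0 1 * sqrt ((real 0)\<^sup>2 + (real 1)\<^sup>2 + real 0 * real 1) * ?S)"
    using e unfolding eps_bound_def by simp
  also have "\<dots> = sqrt 3 / (4 * (c_0 0 1 * ?S))" by simp
  also have "\<dots> \<le> (18/10) / (4 * (3 * 159))"
  proof (intro frac_le)
    show "sqrt 3 \<le> 18/10" by (rule real_le_lsqrt) (simp_all add: power2_eq_square)
    show "4 * (3 * 159) \<le> 4 * (c_0 0 1 * ?S)" using c0 S by (intro mult_left_mono mult_mono) auto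
  qed auto
  finally show ?thesis by simp
qed

text \<open>The last two indices supply the bound. \<open>c_alpha p q (K - 1)\<close> occurs in the
  inner sums for \<open>K - 1\<close> and for \<open>K\<close>, hence the weight 2 in
  \<open>t\<close> and the constant \<open>276 = 92 * 3\<close>. The denominator of
  \<open>c_0\<close> is at most -15, which gives 29/15. In the final quotient the factors
  \<open>sqrt 3\<close> cancel.\<close>

lemma eps_bound_3:
  assumes n: "3 \<le> p + q" and e: "\<epsilon> < eps_bound p q"
  shows "\<epsilon> * (real (p + q)) ^ 3 < 95/100000"
proof -
  define n where "n = p + q"
  have n3: "3 \<le> n" and np: "0 < real n" using n unfolding n_def by auto
  define K where "K = n div 2 + 2"
  define t where "t j = (tan (pi * real j / (2 * real n)))\<^sup>2" for j
  have t0: "0 \<le> t j" for j unfolding t_def by simp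
  have K: "K = Suc (K - 1)" "{K - 1, K} \<subseteq> {0..K}" "K - 1 \<noteq> K" unfolding K_def by auto
  have t: "3 \<le> 2 * t (K - 1) + t K" "2 \<le> t (K - 1) + t K"
  proof -
    have "3 \<le> 2 * t (K - 1) + t K \<and> 2 \<le> t (K - 1) + t K"
    proof (cases "5 \<le> n")
      case True
      then have "1 \<le> t (K - 1)" "1 \<le> t K" unfolding t_def K_def by (intro tan_sq_ge(1); simp; linarith)+
      then show ?thesis by simp
    next
      \<comment> \<open>For \<open>n = 3\<close> and \<open>n = 4\<close> the angle at the index
        \<open>K\<close> is \<open>pi / 2\<close>, where the tangent is 0 by convention; the index
        \<open>K - 1\<close> compensates, its angle being at least \<open>pi / 3\<close>.\<close>
      case False
      then have "n = 3 \<or> n = 4" using n3 by auto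
      then have "K - 1 < n" "2 * n \<le> 3 * (K - 1)" unfolding K_def by auto
      then have "3 \<le> t (K - 1)" unfolding t_def by (rule tan_sq_ge(2))
      then show ?thesis using t0[of K] by simp
    qed
    then show "3 \<le> 2 * t (K - 1) + t K" "2 \<le> t (K - 1) + t K" by auto
  qed
  have "sum t {K - 1, K} \<le> sum t {0..K}" using K t0 by (intro sum_mono2) auto
  then have T: "2 \<le> tan_sum p q" using t(2) K(3) unfolding tan_sum_def t_def K_def n_def by simp
  let ?D = "1 - real (p + q + 2) / (2 * pi * cos (pi / 12) * (real (p + q))\<^sup>2) - 8 * tan_sum p q"
  have "0 \<le> real (p + q + 2) / (2 * pi * cos (pi / 12) * (real (p + q))\<^sup>2)"
    using cos_pi_12(1) by (intro divide_nonneg_nonneg mult_nonneg_nonneg) auto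
  then have D: "?D \<le> - 15" using T by simp
  then have "- 1 / 15 \<le> 1 / ?D" by (simp add: field_simps)
  moreover have "c_0 p q = 2 + 1 / ?D" by (rule c_0_eq) (use D in simp)
  ultimately have c0: "29/15 \<le> c_0 p q" by linarith
  have a: "92 * (real n)\<^sup>2 * t j \<le> c_alpha p q j" "0 \<le> c_alpha p q j" for j
    using c_alpha_ge(2)[of p q j] c_alpha_ge(1)[of p q j] unfolding t_def n_def by auto
  define s where "s i = c_l p q i + (\<Sum>j=0..i. c_alpha p q j)" for i
  have s0: "0 \<le> s i" for i unfolding s_def using c_l_nonneg a(2) by (intro add_nonneg_nonneg sum_nonneg) auto
  have "sum (c_alpha p q) {K - 1} \<le> sum (c_alpha p q) {0..K - 1}" using a(2) by (intro sum_mono2) auto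
  then have s1: "92 * (real n)\<^sup>2 * t (K - 1) \<le> s (K - 1)" using a(1)[of "K - 1"] c_l_nonneg[of p q "K - 1"] unfolding s_def by simp
  have "sum (c_alpha p q) {K - 1, K} \<le> sum (c_alpha p q) {0..K}" using K a(2) by (intro sum_mono2) auto
  then have s2: "92 * (real n)\<^sup>2 * t (K - 1) + 92 * (real n)\<^sup>2 * t K \<le> s K"
    using a(1)[of "K - 1"] a(1)[of K] c_l_nonneg[of p q K] K(3) unfolding s_def by simp
  have "sum s {K - 1, K} \<le> sum s {0..K}" using K s0 by (intro sum_mono2) auto
  then have "92 * (real n)\<^sup>2 * (2 * t (K - 1) + t K) \<le> sum s {0..K}" using s1 s2 K(3) by (simp add: algebra_simps)
  moreover have "92 * (real n)\<^sup>2 * 3 \<le> 92 * (real n)\<^sup>2 * (2 * t (K - 1) + t K)" using t(1) by (intro mult_left_mono) auto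
  ultimately have S: "276 * (real n)\<^sup>2 \<le> sum s {0..K}" by simp
  let ?r = "sqrt ((real p)\<^sup>2 + (real q)\<^sup>2 + real p * real q)"
  have r: "sqrt 3 / 2 * real n \<le> ?r"
  proof (rule real_le_rsqrt)
    have "(sqrt 3 / 2 * real n)\<^sup>2 = 3/4 * (real p + real q)\<^sup>2" unfolding n_def power_mult_distrib by (simp add: power_divide)
    moreover have "0 \<le> (real p - real q)\<^sup>2" by simp
    ultimately show "(sqrt 3 / 2 * real n)\<^sup>2 \<le> (real p)\<^sup>2 + (real q)\<^sup>2 + real p * real q" by (simp add: power2_eq_square algebra_simps)
  qed
  have "4 * (29/15) * (sqrt 3 / 2 * real n) * (276 * (real n)\<^sup>2) \<le> 4 * c_0 p q * ?r * sum s {0..K}"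
    using c0 r S np by (intro mult_mono mult_left_mono mult_nonneg_nonneg) auto
  moreover have "\<epsilon> < sqrt 3 / (4 * c_0 p q * ?r * sum s {0..K})"
    using e unfolding eps_bound_def s_def K_def n_def by simp
  moreover have "sqrt 3 / (4 * c_0 p q * ?r * sum s {0..K}) \<le> sqrt 3 / (4 * (29/15) * (sqrt 3 / 2 * real n) * (276 * (real n)\<^sup>2))"
    using calculation(1) np by (intro frac_le) auto
  ultimately have "\<epsilon> < sqrt 3 / (4 * (29/15) * (sqrt 3 / 2 * real n) * (276 * (real n)\<^sup>2))" by linarith
  also have "\<dots> = 15 / 16008 / (real n) ^ 3" using np by (simp add: power2_eq_square power3_eq_cube)
  finally have "\<epsilon> * (real n) ^ 3 < 15 / 16008" using np by (simp add: field_simps)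
  then show ?thesis unfolding n_def by simp
qed

text \<open>To first order \<open>1 - 2 * cos (pi / 3 + \<epsilon>)\<close> is
  \<open>sqrt 3 * \<epsilon>\<close>. The factor 1733/1000 absorbs the quadratic term, and its
  product with 95/100000 is just below 1/600.\<close>

lemma small_angle:
  assumes cop: "coprime p q" and pq: "p < q" and e0: "0 < \<epsilon>" and e: "\<epsilon> < eps_bound p q"
  shows "\<epsilon> < 1/1000" "(1 - 2 * cos (pi / 3 + \<epsilon>)) * (real (p + q)) ^ 3 \<le> 1/600"
proof -
  have en: "\<epsilon> * (real (p + q)) ^ 3 < 95/100000"
  proof (cases "3 \<le> p + q")
    case True
    then show ?thesis by (rule eps_bound_3[OF _ e])
  next
    case False
    then have "p + q = 1 \<or> p + q = 2" using pq by auto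
    then have "p = 0" using pq by auto
    then have "q = 1" using cop by simp
    then show ?thesis using eps_bound_1 e \<open>p = 0\<close> by simp
  qed
  have p1: "1 \<le> (real (p + q)) ^ 3" using pq by (intro one_le_power) simp
  have "\<epsilon> * 1 \<le> \<epsilon> * (real (p + q)) ^ 3" using p1 e0 by (intro mult_left_mono) auto
  then show small: "\<epsilon> < 1/1000" using en by linarith
  have "cos \<epsilon> = 1 - 2 * (sin (\<epsilon> / 2))\<^sup>2" using cos_double_sin[of "\<epsilon> / 2"] by simp
  then have "1 - 2 * cos (pi / 3 + \<epsilon>) = 2 * (sin (\<epsilon> / 2))\<^sup>2 + sqrt 3 * sin \<epsilon>"
    unfolding cos_add cos_60 sin_60 by (simp add: field_simps)
  also have "\<dots> \<le> 2 * (\<epsilon> / 2)\<^sup>2 + sqrt 3 * \<epsilon>"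
  proof (intro add_mono mult_left_mono power_mono)
    show "0 \<le> sin (\<epsilon> / 2)" by (rule sin_ge_zero) (use e0 small pi_gt3 in auto)
  qed (use e0 sin_x_le_x[of \<epsilon>] sin_x_le_x[of "\<epsilon> / 2"] in auto)
  also have "\<dots> = (\<epsilon> / 2 + sqrt 3) * \<epsilon>" by (simp add: power2_eq_square algebra_simps)
  also have "\<dots> \<le> 1733/1000 * \<epsilon>"
  proof (rule mult_right_mono)
    have "sqrt 3 \<le> 17325/10000" by (rule real_le_lsqrt) (simp_all add: power2_eq_square)
    then show "\<epsilon> / 2 + sqrt 3 \<le> 1733/1000" using small by simp
  qed (use e0 in simp)
  finally have "1 - 2 * cos (pi / 3 + \<epsilon>) \<le> 1733/1000 * \<epsilon>" .
  then have "(1 - 2 * cos (pi / 3 + \<epsilon>)) * (real (p + q)) ^ 3 \<le> 1733/1000 * \<epsilon> * (real (p + q)) ^ 3"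
    by (rule mult_right_mono) simp
  also have "\<dots> \<le> 1/600" using en by (simp add: mult.assoc)
  finally show "(1 - 2 * cos (pi / 3 + \<epsilon>)) * (real (p + q)) ^ 3 \<le> 1/600" .
qed

section \<open>Existence and uniqueness\<close>

text \<open>Faces share edges, so all edges have one length. In an equilateral spherical triangle
  the law of cosines reads \<open>cos \<alpha> = c / (1 + c)\<close>, whence
  \<open>lam = 2 * cos \<alpha>\<close>, and an acute angle forces \<open>0 < c\<close>.\<close>

lemma regular_tetra:
  assumes R: "regular_sph_tetrahedron V \<alpha>" and \<alpha>: "0 < cos \<alpha>"
  obtains c where "tetra V c" "2 * c / (1 + c) = 2 * cos \<alpha>"
proof -
  have V: "V \<subseteq> sphere 0 1" "card V = 4" "independent V" and F: "\<And>v. v \<in> V \<Longrightarrow> regular_sph_triangle (V - {v}) \<alpha>"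
    using R unfolding regular_sph_tetrahedron_def by auto
  have n: "norm v = 1" if "v \<in> V" for v using V(1) that by auto
  have "card V = Suc (Suc (Suc (Suc 0)))" using V(2) by simp
  then obtain x y z w where W: "V = {x, y, z, w}" and d: "distinct [x, y, z, w]"
    by (auto simp: card_Suc_eq)
  have side: "\<exists>l. \<forall>a\<in>V - {v}. \<forall>b\<in>V - {v}. a \<noteq> b \<longrightarrow> sph_dist a b = l" if "v \<in> V" for v
    using F[OF that] unfolding regular_sph_triangle_def by blast
  have mem: "x \<in> V" "y \<in> V" "z \<in> V" "w \<in> V" unfolding W by auto
  obtain l where l: "\<forall>a\<in>V - {w}. \<forall>b\<in>V - {w}. a \<noteq> b \<longrightarrow> sph_dist a b = l" using side[OF mem(4)] by blast
  obtain l2 where l2: "\<forall>a\<in>V - {z}. \<forall>b\<in>V - {z}. a \<noteq> b \<longrightarrow> sph_dist a b = l2" using side[OF mem(3)] by blast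
  obtain l3 where l3: "\<forall>a\<in>V - {x}. \<forall>b\<in>V - {x}. a \<noteq> b \<longrightarrow> sph_dist a b = l3" using side[OF mem(1)] by blast
  have nw: "x \<noteq> y" "x \<noteq> z" "x \<noteq> w" "y \<noteq> z" "y \<noteq> w" "z \<noteq> w" using d by auto
  have e1: "sph_dist x y = l" "sph_dist x z = l" "sph_dist y z = l" using l mem nw by auto
  have e2: "sph_dist x y = l2" "sph_dist x w = l2" "sph_dist y w = l2" using l2 mem nw by auto
  have e3: "sph_dist y z = l3" "sph_dist z w = l3" using l3 mem nw by auto
  have all: "sph_dist a b = l" if "a \<in> V" "b \<in> V" "a \<noteq> b" for a b
  proof -
    have "a = x \<or> a = y \<or> a = z \<or> a = w" "b = x \<or> b = y \<or> b = z \<or> b = w" using that(1,2) unfolding W by auto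
    then show ?thesis using that(3) e1 e2 e3 sph_dist_commute by metis
  qed
  define c where "c = cos l"
  have gram: "a \<bullet> b = c" if "a \<in> V" "b \<in> V" "a \<noteq> b" for a b
    using cos_sph_dist[OF n[OF that(1)] n[OF that(2)]] all[OF that] unfolding c_def by simp
  have c1: "c \<noteq> 1" using unit_inner_eq_1[OF n[OF mem(1)] n[OF mem(2)]] gram[OF mem(1,2) nw(1)] nw(1) by auto
  have c2: "c \<noteq> - 1"
  proof
    assume "c = - 1"
    then have "x \<bullet> - y = 1" "x \<bullet> - z = 1" using gram[OF mem(1,2) nw(1)] gram[OF mem(1,3) nw(2)] by simp_all
    then have "x = - y" "x = - z" using unit_inner_eq_1[of x "- y"] unit_inner_eq_1[of x "- z"] n mem by auto
    then show False using nw(4) by simp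
  qed
  have "-1 \<le> c" "c \<le> 1" unfolding c_def by simp_all
  then have c: "- 1 < c" "c < 1" using c1 c2 by auto
  have angle: "sph_angle x y z = \<alpha>"
    using F[OF mem(4)] mem nw unfolding regular_sph_triangle_def by auto
  have sq: "x \<bullet> x = 1" "y \<bullet> y = 1" "z \<bullet> z = 1" using n mem by (simp_all add: dot_square_norm)
  have ip: "x \<bullet> y = c" "y \<bullet> x = c" "x \<bullet> z = c" "z \<bullet> x = c" "y \<bullet> z = c" using gram mem nw by auto
  let ?a = "y - c *\<^sub>R x" and ?b = "z - c *\<^sub>R x"
  have i: "?a \<bullet> ?a = 1 - c\<^sup>2" "?b \<bullet> ?b = 1 - c\<^sup>2" "?a \<bullet> ?b = c * (1 - c)"
    by (simp_all add: inner_diff_left inner_diff_right sq ip power2_eq_square algebra_simps)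
  have pos: "0 < 1 - c\<^sup>2"
  proof -
    have "0 < (1 - c) * (1 + c)" using c by simp
    then show ?thesis by (simp add: power2_eq_square algebra_simps)
  qed
  have ne: "?a \<noteq> 0" "?b \<noteq> 0" using i pos by auto
  have N: "norm ?a = sqrt (1 - c\<^sup>2)" "norm ?b = sqrt (1 - c\<^sup>2)" unfolding norm_eq_sqrt_inner i by simp_all
  have "cos (sph_angle x y z) = sgn ?a \<bullet> sgn ?b"
    unfolding sph_angle_def sph_dir_def ip by (rule cos_sph_dist) (use ne in \<open>simp_all add: norm_sgn\<close>)
  also have "\<dots> = c * (1 - c) / (1 - c\<^sup>2)"
    unfolding sgn_div_norm N inner_scaleR_left inner_scaleR_right i using pos
    by (simp add: field_simps)
  also have "\<dots> = c / (1 + c)"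
  proof -
    have "1 - c\<^sup>2 = (1 + c) * (1 - c)" by (simp add: power2_eq_square algebra_simps)
    then show ?thesis using c by simp
  qed
  finally have cc: "cos \<alpha> = c / (1 + c)" unfolding angle .
  then have "0 < c" using \<alpha> c(1) by (simp add: zero_less_divide_iff)
  then have "tetra V c" using V n gram c by unfold_locales auto
  then show ?thesis using that cc by simp
qed

lemma great_arc_orthogonal:
  assumes f: "orthogonal_transformation f"
  shows "f (sgn x) = sgn (f x)" "f (great_arc a b t) = great_arc (f a) (f b) t"
proof -
  have lin: "linear f" using f orthogonal_transformation by blast
  show s: "f (sgn x) = sgn (f x)" for x
    unfolding sgn_div_norm linear_scale[OF lin] orthogonal_transformation_norm[OF f] ..
  have i: "f a \<bullet> f b = a \<bullet> b" using f unfolding orthogonal_transformation_def by blast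
  show "f (great_arc a b t) = great_arc (f a) (f b) t"
    unfolding great_arc_def sph_dir_def sph_dist_def i
    by (simp add: linear_add[OF lin] linear_scale[OF lin] linear_diff[OF lin] s)
qed

text \<open>All pairs of distinct vertices have the same inner product, so the linear extension of
  any permutation of the vertices is orthogonal.\<close>

lemma (in tetra) vertex_permutation:
  assumes q: "quad a b d e" and q': "quad a' b' d' e'"
  obtains f where "tetra_motion V f" "f a = a'" "f b = b'" "f d = d'" "f e = e'"
proof -
  define f where "f x = coord x a *\<^sub>R a' + coord x b *\<^sub>R b' + coord x d *\<^sub>R d' + coord x e *\<^sub>R e'" for x
  define g where "g x = coord x a' *\<^sub>R a + coord x b' *\<^sub>R b + coord x d' *\<^sub>R d + coord x e' *\<^sub>R e" for x
  have cf: "coord (f x) a' = coord x a" "coord (f x) b' = coord x b" "coord (f x) d' = coord x d" "coord (f x) e' = coord x e" for x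
    using quad_coord[OF q' f_def] by auto
  have cg: "coord (g x) a = coord x a'" "coord (g x) b = coord x b'" "coord (g x) d = coord x d'" "coord (g x) e = coord x e'" for x
    using quad_coord[OF q g_def] by auto
  have lin: "linear f"
    by (rule linearI) (simp_all add: f_def coord_add coord_scale algebra_simps)
  have ip: "f x \<bullet> f y = x \<bullet> y" for x y
    unfolding inner_coord[OF q', of "f x"] inner_coord[OF q, of x] cf ..
  have orth: "orthogonal_transformation f" unfolding orthogonal_transformation_def using lin ip by blast
  have fg: "f (g x) = x" for x
    by (rule quad_coord_eqI[OF q']) (simp_all add: cf cg)
  have hull: "f x \<in> sph_hull V \<longleftrightarrow> x \<in> sph_hull V" for x
    unfolding sph_hull_V[OF order_refl] quad_ball[OF q, of "\<lambda>v. 0 \<le> coord x v"] quad_ball[OF q', of "\<lambda>v. 0 \<le> coord (f x) v"]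
      cf orthogonal_transformation_norm[OF orth] by simp
  have "f ` sph_hull V = sph_hull V"
  proof (intro equalityI subsetI)
    fix x assume "x \<in> sph_hull V"
    then have "g x \<in> sph_hull V" using hull[of "g x"] fg by simp
    then show "x \<in> f ` sph_hull V" using fg[of x] by (metis imageI)
  qed (use hull in auto)
  then have "tetra_motion V f" unfolding tetra_motion_def using orth by blast
  moreover have "f a = a'" "f b = b'" "f d = d'" "f e = e'"
    unfolding f_def using quad_in[OF q] quad_neq[OF q] by (simp_all add: coord_V)
  ultimately show ?thesis by (rule that)
qed

context tetra_chain begin

text \<open>The type fixes the number of crossings on every edge. Each face has one edge of each of
  the three kinds, and \<open>n = p + q\<close> makes it \<open>ruled\<close>.\<close>

lemma same_type_same_range:
  assumes scg: "simple_closed_geodesic V h"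
    and m: "meets_edge h va vb (nat p)" "meets_edge h vc vd (nat p)" "meets_edge h va vc (nat q)" "meets_edge h vb vd (nat q)"
      "meets_edge h va vd (nat n)" "meets_edge h vb vc (nat n)"
  shows "range h = range geo.curve"
proof -
  define I where "I g x y = range g \<inter> sph_hull {x, y}" for g :: "real \<Rightarrow> point" and x y
  have com: "I g x y = I g y x" for g x y unfolding I_def by (simp add: insert_commute)
  define val where "val g \<longleftrightarrow> card (I g va vb) = nat p \<and> card (I g vc vd) = nat p \<and> card (I g va vc) = nat q \<and> card (I g vb vd) = nat q
    \<and> card (I g va vd) = nat n \<and> card (I g vb vc) = nat n \<and> card (I g vb va) = nat p \<and> card (I g vd vc) = nat p \<and> card (I g vc va) = nat q
    \<and> card (I g vd vb) = nat q \<and> card (I g vd va) = nat n \<and> card (I g vc vb) = nat n" for g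
  have vh: "val h" using m unfolding val_def meets_edge_def I_def by (simp add: insert_commute)
  have vg: "val geo.curve" using curve_meets unfolding val_def meets_edge_def I_def by (simp add: insert_commute)
  have nn: "nat n = nat p + nat q" using p0 pq by (simp add: nat_add_distrib)
  note C = quad_cases[OF quad_abcd]
  have fin: "finite (I h x y)" if xy: "x \<in> V" "y \<in> V" "x \<noteq> y" for x y
  proof -
    have "finite (I h va vb)" "finite (I h vc vd)" "finite (I h va vc)" "finite (I h vb vd)" "finite (I h va vd)" "finite (I h vb vc)"
      using m unfolding meets_edge_def I_def by auto
    moreover from this have "finite (I h vb va)" "finite (I h vd vc)" "finite (I h vc va)" "finite (I h vd vb)" "finite (I h vd va)" "finite (I h vc vb)"
      unfolding com[of h vb va] com[of h vd vc] com[of h vc va] com[of h vd vb] com[of h vd va] com[of h vc vb] by auto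
    ultimately show ?thesis using C[OF xy(1)] C[OF xy(2)] xy(3) by (elim disjE) (simp_all only: simp_thms)
  qed
  have same: "card (I geo.curve x y) = card (I h x y)" if xy: "x \<in> V" "y \<in> V" "x \<noteq> y" for x y
    using C[OF xy(1)] C[OF xy(2)] xy(3) vh vg unfolding val_def by (elim disjE) (simp_all only: simp_thms)
  have sum: "card (I geo.curve u v) = card (I geo.curve u w) + card (I geo.curve v w) \<or>
     card (I geo.curve u w) = card (I geo.curve u v) + card (I geo.curve v w) \<or>
     card (I geo.curve v w) = card (I geo.curve u v) + card (I geo.curve u w)"
    if "u \<in> V" "v \<in> V" "w \<in> V" "u \<noteq> v" "u \<noteq> w" "v \<noteq> w" for u v w
    using C[OF that(1)] C[OF that(2)] C[OF that(3)] that(4-6) vg unfolding val_def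
    by (elim disjE) (simp_all only: simp_thms nn add.commute)
  have "quad va vd vb vc" using quad_abcd unfolding quad_def by auto
  note qd = this
  interpret h: geod V c h
  proof
    show "finite (range h \<inter> sph_hull {x, y})" if "x \<in> V" "y \<in> V" "x \<noteq> y" for x y
      using fin[OF that] unfolding I_def .
    have "card (I h va vd) \<noteq> 0" using vh n_pos unfolding val_def by simp
    then have "I h va vd \<noteq> {}" by auto
    then obtain t where "h t \<in> sph_hull {va, vd}" unfolding I_def by blast
    then show "\<exists>t. \<exists>v\<in>V. \<exists>w\<in>V. v \<noteq> w \<and> coord (h t) v = 0 \<and> coord (h t) w = 0"
      unfolding edge_iff[OF qd] using quad_in[OF qd] quad_neq[OF qd] by blast
  qed (rule scg)
  have E: "geo.curve.E x y = I geo.curve x y" "h.E x y = I h x y" for x y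
    unfolding geo.curve.E_def h.E_def I_def by simp_all
  interpret t: two_geods V c geo.curve h
  proof
    fix u v w z assume q: "quad u v w z"
    note i = quad_in[OF q] and d = quad_neq[OF q]
    show "card (geo.curve.E u v) = card (h.E u v)" unfolding E using same i d by blast
    show "geo.curve.ruled (u, v, w, z)" unfolding geo.curve.ruled.simps E using sum i d by blast
  qed
  have "triples lam (\<lambda>k. turn (c0 + int k)) (0, 0, 1) (nat (4 * n)) \<noteq> (0, 0, 1)"
    using monodromy_not_identity[of lam] lam_less small_deficit unfolding sol_def by simp
  then show ?thesis by (rule t.unique_range[OF geo.curve_follows geo.curve_closes])
qed

lemma unique_up_to_motion:
  assumes scg: "simple_closed_geodesic V h" and q: "quad a b d e"
    and m: "meets_edge h a b (nat p)" "meets_edge h d e (nat p)" "meets_edge h a d (nat q)" "meets_edge h b e (nat q)"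
      "meets_edge h a e (nat n)" "meets_edge h b d (nat n)"
  shows "\<exists>f. tetra_motion V f \<and> f ` range geo.curve = range h"
proof -
  \<comment> \<open>The construction is repeated with the labels of \<open>h\<close>. The lattice
    data and the poles do not involve the labels, so the permutation of the vertices carries one
    curve to the other.\<close>
  interpret r: tetra_chain V c p q s0 c0 a b d e by unfold_locales (use q small_deficit in auto)
  obtain f where f: "tetra_motion V f" "f va = a" "f vb = b" "f vc = d" "f vd = e"
    by (rule vertex_permutation[OF quad_abcd q])
  have orth: "orthogonal_transformation f" using f(1) unfolding tetra_motion_def by blast
  then have lin: "linear f" using orthogonal_transformation by blast
  have cl: "f (cl x) = r.cl x" for x unfolding cl_def r.cl_def using f by simp
  have "f (geo.pt i) = r.geo.pt i" for i
    unfolding geo.pt_def r.geo.pt_def great_arc_orthogonal(1)[OF orth]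
    by (simp add: linear_add[OF lin] linear_scale[OF lin] linear_diff[OF lin] ui_def vi_def r.ui_def r.vi_def cl)
  then have "f (geo.curve t) = r.geo.curve t" for t
    unfolding geo.curve_def r.geo.curve_def geo.G_def r.geo.G_def great_arc_orthogonal(2)[OF orth] by simp
  then have "f ` range geo.curve = range r.geo.curve" by (simp add: image_image)
  moreover have "range h = range r.geo.curve" using scg m by (rule r.same_type_same_range)
  ultimately show ?thesis using f(1) by auto
qed

end

text \<open>A line through midpoints of edges exists for either parity: if \<open>p + q\<close> is
  odd, an antidiagonal edge serves with \<open>2 * s0 + 1 = p + q\<close>. Otherwise
  \<open>p\<close> and \<open>q\<close> are odd, and \<open>2 * s0 + 1 = q\<close> with
  \<open>c0 = 1\<close>.\<close>

lemma chain_exists: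
  assumes "coprime p q" "p < q"
  obtains s0 c0 where "chain (int p) (int q) s0 c0"
proof (cases "even (p + q)")
  case True
  then have "odd q" using assms(1) by (meson coprime_common_divisor even_add odd_one)
  then obtain k where k: "q = 2 * k + 1" by (rule oddE)
  have cop: "coprime (int p) (int q)" using assms(1) by simp
  have "chain (int p) (int q) (int k) 1" by unfold_locales (rule cop | (use assms(2) k in auto)[1])+
  then show ?thesis by (rule that)
next
  case False
  then obtain k where k: "p + q = 2 * k + 1" by (rule oddE)
  then have "int p + int q = 2 * int k + 1" by linarith
  then have "chain (int p) (int q) (int k) 0" by unfold_locales (use assms in auto)
  then show ?thesis by (rule that)
qed

theorem theorem2:
  fixes p q :: nat and \<epsilon> :: real and V :: "point set"
  assumes "coprime p q" and "p < q"
    and "0 < \<epsilon>" and "\<epsilon> < eps_bound p q"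
    and "regular_sph_tetrahedron V (pi / 3 + \<epsilon>)"
  shows "\<exists>g. simple_closed_geodesic V g \<and> geodesic_type V p q g \<and>
           (\<forall>h. simple_closed_geodesic V h \<and> geodesic_type V p q h \<longrightarrow>
                (\<exists>f. tetra_motion V f \<and> f ` range g = range h))"
proof -
  note small = small_angle[OF assms(1-4)]
  have "0 < cos (pi / 3 + \<epsilon>)" by (rule cos_gt_zero) (use small(1) assms(3) pi_gt3 in auto)
  then obtain c where c: "tetra V c" "2 * c / (1 + c) = 2 * cos (pi / 3 + \<epsilon>)" using regular_tetra[OF assms(5)] by blast
  obtain s0 c0 where ch: "chain (int p) (int q) s0 c0" using chain_exists[OF assms(1,2)] .
  interpret t: tetra V c by (rule c(1))
  have "V \<noteq> {}" using t.card_V by auto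
  then obtain x where x: "x \<in> V" by blast
  have "V \<noteq> {x}" using t.card_V by auto
  then obtain y where y: "y \<in> V" "x \<noteq> y" using x by blast
  then obtain z w where quad: "t.quad x y z w" using t.quad_exists[OF x] by blast
  have "tetra_chain V c (int p) (int q) s0 c0 x y z w"
    unfolding tetra_chain_def tetra_chain_axioms_def t.lam_def c(2) using c(1) ch quad small(2) by simp
  then interpret tetra_chain V c "int p" "int q" s0 c0 x y z w .
  have nat: "nat (int p) = p" "nat (int q) = q" "nat (int p + int q) = p + q" by simp_all
  have "geodesic_type V p q geo.curve"
    using quad curve_meets unfolding geodesic_type_def t.quad_def nat by blast
  moreover have "\<exists>f. tetra_motion V f \<and> f ` range geo.curve = range h"
    if h: "simple_closed_geodesic V h" "geodesic_type V p q h" for h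
  proof -
    obtain a b d e where abde: "V = {a, b, d, e} \<and> distinct [a, b, d, e]" and m: "meets_edge h a b p" "meets_edge h d e p"
      "meets_edge h a d q" "meets_edge h b e q" "meets_edge h a e (p + q)" "meets_edge h b d (p + q)"
      using h(2) unfolding geodesic_type_def by blast
    have "t.quad a b d e" unfolding t.quad_def by (rule abde)
    from unique_up_to_motion[OF h(1) this, unfolded nat] m show ?thesis by blast
  qed
  ultimately show ?thesis using geo.curve_scg by blast
qed

end
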